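(* Let $0<s<\gamma$. Assume there exist constants $c_d,C_K>0$ and a threshold $\Lambda_0\ge1$ such that, for every $j$ with $\mu_j\ge\Lambda_0$, $$d_j\ge c_d(1+\mu_j)^\gamma,\qquad\sup_{x\in M}K_j(x,x)\le C_Kd_j .$$ Then there exists a constant $c>0$, independent of $R$ and $n$, such that for every $R>1$ there is an integer $n_0=n_0(R)\ge1$ for which, for every $n\ge n_0$, $$\mathfrak R_n\big(\mathcal P_s(R,1/2,3/2)\big)\ge c\,(R-1)^{\frac{2\gamma}{s+\gamma}}\,n^{-\frac{s}{s+\gamma}}.$$
   Context: $(M,g)$ is a compact connected smooth Riemannian manifold without boundary, $\nu$ is Riemannian volume normalized so that $\nu(M)=1$, and $L^2(M)=L^2(M,\nu)$ (real-valued). $L=-\Delta_M$ is the nonnegative Laplace–Beltrami operator with distinct eigenvalues $0=\mu_0<\mu_1<\mu_2<\cdots$; $E_j=\ker(L-\mu_jI)$, $d_j=\dim E_j$, $P_j:L^2(M)\to E_j$ is the orthogonal projector with integral kernel $K_j(x,y)=\sum_{\ell=1}^{d_j}\phi_{j,\ell}(x)\phi_{j,\ell}(y)$ ($\{\phi_{j,\ell}\}_\ell$ any orthonormal basis of $E_j$). Block-variation norm: $\|f\|_{\mathcal V^{\mathrm{spec}}_s(M)}=\sum_{j\ge0}(1+\mu_j)^{s/2}\|P_jf\|_{L^2(M)}$. For $0<a\le b<\infty$, $\mathcal P_s(R,a,b)=\{p: a\le p\le b,\ \int_Mp\,d\nu=1,\ \|p\|_{\mathcal V^{\mathrm{spec}}_s(M)}\le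 R\}$. For a class $\mathcal F$ of densities, the minimax risk is $\mathfrak R_n(\mathcal F)=\inf_{\widehat p}\sup_{p_0\in\mathcal F}\mathbb E_{p_0}\|\widehat p-p_0\|_{L^2(M)}^2$, where the infimum is over all measurable estimators $\widehat p$ based on $X_1,\dots,X_n$ i.i.d. with law $p_0\,d\nu$. *)

theory Defs
  imports "HOL-Analysis.Analysis" "HOL-Library.Function_Algebras"
begin

section \<open>Smooth maps between Euclidean spaces\<close>

text \<open>Used on open sets \<open>S\<close> only, where the derivatives at points of \<open>S\<close> depend only on the
  restriction of \<open>f\<close> to \<open>S\<close>.\<close>

primrec Ck_on :: "nat \<Rightarrow> 'e::euclidean_space set \<Rightarrow> ('e \<Rightarrow> 'b::real_normed_vector) \<Rightarrow> bool" where
  "Ck_on 0 S f \<longleftrightarrow> continuous_on S f"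
| "Ck_on (Suc k) S f \<longleftrightarrow>
     (\<forall>x\<in>S. f differentiable (at x)) \<and>
     (\<forall>b\<in>Basis. Ck_on k S (\<lambda>x. frechet_derivative f (at x) b))"

definition smooth_on :: "'e::euclidean_space set \<Rightarrow> ('e \<Rightarrow> 'b::real_normed_vector) \<Rightarrow> bool" where
  "smooth_on S f \<longleftrightarrow> (\<forall>k. Ck_on k S f)"

definition partial :: "'n::finite \<Rightarrow> (real^'n \<Rightarrow> real) \<Rightarrow> real^'n \<Rightarrow> real" where
  "partial i f x = frechet_derivative f (at x) (axis i 1)"

section \<open>Compact Riemannian manifolds\<close>

text \<open>A chart is a pair of its domain and its coordinate map; the values of the coordinate map
  outside the domain are irrelevant. The manifold is a subset \<open>M\<close> of a Hausdorff space, with the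
  subspace topology; its dimension is \<open>CARD('n)\<close>, so it is at least 1.\<close>

type_synonym ('a, 'n) chart = "'a set \<times> ('a \<Rightarrow> real^'n)"

abbreviation chart_dom :: "('a, 'n) chart \<Rightarrow> 'a set" where
  "chart_dom \<equiv> fst"

abbreviation chart_map :: "('a, 'n) chart \<Rightarrow> 'a \<Rightarrow> real^'n" where
  "chart_map \<equiv> snd"

definition chart_inv :: "('a, 'n) chart \<Rightarrow> real^'n \<Rightarrow> 'a" where
  "chart_inv c = inv_into (chart_dom c) (chart_map c)"

definition transition :: "('a, 'n) chart \<Rightarrow> ('a, 'n) chart \<Rightarrow> real^'n \<Rightarrow> real^'n" where
  "transition c c' = chart_map c' \<circ> chart_inv c"

text \<open>The metric is given by its coefficient matrices \<open>g c x\<close> in each chart \<open>c\<close> of the atlas, at the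
  points \<open>x\<close> of the image of the chart, subject to the transformation law of covariant 2-tensors.\<close>

locale compact_riemannian_manifold =
  fixes M :: "'a::t2_space set"
    and A :: "('a, 'n::finite) chart set"
    and g :: "('a, 'n) chart \<Rightarrow> real^'n \<Rightarrow> real^'n^'n"
  assumes nonempty: "M \<noteq> {}"
    and compact: "compact M"
    and connected: "connected M"
    and atlas_cover: "(\<Union>c\<in>A. chart_dom c) = M"
    and chart_open: "\<And>c. c \<in> A \<Longrightarrow> openin (top_of_set M) (chart_dom c)"
    and chart_image_open: "\<And>c. c \<in> A \<Longrightarrow> open (chart_map c ` chart_dom c)"
    and chart_homeomorphism: "\<And>c. c \<in> A \<Longrightarrow>
      homeomorphism (chart_dom c) (chart_map c ` chart_dom c) (chart_map c) (chart_inv c)"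
    and transition_smooth: "\<And>c c'. c \<in> A \<Longrightarrow> c' \<in> A \<Longrightarrow>
      smooth_on (chart_map c ` (chart_dom c \<inter> chart_dom c')) (transition c c')"
    and metric_smooth: "\<And>c. c \<in> A \<Longrightarrow> smooth_on (chart_map c ` chart_dom c) (g c)"
    and metric_symmetric: "\<And>c x. c \<in> A \<Longrightarrow> x \<in> chart_map c ` chart_dom c \<Longrightarrow>
      transpose (g c x) = g c x"
    and metric_pos_def: "\<And>c x v. c \<in> A \<Longrightarrow> x \<in> chart_map c ` chart_dom c \<Longrightarrow> v \<noteq> 0 \<Longrightarrow>
      v \<bullet> (g c x *v v) > 0"
    and metric_tensorial: "\<And>c c' x. c \<in> A \<Longrightarrow> c' \<in> A \<Longrightarrow>
      x \<in> chart_map c ` (chart_dom c \<inter> chart_dom c') \<Longrightarrow>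
      g c x =
        transpose (matrix (frechet_derivative (transition c c') (at x)))
        ** g c' (transition c c' x)
        ** matrix (frechet_derivative (transition c c') (at x))"

text \<open>The Riemannian volume has density \<open>sqrt (det g)\<close> with respect to Lebesgue measure in every
  chart; as the atlas has a finite subcover, this determines it.\<close>

definition is_riemannian_volume ::
  "'a::t2_space set \<Rightarrow> ('a, 'n::finite) chart set \<Rightarrow> (('a, 'n) chart \<Rightarrow> real^'n \<Rightarrow> real^'n^'n)
    \<Rightarrow> 'a measure \<Rightarrow> bool" where
  "is_riemannian_volume M A g V \<longleftrightarrow>
     sets V = sets (restrict_space borel M) \<and>
     (\<forall>c\<in>A. \<forall>B\<in>sets V. B \<subseteq> chart_dom c \<longrightarrow>
        emeasure V B =
          (\<integral>\<^sup>+x\<in>chart_map c ` B. ennreal (sqrt (det (g c x))) \<partial>lborel))"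

definition is_normalized_volume ::
  "'a::t2_space set \<Rightarrow> ('a, 'n::finite) chart set \<Rightarrow> (('a, 'n) chart \<Rightarrow> real^'n \<Rightarrow> real^'n^'n)
    \<Rightarrow> 'a measure \<Rightarrow> bool" where
  "is_normalized_volume M A g \<nu> \<longleftrightarrow>
     (\<exists>V. is_riemannian_volume M A g V \<and> \<nu> = scale_measure (1 / emeasure V M) V)"

section \<open>The Laplace--Beltrami operator and its spectrum\<close>

definition smooth_function :: "('a, 'n::finite) chart set \<Rightarrow> ('a \<Rightarrow> real) \<Rightarrow> bool" where
  "smooth_function A f \<longleftrightarrow> (\<forall>c\<in>A. smooth_on (chart_map c ` chart_dom c) (f \<circ> chart_inv c))"

definition chart_laplacian ::
  "(('a, 'n::finite) chart \<Rightarrow> real^'n \<Rightarrow> real^'n^'n) \<Rightarrow> ('a, 'n) chart \<Rightarrow> ('a \<Rightarrow> real)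
    \<Rightarrow> real^'n \<Rightarrow> real" where
  "chart_laplacian g c f x =
     (\<Sum>i\<in>UNIV. partial i
        (\<lambda>y. \<Sum>j\<in>UNIV. sqrt (det (g c y)) * matrix_inv (g c y) $ i $ j
                * partial j (f \<circ> chart_inv c) y) x)
     / sqrt (det (g c x))"

text \<open>\<open>\<Delta>f = h\<close> on the manifold, for smooth \<open>f\<close>.\<close>

definition has_laplacian ::
  "('a, 'n::finite) chart set \<Rightarrow> (('a, 'n) chart \<Rightarrow> real^'n \<Rightarrow> real^'n^'n)
    \<Rightarrow> ('a \<Rightarrow> real) \<Rightarrow> ('a \<Rightarrow> real) \<Rightarrow> bool" where
  "has_laplacian A g f h \<longleftrightarrow>
     (\<forall>c\<in>A. \<forall>p\<in>chart_dom c. h p = chart_laplacian g c f (chart_map c p))"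

text \<open>The kernel of \<open>L - l I\<close>, where \<open>L = -\<Delta>\<close>. By elliptic regularity the kernel of the
  self-adjoint operator on \<open>L\<^sup>2(M)\<close> consists of classes of smooth functions; the smooth
  representative is the one for which \<open>K\<^sub>j(x,x)\<close> makes sense at every point. Functions on \<open>M\<close> are
  extended by 0, so that they form a space of the right dimension.\<close>

definition eigenspace ::
  "'a set \<Rightarrow> ('a, 'n::finite) chart set \<Rightarrow> (('a, 'n) chart \<Rightarrow> real^'n \<Rightarrow> real^'n^'n)
    \<Rightarrow> real \<Rightarrow> ('a \<Rightarrow> real) set" where
  "eigenspace M A g l =
     {f. smooth_function A f \<and> has_laplacian A g f (\<lambda>p. - (l * f p)) \<and> (\<forall>p. p \<notin> M \<longrightarrow> f p = 0)}"

definition is_eigenvalue ::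
  "'a set \<Rightarrow> ('a, 'n::finite) chart set \<Rightarrow> (('a, 'n) chart \<Rightarrow> real^'n \<Rightarrow> real^'n^'n)
    \<Rightarrow> real \<Rightarrow> bool" where
  "is_eigenvalue M A g l \<longleftrightarrow> (\<exists>f\<in>eigenspace M A g l. \<exists>p\<in>M. f p \<noteq> 0)"

definition eigenvalue_enumeration ::
  "'a set \<Rightarrow> ('a, 'n::finite) chart set \<Rightarrow> (('a, 'n) chart \<Rightarrow> real^'n \<Rightarrow> real^'n^'n)
    \<Rightarrow> (nat \<Rightarrow> real) \<Rightarrow> bool" where
  "eigenvalue_enumeration M A g \<mu> \<longleftrightarrow>
     \<mu> 0 = 0 \<and> strict_mono \<mu> \<and> range \<mu> = {l. is_eigenvalue M A g l}"

interpretation real_fun: vector_space "\<lambda>(c::real) (f :: 'a \<Rightarrow> real) x. c * f x"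
  by unfold_locales (auto simp: fun_eq_iff algebra_simps)

definition fun_dim :: "('a \<Rightarrow> real) set \<Rightarrow> nat" where
  "fun_dim E = real_fun.dim E"

definition orthonormal_basis ::
  "'a measure \<Rightarrow> ('a \<Rightarrow> real) set \<Rightarrow> (nat \<Rightarrow> 'a \<Rightarrow> real) \<Rightarrow> bool" where
  "orthonormal_basis \<nu> E e \<longleftrightarrow>
     (\<forall>l<fun_dim E. e l \<in> E) \<and>
     (\<forall>l<fun_dim E. \<forall>m<fun_dim E. (\<integral>x. e l x * e m x \<partial>\<nu>) = (if l = m then 1 else 0)) \<and>
     E \<subseteq> real_fun.span (e ` {..<fun_dim E})"

definition proj_kernel ::
  "('a \<Rightarrow> real) set \<Rightarrow> (nat \<Rightarrow> 'a \<Rightarrow> real) \<Rightarrow> 'a \<Rightarrow> 'a \<Rightarrow> real" where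
  "proj_kernel E e x y = (\<Sum>l<fun_dim E. e l x * e l y)"

section \<open>Function classes\<close>

text \<open>Elements of \<open>L\<^sup>2(M)\<close> are represented by functions; almost everywhere equal ones are not
  identified.\<close>

definition square_integrable :: "'a measure \<Rightarrow> ('a \<Rightarrow> real) \<Rightarrow> bool" where
  "square_integrable \<nu> f \<longleftrightarrow> f \<in> borel_measurable \<nu> \<and> integrable \<nu> (\<lambda>x. (f x)\<^sup>2)"

definition L2_norm :: "'a measure \<Rightarrow> ('a \<Rightarrow> real) \<Rightarrow> real" where
  "L2_norm \<nu> f = sqrt (\<integral>x. (f x)\<^sup>2 \<partial>\<nu>)"

definition orth_proj :: "'a measure \<Rightarrow> ('a \<Rightarrow> real) set \<Rightarrow> ('a \<Rightarrow> real) \<Rightarrow> 'a \<Rightarrow> real" where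
  "orth_proj \<nu> E f = (THE h. h \<in> E \<and> (\<forall>e\<in>E. (\<integral>x. (f x - h x) * e x \<partial>\<nu>) = 0))"

definition variation_norm ::
  "'a set \<Rightarrow> ('a, 'n::finite) chart set \<Rightarrow> (('a, 'n) chart \<Rightarrow> real^'n \<Rightarrow> real^'n^'n)
    \<Rightarrow> 'a measure \<Rightarrow> (nat \<Rightarrow> real) \<Rightarrow> real \<Rightarrow> ('a \<Rightarrow> real) \<Rightarrow> ennreal" where
  "variation_norm M A g \<nu> \<mu> s f =
     (\<Sum>j. ennreal ((1 + \<mu> j) powr (s / 2) * L2_norm \<nu> (orth_proj \<nu> (eigenspace M A g (\<mu> j)) f)))"

definition density_class ::
  "'a set \<Rightarrow> ('a, 'n::finite) chart set \<Rightarrow> (('a, 'n) chart \<Rightarrow> real^'n \<Rightarrow> real^'n^'n)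
    \<Rightarrow> 'a measure \<Rightarrow> (nat \<Rightarrow> real) \<Rightarrow> real \<Rightarrow> real \<Rightarrow> real \<Rightarrow> real \<Rightarrow> ('a \<Rightarrow> real) set" where
  "density_class M A g \<nu> \<mu> s R a b =
     {p. square_integrable \<nu> p \<and> (AE x in \<nu>. a \<le> p x \<and> p x \<le> b) \<and> (\<integral>x. p x \<partial>\<nu>) = 1 \<and>
         variation_norm M A g \<nu> \<mu> s p \<le> ennreal R}"

section \<open>Minimax risk\<close>

text \<open>An estimator maps a sample \<open>X = (X 0, \<dots>, X (n - 1))\<close> to a function on \<open>M\<close>, jointly measurably.
  The squared loss is a nonnegative integral, so an estimate outside \<open>L\<^sup>2(M)\<close> has infinite loss.\<close>

definition estimators :: "'a measure \<Rightarrow> nat \<Rightarrow> ((nat \<Rightarrow> 'a) \<Rightarrow> 'a \<Rightarrow> real) set" where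
  "estimators \<nu> n =
     {T. (\<lambda>(X, x). T X x) \<in> borel_measurable ((\<Pi>\<^sub>M i\<in>{..<n}. \<nu>) \<Otimes>\<^sub>M \<nu>)}"

definition risk ::
  "'a measure \<Rightarrow> nat \<Rightarrow> ((nat \<Rightarrow> 'a) \<Rightarrow> 'a \<Rightarrow> real) \<Rightarrow> ('a \<Rightarrow> real) \<Rightarrow> ennreal" where
  "risk \<nu> n T p =
     (\<integral>\<^sup>+X. (\<integral>\<^sup>+x. ennreal ((T X x - p x)\<^sup>2) \<partial>\<nu>)
        \<partial>(\<Pi>\<^sub>M i\<in>{..<n}. density \<nu> (\<lambda>x. ennreal (p x))))"

definition minimax_risk :: "'a measure \<Rightarrow> nat \<Rightarrow> ('a \<Rightarrow> real) set \<Rightarrow> ennreal" where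
  "minimax_risk \<nu> n F = (INF T\<in>estimators \<nu> n. SUP p\<in>F. risk \<nu> n T p)"

end

theory Submission
  imports Defs "HOL-Probability.Probability_Measure"
begin

text \<open>
Put \<open>D = CARD('n)\<close> and \<open>T = (n * (R - 1)\<^sup>2) powr (1 / (s + \<gamma>))\<close>, so that the claimed rate is
\<open>(R - 1)\<^sup>2 * T powr (- s) = T powr \<gamma> / n\<close>. Densities of the form 1 plus \<open>\<delta>\<close> times a sum of signed, nearly
orthonormal functions cannot be told apart one sign at a time if \<open>n * \<delta>\<^sup>2 \<le> 1 / 2\<close>, and Assouad's argument
(\<open>assouad_risk\<close>, \<open>minimax_risk_ge_hypercube\<close>) bounds the risk below by a multiple of \<open>\<delta>\<^sup>2\<close> times the
number of signs. The rate requires about \<open>T powr \<gamma>\<close> signs; membership in the class requires that the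
perturbation is at most 1/2 everywhere and has variation norm at most \<open>R - 1\<close>.

If some eigenvalue has \<open>T \<le> 1 + \<mu> j \<le> B * T\<close>, a basis of its eigenspace serves (\<open>minimax_eigenspace\<close>):
the dimension is large enough by hypothesis, and only one block contributes to the variation norm. The
hypotheses do not exclude a gap in the spectrum between \<open>T\<close> and \<open>B * T\<close>, and then no eigenspace is of the right
size. In this case (\<open>minimax_spectral_gap\<close>) the signs are put on disjoint bumps of radius \<open>h\<close> in one chart, where
\<open>h powr (- 2)\<close> is the geometric mean of \<open>T\<close> and \<open>B * T\<close>. The number of bumps is of order \<open>T powr (D / 2)\<close>,
which is enough since \<open>\<gamma> \<le> D / 2\<close> (\<open>growth_exponent_le\<close>). Their components along the
eigenfunctions with eigenvalue at most \<open>T powr (1 + \<epsilon>)\<close> are removed. What is left has a tiny variation norm: \<open>k\<close>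
applications of the Laplacian cost \<open>h powr (- 2 * k)\<close>, of order \<open>T powr k\<close>, and gain \<open>T powr (k * (1 + \<epsilon>))\<close>. Thanks to
the gap, the part that is removed is small in mean square: the eigenfunctions below \<open>T\<close> are few in comparison
with the bumps, and those above \<open>B * T\<close> are almost orthogonal to the bumps, again by iterated Laplacians.

The uniform bounds are probabilistic. At each point a random combination of eigenfunctions has moderate even
moments because the kernels are bounded on the diagonal, and so has its integrated \<open>2 * r\<close>-th power. To pass to the
supremum, the combination is written as the value of a heat flow after the time \<open>1 / L\<close>, where \<open>L\<close> bounds the
eigenvalues involved. The initial value has comparable moments, and the flow is bounded by these at the price of a
factor of order \<open>L ^ D\<close> (\<open>heat_sup\<close>), which is harmless when \<open>r\<close> is large. Discarding a quarter of
the signs does not spoil Assouad's argument.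

The smoothing by the heat flow rests on a Nash inequality, proved by comparing functions in charts with their
local averages. For orthonormal families the same comparison yields the upper bound of order
\<open>l powr (D / 2)\<close> for the number of eigenfunctions with eigenvalue at most \<open>l\<close> (\<open>orthonormal_low_energy_count\<close>). The only
facts about eigenfunctions that enter are their smoothness and Green's formula.
\<close>

section \<open>Random signs\<close>

definition rsign :: "'i set \<Rightarrow> 'i \<Rightarrow> real" where
 "rsign S i = (if i \<in> S then 1 else -1)"

lemma cosh_le_exp_half_square: "exp x + exp (- x) <= 2 * exp (x^2 / 2)" for x :: real
proof -
 have pos: "exp x + exp (- x) <= 2 * exp (x^2 / 2)" if "0 <= x" for x :: real
 proof -
  define h where "h t = t^2 / 2 - ln (cosh t)" for t :: real
  have "h 0 <= h x"
  proof (rule DERIV_nonneg_imp_nondecreasing[OF that])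
   fix t :: real assume t: "0 <= t" "t <= x"
   have "(h has_real_derivative (t - sinh t / cosh t)) (at t)" unfolding h_def by (auto intro!: derivative_eq_intros)
   moreover have "0 <= t - sinh t / cosh t"
   proof -
    have "(\<lambda>t::real. t * cosh t - sinh t) 0 <= t * cosh t - sinh t" by (rule DERIV_nonneg_imp_nondecreasing[OF t(1)])
      (auto intro!: exI derivative_eq_intros simp: field_simps)
    then show ?thesis by (simp add: field_simps)
   qed
   ultimately show "\<exists>y. (h has_real_derivative y) (at t) \<and> 0 <= y" by blast
  qed
  then have "ln (cosh x) <= x^2 / 2" by (simp add: h_def)
  then have "cosh x <= exp (x^2 / 2)" by (metis cosh_real_pos exp_le_cancel_iff exp_ln)
  then show ?thesis by (simp add: cosh_def)
 qed
 show ?thesis using pos[of x] pos[of "- x"] by (cases "0 <= x") auto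
qed

text \<open>The moment generating function factorizes over the signs into hyperbolic cosines.\<close>

lemma rsign_mgf_le:
 assumes "finite I"
 shows "(\<Sum>S\<in>Pow I. exp (\<Sum>i\<in>I. rsign S i * a i)) <= 2 ^ card I * exp ((\<Sum>i\<in>I. (a i)^2) / 2)"
proof -
 have "exp (\<Sum>i\<in>I. rsign S i * a i) = (\<Prod>i\<in>S. exp (a i)) * (\<Prod>i\<in>I - S. exp (- a i))"
  if "S \<in> Pow I" for S
 proof -
  have "exp (\<Sum>i\<in>I. rsign S i * a i) = (\<Prod>i\<in>I. exp (rsign S i * a i))" using assms by (simp add: exp_sum)
  also have "... = (\<Prod>i\<in>S. exp (rsign S i * a i)) * (\<Prod>i\<in>I - S. exp (rsign S i * a i))"
   using that assms prod.subset_diff[of S I "\<lambda>i. exp (rsign S i * a i)"] by (simp add: mult.commute)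
  also have "... = (\<Prod>i\<in>S. exp (a i)) * (\<Prod>i\<in>I - S. exp (- a i))" by (simp add: rsign_def)
  finally show ?thesis .
 qed
 then have "(\<Sum>S\<in>Pow I. exp (\<Sum>i\<in>I. rsign S i * a i)) = (\<Prod>i\<in>I. exp (a i) + exp (- a i))"
  using prod_add[OF assms, of "\<lambda>i. exp (a i)" "\<lambda>i. exp (- a i)"] by simp
 also have "... <= (\<Prod>i\<in>I. 2 * exp ((a i)^2 / 2))"
  by (intro prod_mono) (auto intro!: cosh_le_exp_half_square add_nonneg_nonneg)
 also have "... = 2 ^ card I * exp ((\<Sum>i\<in>I. (a i)^2) / 2)"
  unfolding prod.distrib sum_divide_distrib using assms by (simp add: exp_sum)
 finally show ?thesis .
qed

lemma even_power_le_exp: "x ^ (2 * r) <= fact (2 * r) * (exp x + exp (- x))" for x :: real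
proof -
 have pos: "y ^ n <= fact n * exp y" if "0 <= y" for y :: real and n
 proof -
  have "sum (\<lambda>k. y ^ k /\<^sub>R fact k) {n} <= (\<Sum>k. y ^ k /\<^sub>R fact k)"
   using that by (intro sum_le_suminf summable_exp_generic) auto
  then show ?thesis by (simp add: exp_def field_simps)
 qed
 have "x ^ (2 * r) = \<bar>x\<bar> ^ (2 * r)" by (simp add: power_mult)
 also have "... <= fact (2 * r) * exp \<bar>x\<bar>" by (rule pos) simp
 also have "... <= fact (2 * r) * (exp x + exp (- x))" by (intro mult_left_mono) (auto simp: abs_if)
 finally show ?thesis .
qed

text \<open>Khintchine's inequality. After scaling to \<open>V = 1\<close> the even powers are dominated by exponentials, whose averages
over all signs are bounded.\<close>

lemma rsign_even_moment_le:
 assumes "finite I" and V: "(\<Sum>i\<in>I. (a i)^2) <= V"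
 shows "(\<Sum>S\<in>Pow I. (\<Sum>i\<in>I. rsign S i * a i) ^ (2 * r)) <= 2 ^ card I * (4 * fact (2 * r)) * V ^ r"
proof (cases "V = 0")
 case True
 have "a i = 0" if "i \<in> I" for i
  using V sum_nonneg_eq_0_iff[OF assms(1), of "\<lambda>i. (a i)^2"] that True by (simp add: antisym sum_nonneg)
 then have "(\<Sum>S\<in>Pow I. (\<Sum>i\<in>I. rsign S i * a i) ^ (2 * r)) = (\<Sum>S\<in>Pow I. 0 ^ (2 * r))"
  by (intro sum.cong) auto
 also have "... = 2 ^ card I * 0 ^ (2 * r)" using assms by (simp add: card_Pow)
 also have "... <= 2 ^ card I * (4 * fact (2 * r)) * V ^ r" using True by (cases r) (auto)
 finally show ?thesis .
next
 case False
 have "0 <= (\<Sum>i\<in>I. (a i)^2)" by (simp add: sum_nonneg)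
 then have Vp: "V > 0" using V False by linarith
 define b where "b i = a i / sqrt V" for i
 have b2: "(\<Sum>i\<in>I. (b i)^2) <= 1" using V Vp by (simp add: b_def power_divide flip: sum_divide_distrib)
 have X: "(\<Sum>i\<in>I. rsign S i * a i) = sqrt V * (\<Sum>i\<in>I. rsign S i * b i)" for S
  using Vp by (simp add: b_def sum_distrib_left)
 have E: "(\<Sum>S\<in>Pow I. exp (\<Sum>i\<in>I. rsign S i * c i)) <= 2 ^ card I * 2"
  if "(\<Sum>i\<in>I. (c i)^2) <= 1" for c
 proof -
  have "exp ((\<Sum>i\<in>I. (c i)^2) / 2) <= exp (1 / 2)" using that by simp
  also have "... <= (2::real)"
  proof -
   have "exp (1/2 :: real) ^ 2 = exp 1" by (simp flip: exp_double)
   also have "... <= 2 ^ 2" using exp_le by simp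
   finally show ?thesis by (rule power2_le_imp_le) simp
  qed
  finally show ?thesis using rsign_mgf_le[OF assms(1), of c] by (meson mult_left_mono order_trans zero_le_numeral zero_le_power)
 qed
 have "(\<Sum>S\<in>Pow I. (\<Sum>i\<in>I. rsign S i * a i) ^ (2 * r))
   = V ^ r * (\<Sum>S\<in>Pow I. (\<Sum>i\<in>I. rsign S i * b i) ^ (2 * r))"
  unfolding X power_mult_distrib power_mult sum_distrib_left[symmetric] using Vp by simp
 also have "... <= V ^ r * (\<Sum>S\<in>Pow I. fact (2 * r) * (exp (\<Sum>i\<in>I. rsign S i * b i) + exp (- (\<Sum>i\<in>I. rsign S i * b i))))"
  using Vp by (intro mult_left_mono sum_mono even_power_le_exp) auto
 also have "... = V ^ r * (fact (2 * r) * ((\<Sum>S\<in>Pow I. exp (\<Sum>i\<in>I. rsign S i * b i))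
   + (\<Sum>S\<in>Pow I. exp (\<Sum>i\<in>I. rsign S i * - b i))))" by (simp add: sum.distrib sum_negf flip: sum_distrib_left)
 also have "... <= V ^ r * (fact (2 * r) * (2 ^ card I * 2 + 2 ^ card I * 2))"
  using Vp b2 by (intro mult_left_mono add_mono E) auto
 finally show ?thesis by (simp add: mult_ac)
qed

lemma sum_rsign_orthogonal:
 assumes "finite I" "i \<in> I" "j \<in> I"
 shows "(\<Sum>S\<in>Pow I. rsign S i * rsign S j) = (if i = j then 2 ^ card I else 0)"
proof (cases "i = j")
 case True
 have "(\<Sum>S\<in>Pow I. rsign S i * rsign S j) = (\<Sum>S\<in>Pow I. 1)"
  using True by (intro sum.cong) (auto simp: rsign_def)
 then show ?thesis using assms True by (simp add: card_Pow)
next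
 case False
 have fin: "finite (Pow (I - {i}))" using assms by simp
 have "Pow I = Pow (I - {i}) \<union> insert i ` Pow (I - {i})" using assms(2) by (metis Pow_insert insert_Diff)
 moreover have "Pow (I - {i}) \<inter> insert i ` Pow (I - {i}) = {}" by auto
 moreover have "inj_on (insert i) (Pow (I - {i}))" by (auto simp: inj_on_def)
 ultimately have "(\<Sum>S\<in>Pow I. rsign S i * rsign S j)
   = (\<Sum>S\<in>Pow (I - {i}). rsign S i * rsign S j) + (\<Sum>S\<in>Pow (I - {i}). rsign (insert i S) i * rsign (insert i S) j)"
  using fin by (simp add: sum.union_disjoint sum.reindex)
 also have "... = (\<Sum>S\<in>Pow (I - {i}). rsign S i * rsign S j + rsign (insert i S) i * rsign (insert i S) j)"
  by (simp add: sum.distrib)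
 also have "... = 0" using False by (intro sum.neutral) (auto simp: rsign_def)
 finally show ?thesis using False by simp
qed

lemma sum_rsign_square:
 assumes "finite I"
 shows "(\<Sum>S\<in>Pow I. (\<Sum>i\<in>I. rsign S i * a i)^2) = 2 ^ card I * (\<Sum>i\<in>I. (a i)^2)"
proof -
 have "(\<Sum>S\<in>Pow I. (\<Sum>i\<in>I. rsign S i * a i)^2)
   = (\<Sum>S\<in>Pow I. \<Sum>i\<in>I. \<Sum>j\<in>I. a i * a j * (rsign S i * rsign S j))"
  by (simp add: power2_eq_square sum_product mult_ac)
 also have "... = (\<Sum>i\<in>I. \<Sum>j\<in>I. a i * a j * (\<Sum>S\<in>Pow I. rsign S i * rsign S j))"
  by (simp add: sum.swap[of _ "Pow I"] sum_distrib_left)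
 also have "... = (\<Sum>i\<in>I. \<Sum>j\<in>I. if i = j then a i * a j * 2 ^ card I else 0)"
  by (intro sum.cong refl) (simp add: sum_rsign_orthogonal[OF assms])
 also have "... = (\<Sum>i\<in>I. a i * a i * 2 ^ card I)" using assms by (simp add: sum.delta)
 finally show ?thesis by (simp add: power2_eq_square sum_distrib_left mult_ac)
qed

section \<open>Hellinger affinity of product densities\<close>

lemma PiM_density:
 assumes "finite I" "prob_space \<nu>" and [measurable]: "p \<in> borel_measurable \<nu>"
  and fin: "(\<integral>\<^sup>+x. p x \<partial>\<nu>) < \<infinity>"
 shows "(\<Pi>\<^sub>M i\<in>I. density \<nu> p) = density (\<Pi>\<^sub>M i\<in>I. \<nu>) (\<lambda>X. \<Prod>i\<in>I. p (X i))"
proof -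
 interpret \<nu>: prob_space \<nu> by fact
 interpret P: product_sigma_finite "\<lambda>_. \<nu>" ..
 have "finite_measure (density \<nu> p)"
  using fin by (intro finite_measureI) (simp add: emeasure_density cong: nn_integral_cong)
 then interpret D: finite_measure "density \<nu> p" .
 interpret Q: product_sigma_finite "\<lambda>_. density \<nu> p" ..
 show ?thesis
 proof (rule Q.PiM_eqI[symmetric])
  show "finite I" by fact
  have "sets (Pi\<^sub>M I (\<lambda>i. density \<nu> p)) = sets (Pi\<^sub>M I (\<lambda>i. \<nu>))" by (rule sets_PiM_cong) auto
  then show "sets (density (Pi\<^sub>M I (\<lambda>i. \<nu>)) (\<lambda>X. \<Prod>i\<in>I. p (X i))) = sets (Pi\<^sub>M I (\<lambda>i. density \<nu> p))"
   by simp
 next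
  fix A assume A: "\<And>i. i \<in> I ==> A i \<in> sets (density \<nu> p)"
  have [measurable]: "Pi\<^sub>E I A \<in> sets (Pi\<^sub>M I (\<lambda>i. \<nu>))"
   using A \<open>finite I\<close> by (intro sets_PiM_I_finite) auto
  have "emeasure (density (Pi\<^sub>M I (\<lambda>i. \<nu>)) (\<lambda>X. \<Prod>i\<in>I. p (X i))) (Pi\<^sub>E I A)
    = (\<integral>\<^sup>+X. (\<Prod>i\<in>I. p (X i)) * indicator (Pi\<^sub>E I A) X \<partial>Pi\<^sub>M I (\<lambda>i. \<nu>))"
   by (rule emeasure_density) measurable
  also have "... = (\<integral>\<^sup>+X. (\<Prod>i\<in>I. p (X i) * indicator (A i) (X i)) \<partial>Pi\<^sub>M I (\<lambda>i. \<nu>))"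
  proof (intro nn_integral_cong)
   fix X assume X: "X \<in> space (Pi\<^sub>M I (\<lambda>i. \<nu>))"
   have "indicator (Pi\<^sub>E I A) X = (\<Prod>i\<in>I. indicator (A i) (X i) :: ennreal)"
   proof (cases "X \<in> Pi\<^sub>E I A")
    case True
    then have "(\<Prod>i\<in>I. indicator (A i) (X i) :: ennreal) = (\<Prod>i\<in>I. 1)"
     by (intro prod.cong) (auto simp: PiE_def Pi_def)
    then show ?thesis using True by simp
   next
    case False
    then obtain i where "i \<in> I" "X i \<notin> A i" using X by (auto simp: space_PiM PiE_def Pi_def)
    then have "(\<Prod>i\<in>I. indicator (A i) (X i) :: ennreal) = 0"
     using \<open>finite I\<close> by (intro prod_zero) (auto intro!: bexI)
    then show ?thesis using False by simp
   qed
   then show "(\<Prod>i\<in>I. p (X i)) * indicator (Pi\<^sub>E I A) X = (\<Prod>i\<in>I. p (X i) * indicator (A i) (X i))"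
    by (simp add: prod.distrib)
  qed
  also have "... = (\<Prod>i\<in>I. \<integral>\<^sup>+x. p x * indicator (A i) x \<partial>\<nu>)"
   using A by (intro P.product_nn_integral_prod[OF \<open>finite I\<close>, where f="\<lambda>i x. p x * indicator (A i) x"]) auto
  also have "... = (\<Prod>i\<in>I. emeasure (density \<nu> p) (A i))"
   using A by (intro prod.cong refl) (auto simp: emeasure_density)
  finally show "emeasure (density (Pi\<^sub>M I (\<lambda>i. \<nu>)) (\<lambda>X. \<Prod>i\<in>I. p (X i))) (Pi\<^sub>E I A)
    = (\<Prod>i\<in>I. emeasure (density \<nu> p) (A i))" .
 qed
qed

lemma borel_measurable_PiM_prod:
 fixes p :: "'a \<Rightarrow> real"
 assumes [measurable]: "p \<in> borel_measurable \<nu>"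
 shows "(\<lambda>X. \<Prod>i<n. p (X i)) \<in> borel_measurable (\<Pi>\<^sub>M i\<in>{..<n}. \<nu>)" by measurable

lemma integrable_half_bounded:
 fixes p :: "'a \<Rightarrow> real"
 assumes "prob_space \<nu>" "p \<in> borel_measurable \<nu>" "\<And>x. x \<in> space \<nu> ==> p x \<in> {1/2..3/2}"
 shows "integrable \<nu> p"
proof -
 interpret prob_space \<nu> by fact
 show ?thesis by (rule integrable_const_bound[where B = "3/2"]) (use assms in force)+
qed

lemma product_density_total:
 fixes p :: "'a \<Rightarrow> real" and n :: nat
 assumes \<nu>: "prob_space \<nu>" and p: "p \<in> borel_measurable \<nu>" "\<And>x. x \<in> space \<nu> ==> p x \<in> {1/2..3/2}" and p1: "(LINT x|\<nu>. p x) = 1"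
 shows "(\<integral>\<^sup>+X. (\<Prod>i<n. ennreal (p (X i))) \<partial>(\<Pi>\<^sub>M i\<in>{..<n}. \<nu>)) = 1"
proof -
 interpret prob_space \<nu> by fact
 interpret P: product_sigma_finite "\<lambda>_. \<nu>" ..
 have "AE x in \<nu>. 0 <= p x" using p(2) by (intro AE_I2) force
 then have "(\<integral>\<^sup>+x. ennreal (p x) \<partial>\<nu>) = 1" using p1 by (simp add: nn_integral_eq_integral[OF integrable_half_bounded[OF \<nu> p]])
 then show ?thesis using p(1) by (subst P.product_nn_integral_prod) auto
qed

lemma integrable_sqrt_product:
 fixes p q :: "'a \<Rightarrow> real"
 assumes "prob_space \<nu>" and [measurable]: "p \<in> borel_measurable \<nu>" "q \<in> borel_measurable \<nu>"
 and p: "\<And>x. x \<in> space \<nu> ==> p x \<in> {1/2..3/2}" and q: "\<And>x. x \<in> space \<nu> ==> q x \<in> {1/2..3/2}"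
 shows "integrable \<nu> (\<lambda>x. sqrt (p x * q x))"
proof (rule finite_measure.integrable_const_bound[where B = "sqrt (9/4)"])
 show "finite_measure \<nu>" using assms(1) by (simp add: prob_space_def)
 have "\<bar>p x * q x\<bar> <= 3/2 * (3/2)" if "x \<in> space \<nu>" for x
  unfolding abs_mult using p[OF that] q[OF that] by (intro mult_mono) auto
 then show "AE x in \<nu>. norm (sqrt (p x * q x)) <= sqrt (9/4)" by (auto simp flip: real_sqrt_abs2 simp: real_sqrt_le_iff)
qed measurable

text \<open>Both densities are at least \<open>1 / 2\<close>, so \<open>(sqrt p + sqrt q)\<^sup>2 \<ge> 2\<close>, and the
squared Hellinger distance is at most half of the squared \<open>L\<^sup>2\<close> distance.\<close>

lemma hellinger_affinity_ge:
 fixes p q :: "'a \<Rightarrow> real"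
 assumes "prob_space \<nu>" and [measurable]: "p \<in> borel_measurable \<nu>" "q \<in> borel_measurable \<nu>"
  and p: "\<And>x. x \<in> space \<nu> ==> p x \<in> {1/2..3/2}" and q: "\<And>x. x \<in> space \<nu> ==> q x \<in> {1/2..3/2}"
  and p1: "(LINT x|\<nu>. p x) = 1" and q1: "(LINT x|\<nu>. q x) = 1"
  and d: "(LINT x|\<nu>. (p x - q x)^2) <= 4 * e"
 shows "(LINT x|\<nu>. sqrt (p x * q x)) >= 1 - e"
proof -
 interpret \<nu>: prob_space \<nu> by fact
 note ip = integrable_half_bounded[OF assms(1,2) p] and iq = integrable_half_bounded[OF assms(1,3) q]
 have id: "integrable \<nu> (\<lambda>x. (p x - q x)^2)"
 proof (rule \<nu>.integrable_const_bound[where B = 1])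
  have "\<bar>p x - q x\<bar> <= 1" if "x \<in> space \<nu>" for x using p[OF that] q[OF that] by auto
  then show "AE x in \<nu>. norm ((p x - q x)^2) <= 1" by (auto simp: abs_square_le_1)
 qed measurable
 note isq = integrable_sqrt_product[OF assms(1-5)]
 have ptw: "(p x + q x) / 2 - (p x - q x)^2 / 4 <= sqrt (p x * q x)" if "x \<in> space \<nu>" for x
 proof -
  define a b where "a = sqrt (p x)" and "b = sqrt (q x)"
  have ab: "p x = a^2" "q x = b^2" "sqrt (p x * q x) = a * b"
   using p[OF that] q[OF that] by (auto simp: a_def b_def real_sqrt_mult)
  have "a >= 1 / 2" "b >= 1/2" "a^2 >= 1/2" "b^2 >= 1/2"
   using p[OF that] q[OF that] real_le_rsqrt[of "1/2" "p x"] real_le_rsqrt[of "1/2" "q x"]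
   unfolding a_def b_def by (auto simp: power2_eq_square)
  have "2 * a * b >= 1"
  proof -
   have "(2 * a * b)^2 >= 1"
    using mult_mono[of "1/2" "a^2" "1/2" "b^2"] \<open>a^2 >= 1/2\<close> \<open>b^2 >= 1/2\<close> by (simp add: power_mult_distrib)
   then show ?thesis using \<open>a >= 1/2\<close> \<open>b >= 1/2\<close> by (intro power2_le_imp_le[of 1 "2 * a * b"]) auto
  qed
  then have "(a + b)^2 >= 2" using \<open>a^2 >= 1/2\<close> \<open>b^2 >= 1/2\<close> by (simp add: power2_sum)
  then have "(a - b)^2 * 2 <= (a - b)^2 * (a + b)^2" by (intro mult_left_mono) auto
  also have "... = (a^2 - b^2)^2" by (simp add: power2_eq_square algebra_simps)
  finally have "(a^2 + b^2) / 2 - (a^2 - b^2)^2 / 4 <= a * b"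
   unfolding power2_diff[of a b] by (simp add: mult.assoc algebra_simps)
  then show ?thesis unfolding ab(3) unfolding ab(1,2) .
 qed
 have "1 - e <= (LINT x|\<nu>. (p x + q x) / 2 - (p x - q x)^2 / 4)" using ip iq id p1 q1 d by simp
 also have "... <= (LINT x|\<nu>. sqrt (p x * q x))" using ip iq id isq by (intro integral_mono ptw) auto
 finally show ?thesis .
qed

lemma ennreal_eighth_le:
 assumes "ennreal (1/2) ^ 2 <= m * 2"
 shows "ennreal (1/8) <= m"
proof (cases m)
 case (real r)
 then have "ennreal (1/4) <= ennreal (r * 2)"
  using assms ennreal_mult[of r 2] ennreal_power[of "1/2" 2] by (simp add: power2_eq_square del: ennreal_1)
 moreover have "0 <= r * 2" using real by simp
 ultimately have "1/4 <= r * 2" by (simp only: ennreal_le_iff)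
 then have "ennreal (1/8) <= ennreal r" by (intro ennreal_leI) linarith
 then show ?thesis using real by simp
next
 case top
 then show ?thesis by simp
qed

text \<open>The inequality of Le Cam: by Cauchy--Schwarz applied to
\<open>sqrt (p q) = sqrt (min p q) * sqrt (max p q)\<close>, the integral of the minimum is at least half
of the squared affinity. The affinity of the products is the \<open>n\<close>-th power of that of the factors, at least
\<open>(1 - e) ^ n \<ge> 1 / 2\<close>.\<close>

lemma product_min_density_ge:
 fixes p q :: "'a \<Rightarrow> real"
 assumes "prob_space \<nu>" and [measurable]: "p \<in> borel_measurable \<nu>" "q \<in> borel_measurable \<nu>"
  and p: "\<And>x. x \<in> space \<nu> ==> p x \<in> {1/2..3/2}" and q: "\<And>x. x \<in> space \<nu> ==> q x \<in> {1/2..3/2}"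
  and p1: "(LINT x|\<nu>. p x) = 1" and q1: "(LINT x|\<nu>. q x) = 1"
  and d: "(LINT x|\<nu>. (p x - q x)^2) <= 4 * e" and e: "0 <= e" "real n * e <= 1 / 2" and n: "n > 0"
 shows "(\<integral>\<^sup>+X. min (\<Prod>i<n. ennreal (p (X i))) (\<Prod>i<n. ennreal (q (X i))) \<partial>(\<Pi>\<^sub>M i\<in>{..<n}. \<nu>)) >= ennreal (1/8)"
proof -
 interpret \<nu>: prob_space \<nu> by fact
 interpret P: product_sigma_finite "\<lambda>_. \<nu>" ..
 let ?M = "\<Pi>\<^sub>M i\<in>{..<n}. \<nu>"
 define pp where "pp = (\<lambda>X :: nat \<Rightarrow> 'a. \<Prod>i<n. p (X i))"
 define qq where "qq = (\<lambda>X :: nat \<Rightarrow> 'a. \<Prod>i<n. q (X i))"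
 have [measurable]: "pp \<in> borel_measurable ?M" "qq \<in> borel_measurable ?M"
  unfolding pp_def qq_def by (intro borel_measurable_PiM_prod assms(2,3))+
 have ppos: "p x >= 0" "q x >= 0" if "x \<in> space \<nu>" for x using p[OF that] q[OF that] by auto
 have sp: "X i \<in> space \<nu>" if "X \<in> space ?M" "i < n" for X i using that by (auto simp: space_PiM)
 have pp0: "pp X >= 0" "qq X >= 0" if "X \<in> space ?M" for X
  unfolding pp_def qq_def using ppos sp[OF that] by (auto intro!: prod_nonneg)
 have ppe: "(\<Prod>i<n. ennreal (p (X i))) = ennreal (pp X)" "(\<Prod>i<n. ennreal (q (X i))) = ennreal (qq X)"
  if "X \<in> space ?M" for X unfolding pp_def qq_def using ppos sp[OF that] by (auto intro!: prod_ennreal)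
 have tot: "(\<integral>\<^sup>+X. ennreal (pp X) \<partial>?M) = 1" "(\<integral>\<^sup>+X. ennreal (qq X) \<partial>?M) = 1"
 proof -
  show "(\<integral>\<^sup>+X. ennreal (pp X) \<partial>?M) = 1"
   using product_density_total[OF assms(1,2) p p1, of n] by (subst nn_integral_cong[OF ppe(1)[symmetric]]) auto
  show "(\<integral>\<^sup>+X. ennreal (qq X) \<partial>?M) = 1"
   using product_density_total[OF assms(1,3) q q1, of n] by (subst nn_integral_cong[OF ppe(2)[symmetric]]) auto
 qed
 have e1: "e <= 1"
 proof -
  have "e <= real n * e" using n e(1) by (simp add: mult_le_cancel_right1)
  then show ?thesis using e by simp
 qed
 have "1 / 2 <= (1 - e) ^ n" using e e1 Bernoulli_inequality[of "- e" n] by simp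
 also have "... <= (LINT x|\<nu>. sqrt (p x * q x)) ^ n"
  using e1 hellinger_affinity_ge[OF assms(1-8)] by (intro power_mono) auto
 finally have half: "1 / 2 <= (LINT x|\<nu>. sqrt (p x * q x)) ^ n" .
 note isq = integrable_sqrt_product[OF assms(1-5)]
 let ?a = "\<lambda>X. sqrt (min (pp X) (qq X))" and ?b = "\<lambda>X. sqrt (max (pp X) (qq X))"
 let ?I = "\<integral>\<^sup>+X. ennreal (?a X) * ennreal (?b X) \<partial>?M" and ?m = "\<integral>\<^sup>+X. min (\<Prod>i<n. ennreal (p (X i))) (\<Prod>i<n. ennreal (q (X i))) \<partial>?M"
 have "?I
   = (\<integral>\<^sup>+X. (\<Prod>i<n. ennreal (sqrt (p (X i) * q (X i)))) \<partial>?M)"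
 proof (intro nn_integral_cong)
  fix X assume X: "X \<in> space ?M"
  have "?a X * ?b X = sqrt (pp X * qq X)" by (auto simp: min_def max_def real_sqrt_mult)
  also have "... = (\<Prod>i<n. sqrt (p (X i) * q (X i)))"
   unfolding pp_def qq_def prod.distrib[symmetric] by (induction n) (simp_all add: real_sqrt_mult)
  finally show "ennreal (?a X) * ennreal (?b X) = (\<Prod>i<n. ennreal (sqrt (p (X i) * q (X i))))"
   using pp0[OF X] ppos sp[OF X] by (subst prod_ennreal) (auto simp flip: ennreal_mult)
 qed
 also have "... = (\<Prod>i<n. \<integral>\<^sup>+x. ennreal (sqrt (p x * q x)) \<partial>\<nu>)"
  by (rule P.product_nn_integral_prod) auto
 also have "... = ennreal ((LINT x|\<nu>. sqrt (p x * q x)) ^ n)"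
  using ppos by (subst nn_integral_eq_integral[OF isq]) (auto simp: ennreal_power intro!: Bochner_Integration.integral_nonneg)
 also have "... >= ennreal (1/2)" using half by (rule ennreal_leI)
 finally have "ennreal (1/2) <= ?I" .
 then have "ennreal (1/2) ^ 2 <= ?I ^ 2" by (intro power_mono) auto
 also have "... <= (\<integral>\<^sup>+X. ennreal (?a X) ^ 2 \<partial>?M) * (\<integral>\<^sup>+X. ennreal (?b X) ^ 2 \<partial>?M)"
  by (rule Cauchy_Schwarz_nn_integral) measurable
 also have "... <= ?m * 2"
 proof (rule mult_mono)
  show "(\<integral>\<^sup>+X. ennreal (?a X) ^ 2 \<partial>?M)
    <= ?m" using pp0 by (intro nn_integral_mono) (auto simp: ppe ennreal_power min_def)
  have "(\<integral>\<^sup>+X. ennreal (?b X) ^ 2 \<partial>?M) <= (\<integral>\<^sup>+X. ennreal (pp X) + ennreal (qq X) \<partial>?M)"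
   using pp0 by (intro nn_integral_mono) (auto simp: ennreal_power max_def)
  also have "... = 2" using tot by (subst nn_integral_add) (auto simp: one_add_one)
  finally show "(\<integral>\<^sup>+X. ennreal (?b X) ^ 2 \<partial>?M) <= 2" .
 qed auto
 finally have fin: "ennreal (1/2) ^ 2 <= ?m * 2" .
 from ennreal_eighth_le[OF fin] show ?thesis .
qed

section \<open>Orthonormal families of square integrable functions\<close>

lemmas integral_eqI = Bochner_Integration.integral_cong[OF refl]

lemma sq_mult_integrable:
 assumes "square_integrable \<nu> f" "square_integrable \<nu> g"
 shows "integrable \<nu> (\<lambda>x. f x * g x)"
proof -
 have "integrable \<nu> (\<lambda>x. (f x)^2 + (g x)^2)" using assms by (auto simp: square_integrable_def)
 then show ?thesis
 proof (rule Bochner_Integration.integrable_bound)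
  show "(\<lambda>x. f x * g x) \<in> borel_measurable \<nu>" using assms by (auto simp: square_integrable_def)
  have "\<bar>a * b\<bar> <= a^2 + b^2" for a b :: real
  proof -
   have "2 * (\<bar>a\<bar> * \<bar>b\<bar>) <= \<bar>a\<bar>^2 + \<bar>b\<bar>^2" using sum_squares_bound[of "\<bar>a\<bar>" "\<bar>b\<bar>"] by (simp add: mult.assoc)
   moreover have "0 <= \<bar>a\<bar> * \<bar>b\<bar>" by simp
   ultimately show ?thesis unfolding abs_mult power2_abs by linarith
  qed
  then show "AE x in \<nu>. norm (f x * g x) <= norm ((f x)^2 + (g x)^2)" by auto
 qed
qed

lemma sq_add:
 assumes "square_integrable \<nu> f" "square_integrable \<nu> g"
 shows "square_integrable \<nu> (\<lambda>x. f x + g x)"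
proof -
 have "(\<lambda>x. (f x + g x)^2) = (\<lambda>x. (f x)^2 + (g x)^2 + 2 * (f x * g x))" by (auto simp: power2_sum)
 then show ?thesis using assms sq_mult_integrable[OF assms] by (auto simp: square_integrable_def)
qed

lemma sq_cmult:
 "square_integrable \<nu> f ==> square_integrable \<nu> (\<lambda>x. c * f x)"
 by (auto simp: square_integrable_def power_mult_distrib)

lemma sq_diff:
 assumes "square_integrable \<nu> f" "square_integrable \<nu> g"
 shows "square_integrable \<nu> (\<lambda>x. f x - g x)" using sq_add[OF assms(1) sq_cmult[OF assms(2), of "-1"]] by simp

lemma sq_sum:
 assumes "\<And>i. i \<in> I ==> square_integrable \<nu> (f i)"
 shows "square_integrable \<nu> (\<lambda>x. \<Sum>i\<in>I. f i x)"
 using assms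
proof (induction I rule: infinite_finite_induct)
 case (insert i I)
 then show ?case by (simp add: sq_add)
qed (simp_all add: square_integrable_def)

lemma sq_bounded:
 assumes "finite_measure \<nu>" "f \<in> borel_measurable \<nu>" "AE x in \<nu>. \<bar>f x\<bar> <= B"
 shows "square_integrable \<nu> f"
proof -
 interpret finite_measure \<nu> by fact
 have "integrable \<nu> (\<lambda>x. (f x)^2)"
 proof (rule integrable_const_bound[where B = "B^2"])
  show "AE x in \<nu>. norm ((f x)^2) <= B^2"
   using assms(3) by eventually_elim (auto simp: abs_le_square_iff intro: power2_le_iff_abs_le[THEN iffD2] order_trans[OF _ abs_ge_self])
 qed (use assms(2) in measurable)
 then show ?thesis using assms by (simp add: square_integrable_def)
qed

lemma sq_integrable:
 assumes "finite_measure \<nu>" "square_integrable \<nu> f"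
 shows "integrable \<nu> f"
proof -
 have "square_integrable \<nu> (\<lambda>_. 1)" using assms(1) by (intro sq_bounded[where B = 1]) auto
 from sq_mult_integrable[OF assms(2) this] show ?thesis by simp
qed

definition orthonormal_on :: "'a measure \<Rightarrow> 'i set \<Rightarrow> ('i \<Rightarrow> 'a \<Rightarrow> real) \<Rightarrow> bool" where
 "orthonormal_on \<nu> I \<psi> \<longleftrightarrow> (\<forall>i\<in>I. square_integrable \<nu> (\<psi> i)) \<and>
   (\<forall>i\<in>I. \<forall>j\<in>I. (LINT x|\<nu>. \<psi> i x * \<psi> j x) = (if i = j then 1 else 0))"

lemma orthonormal_on_subset: "orthonormal_on \<nu> I \<psi> ==> J \<subseteq> I ==> orthonormal_on \<nu> J \<psi>"
 unfolding orthonormal_on_def by blast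

lemma integral_mult_sum:
 assumes "square_integrable \<nu> f" "\<And>i. i \<in> I ==> square_integrable \<nu> (\<psi> i)"
 shows "(LINT x|\<nu>. f x * (\<Sum>i\<in>I. a i * \<psi> i x)) = (\<Sum>i\<in>I. a i * (LINT x|\<nu>. f x * \<psi> i x))"
proof -
 have "(LINT x|\<nu>. f x * (\<Sum>i\<in>I. a i * \<psi> i x)) = (LINT x|\<nu>. (\<Sum>i\<in>I. a i * (f x * \<psi> i x)))"
  by (intro integral_eqI) (simp add: sum_distrib_left mult_ac)
 also have "... = (\<Sum>i\<in>I. a i * (LINT x|\<nu>. f x * \<psi> i x))"
  using assms by (subst Bochner_Integration.integral_sum) (auto intro!: sq_mult_integrable)
 finally show ?thesis .
qed

lemma orthonormal_coefficient:
 assumes "orthonormal_on \<nu> I \<psi>" "finite I" "j \<in> I"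
 shows "(LINT x|\<nu>. (\<Sum>i\<in>I. a i * \<psi> i x) * \<psi> j x) = a j"
proof -
 have "(LINT x|\<nu>. \<psi> j x * (\<Sum>i\<in>I. a i * \<psi> i x)) = (\<Sum>i\<in>I. a i * (LINT x|\<nu>. \<psi> j x * \<psi> i x))"
  using assms by (intro integral_mult_sum) (auto simp: orthonormal_on_def)
 also have "... = (\<Sum>i\<in>I. if i = j then a i else 0)"
  using assms by (intro sum.cong refl) (auto simp: orthonormal_on_def)
 finally show ?thesis using assms by (simp add: mult.commute)
qed

lemma orthonormal_sum_square:
 assumes "orthonormal_on \<nu> I \<psi>" "finite I"
 shows "(LINT x|\<nu>. (\<Sum>i\<in>I. a i * \<psi> i x)^2) = (\<Sum>i\<in>I. (a i)^2)"
proof -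
 have "(LINT x|\<nu>. (\<Sum>i\<in>I. a i * \<psi> i x) * (\<Sum>i\<in>I. a i * \<psi> i x))
   = (\<Sum>j\<in>I. a j * (LINT x|\<nu>. (\<Sum>i\<in>I. a i * \<psi> i x) * \<psi> j x))"
  using assms by (intro integral_mult_sum sq_sum sq_cmult) (auto simp: orthonormal_on_def)
 also have "... = (\<Sum>i\<in>I. (a i)^2)"
  by (intro sum.cong refl) (simp add: orthonormal_coefficient[OF assms] power2_eq_square)
 finally show ?thesis by (simp add: power2_eq_square)
qed

lemma projection_residual:
 assumes w: "orthonormal_on \<nu> J w" "finite J" and f: "square_integrable \<nu> f"
 shows "(LINT x|\<nu>. (f x - (\<Sum>j\<in>J. (LINT y|\<nu>. f y * w j y) * w j x))^2)
  = (LINT x|\<nu>. (f x)^2) - (\<Sum>j\<in>J. (LINT y|\<nu>. f y * w j y)^2)"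
proof -
 define a where "a j = (LINT y|\<nu>. f y * w j y)" for j
 define p where "p x = (\<Sum>j\<in>J. a j * w j x)" for x
 have wsq: "square_integrable \<nu> (w j)" if "j \<in> J" for j using w(1) that by (simp add: orthonormal_on_def)
 have p: "square_integrable \<nu> p" unfolding p_def by (intro sq_sum sq_cmult wsq)
 have fp: "(LINT x|\<nu>. f x * p x) = (\<Sum>j\<in>J. (a j)^2)"
  unfolding p_def by (subst integral_mult_sum[OF f wsq]) (simp_all add: a_def power2_eq_square)
 have pp: "(LINT x|\<nu>. (p x)^2) = (\<Sum>j\<in>J. (a j)^2)" unfolding p_def by (rule orthonormal_sum_square[OF w])
 have "(LINT x|\<nu>. (f x - p x)^2) = (LINT x|\<nu>. (f x)^2 - 2 * (f x * p x) + (p x)^2)"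
  by (simp add: power2_diff algebra_simps)
 also have "... = (LINT x|\<nu>. (f x)^2) - 2 * (LINT x|\<nu>. f x * p x) + (LINT x|\<nu>. (p x)^2)"
  using f p sq_mult_integrable[OF f p] by (simp add: square_integrable_def)
 finally show ?thesis unfolding fp pp by (simp add: p_def a_def)
qed

lemma bessel_inequality:
 assumes "orthonormal_on \<nu> I \<psi>" "finite I" "square_integrable \<nu> f"
 shows "(\<Sum>i\<in>I. (LINT x|\<nu>. f x * \<psi> i x)^2) <= (LINT x|\<nu>. (f x)^2)"
proof -
 have "0 <= (LINT x|\<nu>. (f x - (\<Sum>i\<in>I. (LINT y|\<nu>. f y * \<psi> i y) * \<psi> i x))^2)"
  by (intro Bochner_Integration.integral_nonneg) simp
 then show ?thesis unfolding projection_residual[OF assms] by simp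
qed

lemma integral_square_triangle:
 assumes "square_integrable \<nu> f" "square_integrable \<nu> g"
 shows "(LINT x|\<nu>. (f x + g x)^2) <= 2 * (LINT x|\<nu>. (f x)^2) + 2 * (LINT x|\<nu>. (g x)^2)"
proof -
 have "(LINT x|\<nu>. (f x + g x)^2) <= (LINT x|\<nu>. 2 * (f x)^2 + 2 * (g x)^2)"
 proof (rule integral_mono)
  fix x
  have "0 <= (f x - g x)^2" by simp
  then show "(f x + g x)^2 <= 2 * (f x)^2 + 2 * (g x)^2" by (simp add: power2_sum power2_diff)
 qed (use assms sq_add[OF assms] in \<open>auto simp: square_integrable_def\<close>)
 also have "... = 2 * (LINT x|\<nu>. (f x)^2) + 2 * (LINT x|\<nu>. (g x)^2)" using assms by (simp add: square_integrable_def)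
 finally show ?thesis .
qed

section \<open>Assouad's bound over a large part of the hypercube\<close>

text \<open>An edge of the cube in direction \<open>i\<close> is lost only if one of its two ends lies outside \<open>G\<close>, and edges in
the same direction are disjoint.\<close>

lemma card_good_edges:
 assumes I: "finite I" "i \<in> I" and G: "G \<subseteq> Pow I" "4 * card G >= 3 * 2 ^ card I"
 shows "4 * card {S \<in> G. i \<notin> S \<and> insert i S \<in> G} >= 2 ^ card I"
proof -
 define H where "H = Pow (I - {i})"
 have fin: "finite (Pow I)" using I by simp
 have cI: "card I = Suc (card (I - {i}))" using I by (metis card.remove)
 have cH: "2 * card H = 2 ^ card I"
  unfolding H_def cI using I by (subst card_Pow) (auto simp del: card_Diff_insert card_Diff_singleton)
 define B where "B = {S \<in> H. S \<notin> G \<or> insert i S \<notin> G}"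
 define C where "C = {S \<in> H. S \<notin> G} \<union> insert i ` {S \<in> H. insert i S \<notin> G}"
 have finH: "finite H" using I by (simp add: H_def)
 have "card B <= card {S \<in> H. S \<notin> G} + card {S \<in> H. insert i S \<notin> G}"
  unfolding B_def using card_Un_le[of "{S \<in> H. S \<notin> G}" "{S \<in> H. insert i S \<notin> G}"]
  by (simp add: Collect_disj_eq[symmetric] conj_disj_distribL[symmetric] Un_def)
 also have "card {S \<in> H. insert i S \<notin> G} = card (insert i ` {S \<in> H. insert i S \<notin> G})"
  by (rule card_image[symmetric]) (auto simp: inj_on_def H_def)
 also have "card {S \<in> H. S \<notin> G} + ... = card C"
  unfolding C_def using finH by (intro card_Un_disjoint[symmetric]) (auto simp: H_def)
 also have "card C <= card (Pow I - G)" using I fin by (intro card_mono) (auto simp: C_def H_def)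
 also have "... = card (Pow I) - card G" using G fin by (intro card_Diff_subset) (auto intro: finite_subset)
 finally have B: "card B <= 2 ^ card I - card G" using I by (simp add: card_Pow)
 have "{S \<in> G. i \<notin> S \<and> insert i S \<in> G} = H - B" using G by (auto simp: H_def B_def)
 then have "card {S \<in> G. i \<notin> S \<and> insert i S \<in> G} = card H - card B"
  using finH by (simp add: card_Diff_subset B_def)
 then show ?thesis using B cH G(2) by linarith
qed

text \<open>On an edge in direction \<open>i\<close> the two values of the sign cannot both be close to \<open>a i\<close>:
\<open>(a i + 1)\<^sup>2 + (a i - 1)\<^sup>2 \<ge> 2\<close>.\<close>

lemma assouad_pointwise:
 fixes P :: "'i set \<Rightarrow> real"
 assumes I: "finite I" and G: "G \<subseteq> Pow I" and P: "\<And>S. S \<in> G ==> P S >= 0"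
 shows "(\<Sum>i\<in>I. \<Sum>S | S \<in> G \<and> i \<notin> S \<and> insert i S \<in> G. 2 * min (P S) (P (insert i S)))
   <= (\<Sum>S\<in>G. (\<Sum>i\<in>I. (a i - rsign S i)^2) * P S)"
proof -
 have finG: "finite G" using I G by (meson finite_Pow_iff finite_subset)
 have "(\<Sum>S | S \<in> G \<and> i \<notin> S \<and> insert i S \<in> G. 2 * min (P S) (P (insert i S)))
   <= (\<Sum>S\<in>G. (a i - rsign S i)^2 * P S)" if "i \<in> I" for i
 proof -
  let ?E = "{S \<in> G. i \<notin> S \<and> insert i S \<in> G}"
  have inj: "inj_on (insert i) ?E" by (auto simp: inj_on_def)
  have "(\<Sum>S\<in>?E. 2 * min (P S) (P (insert i S)))
    <= (\<Sum>S\<in>?E. (a i - rsign S i)^2 * P S + (a i - rsign (insert i S) i)^2 * P (insert i S))"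
  proof (rule sum_mono)
   fix S assume S: "S \<in> ?E"
   define m where "m = min (P S) (P (insert i S))"
   have m: "0 <= m" "m <= P S" "m <= P (insert i S)" using S P by (auto simp: m_def)
   have "2 * m <= ((a i + 1)^2 + (a i - 1)^2) * m" using m by (intro mult_right_mono) (auto simp: power2_sum power2_diff)
   also have "... <= (a i + 1)^2 * P S + (a i - 1)^2 * P (insert i S)"
    using m unfolding distrib_right by (intro add_mono mult_left_mono) auto
   finally show "2 * min (P S) (P (insert i S))
     <= (a i - rsign S i)^2 * P S + (a i - rsign (insert i S) i)^2 * P (insert i S)" using S by (simp add: rsign_def m_def)
  qed
  also have "... = (\<Sum>S\<in>?E \<union> insert i ` ?E. (a i - rsign S i)^2 * P S)"
   using finG inj by (subst sum.union_disjoint) (auto simp: sum.distrib sum.reindex)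
  also have "... <= (\<Sum>S\<in>G. (a i - rsign S i)^2 * P S)" using finG P by (intro sum_mono2) auto
  finally show ?thesis .
 qed
 then have "(\<Sum>i\<in>I. \<Sum>S | S \<in> G \<and> i \<notin> S \<and> insert i S \<in> G. 2 * min (P S) (P (insert i S)))
   <= (\<Sum>i\<in>I. \<Sum>S\<in>G. (a i - rsign S i)^2 * P S)" by (rule sum_mono)
 also have "... = (\<Sum>S\<in>G. (\<Sum>i\<in>I. (a i - rsign S i)^2) * P S)" by (subst sum.swap) (simp add: sum_distrib_right)
 finally show ?thesis .
qed

text \<open>The \<open>a i\<close> are the coefficients of the estimate \<open>t\<close>, up to scaling. By Bessel's inequality the loss
controls the error in the signs; \<open>e\<close> accounts for the densities being only approximately of the form
\<open>1 + \<delta> * (\<Sum>i\<in>I. \<plusminus> \<psi> i)\<close>.\<close>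

lemma loss_coefficients:
 assumes ons: "orthonormal_on \<nu> I \<psi>" "finite I" and fin: "finite_measure \<nu>" and d: "\<delta> > 0"
  and t: "square_integrable \<nu> t" and p: "\<And>S. S \<in> G ==> square_integrable \<nu> (p S)"
  and err: "\<And>S. S \<in> G ==> (LINT x|\<nu>. (p S x - (1 + \<delta> * (\<Sum>i\<in>I. rsign S i * \<psi> i x)))^2) <= e"
 shows "\<exists>a. \<forall>S\<in>G. \<delta>^2 * (\<Sum>i\<in>I. (a i - rsign S i)^2) <= 2 * (LINT x|\<nu>. (t x - p S x)^2) + 2 * e"
proof -
 have one: "square_integrable \<nu> (\<lambda>_. 1)" using fin by (intro sq_bounded[where B = 1]) auto
 have t1: "square_integrable \<nu> (\<lambda>x. t x - 1)" by (rule sq_diff[OF t one])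
 define a where "a i = (LINT x|\<nu>. (t x - 1) * \<psi> i x) / \<delta>" for i
 have "\<delta>^2 * (\<Sum>i\<in>I. (a i - rsign S i)^2) <= 2 * (LINT x|\<nu>. (t x - p S x)^2) + 2 * e" if S: "S \<in> G" for S
 proof -
  define f where "f x = \<delta> * (\<Sum>i\<in>I. rsign S i * \<psi> i x)" for x
  have f: "square_integrable \<nu> f" unfolding f_def using ons by (intro sq_sum sq_cmult) (auto simp: orthonormal_on_def)
  have q: "square_integrable \<nu> (\<lambda>x. 1 + f x)" by (rule sq_add[OF one f])
  have tf: "square_integrable \<nu> (\<lambda>x. t x - 1 - f x)" by (rule sq_diff[OF t1 f])
  have coef: "(LINT x|\<nu>. (t x - 1 - f x) * \<psi> i x) = \<delta> * (a i - rsign S i)" if "i \<in> I" for i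
  proof -
   have psi: "square_integrable \<nu> (\<psi> i)" using ons that by (auto simp: orthonormal_on_def)
   have fx: "f = (\<lambda>x. \<Sum>i\<in>I. (\<delta> * rsign S i) * \<psi> i x)"
    by (auto simp: f_def sum_distrib_left mult_ac)
   have "(LINT x|\<nu>. (t x - 1 - f x) * \<psi> i x) = (LINT x|\<nu>. (t x - 1) * \<psi> i x - f x * \<psi> i x)"
    by (intro integral_eqI) (simp add: algebra_simps)
   also have "... = (LINT x|\<nu>. (t x - 1) * \<psi> i x) - (LINT x|\<nu>. f x * \<psi> i x)"
    by (intro Bochner_Integration.integral_diff sq_mult_integrable t1 f psi)
   also have "(LINT x|\<nu>. f x * \<psi> i x) = \<delta> * rsign S i"
    unfolding fx by (rule orthonormal_coefficient[OF ons that])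
   finally show ?thesis using d by (simp add: a_def algebra_simps)
  qed
  have "\<delta>^2 * (\<Sum>i\<in>I. (a i - rsign S i)^2) = (\<Sum>i\<in>I. (LINT x|\<nu>. (t x - 1 - f x) * \<psi> i x)^2)"
   by (simp add: coef power_mult_distrib sum_distrib_left)
  also have "... <= (LINT x|\<nu>. (t x - 1 - f x)^2)" by (rule bessel_inequality[OF ons tf])
  also have "... = (LINT x|\<nu>. ((t x - p S x) + (p S x - (1 + f x)))^2)" by (intro integral_eqI) (simp add: algebra_simps)
  also have "... <= 2 * (LINT x|\<nu>. (t x - p S x)^2) + 2 * (LINT x|\<nu>. (p S x - (1 + f x))^2)"
   by (intro integral_square_triangle sq_diff t p[OF S] q)
  also have "(LINT x|\<nu>. (p S x - (1 + f x))^2) <= e" using err[OF S] by (simp add: f_def)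
  finally show ?thesis by simp
 qed
 then show ?thesis by blast
qed

text \<open>The signs range over a part \<open>G\<close> of the cube, as the densities may fail to be admissible at the other vertices. Three
quarters of the vertices leave at least half of the edges in every direction, and on each edge the two product densities overlap
by a constant, so the sum of the risks over \<open>G\<close> is at least
\<open>\<delta>\<^sup>2 * card I * 2 ^ card I / 32\<close>, up to the error term.\<close>

theorem assouad_risk:
 fixes I :: "'i set" and \<psi> :: "'i \<Rightarrow> 'a \<Rightarrow> real" and p :: "'i set \<Rightarrow> 'a \<Rightarrow> real"
 assumes prob: "prob_space \<nu>" and I: "finite I" and ons: "orthonormal_on \<nu> I \<psi>"
  and G: "G \<subseteq> Pow I" "4 * card G >= 3 * 2 ^ card I"
  and pm: "\<And>S. S \<in> G ==> p S \<in> borel_measurable \<nu>"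
  and pb: "\<And>S x. S \<in> G ==> x \<in> space \<nu> ==> p S x \<in> {1/2..3/2}"
  and p1: "\<And>S. S \<in> G ==> (LINT x|\<nu>. p S x) = 1"
  and err: "\<And>S. S \<in> G ==> (LINT x|\<nu>. (p S x - (1 + \<delta> * (\<Sum>i\<in>I. rsign S i * \<psi> i x)))^2) <= \<delta>^2 * real (card I) / 64"
  and near: "\<And>S i. S \<in> G ==> i \<in> I ==> i \<notin> S ==> insert i S \<in> G ==>
   (LINT x|\<nu>. (p S x - p (insert i S) x)^2) <= 4 * \<delta>^2"
  and d: "\<delta> > 0" "real n * \<delta>^2 <= 1 / 2" and n: "n > 0"
  and T: "T \<in> estimators \<nu> n"
 shows "\<exists>S\<in>G. risk \<nu> n T (p S) >= ennreal (\<delta>^2 * real (card I) / 64)"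
proof -
 interpret \<nu>: prob_space \<nu> by fact
 let ?M = "\<Pi>\<^sub>M i\<in>{..<n}. \<nu>"
 define m where "m = real (card I)"
 define e where "e = \<delta>^2 * m / 64"
 have e0: "e >= 0" by (simp add: e_def m_def)
 define PP where "PP = (\<lambda>S (X :: nat \<Rightarrow> 'a). \<Prod>i<n. p S (X i))"
 define loss where "loss = (\<lambda>S X. \<integral>\<^sup>+x. ennreal ((T X x - p S x)^2) \<partial>\<nu>)"
 define E where "E i = {S \<in> G. i \<notin> S \<and> insert i S \<in> G}" for i
 have finG: "finite G" using I G(1) by (meson finite_Pow_iff finite_subset)
 have finE: "finite (E i)" for i using finG by (simp add: E_def)
 have sqp: "square_integrable \<nu> (p S)" if "S \<in> G" for S
  using pb[OF that] by (intro sq_bounded[where B = "3/2"] \<nu>.finite_measure_axioms pm that) force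
 have PPm: "PP S \<in> borel_measurable ?M" if "S \<in> G" for S
  unfolding PP_def by (rule borel_measurable_PiM_prod[OF pm[OF that]])
 have sp: "X i \<in> space \<nu>" if "X \<in> space ?M" "i < n" for X i using that by (auto simp: space_PiM)
 have PPpos: "PP S X > 0" if "S \<in> G" "X \<in> space ?M" for S X
 proof -
  have "p S (X i) > 0" if "i < n" for i using pb[OF \<open>S \<in> G\<close> sp[OF \<open>X \<in> space ?M\<close> that]] by auto
  then show ?thesis unfolding PP_def by (intro prod_pos) auto
 qed
 have PPe: "(\<Prod>i<n. ennreal (p S (X i))) = ennreal (PP S X)" if "S \<in> G" "X \<in> space ?M" for S X
 proof -
  have "p S (X i) >= 0" if "i < n" for i using pb[OF \<open>S \<in> G\<close> sp[OF \<open>X \<in> space ?M\<close> that]] by auto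
  then show ?thesis unfolding PP_def by (intro prod_ennreal) auto
 qed
 have lossm: "loss S \<in> borel_measurable ?M" if S: "S \<in> G" for S
 proof -
  have [measurable]: "(\<lambda>(X, x). T X x) \<in> borel_measurable (?M \<Otimes>\<^sub>M \<nu>)" "p S \<in> borel_measurable \<nu>"
   using T pm[OF S] by (auto simp: estimators_def)
  have "(\<lambda>(X, x). ennreal ((T X x - p S x)^2)) \<in> borel_measurable (?M \<Otimes>\<^sub>M \<nu>)"
   by (simp add: split_beta') measurable
  from \<nu>.borel_measurable_nn_integral[OF this] show ?thesis by (simp add: loss_def)
 qed
 have Tm: "T X \<in> borel_measurable \<nu>" if "X \<in> space ?M" for X
 proof -
  have "(\<lambda>(X, x). T X x) \<in> borel_measurable (?M \<Otimes>\<^sub>M \<nu>)" using T by (simp add: estimators_def)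
  from measurable_Pair2[OF this that] show ?thesis by simp
 qed
 have riskeq: "risk \<nu> n T (p S) = (\<integral>\<^sup>+X. ennreal (PP S X) * loss S X \<partial>?M)" if S: "S \<in> G" for S
 proof -
  have [measurable]: "p S \<in> borel_measurable \<nu>" by (rule pm[OF S])
  have D: "(\<Pi>\<^sub>M i\<in>{..<n}. density \<nu> (\<lambda>x. ennreal (p S x))) = density ?M (\<lambda>X. \<Prod>i\<in>{..<n}. ennreal (p S (X i)))"
  proof (rule PiM_density[OF _ prob])
   have "(\<integral>\<^sup>+x. ennreal (p S x) \<partial>\<nu>) <= (\<integral>\<^sup>+x. ennreal (3/2) \<partial>\<nu>)"
    using pb[OF S] by (intro nn_integral_mono ennreal_leI) auto
   also have "... < \<infinity>" by (simp add: \<nu>.emeasure_space_1 ennreal_mult_less_top)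
   finally show "(\<integral>\<^sup>+x. ennreal (p S x) \<partial>\<nu>) < \<infinity>" .
  qed auto
  have "risk \<nu> n T (p S) = (\<integral>\<^sup>+X. (\<Prod>i\<in>{..<n}. ennreal (p S (X i))) * loss S X \<partial>?M)"
   unfolding risk_def D loss_def[symmetric, THEN fun_cong, THEN fun_cong]
   using lossm[OF S] by (subst nn_integral_density) (auto simp: loss_def)
  also have "... = (\<integral>\<^sup>+X. ennreal (PP S X) * loss S X \<partial>?M)"
   by (intro nn_integral_cong) (simp add: PPe[OF S])
  finally show ?thesis .
 qed
 have PPtot: "(\<integral>\<^sup>+X. ennreal (PP S X) \<partial>?M) = 1" if S: "S \<in> G" for S
  using product_density_total[OF prob pm[OF S] pb[OF S] p1[OF S], of n] by (subst nn_integral_cong[OF PPe[OF S, symmetric]]) auto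
 let ?m = "\<lambda>i S X. min (ennreal (PP S X)) (ennreal (PP (insert i S) X))" and ?V = "\<lambda>X. \<Sum>i\<in>I. \<Sum>S\<in>E i. ennreal (\<delta>^2) * min (ennreal (PP S X)) (ennreal (PP (insert i S) X))" and ?W = "\<lambda>X. \<Sum>S\<in>G. ennreal (PP S X) * loss S X + ennreal e * ennreal (PP S X)" and ?r = "\<lambda>X. \<Sum>i\<in>I. \<Sum>S\<in>E i. \<delta>^2 * min (PP S X) (PP (insert i S) X)"
 have ptw: "?V X <= ?W X" if X: "X \<in> space ?M" for X
 proof (cases "\<forall>S\<in>G. loss S X < \<infinity>")
  case False
  then obtain S where S: "S \<in> G" "loss S X = \<infinity>" by (auto simp: not_less top_unique)
  have "ennreal (PP S X) * loss S X = \<infinity>" using PPpos[OF S(1) X] S(2) by (simp add: ennreal_mult_top)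
  then have "?W X = \<infinity>" using finG S(1) by (subst sum.remove[OF finG S(1)]) simp
  then show ?thesis by simp
 next
  case fin: True
  have tS: "square_integrable \<nu> (\<lambda>x. T X x - p S x)" if "S \<in> G" for S
   unfolding square_integrable_def
  proof (intro conjI integrableI_nonneg)
   show "(\<lambda>x. T X x - p S x) \<in> borel_measurable \<nu>" using Tm[OF X] pm[OF that] by simp
   then show "(\<lambda>x. (T X x - p S x)^2) \<in> borel_measurable \<nu>" by simp
  qed (use fin that in \<open>auto simp: loss_def\<close>)
  have lossS: "loss S X = ennreal (LINT x|\<nu>. (T X x - p S x)^2)" if "S \<in> G" for S
   unfolding loss_def using tS[OF that] by (intro nn_integral_eq_integral) (auto simp: square_integrable_def)
  show ?thesis
  proof (cases "G = {}")
   case True then show ?thesis by (simp add: E_def)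
  next
   case False
   then obtain S0 where S0: "S0 \<in> G" by blast
   have t: "square_integrable \<nu> (T X)" using sq_add[OF tS[OF S0] sqp[OF S0]] by simp
   obtain a where a: "\<And>S. S \<in> G ==> \<delta>^2 * (\<Sum>i\<in>I. (a i - rsign S i)^2)
     <= 2 * (LINT x|\<nu>. (T X x - p S x)^2) + 2 * e"
    using loss_coefficients[OF ons I \<nu>.finite_measure_axioms d(1) t, of G p e] sqp err by (auto simp: e_def m_def)
   define l where "l S = (LINT x|\<nu>. (T X x - p S x)^2)" for S
   have l0: "l S >= 0" for S by (simp add: l_def)
   have "?r X
     = \<delta>^2 / 2 * (\<Sum>i\<in>I. \<Sum>S | S \<in> G \<and> i \<notin> S \<and> insert i S \<in> G. 2 * min (PP S X) (PP (insert i S) X))"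
    by (simp add: E_def sum_distrib_left mult_ac)
   also have "... <= \<delta>^2 / 2 * (\<Sum>S\<in>G. (\<Sum>i\<in>I. (a i - rsign S i)^2) * PP S X)"
    by (intro mult_left_mono assouad_pointwise[OF I G(1)]) (use PPpos[OF _ X] in \<open>auto intro: less_imp_le\<close>)
   also have "... = (\<Sum>S\<in>G. \<delta>^2 * (\<Sum>i\<in>I. (a i - rsign S i)^2) / 2 * PP S X)"
    unfolding sum_distrib_left[of "\<delta>^2 / 2" _ G] by (intro sum.cong refl) simp
   also have "... <= (\<Sum>S\<in>G. (l S + e) * PP S X)"
    using a PPpos[OF _ X] by (intro sum_mono mult_right_mono) (force simp: l_def intro: less_imp_le)+
   finally have real_le: "?r X <= (\<Sum>S\<in>G. (l S + e) * PP S X)" .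
   have "?V X = (\<Sum>i\<in>I. \<Sum>S\<in>E i. ennreal (\<delta>^2 * min (PP S X) (PP (insert i S) X)))"
   proof (intro sum.cong refl)
    fix i S assume "S \<in> E i"
    then have "0 <= PP S X" "0 <= PP (insert i S) X"
     using PPpos[OF _ X, of S] PPpos[OF _ X, of "insert i S"] by (auto simp: E_def)
    then show "ennreal (\<delta>^2) * ?m i S X
      = ennreal (\<delta>^2 * min (PP S X) (PP (insert i S) X))" by (simp add: ennreal_mult min_def)
   qed
   also have "... = ennreal (?r X)"
   proof -
    have nn: "0 <= \<delta>^2 * min (PP S X) (PP (insert i S) X)" if "S \<in> E i" for i S
     using PPpos[OF _ X, of S] PPpos[OF _ X, of "insert i S"] that by (auto simp: E_def)
    show ?thesis by (simp add: nn sum_nonneg)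
   qed
   also have "... <= ennreal (\<Sum>S\<in>G. (l S + e) * PP S X)" by (rule ennreal_leI[OF real_le])
   also have "... = (\<Sum>S\<in>G. ennreal ((l S + e) * PP S X))"
    using l0 e0 PPpos[OF _ X] by (intro sum_ennreal[symmetric] mult_nonneg_nonneg) (auto intro: less_imp_le)
   also have "... = ?W X"
    using l0 e0 PPpos[OF _ X]
    by (intro sum.cong refl) (simp add: lossS l_def[symmetric] ennreal_mult[symmetric] ennreal_plus[symmetric] less_imp_le algebra_simps del: ennreal_plus)
   finally show ?thesis .
  qed
 qed
 have m2: "ennreal (\<delta>^2 * m * 2 ^ card I / 32) <= (\<Sum>i\<in>I. \<Sum>S\<in>E i. ennreal (\<delta>^2) * ennreal (1/8))"
 proof -
  have "\<delta>^2 * m * 2 ^ card I / 32 = (\<Sum>i\<in>I. \<delta>^2 * (1/8) * (2 ^ card I / 4))" by (simp add: m_def)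
  also have "... <= (\<Sum>i\<in>I. \<delta>^2 * (1/8) * real (card (E i)))"
  proof (intro sum_mono mult_left_mono)
   fix i assume "i \<in> I"
   from card_good_edges[OF I this G] have "2 ^ card I <= 4 * card (E i)" by (simp add: E_def)
   then have "real (2 ^ card I) <= real (4 * card (E i))" by (rule of_nat_mono)
   then show "2 ^ card I / 4 <= real (card (E i))" by simp
  qed simp
  also have "... = (\<Sum>i\<in>I. \<Sum>S\<in>E i. \<delta>^2 * (1/8))" by (simp add: mult_ac)
  finally have "ennreal (\<delta>^2 * m * 2 ^ card I / 32) <= ennreal (\<Sum>i\<in>I. \<Sum>S\<in>E i. \<delta>^2 * (1/8))" by (rule ennreal_leI)
  also have "... = (\<Sum>i\<in>I. \<Sum>S\<in>E i. ennreal (\<delta>^2 * (1/8)))"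
   by (simp only: sum_ennreal sum_nonneg zero_le_power2 zero_le_mult_iff zero_le_divide_1_iff zero_le_numeral simp_thms)
  also have "... = (\<Sum>i\<in>I. \<Sum>S\<in>E i. ennreal (\<delta>^2) * ennreal (1/8))"
   by (intro sum.cong refl ennreal_mult) auto
  finally show ?thesis .
 qed
 also have "... <= (\<Sum>i\<in>I. \<Sum>S\<in>E i. ennreal (\<delta>^2) * (\<integral>\<^sup>+X. ?m i S X \<partial>?M))"
 proof (intro sum_mono mult_left_mono)
  fix i S assume i: "i \<in> I" and "S \<in> E i"
  then have S: "S \<in> G" "insert i S \<in> G" "i \<notin> S" by (auto simp: E_def)
  have "ennreal (1/8) <= (\<integral>\<^sup>+X. min (\<Prod>j<n. ennreal (p S (X j))) (\<Prod>j<n. ennreal (p (insert i S) (X j))) \<partial>?M)"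
   using d by (intro product_min_density_ge[where e = "\<delta>^2"] prob pm pb p1 near S i n) auto
  also have "... = (\<integral>\<^sup>+X. ?m i S X \<partial>?M)" by (intro nn_integral_cong) (simp add: PPe S)
  finally show "ennreal (1/8) <= (\<integral>\<^sup>+X. ?m i S X \<partial>?M)" .
 qed simp
 also have "... = (\<integral>\<^sup>+X. ?V X \<partial>?M)"
 proof -
  have [measurable]: "PP S \<in> borel_measurable ?M" "PP (insert i S) \<in> borel_measurable ?M" if "S \<in> E i" for i S
   using that by (auto simp: E_def intro: PPm)
  show ?thesis by (simp add: nn_integral_sum nn_integral_cmult)
 qed
 also have "... <= (\<integral>\<^sup>+X. ?W X \<partial>?M)" by (intro nn_integral_mono ptw)
 also have "... = (\<Sum>S\<in>G. risk \<nu> n T (p S) + ennreal e)"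
  using PPm lossm by (simp add: nn_integral_sum nn_integral_add nn_integral_cmult riskeq PPtot)
 finally have main: "ennreal (\<delta>^2 * m * 2 ^ card I / 32) <= (\<Sum>S\<in>G. risk \<nu> n T (p S) + ennreal e)" .
 show ?thesis
 proof (rule ccontr)
  assume "\<not> ?thesis"
  then have less: "risk \<nu> n T (p S) < ennreal e" if "S \<in> G" for S using that by (auto simp: e_def m_def not_le)
  define r where "r S = enn2real (risk \<nu> n T (p S))" for S
  have rr: "risk \<nu> n T (p S) = ennreal (r S)" "r S < e" "0 <= r S" if "S \<in> G" for S
  proof -
   have "risk \<nu> n T (p S) < top" using less[OF that] by (rule order_less_trans) simp
   then show a: "risk \<nu> n T (p S) = ennreal (r S)" by (simp add: r_def)
   show "0 <= r S" by (simp add: r_def)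
   then show "r S < e" using less[OF that] unfolding a by (simp add: ennreal_less_iff)
  qed
  have Gne: "G \<noteq> {}" using G(2) by auto
  have "(\<Sum>S\<in>G. risk \<nu> n T (p S) + ennreal e) = (\<Sum>S\<in>G. ennreal (r S + e))"
   using rr e0 by (intro sum.cong refl) simp
  also have "... = ennreal (\<Sum>S\<in>G. r S + e)" using rr e0 by (intro sum_ennreal) auto
  finally have "ennreal (\<delta>^2 * m * 2 ^ card I / 32) <= ennreal (\<Sum>S\<in>G. r S + e)" using main by simp
  then have "\<delta>^2 * m * 2 ^ card I / 32 <= (\<Sum>S\<in>G. r S + e)"
   using rr e0 by (subst (asm) ennreal_le_iff) (auto intro!: sum_nonneg)
  also have "... < (\<Sum>S\<in>G. e + e)" using rr finG Gne by (intro sum_strict_mono) auto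
  also have "... = real (card G) * (2 * e)" by simp
  also have "... <= 2 ^ card I * (2 * e)"
  proof (intro mult_right_mono)
   have "card G <= 2 ^ card I" using card_mono[OF _ G(1)] I by (simp add: card_Pow)
   then have "real (card G) <= real (2 ^ card I)" by (rule of_nat_mono)
   then show "real (card G) <= 2 ^ card I" by simp
  qed (use e0 in simp)
  finally show False by (simp add: e_def)
 qed
qed

section \<open>Differentiability classes of functions in charts\<close>

lemma Ck_on_cong:
 assumes "open S" "\<And>x. x \<in> S ==> f x = g x"
 shows "Ck_on k S f \<longleftrightarrow> Ck_on k S g"
proof -
 have *: "Ck_on k S g" if "Ck_on k S f" "\<And>x. x \<in> S ==> f x = g x" for k and f g :: "'a \<Rightarrow> 'b"
  using that
 proof (induction k arbitrary: f g)
  case 0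
  then show ?case using continuous_on_cong[of S S f g] by simp
 next
  case (Suc k)
  have D: "(g has_derivative frechet_derivative f (at x)) (at x)" if "x \<in> S" for x
  proof (rule has_derivative_transform_within_open[OF _ \<open>open S\<close> that])
   show "(f has_derivative frechet_derivative f (at x)) (at x)" using Suc.prems(1) that by (simp add: frechet_derivative_works)
  qed (use Suc.prems in auto)
  then have "frechet_derivative g (at x) = frechet_derivative f (at x)" if "x \<in> S" for x
   using frechet_derivative_at that by metis
  then show ?case
   using Suc.prems D Suc.IH[of "\<lambda>x. frechet_derivative f (at x) b" "\<lambda>x. frechet_derivative g (at x) b" for b]
   by (auto simp: differentiable_def)
 qed
 show ?thesis using *[of k f g] *[of k g f] assms(2) by auto
qed

lemma Ck_on_subset: "Ck_on k S f ==> T \<subseteq> S ==> Ck_on k T f"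
 by (induction k arbitrary: f) (auto intro: continuous_on_subset)

lemma Ck_on_imp_continuous: "Ck_on k S f ==> continuous_on S f"
 by (cases k) (auto intro!: continuous_at_imp_continuous_on differentiable_imp_continuous_within)

lemma Ck_on_SucD: "Ck_on (Suc k) S f ==> Ck_on k S f"
proof (induction k arbitrary: f)
 case 0
 then show ?case using Ck_on_imp_continuous[of "Suc 0" S f] by simp
next
 case (Suc k)
 then have "\<forall>x\<in>S. f differentiable at x"
  and "\<forall>b\<in>Basis. Ck_on (Suc k) S (\<lambda>x. frechet_derivative f (at x) b)"
  unfolding Ck_on.simps(2)[of "Suc k" S f] by blast+
 then show ?case using Suc.IH by simp
qed
lemma Ck_on_Suc_I:
 assumes "open S" "\<And>x. x \<in> S ==> (f has_derivative D x) (at x)"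
  and "\<And>b. b \<in> Basis ==> Ck_on k S (\<lambda>x. D x b)"
 shows "Ck_on (Suc k) S f"
proof -
 have "frechet_derivative f (at x) = D x" if "x \<in> S" for x using frechet_derivative_at[OF assms(2)[OF that]] by simp
 then have "Ck_on k S (\<lambda>x. frechet_derivative f (at x) b) = Ck_on k S (\<lambda>x. D x b)" for b
  by (intro Ck_on_cong assms(1)) simp
 then show ?thesis using assms by (auto simp: differentiable_def)
qed

lemma Ck_on_has_derivative:
 "Ck_on (Suc k) S f ==> x \<in> S ==> (f has_derivative frechet_derivative f (at x)) (at x)"
 by (simp add: frechet_derivative_works)

lemma Ck_on_const [simp]: "open S ==> Ck_on k S (\<lambda>x. c)"
proof (induction k arbitrary: c)
 case (Suc k)
 then show ?case by (intro Ck_on_Suc_I[where D = "\<lambda>x b. 0"]) auto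
qed simp

lemma Ck_on_bounded_linear_compose:
 assumes "open S" "bounded_linear L" "Ck_on k S f"
 shows "Ck_on k S (\<lambda>x. L (f x))"
 using assms(3)
proof (induction k arbitrary: f)
 case 0
 then show ?case using assms(2) by (simp add: bounded_linear.continuous_on)
next
 case (Suc k)
 show ?case
 proof (rule Ck_on_Suc_I[OF assms(1)])
  show "((\<lambda>x. L (f x)) has_derivative (\<lambda>b. L (frechet_derivative f (at x) b))) (at x)" if "x \<in> S" for x
   using Ck_on_has_derivative[OF Suc.prems that] assms(2) by (rule bounded_linear.has_derivative[rotated])
 qed (use Suc in simp)
qed

lemma Ck_on_add:
 assumes "open S" "Ck_on k S f" "Ck_on k S g"
 shows "Ck_on k S (\<lambda>x. f x + g x)"
 using assms(2,3)
proof (induction k arbitrary: f g)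
 case 0
 then show ?case by (simp add: continuous_on_add)
next
 case (Suc k)
 show ?case
 proof (rule Ck_on_Suc_I[OF assms(1)])
  show "((\<lambda>x. f x + g x) has_derivative (\<lambda>b. frechet_derivative f (at x) b + frechet_derivative g (at x) b)) (at x)"
   if "x \<in> S" for x using Suc.prems that by (intro has_derivative_add Ck_on_has_derivative)
 qed (use Suc in simp)
qed

lemma Ck_on_mult:
 fixes f g :: "'a::euclidean_space \<Rightarrow> real"
 assumes "open S" "Ck_on k S f" "Ck_on k S g"
 shows "Ck_on k S (\<lambda>x. f x * g x)"
 using assms(2,3)
proof (induction k arbitrary: f g)
 case 0
 then show ?case by (simp add: continuous_on_mult)
next
 case (Suc k)
 show ?case
 proof (rule Ck_on_Suc_I[OF assms(1)])
  show "((\<lambda>x. f x * g x) has_derivative (\<lambda>b. f x * frechet_derivative g (at x) b + frechet_derivative f (at x) b * g x)) (at x)"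
   if "x \<in> S" for x using Suc.prems that by (intro has_derivative_mult Ck_on_has_derivative)
  show "Ck_on k S (\<lambda>x. f x * frechet_derivative g (at x) b + frechet_derivative f (at x) b * g x)" if "b \<in> Basis" for b
   using Suc.prems that by (intro Ck_on_add[OF assms(1)] Suc.IH) (auto simp del: Ck_on.simps intro: Ck_on_SucD, auto)
 qed
qed

lemma Ck_on_sum:
 assumes "open S" "\<And>i. i \<in> I ==> Ck_on k S (f i)"
 shows "Ck_on k S (\<lambda>x. \<Sum>i\<in>I. f i x)"
 using assms(2) by (induction I rule: infinite_finite_induct) (auto intro: Ck_on_add[OF assms(1)] simp: assms(1))

lemma Ck_on_prod:
 fixes f :: "'i \<Rightarrow> 'a::euclidean_space \<Rightarrow> real"
 assumes "open S" "\<And>i. i \<in> I ==> Ck_on k S (f i)"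
 shows "Ck_on k S (\<lambda>x. \<Prod>i\<in>I. f i x)"
 using assms(2) by (induction I rule: infinite_finite_induct) (auto intro: Ck_on_mult[OF assms(1)] simp: assms(1))
lemma Ck_on_inverse:
 fixes f :: "'a::euclidean_space \<Rightarrow> real"
 assumes "open S" "Ck_on k S f" "\<And>x. x \<in> S ==> f x \<noteq> 0"
 shows "Ck_on k S (\<lambda>x. inverse (f x))"
 using assms(2)
proof (induction k)
 case 0
 then show ?case using assms(3) by (simp add: continuous_on_inverse)
next
 case (Suc k)
 show ?case
 proof (rule Ck_on_Suc_I[OF assms(1)])
  show "((\<lambda>x. inverse (f x)) has_derivative (\<lambda>b. - 1 * (inverse (f x) * frechet_derivative f (at x) b * inverse (f x)))) (at x)"
   if "x \<in> S" for x using Deriv.has_derivative_inverse[OF assms(3)[OF that] Ck_on_has_derivative[OF Suc.prems that]] by simp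
  show "Ck_on k S (\<lambda>x. - 1 * (inverse (f x) * frechet_derivative f (at x) b * inverse (f x)))" if "b \<in> Basis" for b
   using Suc that Ck_on_SucD[OF Suc.prems] by (intro Ck_on_mult[OF assms(1)] Ck_on_const assms(1)) auto
 qed
qed

lemma Ck_on_sqrt:
 fixes f :: "'a::euclidean_space \<Rightarrow> real"
 assumes "open S" "Ck_on k S f" "\<And>x. x \<in> S ==> f x > 0"
 shows "Ck_on k S (\<lambda>x. sqrt (f x))"
 using assms(2)
proof (induction k)
 case 0
 then show ?case by (simp add: continuous_on_real_sqrt)
next
 case (Suc k)
 have s0: "sqrt (f x) \<noteq> 0" if "x \<in> S" for x using assms(3)[OF that] by simp
 show ?case
 proof (rule Ck_on_Suc_I[OF assms(1)])
  show "((\<lambda>x. sqrt (f x)) has_derivative (\<lambda>b. frechet_derivative f (at x) b * (inverse (sqrt (f x)) * (1 / 2)))) (at x)"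
   if "x \<in> S" for x
   using has_derivative_real_sqrt[OF assms(3)[OF that] Ck_on_has_derivative[OF Suc.prems that]] by (simp add: field_simps)
  show "Ck_on k S (\<lambda>x. frechet_derivative f (at x) b * (inverse (sqrt (f x)) * (1 / 2)))" if "b \<in> Basis" for b
   using Suc that Ck_on_SucD[OF Suc.prems] s0 by (intro Ck_on_mult[OF assms(1)] Ck_on_const Ck_on_inverse assms(1)) auto
 qed
qed

lemma Ck_on_component: "open S ==> Ck_on k S (\<lambda>x::real^'n. x $ i)"
proof (induction k)
 case 0
 then show ?case by (simp add: continuous_on_component)
next
 case (Suc k)
 show ?case by (rule Ck_on_Suc_I[OF Suc.prems bounded_linear.has_derivative[OF bounded_linear_vec_nth has_derivative_ident]])
   (simp add: Suc.prems)
qed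

lemma Ck_on_det:
 fixes B :: "'a::euclidean_space \<Rightarrow> real^'n^'n"
 assumes "open S" "\<And>i j. Ck_on k S (\<lambda>x. B x $ i $ j)"
 shows "Ck_on k S (\<lambda>x. det (B x))" unfolding det_def by (intro Ck_on_sum Ck_on_mult Ck_on_prod Ck_on_const assms)

lemma matrix_inv_inverse:
 fixes B :: "real^'n^'n"
 assumes "det B \<noteq> 0"
 shows "B ** matrix_inv B = mat 1" "matrix_inv B ** B = mat 1"
proof -
 have "\<exists>B'. B ** B' = mat 1 \<and> B' ** B = mat 1"
  using assms by (simp add: invertible_det_nz[symmetric] invertible_def)
 then have "B ** matrix_inv B = mat 1 \<and> matrix_inv B ** B = mat 1" unfolding matrix_inv_def by (rule someI_ex)
 then show "B ** matrix_inv B = mat 1" "matrix_inv B ** B = mat 1" by auto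
qed

lemma matrix_inv_entry_cramer:
 fixes B :: "real^'n^'n"
 assumes "det B \<noteq> 0"
 shows "matrix_inv B $ k $ j = det (\<chi> i l. if l = k then axis j 1 $ i else B $ i $ l) / det B"
proof -
 have "B ** matrix_inv B = mat 1" by (rule matrix_inv_inverse[OF assms])
 then have "B *v (matrix_inv B *v axis j 1) = axis j 1" by (simp add: matrix_vector_mul_assoc)
 then have "matrix_inv B *v axis j 1 = (\<chi> k. det (\<chi> i l. if l = k then axis j 1 $ i else B $ i $ l) / det B)"
  using cramer[OF assms] by blast
 moreover have "(matrix_inv B *v axis j 1) $ k = matrix_inv B $ k $ j"
  by (simp add: matrix_vector_mult_def axis_def if_distrib cong: if_cong)
 ultimately show ?thesis by (metis (no_types, lifting) vec_lambda_beta)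
qed

lemma Ck_on_if:
 "Ck_on k S f ==> Ck_on k S g ==> Ck_on k S (\<lambda>x. if P then f x else g x)" by (cases P) auto

lemma Ck_on_matrix_inv_entry:
 fixes B :: "'a::euclidean_space \<Rightarrow> real^'n^'n"
 assumes "open S" "\<And>i j. Ck_on k S (\<lambda>x. B x $ i $ j)" "\<And>x. x \<in> S ==> det (B x) \<noteq> 0"
 shows "Ck_on k S (\<lambda>x. matrix_inv (B x) $ a $ b)"
proof -
 have "Ck_on k S (\<lambda>x. det (\<chi> i l. if l = a then axis b 1 $ i else B x $ i $ l) * inverse (det (B x)))"
  by (intro Ck_on_mult Ck_on_inverse Ck_on_det assms) (auto simp: assms intro!: Ck_on_if)
 moreover have "Ck_on k S (\<lambda>x. matrix_inv (B x) $ a $ b)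
   = Ck_on k S (\<lambda>x. det (\<chi> i l. if l = a then axis b 1 $ i else B x $ i $ l) * inverse (det (B x)))"
  by (intro Ck_on_cong assms(1)) (simp add: matrix_inv_entry_cramer assms(3) divide_inverse)
 ultimately show ?thesis by simp
qed

section \<open>Integration in charts\<close>

text \<open>The segment from the identity to \<open>B\<close> consists of positive definite, hence invertible, matrices, so the determinant
does not change its sign.\<close>

lemma pos_def_det_pos:
 fixes B :: "real^'n^'n"
 assumes "\<And>v. v \<noteq> 0 ==> v \<bullet> (B *v v) > 0"
 shows "det B > 0"
proof (rule ccontr)
 assume neg: "\<not> det B > 0"
 define C where "C t = (1 - t) *\<^sub>R mat 1 + t *\<^sub>R B" for t :: real
 have Cv: "C t *v v = (1 - t) *\<^sub>R v + t *\<^sub>R (B *v v)" for t v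
  by (simp add: C_def matrix_vector_mult_add_rdistrib scaleR_matrix_vector_assoc[symmetric])
 have nz: "det (C t) \<noteq> 0" if "0 <= t" "t <= 1" for t
 proof
  assume "det (C t) = 0"
  then have "\<not> invertible (C t)" by (simp add: invertible_det_nz)
  then obtain v where v: "v \<noteq> 0" "C t *v v = 0"
   using matrix_left_invertible_ker[of "C t"] invertible_left_inverse[of "C t"] by auto
  have "0 = v \<bullet> (C t *v v)" using v by simp
  also have "... = (1 - t) * (v \<bullet> v) + t * (v \<bullet> (B *v v))" by (simp add: Cv inner_add_right)
  finally have eq: "(1 - t) * (v \<bullet> v) + t * (v \<bullet> (B *v v)) = 0" by simp
  have ab: "v \<bullet> v > 0" "v \<bullet> (B *v v) > 0" using v assms by auto
  show False
  proof (cases "t = 0")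
   case True
   then show False using eq ab by simp
  next
   case False
   then have "t * (v \<bullet> (B *v v)) > 0" using that ab by simp
   moreover have "0 <= (1 - t) * (v \<bullet> v)" using that by simp
   ultimately show False using eq by linarith
  qed
 qed
 have cont: "continuous_on {0..1} (\<lambda>t. det (C t))" unfolding det_def C_def by (simp; intro continuous_intros)
 have "C 0 = mat 1" "C 1 = B" by (simp_all add: C_def)
 then have "det (C 1) <= 0" "0 <= det (C 0)" using neg by auto
 then have "\<exists>t. 0 <= t \<and> t <= 1 \<and> det (C t) = 0" by (intro IVT2') (use cont in auto)
 then show False using nz by blast
qed

abbreviation chart_image :: "('a, 'n::finite) chart \<Rightarrow> (real^'n) set" where
 "chart_image c \<equiv> chart_map c ` chart_dom c"

locale riemannian_probability = compact_riemannian_manifold M A g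
 for M :: "'a::t2_space set" and A :: "('a, 'n::finite) chart set"
  and g :: "('a, 'n) chart \<Rightarrow> real^'n \<Rightarrow> real^'n^'n" +
 fixes \<nu> :: "'a measure"
 assumes normalized: "is_normalized_volume M A g \<nu>"
begin

abbreviation L2 :: "('a \<Rightarrow> real) \<Rightarrow> bool" where "L2 \<equiv> square_integrable \<nu>"

lemma dom_subset: "c \<in> A ==> chart_dom c \<subseteq> M" using atlas_cover by blast

lemma inv_in_dom: "c \<in> A ==> y \<in> chart_image c ==> chart_inv c y \<in> chart_dom c"
 by (simp add: chart_inv_def inv_into_into)

lemma inv_in_M: "c \<in> A ==> y \<in> chart_image c ==> chart_inv c y \<in> M" using inv_in_dom dom_subset by blast

lemma map_inv: "c \<in> A ==> y \<in> chart_image c ==> chart_map c (chart_inv c y) = y"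
 by (simp add: chart_inv_def f_inv_into_f)

lemma inv_map: "c \<in> A ==> p \<in> chart_dom c ==> chart_inv c (chart_map c p) = p"
 using homeomorphism_apply1[OF chart_homeomorphism] by blast

lemma chart_inv_continuous: "c \<in> A ==> continuous_on (chart_image c) (chart_inv c)"
 using chart_homeomorphism by (auto simp: homeomorphism_def)

lemma chart_map_continuous: "c \<in> A ==> continuous_on (chart_dom c) (chart_map c)"
 using chart_homeomorphism by (auto simp: homeomorphism_def)

lemma det_pos: "c \<in> A ==> y \<in> chart_image c ==> det (g c y) > 0" by (rule pos_def_det_pos) (rule metric_pos_def)

lemma metric_entry_Ck: "c \<in> A ==> Ck_on k (chart_image c) (\<lambda>y. g c y $ i $ j)"
proof -
 assume c: "c \<in> A"
 have "bounded_linear (\<lambda>B :: real^'n^'n. B $ i $ j)"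
  by (intro bounded_linear_compose[OF bounded_linear_vec_nth] bounded_linear_vec_nth)
 from Ck_on_bounded_linear_compose[OF chart_image_open[OF c] this, of k "g c"] metric_smooth[OF c]
 show ?thesis by (simp add: smooth_on_def)
qed

lemma sqrt_det_Ck: "c \<in> A ==> Ck_on k (chart_image c) (\<lambda>y. sqrt (det (g c y)))"
 by (intro Ck_on_sqrt Ck_on_det chart_image_open metric_entry_Ck det_pos) auto

lemma inverse_metric_Ck: "c \<in> A ==> Ck_on k (chart_image c) (\<lambda>y. matrix_inv (g c y) $ i $ j)"
 by (intro Ck_on_matrix_inv_entry chart_image_open metric_entry_Ck) (auto dest: det_pos)

lemma sqrt_det_continuous: "c \<in> A ==> continuous_on (chart_image c) (\<lambda>y. sqrt (det (g c y)))"
 using sqrt_det_Ck[of c 0] by simp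

definition vol :: "'a measure" where
 "vol = (SOME V. is_riemannian_volume M A g V \<and> \<nu> = scale_measure (1 / emeasure V M) V)"

lemma vol: "is_riemannian_volume M A g vol" "\<nu> = scale_measure (1 / emeasure vol M) vol"
proof -
 have "is_riemannian_volume M A g vol \<and> \<nu> = scale_measure (1 / emeasure vol M) vol"
  using normalized someI_ex[of "\<lambda>V. is_riemannian_volume M A g V \<and> \<nu> = scale_measure (1 / emeasure V M) V"]
  unfolding is_normalized_volume_def vol_def by blast
 then show "is_riemannian_volume M A g vol" "\<nu> = scale_measure (1 / emeasure vol M) vol" by auto
qed

lemma sets_vol: "sets vol = sets (restrict_space borel M)" using vol(1) by (simp add: is_riemannian_volume_def)

lemma sets_nu: "sets \<nu> = sets (restrict_space borel M)" using sets_vol vol(2) by (metis sets_scale_measure)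

lemma space_vol: "space vol = M" using sets_eq_imp_space_eq[OF sets_vol] by (simp add: space_restrict_space)

lemma space_nu [simp]: "space \<nu> = M" using sets_eq_imp_space_eq[OF sets_nu] by (simp add: space_restrict_space)

lemma openin_sets:
 assumes "openin (top_of_set M) U"
 shows "U \<in> sets vol"
proof -
 obtain T where T: "open T" "U = M \<inter> T" using assms unfolding openin_open by blast
 then have "T \<in> sets borel" by simp
 then show ?thesis unfolding sets_vol sets_restrict_space T(2) by (rule imageI)
qed

lemma dom_sets: "c \<in> A ==> chart_dom c \<in> sets vol" by (intro openin_sets chart_open)

lemma image_borel [measurable]: "c \<in> A ==> chart_image c \<in> sets borel" by (intro borel_open chart_image_open)

definition some_point :: 'a where "some_point = (SOME p. p \<in> M)"

lemma some_point: "some_point \<in> M" unfolding some_point_def using nonempty by (simp add: some_in_eq)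

text \<open>Totalizing the inverse chart by an arbitrary point of \<open>M\<close> makes it a measurable map on the whole Euclidean space;
integrands carry the factor \<open>sqrt_det\<close>, which vanishes outside the image of the chart.\<close>

definition chart_inv_ext :: "('a, 'n) chart \<Rightarrow> real^'n \<Rightarrow> 'a" where
 "chart_inv_ext c y = (if y \<in> chart_image c then chart_inv c y else some_point)"

lemma chart_inv_ext_measurable:
 assumes c: "c \<in> A"
 shows "chart_inv_ext c \<in> measurable borel vol"
proof -
 have "chart_inv c \<in> measurable (restrict_space borel (chart_image c)) borel"
  by (rule borel_measurable_continuous_on_restrict[OF chart_inv_continuous[OF c]])
 then have "chart_inv_ext c \<in> measurable borel borel"
  unfolding chart_inv_ext_def by (subst measurable_If_restrict_space_iff) (use c in auto)
 moreover have "chart_inv_ext c y \<in> M" for y using some_point inv_in_M[OF c] by (auto simp: chart_inv_ext_def)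
 ultimately have "chart_inv_ext c \<in> measurable borel (restrict_space borel M)" by (intro measurable_restrict_space2) auto
 then show ?thesis using measurable_cong_sets[OF refl sets_vol] by blast
qed

definition sqrt_det :: "('a, 'n) chart \<Rightarrow> real^'n \<Rightarrow> real" where
 "sqrt_det c y = (if y \<in> chart_image c then sqrt (det (g c y)) else 0)"

lemma sqrt_det_measurable [measurable]: "c \<in> A ==> sqrt_det c \<in> borel_measurable borel"
 unfolding sqrt_det_def by (subst measurable_If_restrict_space_iff)
  (auto intro!: borel_measurable_continuous_on_restrict sqrt_det_continuous)

lemma nn_integral_chart_vol:
 assumes c: "c \<in> A" and f[measurable]: "f \<in> borel_measurable vol"
 shows "(\<integral>\<^sup>+p\<in>chart_dom c. f p \<partial>vol) = (\<integral>\<^sup>+y. f (chart_inv_ext c y) * ennreal (sqrt_det c y) \<partial>lborel)"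
proof -
 note [measurable] = dom_sets[OF c] chart_inv_ext_measurable[OF c] sqrt_det_measurable[OF c]
 define N where "N = distr (density lborel (\<lambda>y. ennreal (sqrt_det c y))) vol (chart_inv_ext c)"
 have "density vol (indicator (chart_dom c)) = N"
 proof (rule measure_eqI)
  fix B assume "B \<in> sets (density vol (indicator (chart_dom c)))"
  then have [measurable]: "B \<in> sets vol" by simp
  have BM: "B \<subseteq> M" using sets.sets_into_space[OF \<open>B \<in> sets vol\<close>] by (simp add: space_vol)
  have "emeasure (density vol (indicator (chart_dom c))) B = emeasure vol (chart_dom c \<inter> B)"
   by (simp add: emeasure_density indicator_inter_arith[symmetric])
  also have "... = (\<integral>\<^sup>+y\<in>chart_map c ` (chart_dom c \<inter> B). ennreal (sqrt (det (g c y))) \<partial>lborel)"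
   using vol(1) c unfolding is_riemannian_volume_def by auto
  also have "... = (\<integral>\<^sup>+y. ennreal (sqrt_det c y) * indicator B (chart_inv_ext c y) \<partial>lborel)"
  proof (intro nn_integral_cong)
   fix y
   have "y \<in> chart_map c ` (chart_dom c \<inter> B) \<longleftrightarrow> y \<in> chart_image c \<and> chart_inv c y \<in> B"
   proof
    assume "y \<in> chart_map c ` (chart_dom c \<inter> B)"
    then show "y \<in> chart_image c \<and> chart_inv c y \<in> B" using inv_map[OF c] by auto
   next
    assume y: "y \<in> chart_image c \<and> chart_inv c y \<in> B"
    then show "y \<in> chart_map c ` (chart_dom c \<inter> B)"
     using map_inv[OF c, of y] inv_in_dom[OF c, of y] by (intro image_eqI[where x = "chart_inv c y"]) auto
   qed
   then show "ennreal (sqrt (det (g c y))) * indicator (chart_map c ` (chart_dom c \<inter> B)) y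
     = ennreal (sqrt_det c y) * indicator B (chart_inv_ext c y)" by (auto simp: sqrt_det_def chart_inv_ext_def indicator_def)
  qed
  also have "... = emeasure N B"
   using measurable_sets[OF chart_inv_ext_measurable[OF c] \<open>B \<in> sets vol\<close>]
   unfolding N_def by (subst emeasure_distr; (subst emeasure_density)?) (auto intro!: nn_integral_cong simp: indicator_def)
  finally show "emeasure (density vol (indicator (chart_dom c))) B = emeasure N B" .
 qed (simp add: N_def)
 then have "(\<integral>\<^sup>+p. f p \<partial>density vol (indicator (chart_dom c))) = (\<integral>\<^sup>+p. f p \<partial>N)" by simp
 then show ?thesis unfolding N_def by (simp add: nn_integral_density nn_integral_distr mult.commute)
qed

text \<open>Closed balls inside the image of a chart, where continuous coefficients are bounded. Finitely many of them cover the manifold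
(\<open>cover\<close> below), which turns local estimates into global ones.\<close>

definition good_ball :: "('a, 'n) chart \<times> (real^'n) \<times> real \<Rightarrow> bool" where
 "good_ball b = (case b of (c, x, r) \<Rightarrow> c \<in> A \<and> 0 < r \<and> cball x r \<subseteq> chart_image c)"

definition patch :: "('a, 'n) chart \<times> (real^'n) \<times> real \<Rightarrow> 'a set" where
 "patch b = (case b of (c, x, r) \<Rightarrow> chart_inv c ` ball x r)"

lemma patch_openin:
 assumes "good_ball b"
 shows "openin (top_of_set M) (patch b)"
proof -
 obtain c x r where b: "b = (c, x, r)" "c \<in> A" "cball x r \<subseteq> chart_image c"
  using assms by (cases b) (auto simp: good_ball_def)
 have "ball x r \<subseteq> chart_image c" using b(3) ball_subset_cball by blast
 then have "openin (top_of_set (chart_image c)) (ball x r)" using openin_open_eq[OF chart_image_open[OF b(2)]] by simp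
 then have "openin (top_of_set (chart_dom c)) (chart_inv c ` ball x r)"
  using homeomorphism_imp_open_map[OF homeomorphism_symD[OF chart_homeomorphism[OF b(2)]]] by blast
 then show ?thesis using openin_trans[OF _ chart_open[OF b(2)]] by (simp add: patch_def b)
qed

lemma good_ball_exists:
 assumes "p \<in> M" shows "\<exists>b. good_ball b \<and> p \<in> patch b"
proof -
 obtain c where c: "c \<in> A" "p \<in> chart_dom c" using assms atlas_cover by auto
 then have "chart_map c p \<in> chart_image c" by simp
 then obtain r where r: "r > 0" "cball (chart_map c p) r \<subseteq> chart_image c"
  using chart_image_open[OF c(1)] open_contains_cball by blast
 have "p = chart_inv c (chart_map c p)" using inv_map[OF c] by simp
 then have "p \<in> chart_inv c ` ball (chart_map c p) r" using r by (metis centre_in_ball imageI)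
 then show ?thesis using c r by (intro exI[of _ "(c, chart_map c p, r)"]) (simp add: good_ball_def patch_def)
qed

definition cover :: "(('a, 'n) chart \<times> (real^'n) \<times> real) set" where
 "cover = (SOME B. finite B \<and> (\<forall>b\<in>B. good_ball b) \<and> M = (\<Union>b\<in>B. patch b))"

lemma cover: "finite cover" "\<And>b. b \<in> cover ==> good_ball b" "M = (\<Union>b\<in>cover. patch b)"
proof -
 have "\<exists>B. finite B \<and> (\<forall>b\<in>B. good_ball b) \<and> M = (\<Union>b\<in>B. patch b)"
 proof -
  let ?C = "patch ` {b. good_ball b}"
  have "\<forall>U\<in>?C. openin (top_of_set M) U" using patch_openin by auto
  moreover have "M \<subseteq> \<Union>?C" using good_ball_exists by blast
  ultimately obtain D where D: "D \<subseteq> ?C" "finite D" "M \<subseteq> \<Union>D"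
   using compact unfolding compact_eq_openin_cover by meson
  then obtain B where B: "finite B" "B \<subseteq> {b. good_ball b}" "D = patch ` B" by (meson finite_subset_image)
  have "patch b \<subseteq> M" if "b \<in> B" for b using patch_openin[THEN openin_imp_subset] B(2) that by blast
  then have "(\<Union>b\<in>B. patch b) \<subseteq> M" by (rule UN_least)
  then have "M = (\<Union>b\<in>B. patch b)" using D(3) unfolding B(3) by (rule equalityI[rotated])
  then show ?thesis using B(1,2) by blast
 qed
 from someI_ex[OF this] show "finite cover" "\<And>b. b \<in> cover ==> good_ball b" "M = (\<Union>b\<in>cover. patch b)"
  unfolding cover_def by auto
qed

lemma good_ballD:
 assumes "good_ball (c, x, r)"
 shows "c \<in> A" "0 < r" "cball x r \<subseteq> chart_image c" "ball x r \<subseteq> chart_image c"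
 using assms ball_subset_cball[of x r] by (auto simp: good_ball_def)

lemma sqrt_det_bounds:
 assumes "good_ball (c, x, r)"
 shows "\<exists>l>0. \<exists>u>0. \<forall>y\<in>cball x r. l <= sqrt_det c y \<and> sqrt_det c y <= u"
proof -
 note gb = good_ballD[OF assms]
 have cont: "continuous_on (cball x r) (\<lambda>y. sqrt (det (g c y)))"
  using continuous_on_subset[OF sqrt_det_continuous[OF gb(1)] gb(3)] .
 have ne: "cball x r \<noteq> {}" using gb(2) by simp
 obtain y1 where y1: "y1 \<in> cball x r" "\<And>y. y \<in> cball x r ==> sqrt (det (g c y1)) <= sqrt (det (g c y))"
  using continuous_attains_inf[OF compact_cball ne cont] by blast
 obtain y2 where y2: "y2 \<in> cball x r" "\<And>y. y \<in> cball x r ==> sqrt (det (g c y)) <= sqrt (det (g c y2))"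
  using continuous_attains_sup[OF compact_cball ne cont] by blast
 have "sqrt (det (g c y1)) > 0" "sqrt (det (g c y2)) > 0" using det_pos[OF gb(1)] y1(1) y2(1) gb(3) by auto
 moreover have "sqrt_det c y = sqrt (det (g c y))" if "y \<in> cball x r" for y using that gb(3) by (auto simp: sqrt_det_def)
 ultimately show ?thesis using y1(2) y2(2) by (intro exI[of _ "sqrt (det (g c y1))"] exI[of _ "sqrt (det (g c y2))"] conjI) auto
qed

lemma patch_sets: "good_ball b ==> patch b \<in> sets vol" by (rule openin_sets[OF patch_openin])

lemma inv_ext_in_patch:
 assumes "good_ball (c, x, r)" "y \<in> chart_image c"
 shows "chart_inv_ext c y \<in> patch (c, x, r) \<longleftrightarrow> y \<in> ball x r"
proof
 assume "chart_inv_ext c y \<in> patch (c, x, r)"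
 then obtain z where z: "z \<in> ball x r" "chart_inv c y = chart_inv c z"
  using assms(2) by (auto simp: chart_inv_ext_def patch_def)
 then have "y = z" using map_inv[OF good_ballD(1)[OF assms(1)]] assms(2) good_ballD(4)[OF assms(1)] by (metis subsetD)
 then show "y \<in> ball x r" using z by simp
qed (use assms(2) in \<open>auto simp: chart_inv_ext_def patch_def\<close>)

lemma patch_subset_dom:
 assumes "good_ball (c, x, r)"
 shows "patch (c, x, r) \<subseteq> chart_dom c"
proof
 fix p assume "p \<in> patch (c, x, r)"
 then obtain y where "y \<in> ball x r" "p = chart_inv c y" by (auto simp: patch_def)
 then show "p \<in> chart_dom c"
  using inv_in_dom[OF good_ballD(1)[OF assms], of y] good_ballD(4)[OF assms] by (simp add: subsetD)
qed

lemma emeasure_patch_finite: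
 assumes gb: "good_ball b" shows "emeasure vol (patch b) < \<infinity>"
proof -
 obtain c x r where b: "b = (c, x, r)" by (cases b)
 note gb = gb[unfolded b]
 note gbD = good_ballD[OF gb]
 obtain u where u: "u > 0" "\<forall>y\<in>cball x r. sqrt_det c y <= u" using sqrt_det_bounds[OF gb] by blast
 have "emeasure vol (patch b) = (\<integral>\<^sup>+p\<in>chart_dom c. indicator (patch b) p \<partial>vol)"
 proof -
  have "indicator (patch b) p * indicator (chart_dom c) p = (indicator (patch b) p :: ennreal)" for p
   using patch_subset_dom[OF gb] by (auto simp: indicator_def b)
  then show ?thesis using patch_sets[OF gb] by (simp add: b)
 qed
 also have "... = (\<integral>\<^sup>+y. indicator (patch b) (chart_inv_ext c y) * ennreal (sqrt_det c y) \<partial>lborel)"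
  using patch_sets[OF gb] by (intro nn_integral_chart_vol[OF gbD(1)]) (simp add: b)
 also have "... <= (\<integral>\<^sup>+y. ennreal u * indicator (cball x r) y \<partial>lborel)"
 proof (intro nn_integral_mono)
  fix y
  show "indicator (patch b) (chart_inv_ext c y) * ennreal (sqrt_det c y) <= ennreal u * indicator (cball x r) y"
  proof (cases "y \<in> chart_image c \<and> y \<in> ball x r")
   case True
   then show ?thesis using u by (auto simp: indicator_def ennreal_leI)
  next
   case False
   then show ?thesis using inv_ext_in_patch[OF gb, of y] by (auto simp: b sqrt_det_def)
  qed
 qed
 also have "... = ennreal u * emeasure lborel (cball x r)" by (simp add: nn_integral_cmult_indicator)
 also have "... < \<infinity>" using emeasure_lborel_cball_finite[of x r] by (simp add: ennreal_mult_less_top)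
 finally show ?thesis .
qed

lemma vol_finite: "emeasure vol M < \<infinity>"
proof -
 have "emeasure vol M <= (\<Sum>b\<in>cover. emeasure vol (patch b))"
  using cover patch_sets by (subst cover(3)) (intro emeasure_subadditive_finite; auto)
 also have "... < \<infinity>" using cover emeasure_patch_finite by (simp add: less_top)
 finally show ?thesis .
qed

lemma vol_positive: "emeasure vol M > 0"
proof -
 obtain b where b: "good_ball b" using good_ball_exists[OF some_point] by blast
 obtain c x r where b': "b = (c, x, r)" by (cases b)
 note gb = b[unfolded b']
 note gbD = good_ballD[OF gb]
 obtain l where l: "l > 0" "\<forall>y\<in>cball x r. l <= sqrt_det c y" using sqrt_det_bounds[OF gb] by blast
 have "0 < ennreal l * emeasure lborel (ball x r)"
 proof -
  have "emeasure lborel (ball x r) \<noteq> 0"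
   using gbD(2) by (simp add: emeasure_ball unit_ball_vol_pos less_imp_neq[symmetric])
  then show ?thesis using l by (simp add: zero_less_iff_neq_zero)
 qed
 also have "... = (\<integral>\<^sup>+y. ennreal l * indicator (ball x r) y \<partial>lborel)" by (simp add: nn_integral_cmult_indicator)
 also have "... <= (\<integral>\<^sup>+y. indicator (patch b) (chart_inv_ext c y) * ennreal (sqrt_det c y) \<partial>lborel)"
  using l gbD(4) inv_ext_in_patch[OF gb] by (intro nn_integral_mono) (auto simp: indicator_def b' ennreal_leI)
 also have "... = (\<integral>\<^sup>+p\<in>chart_dom c. indicator (patch b) p \<partial>vol)"
  using patch_sets[OF gb] by (intro nn_integral_chart_vol[OF gbD(1), symmetric]) (simp add: b')
 also have "... <= (\<integral>\<^sup>+p. indicator M p \<partial>vol)"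
  using patch_openin[OF gb] openin_imp_subset by (intro nn_integral_mono) (fastforce simp: indicator_def b')
 also have "... = emeasure vol M" using sets.top[of vol] by (simp add: space_vol)
 finally show ?thesis .
qed

definition \<kappa> :: real where "\<kappa> = 1 / measure vol M"

lemma measure_vol_pos: "measure vol M > 0" using vol_finite vol_positive by (simp add: measure_def enn2real_positive_iff)

lemma \<kappa>_pos: "\<kappa> > 0" using measure_vol_pos by (simp add: \<kappa>_def)

lemma nu_scale: "\<nu> = scale_measure (ennreal \<kappa>) vol"
proof -
 have "emeasure vol M = ennreal (measure vol M)" using vol_finite by (simp add: measure_def)
 then have "1 / emeasure vol M = ennreal \<kappa>"
  using measure_vol_pos by (simp add: \<kappa>_def divide_ennreal flip: ennreal_1)
 then show ?thesis using vol(2) by simp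
qed

lemma prob_space_nu: "prob_space \<nu>"
proof
 have "emeasure vol M = ennreal (measure vol M)" using vol_finite by (simp add: measure_def)
 moreover have "emeasure \<nu> M = emeasure (scale_measure (ennreal \<kappa>) vol) M"
  by (rule arg_cong[where f = "\<lambda>N. emeasure N M", OF nu_scale])
 ultimately have "emeasure \<nu> M = ennreal \<kappa> * ennreal (measure vol M)" by (simp only: emeasure_scale_measure)
 also have "... = ennreal (\<kappa> * measure vol M)" using \<kappa>_pos measure_vol_pos by (intro ennreal_mult[symmetric]) auto
 also have "\<kappa> * measure vol M = 1" using measure_vol_pos by (simp add: \<kappa>_def)
 finally show "emeasure \<nu> (space \<nu>) = 1" by simp
qed

sublocale nu: prob_space \<nu> by (rule prob_space_nu)

definition dens :: "('a, 'n) chart \<Rightarrow> real^'n \<Rightarrow> real" where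
 "dens c y = \<kappa> * sqrt_det c y"

lemma sqrt_det_nonneg: "c \<in> A ==> sqrt_det c y >= 0" using det_pos[of c y] by (auto simp: sqrt_det_def intro: less_imp_le)

lemma dens_nonneg: "c \<in> A ==> dens c y >= 0" using \<kappa>_pos sqrt_det_nonneg by (simp add: dens_def)

lemma dens_measurable: "c \<in> A ==> dens c \<in> borel_measurable borel"
 unfolding dens_def by (intro borel_measurable_times sqrt_det_measurable) auto

lemma sets_nu_vol: "sets \<nu> = sets vol" by (simp add: sets_nu sets_vol)

lemma chart_inv_ext_measurable_nu: "c \<in> A ==> chart_inv_ext c \<in> measurable borel \<nu>"
 using chart_inv_ext_measurable measurable_cong_sets[OF refl sets_nu_vol] by blast

lemma dom_sets_nu: "c \<in> A ==> chart_dom c \<in> sets \<nu>" using dom_sets sets_nu_vol by blast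

lemma nu_chart_distr:
 assumes c: "c \<in> A"
 shows "density \<nu> (indicator (chart_dom c)) = distr (density lborel (\<lambda>y. ennreal (dens c y))) \<nu> (chart_inv_ext c)"
  (is "?L = ?R")
proof (rule measure_eqI)
 fix B assume "B \<in> sets ?L"
 then have B: "B \<in> sets \<nu>" by simp
 then have Bv: "B \<in> sets vol" using sets_nu_vol by simp
 have dm: "(\<lambda>y. ennreal (sqrt_det c y)) \<in> borel_measurable borel" using sqrt_det_measurable[OF c] by simp
 have im: "chart_inv_ext c -` B \<in> sets borel" using measurable_sets[OF chart_inv_ext_measurable[OF c] Bv] by simp
 have "emeasure ?L B = emeasure \<nu> (chart_dom c \<inter> B)"
  using B dom_sets_nu[OF c] by (simp add: emeasure_density indicator_inter_arith[symmetric])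
 also have "... = emeasure (scale_measure (ennreal \<kappa>) vol) (chart_dom c \<inter> B)"
  by (rule arg_cong[where f = "\<lambda>N. emeasure N (chart_dom c \<inter> B)", OF nu_scale])
 also have "... = ennreal \<kappa> * emeasure vol (chart_dom c \<inter> B)" by simp
 also have "emeasure vol (chart_dom c \<inter> B) = (\<integral>\<^sup>+p\<in>chart_dom c. indicator B p \<partial>vol)"
  using Bv dom_sets[OF c] by (simp add: indicator_inter_arith[symmetric] Int_commute)
 also have "... = (\<integral>\<^sup>+y. indicator B (chart_inv_ext c y) * ennreal (sqrt_det c y) \<partial>lborel)"
  using Bv by (intro nn_integral_chart_vol c) simp
 also have "ennreal \<kappa> * ... = (\<integral>\<^sup>+y. ennreal \<kappa> * (indicator B (chart_inv_ext c y) * ennreal (sqrt_det c y)) \<partial>lborel)"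
 proof (rule nn_integral_cmult[symmetric])
  have "(\<lambda>y. indicator (chart_inv_ext c -` B) y * ennreal (sqrt_det c y)) \<in> borel_measurable lborel"
   using im dm by (intro borel_measurable_times_ennreal borel_measurable_indicator) auto
  then show "(\<lambda>y. indicator B (chart_inv_ext c y) * ennreal (sqrt_det c y)) \<in> borel_measurable lborel"
   by (simp add: indicator_def)
 qed
 also have "... = (\<integral>\<^sup>+y. ennreal (dens c y) * indicator (chart_inv_ext c -` B) y \<partial>lborel)"
  using \<kappa>_pos sqrt_det_nonneg[OF c] by (intro nn_integral_cong) (auto simp: dens_def indicator_def ennreal_mult)
 also have "... = emeasure (density lborel (\<lambda>y. ennreal (dens c y))) (chart_inv_ext c -` B)"
  using dens_measurable[OF c] im by (subst emeasure_density) auto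
 also have "... = emeasure ?R B" using chart_inv_ext_measurable_nu[OF c] B by (subst emeasure_distr) auto
 finally show "emeasure ?L B = emeasure ?R B" .
qed simp

lemma nn_integral_chart:
 assumes c: "c \<in> A" and f: "f \<in> borel_measurable \<nu>"
 shows "(\<integral>\<^sup>+p\<in>chart_dom c. f p \<partial>\<nu>) = (\<integral>\<^sup>+y. f (chart_inv_ext c y) * ennreal (dens c y) \<partial>lborel)"
proof -
 have "(\<integral>\<^sup>+p\<in>chart_dom c. f p \<partial>\<nu>) = (\<integral>\<^sup>+p. f p \<partial>density \<nu> (indicator (chart_dom c)))"
  using f dom_sets_nu[OF c] by (subst nn_integral_density) (auto simp: mult.commute)
 also have "... = (\<integral>\<^sup>+y. f (chart_inv_ext c y) \<partial>density lborel (\<lambda>y. ennreal (dens c y)))"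
  unfolding nu_chart_distr[OF c] using f chart_inv_ext_measurable_nu[OF c] by (subst nn_integral_distr) auto
 also have "... = (\<integral>\<^sup>+y. f (chart_inv_ext c y) * ennreal (dens c y) \<partial>lborel)"
  using dens_measurable[OF c] measurable_compose[OF chart_inv_ext_measurable_nu[OF c] f]
  by (subst nn_integral_density) (auto simp: mult.commute)
 finally show ?thesis .
qed

lemma
 fixes f :: "'a \<Rightarrow> real"
 assumes c: "c \<in> A" and f: "f \<in> borel_measurable \<nu>" and out: "\<And>p. p \<in> M ==> p \<notin> chart_dom c ==> f p = 0"
 shows integral_chart: "(LINT p|\<nu>. f p) = (LINT y|lborel. dens c y * f (chart_inv_ext c y))"
  and integrable_chart_iff: "integrable \<nu> f \<longleftrightarrow> integrable lborel (\<lambda>y. dens c y * f (chart_inv_ext c y))"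
proof -
 have ind: "(\<lambda>p. indicator (chart_dom c) p :: real) \<in> borel_measurable \<nu>" using dom_sets_nu[OF c] by simp
 have D: "density \<nu> (indicator (chart_dom c)) = density \<nu> (\<lambda>p. ennreal (indicator (chart_dom c) p))"
  by (simp add: ennreal_indicator)
 have e: "indicator (chart_dom c) p *\<^sub>R f p = f p" if "p \<in> space \<nu>" for p
  using out[of p] that by (auto simp: indicator_def)
 have fc: "(\<lambda>y. f (chart_inv_ext c y)) \<in> borel_measurable lborel"
  using measurable_compose[OF chart_inv_ext_measurable_nu[OF c] f] by simp
 have "(LINT p|\<nu>. f p) = (LINT p|\<nu>. indicator (chart_dom c) p *\<^sub>R f p)"
  by (intro Bochner_Integration.integral_cong[OF refl] e[symmetric])
 also have "... = (LINT p|(density \<nu> (indicator (chart_dom c))). f p)"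
  unfolding D using f ind by (intro integral_density[symmetric]) auto
 also have "... = (LINT y|(density lborel (\<lambda>y. ennreal (dens c y))). f (chart_inv_ext c y))"
  unfolding nu_chart_distr[OF c] using f chart_inv_ext_measurable_nu[OF c] by (intro integral_distr) auto
 also have "... = (LINT y|lborel. dens c y *\<^sub>R f (chart_inv_ext c y))"
  using fc dens_measurable[OF c] dens_nonneg[OF c] by (intro integral_density) auto
 finally show "(LINT p|\<nu>. f p) = (LINT y|lborel. dens c y * f (chart_inv_ext c y))" by simp
 have "integrable \<nu> f \<longleftrightarrow> integrable \<nu> (\<lambda>p. indicator (chart_dom c) p *\<^sub>R f p)"
  by (intro Bochner_Integration.integrable_cong[OF refl] e[symmetric])
 also have "... \<longleftrightarrow> integrable (density \<nu> (indicator (chart_dom c))) f"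
  unfolding D using f ind by (intro integrable_density[symmetric]) auto
 also have "... \<longleftrightarrow> integrable (density lborel (\<lambda>y. ennreal (dens c y))) (\<lambda>y. f (chart_inv_ext c y))"
  unfolding nu_chart_distr[OF c] using f chart_inv_ext_measurable_nu[OF c] by (intro integrable_distr_eq) auto
 also have "... \<longleftrightarrow> integrable lborel (\<lambda>y. dens c y *\<^sub>R f (chart_inv_ext c y))"
  using fc dens_measurable[OF c] dens_nonneg[OF c] by (intro integrable_density) auto
 finally show "integrable \<nu> f \<longleftrightarrow> integrable lborel (\<lambda>y. dens c y * f (chart_inv_ext c y))" by simp
qed

end

section \<open>Continuously differentiable functions and the carre du champ\<close>

definition grad :: "(real^'n \<Rightarrow> real) \<Rightarrow> real^'n \<Rightarrow> real^'n" where
 "grad F y = (\<chi> i. partial i F y)"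

lemma has_derivative_grad:
 assumes "F differentiable (at y)"
 shows "(F has_derivative (\<lambda>v. grad F y \<bullet> v)) (at y)"
proof -
 have D: "(F has_derivative frechet_derivative F (at y)) (at y)" using assms by (simp add: frechet_derivative_works)
 have "frechet_derivative F (at y) v = grad F y \<bullet> v" for v
 proof -
  have lin: "linear (frechet_derivative F (at y))" by (rule linear_frechet_derivative[OF assms])
  have "frechet_derivative F (at y) v = frechet_derivative F (at y) (\<Sum>i\<in>UNIV. v $ i *\<^sub>R axis i 1)"
   by (simp add: basis_expansion flip: scalar_mult_eq_scaleR)
  also have "... = (\<Sum>i\<in>UNIV. v $ i * frechet_derivative F (at y) (axis i 1))"
   using lin by (simp add: linear_sum linear_cmul)
  also have "... = grad F y \<bullet> v" by (simp add: grad_def partial_def inner_vec_def mult.commute)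
  finally show ?thesis .
 qed
 then have "frechet_derivative F (at y) = (\<lambda>v. grad F y \<bullet> v)" by (rule ext)
 then show ?thesis using D by simp
qed

lemma grad_unique:
 assumes "(F has_derivative (\<lambda>v. a \<bullet> v)) (at y)"
 shows "grad F y = a"
proof -
 have "frechet_derivative F (at y) = (\<lambda>v. a \<bullet> v)" using frechet_derivative_at[OF assms] by simp
 then show ?thesis by (simp add: grad_def partial_def vec_eq_iff inner_axis)
qed

context riemannian_probability
begin

definition C1_function :: "('a \<Rightarrow> real) \<Rightarrow> bool" where
 "C1_function f \<longleftrightarrow> (\<forall>c\<in>A. Ck_on (Suc 0) (chart_image c) (f \<circ> chart_inv c))"

lemma C1D: "C1_function f ==> c \<in> A ==> Ck_on (Suc 0) (chart_image c) (\<lambda>y. f (chart_inv c y))"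
 unfolding C1_function_def o_def by blast

lemma C1I: "(\<And>c. c \<in> A ==> Ck_on (Suc 0) (chart_image c) (\<lambda>y. f (chart_inv c y))) ==> C1_function f"
 unfolding C1_function_def o_def by blast

lemma C1_const [simp]: "C1_function (\<lambda>_. a)" by (rule C1I) (rule Ck_on_const[OF chart_image_open])

lemma C1_add: "C1_function f ==> C1_function u ==> C1_function (\<lambda>p. f p + u p)"
 by (rule C1I) (intro Ck_on_add C1D chart_image_open)

lemma C1_mult: "C1_function f ==> C1_function u ==> C1_function (\<lambda>p. f p * u p)"
 by (rule C1I) (intro Ck_on_mult C1D chart_image_open)

lemma C1_sum: "(\<And>i. i \<in> I ==> C1_function (f i)) ==> C1_function (\<lambda>p. \<Sum>i\<in>I. f i p)"
 by (induction I rule: infinite_finite_induct) (auto intro: C1_add)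

lemma C1_power: "C1_function f ==> C1_function (\<lambda>p. f p ^ n)" by (induction n) (auto intro: C1_mult)

lemma C1_inverse:
 assumes "C1_function f" "\<And>p. p \<in> M ==> f p \<noteq> 0"
 shows "C1_function (\<lambda>p. inverse (f p))"
proof (rule C1I)
 fix c assume c: "c \<in> A"
 show "Ck_on (Suc 0) (chart_image c) (\<lambda>y. inverse (f (chart_inv c y)))"
  using assms(2)[OF inv_in_M[OF c]] by (rule Ck_on_inverse[OF chart_image_open[OF c] C1D[OF assms(1) c]])
qed

lemma smooth_imp_C1: "smooth_function A f ==> C1_function f"
 by (simp add: smooth_function_def smooth_on_def C1_function_def del: Ck_on.simps)

lemma C1_differentiable: "C1_function f ==> c \<in> A ==> y \<in> chart_image c ==> (f \<circ> chart_inv c) differentiable (at y)"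
 using C1D[of f c] by (auto simp: o_def)

lemma C1_partial_continuous:
 assumes "C1_function f" "c \<in> A"
 shows "continuous_on (chart_image c) (partial i (f \<circ> chart_inv c))"
proof -
 have "axis i (1::real) \<in> Basis" by simp
 then show ?thesis using C1D[OF assms] by (simp add: partial_def[abs_def] o_def)
qed

lemma grad_continuous:
 assumes "C1_function f" "c \<in> A"
 shows "continuous_on (chart_image c) (grad (f \<circ> chart_inv c))"
 unfolding grad_def[abs_def]
 by (intro continuous_on_vec_lambda) (use C1_partial_continuous[OF assms] in \<open>simp add: eta_contract_eq\<close>)

lemma continuous_on_M:
 assumes "\<And>c. c \<in> A ==> continuous_on (chart_image c) (h c)"
  and "\<And>c p. c \<in> A ==> p \<in> chart_dom c ==> f p = (h c (chart_map c p) :: real)"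
 shows "continuous_on M f"
 unfolding continuous_on_eq_continuous_within
proof
 fix p assume p: "p \<in> M"
 then obtain c where c: "c \<in> A" "p \<in> chart_dom c" using atlas_cover by blast
 obtain T where T: "open T" "chart_dom c = M \<inter> T" using chart_open[OF c(1)] unfolding openin_open by blast
 have "continuous_on (chart_dom c) (\<lambda>q. h c (chart_map c q))"
  using continuous_on_compose2[OF assms(1)[OF c(1)] chart_map_continuous[OF c(1)]] by blast
 then have "continuous_on (chart_dom c) f" using assms(2)[OF c(1)] by (simp cong: continuous_on_cong)
 then have "continuous (at p within chart_dom c) f" using c(2) by (simp add: continuous_on_eq_continuous_within)
 moreover have "at p within chart_dom c = at p within M" using c(2) T by (intro at_within_nhd[where S = T]) auto
 ultimately show "continuous (at p within M) f" by simp
qed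

lemma C1_continuous:
 assumes "C1_function f" shows "continuous_on M f"
proof (rule continuous_on_M)
 show "continuous_on (chart_image c) (f \<circ> chart_inv c)" if "c \<in> A" for c
  using Ck_on_imp_continuous[OF C1D[OF assms that]] by (simp add: o_def)
 show "f p = (f \<circ> chart_inv c) (chart_map c p)" if "c \<in> A" "p \<in> chart_dom c" for c p
  using inv_map[OF that] by simp
qed

lemma continuous_measurable: "continuous_on M f ==> (f :: 'a \<Rightarrow> real) \<in> borel_measurable \<nu>"
 using borel_measurable_continuous_on_restrict[of M f] measurable_cong_sets[OF sets_nu refl] by blast

lemma continuous_bounded:
 assumes "continuous_on M (f :: 'a \<Rightarrow> real)"
 obtains B where "B > 0" "\<And>p. p \<in> M ==> \<bar>f p\<bar> <= B"
proof -
 have "bounded (f ` M)" by (rule compact_imp_bounded[OF compact_continuous_image[OF assms compact]])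
 then obtain B where "\<forall>p\<in>M. norm (f p) <= B" unfolding bounded_iff by auto
 then have "\<And>p. p \<in> M ==> \<bar>f p\<bar> <= \<bar>B\<bar> + 1" by force
 then show thesis using that[of "\<bar>B\<bar> + 1"] by simp
qed

lemma continuous_integrable:
 assumes "continuous_on M (f :: 'a \<Rightarrow> real)" shows "integrable \<nu> f"
proof -
 obtain B where "B > 0" "\<And>p. p \<in> M ==> \<bar>f p\<bar> <= B" using continuous_bounded[OF assms] by blast
 then show ?thesis by (intro nu.integrable_const_bound[where B = B] continuous_measurable assms) (auto intro!: AE_I2)
qed

lemma continuous_sq:
 assumes "continuous_on M (f :: 'a \<Rightarrow> real)" shows "L2 f"
 unfolding square_integrable_def using assms by (intro conjI continuous_measurable continuous_integrable continuous_intros)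

definition chart_gamma :: "('a, 'n) chart \<Rightarrow> ('a \<Rightarrow> real) \<Rightarrow> ('a \<Rightarrow> real) \<Rightarrow> real^'n \<Rightarrow> real" where
 "chart_gamma c f u y = grad (f \<circ> chart_inv c) y \<bullet> (matrix_inv (g c y) *v grad (u \<circ> chart_inv c) y)"

lemma metric_inverse:
 assumes "c \<in> A" "y \<in> chart_image c"
 shows "g c y ** matrix_inv (g c y) = mat 1" "matrix_inv (g c y) ** g c y = mat 1"
 using matrix_inv_inverse[of "g c y"] det_pos[OF assms] by auto

lemma overlap_open:
 assumes c: "c \<in> A" and c': "c' \<in> A"
 shows "open (chart_map c ` (chart_dom c \<inter> chart_dom c'))"
proof -
 have "openin (top_of_set M) (chart_dom c \<inter> chart_dom c')" using chart_open c c' by blast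
 then have "openin (top_of_set (chart_dom c)) (chart_dom c \<inter> chart_dom c')"
  using dom_subset[OF c] by (meson inf_le1 openin_subset_trans)
 then have "openin (top_of_set (chart_image c)) (chart_map c ` (chart_dom c \<inter> chart_dom c'))"
  using homeomorphism_imp_open_map[OF chart_homeomorphism[OF c]] by blast
 then show ?thesis using chart_image_open[OF c] openin_open_trans by blast
qed

text \<open>Gradients transform with the transpose of the Jacobian of the transition map, the inverse metric with its inverse on both sides;
these cancel.\<close>

lemma chart_gamma_invariant:
 assumes c: "c \<in> A" "p \<in> chart_dom c" and c': "c' \<in> A" "p \<in> chart_dom c'"
  and f: "C1_function f" and u: "C1_function u"
 shows "chart_gamma c f u (chart_map c p) = chart_gamma c' f u (chart_map c' p)"
proof -
 define S where "S = chart_map c ` (chart_dom c \<inter> chart_dom c')"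
 define y y' where "y = chart_map c p" and "y' = chart_map c' p"
 define J where "J = matrix (frechet_derivative (transition c c') (at y))"
 have yS: "y \<in> S" using c c' by (auto simp: S_def y_def)
 have S: "S \<subseteq> chart_image c" by (auto simp: S_def)
 have openS: "open S" unfolding S_def by (rule overlap_open[OF c(1) c'(1)])
 have tr: "transition c c' z = chart_map c' (chart_inv c z)" for z by (simp add: transition_def)
 have try_: "transition c c' y = y'" using inv_map[OF c] by (simp add: tr y_def y'_def)
 have "Ck_on (Suc 0) S (transition c c')"
  using transition_smooth[OF c(1) c'(1)] by (simp add: smooth_on_def S_def del: Ck_on.simps)
 then have "transition c c' differentiable (at y)" using yS by simp
 then have Dtr: "(transition c c' has_derivative (\<lambda>v. J *v v)) (at y)"
  using frechet_derivative_works[of "transition c c'" "at y"]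
   matrix_vector_mul(2)[OF linear_frechet_derivative[of "transition c c'" "at y"]] unfolding J_def by simp
 have y': "y' \<in> chart_image c'" and y: "y \<in> chart_image c" using c c' by (auto simp: y_def y'_def)
 have gr: "grad (w \<circ> chart_inv c) y = transpose J *v grad (w \<circ> chart_inv c') y'" if w: "C1_function w" for w
 proof (rule grad_unique)
  have "((w \<circ> chart_inv c') has_derivative (\<lambda>v. grad (w \<circ> chart_inv c') y' \<bullet> v)) (at (transition c c' y))"
   unfolding try_ by (rule has_derivative_grad[OF C1_differentiable[OF w c'(1) y']])
  from has_derivative_compose[OF Dtr this]
  have "((\<lambda>z. (w \<circ> chart_inv c') (transition c c' z)) has_derivative (\<lambda>v. grad (w \<circ> chart_inv c') y' \<bullet> (J *v v))) (at y)" .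
  then have "((w \<circ> chart_inv c) has_derivative (\<lambda>v. grad (w \<circ> chart_inv c') y' \<bullet> (J *v v))) (at y)"
  proof (rule has_derivative_transform_within_open[OF _ openS yS])
   fix z assume "z \<in> S"
   then obtain q where q: "q \<in> chart_dom c" "q \<in> chart_dom c'" "z = chart_map c q" by (auto simp: S_def)
   then show "(w \<circ> chart_inv c') (transition c c' z) = (w \<circ> chart_inv c) z"
    using inv_map[OF c(1) q(1)] inv_map[OF c'(1) q(2)] by (simp add: tr)
  qed
  then show "((w \<circ> chart_inv c) has_derivative (\<lambda>v. (transpose J *v grad (w \<circ> chart_inv c') y') \<bullet> v)) (at y)"
   by (simp only: transpose_matrix_vector dot_lmul_matrix)
 qed
 have met: "g c y = transpose J ** g c' y' ** J" using metric_tensorial[OF c(1) c'(1), of y] yS by (simp add: S_def try_ J_def)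
 have "det J \<noteq> 0"
 proof
  assume "det J = 0"
  then have "det (g c y) = 0" by (simp add: met det_mul)
  then show False using det_pos[OF c(1) y] by simp
 qed
 then have injT: "a = b" if "transpose J *v a = transpose J *v b" for a b
 proof -
  have "invertible (transpose J)" using \<open>det J \<noteq> 0\<close> by (simp add: invertible_det_nz)
  then show ?thesis using injD[OF inj_matrix_vector_mult that] by blast
 qed
 define a b where "a = grad (f \<circ> chart_inv c') y'" and "b = grad (u \<circ> chart_inv c') y'"
 define w where "w = matrix_inv (g c y) *v (transpose J *v b)"
 have "g c y *v w = transpose J *v b" by (simp add: w_def matrix_vector_mul_assoc metric_inverse[OF c(1) y])
 then have "transpose J *v (g c' y' *v (J *v w)) = transpose J *v b" by (simp add: met matrix_vector_mul_assoc matrix_mul_assoc)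
 then have "g c' y' *v (J *v w) = b" by (rule injT)
 then have "matrix_inv (g c' y') *v b = matrix_inv (g c' y') *v (g c' y' *v (J *v w))" by simp
 also have "... = J *v w" by (simp add: matrix_vector_mul_assoc metric_inverse[OF c'(1) y'] matrix_mul_assoc)
 finally have Jw: "J *v w = matrix_inv (g c' y') *v b" by simp
 have "chart_gamma c f u y = (transpose J *v a) \<bullet> w" by (simp add: chart_gamma_def gr f u a_def b_def w_def)
 also have "... = a \<bullet> (J *v w)" by (simp only: transpose_matrix_vector dot_lmul_matrix)
 also have "... = chart_gamma c' f u y'" by (simp add: Jw chart_gamma_def a_def b_def)
 finally show ?thesis by (simp add: y_def y'_def)
qed

end

lemma grad_cong:
 assumes "open S" "y \<in> S" "\<And>z. z \<in> S ==> F z = G z" "F differentiable (at y)"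
 shows "grad G y = grad F y"
proof (rule grad_unique)
 show "(G has_derivative (\<lambda>v. grad F y \<bullet> v)) (at y)"
  by (rule has_derivative_transform_within_open[OF has_derivative_grad[OF assms(4)] assms(1,2)]) (simp add: assms(3))
qed

lemma grad_const [simp]: "grad (\<lambda>_. a) y = 0" by (rule grad_unique) simp

lemma grad_add:
 assumes "F differentiable (at y)" "G differentiable (at y)"
 shows "grad (\<lambda>z. F z + G z) y = grad F y + grad G y" by (rule grad_unique)
  (use has_derivative_add[OF has_derivative_grad[OF assms(1)] has_derivative_grad[OF assms(2)]] in \<open>simp add: inner_add_left\<close>)

lemma grad_mult:
 assumes "F differentiable (at y)" "G differentiable (at y)"
 shows "grad (\<lambda>z. F z * G z) y = F y *\<^sub>R grad G y + G y *\<^sub>R grad F y" by (rule grad_unique)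
  (use has_derivative_mult[OF has_derivative_grad[OF assms(1)] has_derivative_grad[OF assms(2)]]
   in \<open>simp add: inner_add_left mult.commute\<close>)

lemma continuous_on_matrix_vector:
 fixes B :: "'b::topological_space \<Rightarrow> real^'n^'m"
 assumes "\<And>i j. continuous_on S (\<lambda>y. B y $ i $ j)" "continuous_on S w"
 shows "continuous_on S (\<lambda>y. B y *v w y)"
proof -
 have "continuous_on S (\<lambda>y. \<Sum>j\<in>UNIV. B y $ i $ j * w y $ j)" for i
  by (rule continuous_on_sum) (rule continuous_on_mult[OF assms(1) continuous_on_component[OF assms(2)]])
 then show ?thesis unfolding matrix_vector_mult_def by (rule continuous_on_vec_lambda)
qed

context riemannian_probability
begin

text \<open>The inner product of the gradients with respect to the metric, the carre du champ operator. By
\<open>chart_gamma_invariant\<close> the choice of the chart is immaterial.\<close>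

definition gamma :: "('a \<Rightarrow> real) \<Rightarrow> ('a \<Rightarrow> real) \<Rightarrow> 'a \<Rightarrow> real" where
 "gamma f u p = (let c = (SOME c. c \<in> A \<and> p \<in> chart_dom c) in chart_gamma c f u (chart_map c p))"

lemma gamma_chart:
 assumes "c \<in> A" "p \<in> chart_dom c" "C1_function f" "C1_function u"
 shows "gamma f u p = chart_gamma c f u (chart_map c p)"
proof -
 define c0 where "c0 = (SOME c. c \<in> A \<and> p \<in> chart_dom c)"
 have "c0 \<in> A \<and> p \<in> chart_dom c0" unfolding c0_def by (rule someI[where x = c]) (simp add: assms)
 then show ?thesis using chart_gamma_invariant[OF assms(1,2) _ _ assms(3,4), of c0] by (simp add: gamma_def c0_def[symmetric])
qed

lemma gamma_chart_inv:
 assumes "c \<in> A" "y \<in> chart_image c" "C1_function f" "C1_function u"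
 shows "gamma f u (chart_inv c y) = chart_gamma c f u y"
 using gamma_chart[OF assms(1) inv_in_dom[OF assms(1,2)] assms(3,4)] map_inv[OF assms(1,2)] by simp

lemma C1_differentiable':
 "C1_function f ==> c \<in> A ==> y \<in> chart_image c ==> (\<lambda>z. f (chart_inv c z)) differentiable (at y)"
 using C1_differentiable by (simp add: o_def)

lemma inverse_metric_symmetric:
 assumes "c \<in> A" "y \<in> chart_image c"
 shows "a \<bullet> (matrix_inv (g c y) *v b) = b \<bullet> (matrix_inv (g c y) *v a)"
proof -
 note inv = metric_inverse[OF assms]
 define wa wb where "wa = matrix_inv (g c y) *v a" and "wb = matrix_inv (g c y) *v b"
 have a: "g c y *v wa = a" and b: "g c y *v wb = b" by (simp_all add: wa_def wb_def matrix_vector_mul_assoc inv)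
 have "a \<bullet> wb = (g c y *v wa) \<bullet> wb" by (simp add: a)
 also have "... = wa \<bullet> (transpose (g c y) *v wb)" by (metis dot_lmul_matrix inner_commute transpose_matrix_vector)
 also have "... = b \<bullet> wa" by (simp add: metric_symmetric[OF assms] b inner_commute)
 finally show ?thesis by (simp add: wa_def wb_def)
qed

lemma inverse_metric_pos_def:
 assumes "c \<in> A" "y \<in> chart_image c" "v \<noteq> 0"
 shows "v \<bullet> (matrix_inv (g c y) *v v) > 0"
proof -
 note inv = metric_inverse[OF assms(1,2)]
 define w where "w = matrix_inv (g c y) *v v"
 have v: "g c y *v w = v" by (simp add: w_def matrix_vector_mul_assoc inv)
 have "w \<noteq> 0" using v assms(3) by auto
 then have "w \<bullet> (g c y *v w) > 0" by (rule metric_pos_def[OF assms(1,2)])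
 then show ?thesis by (simp add: v inner_commute flip: w_def)
qed

lemma gamma_sym:
 assumes "p \<in> M" "C1_function f" "C1_function u"
 shows "gamma f u p = gamma u f p"
proof -
 obtain c where c: "c \<in> A" "p \<in> chart_dom c" using assms(1) atlas_cover by blast
 then have "chart_map c p \<in> chart_image c" by simp
 then show ?thesis using inverse_metric_symmetric[OF c(1)] by (simp add: gamma_chart[OF c] assms chart_gamma_def)
qed

lemma gamma_nonneg:
 assumes "p \<in> M" "C1_function f"
 shows "gamma f f p >= 0"
proof -
 obtain c where c: "c \<in> A" "p \<in> chart_dom c" using assms(1) atlas_cover by blast
 then have "chart_map c p \<in> chart_image c" by simp
 then show ?thesis using inverse_metric_pos_def[OF c(1), of "chart_map c p" "grad (f \<circ> chart_inv c) (chart_map c p)"]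
  by (cases "grad (f \<circ> chart_inv c) (chart_map c p) = 0")
   (auto simp: gamma_chart[OF c] assms chart_gamma_def)
qed

lemma gamma_add:
 assumes "p \<in> M" "C1_function f" "C1_function u" "C1_function w"
 shows "gamma (\<lambda>q. f q + u q) w p = gamma f w p + gamma u w p"
proof -
 obtain c where c: "c \<in> A" "p \<in> chart_dom c" using assms(1) atlas_cover by blast
 then have y: "chart_map c p \<in> chart_image c" by simp
 show ?thesis by (simp add: gamma_chart[OF c] assms C1_add chart_gamma_def o_def grad_add
    C1_differentiable'[OF _ c(1) y] inner_add_left)
qed

lemma gamma_mult:
 assumes "p \<in> M" "C1_function f" "C1_function u" "C1_function w"
 shows "gamma (\<lambda>q. f q * u q) w p = f p * gamma u w p + u p * gamma f w p"
proof -
 obtain c where c: "c \<in> A" "p \<in> chart_dom c" using assms(1) atlas_cover by blast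
 then have y: "chart_map c p \<in> chart_image c" by simp
 show ?thesis by (simp add: gamma_chart[OF c] assms C1_mult chart_gamma_def o_def grad_mult
    C1_differentiable'[OF _ c(1) y] inner_add_left inv_map[OF c])
qed

lemma gamma_cong:
 assumes "p \<in> M" "C1_function f" "C1_function u" "C1_function w" "\<And>q. q \<in> M ==> f q = u q"
 shows "gamma f w p = gamma u w p"
proof -
 obtain c where c: "c \<in> A" "p \<in> chart_dom c" using assms(1) atlas_cover by blast
 then have y: "chart_map c p \<in> chart_image c" by simp
 have "grad (\<lambda>z. u (chart_inv c z)) (chart_map c p) = grad (\<lambda>z. f (chart_inv c z)) (chart_map c p)"
  by (rule grad_cong[OF chart_image_open[OF c(1)] y])
   (auto simp: assms(5) inv_in_M[OF c(1)] C1_differentiable'[OF assms(2) c(1) y])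
 then show ?thesis by (simp add: gamma_chart[OF c] assms(2-4) chart_gamma_def o_def)
qed

lemma gamma_const [simp]:
 assumes "p \<in> M" "C1_function w"
 shows "gamma (\<lambda>_. a) w p = 0"
proof -
 obtain c where c: "c \<in> A" "p \<in> chart_dom c" using assms(1) atlas_cover by blast
 then show ?thesis by (simp add: gamma_chart[OF c] assms chart_gamma_def o_def)
qed

lemma gamma_cmult:
 assumes "p \<in> M" "C1_function f" "C1_function w"
 shows "gamma (\<lambda>q. a * f q) w p = a * gamma f w p" using gamma_mult[OF assms(1) C1_const assms(2,3), of a] assms by simp

lemma gamma_sum:
 assumes "p \<in> M" "\<And>i. i \<in> I ==> C1_function (f i)" "C1_function w"
 shows "gamma (\<lambda>q. \<Sum>i\<in>I. f i q) w p = (\<Sum>i\<in>I. gamma (f i) w p)"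
 using assms(2)
proof (induction I rule: infinite_finite_induct)
 case (insert i I)
 then show ?case using gamma_add[OF assms(1), of "f i" "\<lambda>q. \<Sum>i\<in>I. f i q" w] by (simp add: C1_sum assms(3))
qed (simp_all add: assms)

lemma gamma_power:
 assumes "p \<in> M" "C1_function f" "C1_function w"
 shows "gamma (\<lambda>q. f q ^ n) w p = real n * f p ^ (n - 1) * gamma f w p"
proof (induction n)
 case (Suc n)
 have "gamma (\<lambda>q. f q ^ Suc n) w p = f p * gamma (\<lambda>q. f q ^ n) w p + f p ^ n * gamma f w p"
  using gamma_mult[OF assms(1,2) C1_power[OF assms(2)] assms(3), of n] by simp
 also have "... = real (Suc n) * f p ^ n * gamma f w p"
 proof -
  have "f p * (real n * f p ^ (n - 1) * gamma f w p) = real n * f p ^ n * gamma f w p" by (cases n) simp_all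
  then show ?thesis by (simp add: Suc.IH algebra_simps)
 qed
 finally show ?case by simp
qed (simp add: assms)

lemma chart_gamma_continuous:
 assumes "c \<in> A" "C1_function f" "C1_function u"
 shows "continuous_on (chart_image c) (chart_gamma c f u)"
proof -
 have "continuous_on (chart_image c) (\<lambda>y. matrix_inv (g c y) $ i $ j)" for i j
  using inverse_metric_Ck[OF assms(1), of 0] by simp
 then show ?thesis
  unfolding chart_gamma_def[abs_def] by (intro continuous_on_inner continuous_on_matrix_vector grad_continuous assms)
qed

lemma gamma_continuous:
 assumes "C1_function f" "C1_function u"
 shows "continuous_on M (gamma f u)" by (rule continuous_on_M[where h = "\<lambda>c. chart_gamma c f u"])
  (auto intro: chart_gamma_continuous assms gamma_chart)

text \<open>The inverse metric is uniformly positive definite on a compact ball: the quadratic form attains its minimum on the product of the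
ball with the unit sphere.\<close>

lemma gamma_elliptic:
 assumes gb: "good_ball (c, x, r)"
 shows "\<exists>C>0. \<forall>y\<in>cball x r. \<forall>v. (norm v)^2 <= C * (v \<bullet> (matrix_inv (g c y) *v v))"
proof -
 note gbD = good_ballD[OF gb]
 define Q where "Q = (\<lambda>(y, v :: real^'n). v \<bullet> (matrix_inv (g c y) *v v))"
 have im: "continuous_on (cball x r) (\<lambda>y. matrix_inv (g c y) $ i $ j)" for i j
  using inverse_metric_Ck[OF gbD(1), of 0 i j] by (intro continuous_on_subset[OF _ gbD(3)]) simp
 have cont: "continuous_on (cball x r \<times> sphere 0 1) Q"
  unfolding Q_def case_prod_unfold by (intro continuous_on_inner continuous_on_matrix_vector continuous_on_snd continuous_on_id
    continuous_on_compose2[OF im continuous_on_fst[OF continuous_on_id]]) auto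
 have cpt: "compact (cball x r \<times> (sphere 0 1 :: (real^'n) set))" by (intro compact_Times) auto
 obtain i :: 'n where True by blast
 have "(x, axis i 1) \<in> cball x r \<times> (sphere 0 1 :: (real^'n) set)" using gbD(2) by simp
 then have ne: "cball x r \<times> (sphere 0 1 :: (real^'n) set) \<noteq> {}" by blast
 obtain z where z: "z \<in> cball x r \<times> sphere 0 1" "\<And>w. w \<in> cball x r \<times> sphere 0 1 ==> Q z <= Q w"
  using continuous_attains_inf[OF cpt ne cont] by blast
 have "Q z > 0"
 proof -
  obtain y v where yv: "z = (y, v)" "y \<in> cball x r" "norm v = 1" using z(1) by auto
  then have "v \<noteq> 0" by auto
  then show ?thesis using inverse_metric_pos_def[OF gbD(1), of y v] gbD(3) yv by (auto simp: Q_def)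
 qed
 have "(norm v)^2 <= 1 / Q z * (v \<bullet> (matrix_inv (g c y) *v v))" if y: "y \<in> cball x r" for y v
 proof (cases "v = 0")
  case False
  define w where "w = v /\<^sub>R norm v"
  have v: "v = norm v *\<^sub>R w" and "norm w = 1" using False by (auto simp: w_def)
  then have "Q z <= Q (y, w)" using z(2) y by auto
  then have "Q z * (norm v)^2 <= Q (y, w) * (norm v)^2" by (intro mult_right_mono) auto
  also have "... = v \<bullet> (matrix_inv (g c y) *v v)"
  proof -
   have "v \<bullet> (matrix_inv (g c y) *v v) = (norm v *\<^sub>R w) \<bullet> (matrix_inv (g c y) *v (norm v *\<^sub>R w))"
    using v by simp
   also have "... = Q (y, w) * (norm v)^2" by (simp add: Q_def matrix_vector_mult_scaleR power2_eq_square)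
   finally show ?thesis by simp
  qed
  finally show ?thesis using \<open>Q z > 0\<close> by (simp add: field_simps)
 qed simp
 then show ?thesis using \<open>Q z > 0\<close> by (intro exI[of _ "1 / Q z"]) auto
qed

end

section \<open>Integration by parts in Euclidean space\<close>

lemma lborel_integral_translate:
 fixes f :: "'e::euclidean_space \<Rightarrow> real"
 assumes "f \<in> borel_measurable borel"
 shows "(LINT x|lborel. f (x + a)) = (LINT x|lborel. f x)"
proof -
 have "(LINT x|lborel. f x) = (LINT x|(distr lborel borel ((+) a)). f x)" by (simp add: lborel_distr_plus)
 also have "... = (LINT x|lborel. f (a + x))" using assms by (intro integral_distr) auto
 finally show ?thesis by (simp add: add.commute)
qed

lemma integrable_continuous_compact_support:
 fixes f :: "'e::euclidean_space \<Rightarrow> real"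
 assumes "continuous_on UNIV f" "compact K" "\<And>x. x \<notin> K ==> f x = 0"
 shows "integrable lborel f"
proof -
 have "integrable lborel (\<lambda>x. indicator K x *\<^sub>R f x)"
  using assms(1,2) by (intro borel_integrable_compact) (auto intro: continuous_on_subset)
 moreover have "(\<lambda>x. indicator K x *\<^sub>R f x) = f" using assms(3) by (auto simp: fun_eq_iff indicator_def)
 ultimately show ?thesis by simp
qed

text \<open>The derivative is the bounded limit of difference quotients, whose integrals vanish by translation invariance.\<close>

lemma integral_directional_derivative_zero:
 fixes Z :: "'e::euclidean_space \<Rightarrow> real"
 assumes D: "\<And>x t. ((\<lambda>t. Z (x + t *\<^sub>R e)) has_real_derivative Z' (x + t *\<^sub>R e)) (at t)"
  and Z: "continuous_on UNIV Z" and Z': "continuous_on UNIV Z'"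
  and K: "compact K" "\<And>x. x \<notin> K ==> Z x = 0" "\<And>x. x \<notin> K ==> Z' x = 0"
 shows "(LINT x|lborel. Z' x) = 0"
proof -
 have iZ: "integrable lborel Z" by (rule integrable_continuous_compact_support[OF Z K(1,2)])
 have Zm: "Z \<in> borel_measurable borel" using Z by (rule borel_measurable_continuous_onI)
 have Z'm: "Z' \<in> borel_measurable borel" using Z' by (rule borel_measurable_continuous_onI)
 obtain R where R: "\<And>x. x \<in> K ==> norm x <= R" using compact_imp_bounded[OF K(1)] bounded_iff by metis
 have "bounded (Z' ` K)" by (rule compact_imp_bounded[OF compact_continuous_image[OF continuous_on_subset[OF Z'] K(1)]]) auto
 then obtain B0 where B0: "\<And>x. x \<in> K ==> \<bar>Z' x\<bar> <= B0" unfolding bounded_iff by auto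
 define B where "B = \<bar>B0\<bar>"
 have B: "\<bar>Z' x\<bar> <= B" for x using B0[of x] K(3)[of x] by (cases "x \<in> K") (auto simp: B_def)
 define K' where "K' = cball (0::'e) (R + norm e)"
 define d where "d n x = real (Suc n) * (Z (x + (1 / real (Suc n)) *\<^sub>R e) - Z x)" for n x
 have mvt: "\<exists>t. 0 < t \<and> t < 1 \<and> d n x = Z' (x + t *\<^sub>R e)" for n x
 proof -
  have "\<exists>t. 0 < t \<and> t < 1 / real (Suc n) \<and> Z (x + (1 / real (Suc n)) *\<^sub>R e) - Z (x + 0 *\<^sub>R e) = (1 / real (Suc n) - 0) * Z' (x + t *\<^sub>R e)"
   by (rule MVT2[of 0 "1 / real (Suc n)" "\<lambda>t. Z (x + t *\<^sub>R e)" "\<lambda>t. Z' (x + t *\<^sub>R e)"]) (use D in auto)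
  then obtain t where t: "0 < t" "t < 1 / real (Suc n)"
    "Z (x + (1 / real (Suc n)) *\<^sub>R e) - Z x = 1 / real (Suc n) * Z' (x + t *\<^sub>R e)" by auto
  have "d n x = real (Suc n) * (1 / real (Suc n) * Z' (x + t *\<^sub>R e))" unfolding d_def t(3) ..
  also have "... = Z' (x + t *\<^sub>R e)" by simp
  finally have "d n x = Z' (x + t *\<^sub>R e)" .
  moreover have "t < 1" using t(2) by (rule less_le_trans) simp
  ultimately show ?thesis using t(1) by blast
 qed
 have dbound: "norm (d n x) <= B * indicator K' x" for n x
 proof -
  obtain t where t: "0 < t" "t < 1" "d n x = Z' (x + t *\<^sub>R e)" using mvt by blast
  show ?thesis
  proof (cases "x + t *\<^sub>R e \<in> K")
   case True
   have "norm x <= norm (x + t *\<^sub>R e) + norm (t *\<^sub>R e)" using norm_triangle_ineq4[of "x + t *\<^sub>R e" "t *\<^sub>R e"] by simp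
   also have "... <= R + norm e" using R[OF True] t mult_right_mono[of t 1 "norm e"] by simp
   finally show ?thesis using B t by (simp add: K'_def)
  next
   case False
   then show ?thesis using t K(3) by (simp add: B_def)
  qed
 qed
 have int0: "(LINT x|lborel. d n x) = 0" for n
 proof -
  have "integrable lborel (\<lambda>x. Z (x + (1 / real (Suc n)) *\<^sub>R e))"
  proof (rule integrable_continuous_compact_support)
   show "continuous_on UNIV (\<lambda>x. Z (x + (1 / real (Suc n)) *\<^sub>R e))"
    by (rule continuous_on_compose2[OF Z]) (auto intro!: continuous_intros)
   show "compact ((\<lambda>x. x + (- (1 / real (Suc n))) *\<^sub>R e) ` K)"
    by (intro compact_continuous_image K(1) continuous_intros)
   fix x assume "x \<notin> (\<lambda>x. x + (- (1 / real (Suc n))) *\<^sub>R e) ` K"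
   moreover have "x = (x + (1 / real (Suc n)) *\<^sub>R e) + (- (1 / real (Suc n))) *\<^sub>R e" by simp
   ultimately show "Z (x + (1 / real (Suc n)) *\<^sub>R e) = 0" using K(2) by blast
  qed
  then have "(LINT x|lborel. Z (x + (1 / real (Suc n)) *\<^sub>R e) - Z x) = 0"
   using iZ lborel_integral_translate[OF Zm] by simp
  then show ?thesis by (simp add: d_def)
 qed
 have "(\<lambda>n. LINT x|lborel. d n x) \<longlonglongrightarrow> (LINT x|lborel. Z' x)"
 proof (rule integral_dominated_convergence[where w = "\<lambda>x. B * indicator K' x"])
  show "integrable lborel (\<lambda>x. B * indicator K' x)"
   unfolding K'_def using emeasure_lborel_cball_finite by (intro integrable_mult_right) (simp add: integrable_indicator_iff)
  show "AE x in lborel. (\<lambda>n. d n x) \<longlonglongrightarrow> Z' x"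
  proof (rule AE_I2)
   fix x
   have "((\<lambda>t. (Z (x + (0 + t) *\<^sub>R e) - Z (x + 0 *\<^sub>R e)) / t) \<longlongrightarrow> Z' (x + 0 *\<^sub>R e)) (at 0)"
    using D[of x 0] unfolding DERIV_def .
   then have L: "((\<lambda>t. (Z (x + t *\<^sub>R e) - Z x) / t) \<longlongrightarrow> Z' x) (at 0)" by simp
   have "filterlim (\<lambda>n. 1 / real (Suc n)) (at 0) sequentially"
    using LIMSEQ_inverse_real_of_nat by (intro filterlim_atI) (auto simp: divide_inverse)
   from filterlim_compose[OF L this] show "(\<lambda>n. d n x) \<longlonglongrightarrow> Z' x" by (simp add: d_def mult.commute)
  qed
  show "d n \<in> borel_measurable lborel" for n unfolding d_def using Zm by measurable
 qed (use Z'm dbound in auto)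
 then show ?thesis using int0 by (simp add: LIMSEQ_const_iff)
qed

lemma max_0_power_has_derivative:
 "((\<lambda>s::real. (max 0 s) ^ Suc (Suc n)) has_real_derivative real (Suc (Suc n)) * (max 0 s) ^ Suc n) (at s)"
proof -
 consider "s > 0" | "s < 0" | "s = 0" by linarith
 then show ?thesis
 proof cases
  case 1
  have "((\<lambda>s. s ^ Suc (Suc n)) has_real_derivative real (Suc (Suc n)) * s ^ Suc n) (at s)"
   using DERIV_pow[of "Suc (Suc n)" s] by (simp del: power_Suc)
  then show ?thesis using 1 by (subst DERIV_cong_ev[OF refl _ refl, of _ "\<lambda>s. s ^ Suc (Suc n)"])
    (auto simp: max_def intro!: eventually_mono[OF order_tendstoD(1)[OF tendsto_ident_at 1]] eventually_nhds_in_open[of "{0<..}", THEN eventually_mono])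
 next
  case 2
  have "((\<lambda>s. 0) has_real_derivative 0) (at s)" by simp
  then show ?thesis using 2 by (subst DERIV_cong_ev[OF refl _ refl, of _ "\<lambda>s. 0"])
    (auto simp: max_def intro!: eventually_nhds_in_open[of "{..<0}", THEN eventually_mono])
 next
  case 3
  have "((\<lambda>h::real. (max 0 h) ^ Suc n * (max 0 h / h)) \<longlongrightarrow> 0) (at 0)"
  proof (rule Lim_null_comparison)
   have "\<bar>max 0 h ^ Suc n * (max 0 h / h)\<bar> <= \<bar>h\<bar> ^ Suc n" for h :: real
   proof (cases "h > 0")
    case False
    then have "max 0 h = 0" by simp
    then have "max 0 h ^ Suc n * (max 0 h / h) = 0" by simp
    then show ?thesis by (simp only: abs_zero zero_le_power abs_ge_zero)
   qed simp
   then show "\<forall>\<^sub>F h in at 0. norm (max 0 h ^ Suc n * (max 0 h / h)) <= \<bar>h\<bar> ^ Suc n" for h :: real by simp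
   show "((\<lambda>h::real. \<bar>h\<bar> ^ Suc n) \<longlongrightarrow> 0) (at 0)" by (rule tendsto_eq_intros | simp)+
  qed
  then show ?thesis using 3 by (simp add: DERIV_def mult_ac)
 qed
qed

lemma continuous_on_extend_zero:
 fixes F :: "'b::t2_space \<Rightarrow> real"
 assumes "open U" "compact K" "K \<subseteq> U" "continuous_on U F" "\<And>y. y \<in> U ==> y \<notin> K ==> F y = 0"
 shows "continuous_on UNIV (\<lambda>y. if y \<in> U then F y else 0)"
proof -
 have "continuous_on U (\<lambda>y. if y \<in> U then F y else 0)" using assms(4) by (rule continuous_on_eq) simp
 moreover have "continuous_on (- K) (\<lambda>y. if y \<in> U then F y else 0)"
  by (rule continuous_on_eq[of _ "\<lambda>_. 0"]) (auto simp: assms(5))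
 ultimately have "continuous_on (U \<union> - K) (\<lambda>y. if y \<in> U then F y else 0)"
  using assms(1) compact_imp_closed[OF assms(2)] by (intro continuous_on_open_Un) auto
 moreover have "U \<union> - K = UNIV" using assms(3) by auto
 ultimately show ?thesis by simp
qed

lemma integral_divergence_product:
 fixes X :: "real^'n \<Rightarrow> real" and W :: "real^'n \<Rightarrow> real"
 assumes U: "open U" and K: "compact K" "K \<subseteq> U"
  and X: "Ck_on (Suc 0) U X" "\<And>y. y \<in> U ==> y \<notin> K ==> X y = 0" and W: "Ck_on (Suc 0) U W"
 shows "integrable lborel (\<lambda>y. if y \<in> U then partial i X y * W y else 0)"
  and "integrable lborel (\<lambda>y. if y \<in> U then X y * partial i W y else 0)"
  and "(LINT y|lborel. (if y \<in> U then X y * partial i W y else 0)) = - (LINT y|lborel. (if y \<in> U then partial i X y * W y else 0))"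
proof -
 have ax: "axis i (1::real) \<in> Basis" by simp
 have cX: "continuous_on U X" and cW: "continuous_on U W" using Ck_on_imp_continuous X(1) W by blast+
 have cpX: "continuous_on U (partial i X)" and cpW: "continuous_on U (partial i W)"
  using X(1) W ax by (auto simp: partial_def[abs_def])
 have opn: "open (- K)" using compact_imp_closed[OF K(1)] by auto
 have pX0: "partial i X y = 0" if "y \<in> U" "y \<notin> K" for y
 proof -
  have "grad X y = grad (\<lambda>_. 0) y" by (rule grad_cong[of "U \<inter> - K"]) (use U opn that X(2) in auto)
  then show ?thesis by (simp add: grad_def vec_eq_iff)
 qed
 define Z1 where "Z1 = (\<lambda>y. if y \<in> U then partial i X y * W y else 0)"
 define Z2 where "Z2 = (\<lambda>y. if y \<in> U then X y * partial i W y else 0)"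
 define Z where "Z = (\<lambda>y. if y \<in> U then X y * W y else 0)"
 have c1: "continuous_on UNIV Z1" unfolding Z1_def
  by (rule continuous_on_extend_zero[OF U K]) (auto intro!: continuous_on_mult cpX cW simp: pX0)
 have c2: "continuous_on UNIV Z2" unfolding Z2_def
  by (rule continuous_on_extend_zero[OF U K]) (auto intro!: continuous_on_mult cpW cX simp: X(2))
 have cZ: "continuous_on UNIV Z" unfolding Z_def
  by (rule continuous_on_extend_zero[OF U K]) (auto intro!: continuous_on_mult cW cX simp: X(2))
 have z0: "Z1 y = 0" "Z2 y = 0" "Z y = 0" if "y \<notin> K" for y using that pX0 X(2) by (auto simp: Z1_def Z2_def Z_def)
 show i1: "integrable lborel (\<lambda>y. if y \<in> U then partial i X y * W y else 0)"
  using integrable_continuous_compact_support[OF c1 K(1) z0(1)] by (simp add: Z1_def)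
 show i2: "integrable lborel (\<lambda>y. if y \<in> U then X y * partial i W y else 0)"
  using integrable_continuous_compact_support[OF c2 K(1) z0(2)] by (simp add: Z2_def)
 have DZ: "\<exists>D. (Z has_derivative D) (at y) \<and> D (axis i 1) = Z1 y + Z2 y" for y
 proof (cases "y \<in> U")
  case True
  have dX: "(X has_derivative frechet_derivative X (at y)) (at y)"
   and dW: "(W has_derivative frechet_derivative W (at y)) (at y)" using Ck_on_has_derivative X(1) W True by blast+
  have "(Z has_derivative (\<lambda>v. X y * frechet_derivative W (at y) v + frechet_derivative X (at y) v * W y)) (at y)"
   by (rule has_derivative_transform_within_open[OF has_derivative_mult[OF dX dW] U True]) (simp add: Z_def)
  moreover have "X y * frechet_derivative W (at y) (axis i 1) + frechet_derivative X (at y) (axis i 1) * W y = Z1 y + Z2 y"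
   using True by (simp add: Z1_def Z2_def partial_def)
  ultimately show ?thesis by blast
 next
  case False
  then have "y \<in> - K" using K(2) by auto
  then have "(Z has_derivative (\<lambda>_. 0)) (at y)"
   by (intro has_derivative_transform_within_open[OF has_derivative_const[of 0] opn]) (auto simp: z0)
  then show ?thesis using z0[of y] \<open>y \<in> - K\<close> by (intro exI[of _ "\<lambda>_. 0"]) auto
 qed
 have "(LINT y|lborel. Z1 y + Z2 y) = 0"
 proof (rule integral_directional_derivative_zero[where Z = Z and e = "axis i 1" and K = K])
  fix x :: "real^'n" and t :: real
  obtain D where D: "(Z has_derivative D) (at (x + t *\<^sub>R axis i 1))" "D (axis i 1) = Z1 (x + t *\<^sub>R axis i 1) + Z2 (x + t *\<^sub>R axis i 1)"
   using DZ by blast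
  have "((\<lambda>t. x + t *\<^sub>R axis i 1) has_derivative (\<lambda>s. s *\<^sub>R axis i 1)) (at t)"
   by (auto intro!: derivative_eq_intros)
  from has_derivative_compose[OF this D(1)]
  have "((\<lambda>t. Z (x + t *\<^sub>R axis i 1)) has_derivative (\<lambda>s. D (s *\<^sub>R axis i 1))) (at t)" .
  moreover have "(\<lambda>s. D (s *\<^sub>R axis i 1)) = (*) (Z1 (x + t *\<^sub>R axis i 1) + Z2 (x + t *\<^sub>R axis i 1))"
   using linear_cmul[OF has_derivative_linear[OF D(1)]] D(2) by (auto simp: fun_eq_iff)
  ultimately show "((\<lambda>t. Z (x + t *\<^sub>R axis i 1)) has_real_derivative Z1 (x + t *\<^sub>R axis i 1) + Z2 (x + t *\<^sub>R axis i 1)) (at t)"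
   by (simp add: has_field_derivative_def)
 qed (auto intro!: continuous_on_add c1 c2 cZ K simp: z0)
 then show "(LINT y|lborel. (if y \<in> U then X y * partial i W y else 0)) = - (LINT y|lborel. (if y \<in> U then partial i X y * W y else 0))"
  using i1 i2 by (simp add: Z1_def Z2_def)
qed

lemma Ck_on_compose_1:
 fixes B :: "real^'m \<Rightarrow> real" and \<tau> :: "real^'n \<Rightarrow> real^'m"
 assumes S: "open S" and B: "Ck_on (Suc 0) T B" and \<tau>: "Ck_on (Suc 0) S \<tau>" and ST: "\<tau> ` S \<subseteq> T"
 shows "Ck_on (Suc 0) S (\<lambda>y. B (\<tau> y))"
proof (rule Ck_on_Suc_I[OF S])
 show "((\<lambda>y. B (\<tau> y)) has_derivative (\<lambda>v. grad B (\<tau> y) \<bullet> frechet_derivative \<tau> (at y) v)) (at y)" if "y \<in> S" for y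
 proof -
  have "\<tau> y \<in> T" using ST that by auto
  then have "B differentiable (at (\<tau> y))" using B by simp
  from has_derivative_compose[OF Ck_on_has_derivative[OF \<tau> that] has_derivative_grad[OF this]]
  show ?thesis .
 qed
 fix b :: "real^'n" assume b: "b \<in> Basis"
 have "continuous_on T (\<lambda>z. partial i B z)" for i using B by (auto simp: partial_def)
 then have "continuous_on T (grad B)" unfolding grad_def[abs_def] by (rule continuous_on_vec_lambda)
 moreover have "continuous_on S (\<lambda>y. frechet_derivative \<tau> (at y) b)" using \<tau> b by simp
 ultimately show "Ck_on 0 S (\<lambda>y. grad B (\<tau> y) \<bullet> frechet_derivative \<tau> (at y) b)"
  using continuous_on_compose2[OF _ Ck_on_imp_continuous[OF \<tau>] ST, of "grad B"]
  unfolding Ck_on.simps(1) by (intro continuous_on_inner)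
qed

lemma Ck_on_Un:
 "Ck_on k S f ==> Ck_on k T f ==> open S ==> open T ==> Ck_on k (S \<union> T) f"
 by (induction k arbitrary: f) (auto intro: continuous_on_open_Un)

section \<open>Green's formula\<close>

lemma Ck_on_partial: "Ck_on (Suc k) S F ==> Ck_on k S (partial i F)"
proof -
 assume F: "Ck_on (Suc k) S F"
 have "axis i (1::real) \<in> Basis" by simp
 then show ?thesis using F by (simp add: partial_def[abs_def])
qed

context riemannian_probability
begin

text \<open>The components of the vector field \<open>sqrt (det g) * grad F\<close>, whose divergence, divided by
\<open>sqrt (det g)\<close>, is the Laplacian \<open>lap\<close>. Both act on functions of the coordinates, so that they apply
to functions living in one chart.\<close>

definition flux :: "('a, 'n) chart \<Rightarrow> (real^'n \<Rightarrow> real) \<Rightarrow> 'n \<Rightarrow> real^'n \<Rightarrow> real" where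
 "flux c F i y = (\<Sum>j\<in>UNIV. sqrt (det (g c y)) * matrix_inv (g c y) $ i $ j * partial j F y)"

definition lap :: "('a, 'n) chart \<Rightarrow> (real^'n \<Rightarrow> real) \<Rightarrow> real^'n \<Rightarrow> real" where
 "lap c F y = (\<Sum>i\<in>UNIV. partial i (flux c F i) y) / sqrt (det (g c y))"

lemma chart_laplacian_eq_lap: "chart_laplacian g c f = lap c (\<lambda>y. f (chart_inv c y))"
 by (rule ext) (simp add: chart_laplacian_def lap_def flux_def[abs_def] o_def)

lemma flux_Ck:
 assumes "c \<in> A" "Ck_on (Suc k) (chart_image c) F"
 shows "Ck_on k (chart_image c) (flux c F i)"
 unfolding flux_def[abs_def] by (intro Ck_on_sum Ck_on_mult chart_image_open sqrt_det_Ck inverse_metric_Ck Ck_on_partial assms)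

definition chart_form :: "('a, 'n) chart \<Rightarrow> (real^'n \<Rightarrow> real) \<Rightarrow> (real^'n \<Rightarrow> real) \<Rightarrow> real^'n \<Rightarrow> real" where
 "chart_form c F G y = grad F y \<bullet> (matrix_inv (g c y) *v grad G y)"

lemma flux_sum:
 "(\<Sum>i\<in>UNIV. partial i F y * flux c G i y) = sqrt (det (g c y)) * chart_form c F G y"
 by (simp add: flux_def chart_form_def inner_vec_def matrix_vector_mult_def grad_def sum_distrib_left mult_ac)

lemma chart_form_sym: "c \<in> A ==> y \<in> chart_image c ==> chart_form c F G y = chart_form c G F y"
 unfolding chart_form_def by (rule inverse_metric_symmetric)

lemma chart_green_aux:
 assumes c: "c \<in> A" and K: "compact K" "K \<subseteq> chart_image c"
  and W: "\<And>i. Ck_on (Suc 0) (chart_image c) (W i)" and X: "\<And>i. Ck_on (Suc 0) (chart_image c) (X i)"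
  and X0: "\<And>i y. y \<in> chart_image c ==> y \<notin> K ==> X i y = 0"
 shows "(LINT y|lborel. (if y \<in> chart_image c then \<Sum>i\<in>UNIV. X i y * partial i (W i) y else 0))
  = - (LINT y|lborel. (if y \<in> chart_image c then \<Sum>i\<in>UNIV. partial i (X i) y * W i y else 0))"
proof -
 note div = integral_divergence_product[OF chart_image_open[OF c] K X X0 W]
 have "(LINT y|lborel. (if y \<in> chart_image c then \<Sum>i\<in>UNIV. X i y * partial i (W i) y else 0))
   = (LINT y|lborel. (\<Sum>i\<in>UNIV. if y \<in> chart_image c then X i y * partial i (W i) y else 0))"
  by (intro integral_eqI) simp
 also have "... = (\<Sum>i\<in>UNIV. LINT y|lborel. (if y \<in> chart_image c then X i y * partial i (W i) y else 0))"
  by (intro Bochner_Integration.integral_sum div(2))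
 also have "... = - (\<Sum>i\<in>UNIV. LINT y|lborel. (if y \<in> chart_image c then partial i (X i) y * W i y else 0))"
  by (simp add: div(3) sum_negf)
 also have "(\<Sum>i\<in>UNIV. LINT y|lborel. (if y \<in> chart_image c then partial i (X i) y * W i y else 0))
   = (LINT y|lborel. (\<Sum>i\<in>UNIV. if y \<in> chart_image c then partial i (X i) y * W i y else 0))"
  by (intro Bochner_Integration.integral_sum[symmetric] div(1))
 also have "... = (LINT y|lborel. (if y \<in> chart_image c then \<Sum>i\<in>UNIV. partial i (X i) y * W i y else 0))"
  by (intro integral_eqI) simp
 finally show ?thesis .
qed

lemma sqrt_det_lap:
 "c \<in> A ==> sqrt_det c y * (a * lap c F y) = (if y \<in> chart_image c then \<Sum>i\<in>UNIV. a * partial i (flux c F i) y else 0)"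
 using det_pos[of c y] by (cases "y \<in> chart_image c") (simp_all add: sqrt_det_def lap_def flip: sum_distrib_left)

lemma chart_green:
 assumes c: "c \<in> A" and K: "compact K" "K \<subseteq> chart_image c"
  and F: "Ck_on (Suc (Suc 0)) (chart_image c) F"
  and X: "Ck_on (Suc 0) (chart_image c) X" "\<And>y. y \<in> chart_image c ==> y \<notin> K ==> X y = 0"
 shows "(LINT y|lborel. sqrt_det c y * (X y * lap c F y)) = - (LINT y|lborel. sqrt_det c y * chart_form c X F y)"
proof -
 have "(LINT y|lborel. sqrt_det c y * (X y * lap c F y))
   = - (LINT y|lborel. (if y \<in> chart_image c then \<Sum>i\<in>UNIV. partial i X y * flux c F i y else 0))"
  unfolding sqrt_det_lap[OF c]
  by (rule chart_green_aux[OF c K, where X = "\<lambda>_. X" and W = "flux c F"]) (intro flux_Ck c F X | simp add: X)+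
 also have "(\<lambda>y. if y \<in> chart_image c then \<Sum>i\<in>UNIV. partial i X y * flux c F i y else 0)
   = (\<lambda>y. sqrt_det c y * chart_form c X F y)" by (auto simp: flux_sum sqrt_det_def)
 finally show ?thesis .
qed

lemma partial_zero_outside:
 assumes "open U" "closed K" "\<And>y. y \<in> U ==> y \<notin> K ==> F y = 0" "y \<in> U" "y \<notin> K"
 shows "partial i F y = 0"
proof -
 have "grad F y = grad (\<lambda>_. 0) y" by (rule grad_cong[of "U \<inter> - K"]) (use assms in auto)
 then show ?thesis by (simp add: grad_def vec_eq_iff)
qed

lemma flux_zero_outside:
 assumes "c \<in> A" "compact K" "\<And>y. y \<in> chart_image c ==> y \<notin> K ==> F y = 0" "y \<in> chart_image c" "y \<notin> K"
 shows "flux c F i y = 0"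
 using partial_zero_outside[OF chart_image_open[OF assms(1)] compact_imp_closed[OF assms(2)] assms(3-5)] by (simp add: flux_def)
text \<open>Green's formula twice: one integration by parts moves a derivative from each factor, and the Dirichlet form is symmetric. The
boundary terms vanish because \<open>X\<close> has compact support.\<close>

lemma chart_lap_symmetric:
 assumes c: "c \<in> A" and K: "compact K" "K \<subseteq> chart_image c"
  and F: "Ck_on (Suc (Suc 0)) (chart_image c) F"
  and X: "Ck_on (Suc (Suc 0)) (chart_image c) X" "\<And>y. y \<in> chart_image c ==> y \<notin> K ==> X y = 0"
 shows "(LINT y|lborel. sqrt_det c y * (X y * lap c F y)) = (LINT y|lborel. sqrt_det c y * (F y * lap c X y))"
proof -
 have "(LINT y|lborel. (if y \<in> chart_image c then \<Sum>i\<in>UNIV. flux c X i y * partial i F y else 0))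
   = - (LINT y|lborel. (if y \<in> chart_image c then \<Sum>i\<in>UNIV. partial i (flux c X i) y * F y else 0))"
  by (rule chart_green_aux[OF c K, where X = "flux c X" and W = "\<lambda>_. F"])
   (intro flux_Ck c X Ck_on_SucD[OF F] flux_zero_outside[OF c K(1)] | simp)+
 also have "(\<lambda>y. if y \<in> chart_image c then \<Sum>i\<in>UNIV. flux c X i y * partial i F y else 0)
   = (\<lambda>y. sqrt_det c y * chart_form c X F y)"
  using chart_form_sym[OF c] flux_sum[of F _ c X] by (auto simp: sqrt_det_def mult.commute)
 also have "(\<lambda>y. if y \<in> chart_image c then \<Sum>i\<in>UNIV. partial i (flux c X i) y * F y else 0)
   = (\<lambda>y. sqrt_det c y * (F y * lap c X y))"
  unfolding sqrt_det_lap[OF c] by (intro ext if_cong sum.cong refl mult.commute)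
 finally show ?thesis using chart_green[OF c K F Ck_on_SucD[OF X(1)] X(2)] by simp
qed

lemma eigen_smooth: "f \<in> eigenspace M A g l ==> smooth_function A f" by (simp add: eigenspace_def)

lemma eigen_C1: "f \<in> eigenspace M A g l ==> C1_function f" by (rule smooth_imp_C1[OF eigen_smooth])

lemma eigen_Ck:
 assumes "f \<in> eigenspace M A g l" "c \<in> A"
 shows "Ck_on k (chart_image c) (\<lambda>y. f (chart_inv c y))"
 using eigen_smooth[OF assms(1)] assms(2) by (simp add: smooth_function_def smooth_on_def o_def)

lemma eigen_lap:
 assumes f: "f \<in> eigenspace M A g l" and c: "c \<in> A" "y \<in> chart_image c"
 shows "lap c (\<lambda>y. f (chart_inv c y)) y = - (l * f (chart_inv c y))"
proof -
 have "has_laplacian A g f (\<lambda>p. - (l * f p))" using f by (simp add: eigenspace_def)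
 then have "- (l * f (chart_inv c y)) = chart_laplacian g c f (chart_map c (chart_inv c y))"
  using inv_in_dom[OF c] c(1) unfolding has_laplacian_def by blast
 then show ?thesis by (simp add: map_inv[OF c] chart_laplacian_eq_lap)
qed

lemma green_local:
 assumes c: "c \<in> A" and K: "compact K" "K \<subseteq> chart_image c"
  and X: "C1_function X" "\<And>p. p \<in> M ==> p \<notin> chart_inv c ` K ==> X p = 0"
  and f: "f \<in> eigenspace M A g l"
 shows "l * (LINT p|\<nu>. X p * f p) = (LINT p|\<nu>. gamma X f p)"
proof -
 let ?X = "\<lambda>y. X (chart_inv c y)" and ?F = "\<lambda>y. f (chart_inv c y)"
 have Kdom: "chart_inv c ` K \<subseteq> chart_dom c"
 proof (rule image_subsetI)
  fix y assume "y \<in> K"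
  then show "chart_inv c y \<in> chart_dom c" by (intro inv_in_dom[OF c] subsetD[OF K(2)])
 qed
 have out: "X p = 0" if "p \<in> M" "p \<notin> chart_dom c" for p
  using X(2)[OF that(1)] subsetD[OF Kdom, of p] that(2) by blast
 have X0: "?X y = 0" if "y \<in> chart_image c" "y \<notin> K" for y
 proof (rule X(2)[OF inv_in_M[OF c that(1)]])
  show "chart_inv c y \<notin> chart_inv c ` K"
  proof
   assume "chart_inv c y \<in> chart_inv c ` K"
   then obtain z where z: "z \<in> K" "chart_inv c y = chart_inv c z" by blast
   have "y = chart_map c (chart_inv c y)" by (rule map_inv[OF c that(1), symmetric])
   also have "... = chart_map c (chart_inv c z)" by (rule arg_cong[OF z(2)])
   also have "... = z" by (rule map_inv[OF c subsetD[OF K(2) z(1)]])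
   finally have "y = z" .
   then show False using z that by simp
  qed
 qed
 have "compact (chart_inv c ` K)"
  by (rule compact_continuous_image[OF continuous_on_subset[OF chart_inv_continuous[OF c] K(2)] K(1)])
 then have clK: "closed (chart_inv c ` K)" by (rule compact_imp_closed)
 have gam_out: "gamma X f p = 0" if p: "p \<in> M" "p \<notin> chart_dom c" for p
 proof -
  obtain c' where c': "c' \<in> A" "p \<in> chart_dom c'" using p atlas_cover by blast
  define S where "S = {y \<in> chart_image c'. chart_inv c' y \<in> - (chart_inv c ` K)}"
  have "open S"
   using continuous_open_preimage[OF chart_inv_continuous[OF c'(1)] chart_image_open[OF c'(1)], of "- (chart_inv c ` K)"] clK
   by (simp add: S_def vimage_def Int_def open_Compl)
  moreover have "p \<notin> chart_inv c ` K" using p(2) subsetD[OF Kdom, of p] by blast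
  then have "chart_map c' p \<in> S" using c' inv_map[OF c'] by (simp add: S_def)
  ultimately have "grad (\<lambda>y. X (chart_inv c' y)) (chart_map c' p) = grad (\<lambda>_. 0) (chart_map c' p)"
   by (intro grad_cong[of S]) (auto simp: S_def X(2) inv_in_M[OF c'(1)])
  then show ?thesis by (simp add: gamma_chart[OF c' X(1) eigen_C1[OF f]] chart_gamma_def o_def)
 qed
 have cX: "continuous_on M X" and cf: "continuous_on M f" using X(1) eigen_C1[OF f] by (auto intro: C1_continuous)
 have "(LINT p|\<nu>. X p * f p) = (LINT y|lborel. dens c y * (X (chart_inv_ext c y) * f (chart_inv_ext c y)))"
  using cX cf by (intro integral_chart[OF c]) (auto intro!: continuous_measurable continuous_on_mult simp: out)
 then have "l * (LINT p|\<nu>. X p * f p) = (LINT y|lborel. l * (dens c y * (X (chart_inv_ext c y) * f (chart_inv_ext c y))))"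
  by simp
 also have "... = (LINT y|lborel. - (\<kappa> * (sqrt_det c y * (?X y * lap c ?F y))))"
  using eigen_lap[OF f c] by (intro integral_eqI) (auto simp: dens_def sqrt_det_def chart_inv_ext_def)
 also have "... = - (\<kappa> * (LINT y|lborel. sqrt_det c y * (?X y * lap c ?F y)))" by simp
 also have "... = \<kappa> * (LINT y|lborel. sqrt_det c y * chart_form c ?X ?F y)"
  by (subst chart_green[OF c K eigen_Ck[OF f c] C1D[OF X(1) c] X0]) auto
 also have "... = (LINT y|lborel. \<kappa> * (sqrt_det c y * chart_form c ?X ?F y))" by simp
 also have "... = (LINT y|lborel. dens c y * gamma X f (chart_inv_ext c y))" by (intro integral_eqI)
   (auto simp: dens_def sqrt_det_def chart_inv_ext_def gamma_chart_inv[OF c _ X(1) eigen_C1[OF f]] chart_gamma_def chart_form_def o_def)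
 also have "... = (LINT p|\<nu>. gamma X f p)"
  using gam_out by (intro integral_chart[OF c, symmetric] continuous_measurable gamma_continuous X(1) eigen_C1[OF f]) auto
 finally show ?thesis .
qed

end

lemma max_0_power_compose_Ck:
 fixes q :: "'e::euclidean_space \<Rightarrow> real"
 assumes S: "open S" and q: "Ck_on (Suc 0) S q"
 shows "Ck_on (Suc 0) S (\<lambda>y. (max 0 (q y)) ^ Suc (Suc n))"
proof (rule Ck_on_Suc_I[OF S])
 show "((\<lambda>y. (max 0 (q y)) ^ Suc (Suc n)) has_derivative
   (\<lambda>v. real (Suc (Suc n)) * (max 0 (q y)) ^ Suc n * frechet_derivative q (at y) v)) (at y)" if "y \<in> S" for y
  using has_derivative_compose[OF Ck_on_has_derivative[OF q that]
    max_0_power_has_derivative[of n "q y", unfolded has_field_derivative_def]] .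
 show "Ck_on 0 S (\<lambda>y. real (Suc (Suc n)) * (max 0 (q y)) ^ Suc n * frechet_derivative q (at y) b)" if "b \<in> Basis" for b
  using q that Ck_on_imp_continuous[OF q] by (auto intro!: continuous_intros simp del: power_Suc)
qed

lemma dist_square_Ck: "open S ==> Ck_on k S (\<lambda>y::real^'n. (y - x) \<bullet> (y - x))"
 unfolding inner_vec_def inner_real_def vector_minus_component
 by (intro Ck_on_sum Ck_on_mult; simp add: Ck_on_component Ck_on_add[where g = "\<lambda>_. - a" for a, simplified])

context riemannian_probability
begin

text \<open>The square makes the function continuously differentiable across the boundary of the ball.\<close>

definition bump :: "('a, 'n) chart \<times> (real^'n) \<times> real \<Rightarrow> 'a \<Rightarrow> real" where
 "bump b p = (case b of (c, x, r) \<Rightarrow>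
   if p \<in> chart_dom c then (max 0 (r^2 - (chart_map c p - x) \<bullet> (chart_map c p - x)))^2 else 0)"

lemma bump_outside:
 assumes gb: "good_ball (c, x, r)" and p: "p \<notin> chart_inv c ` cball x r"
 shows "bump (c, x, r) p = 0"
proof (cases "p \<in> chart_dom c")
 case True
 have "chart_map c p \<notin> cball x r"
 proof
  assume "chart_map c p \<in> cball x r"
  then have "chart_inv c (chart_map c p) \<in> chart_inv c ` cball x r" by (rule imageI)
  then show False using p inv_map[OF good_ballD(1)[OF gb] True] by simp
 qed
 then have "r < norm (chart_map c p - x)" by (simp add: dist_norm norm_minus_commute)
 then have "r^2 < (norm (chart_map c p - x))^2" using good_ballD(2)[OF gb] by (intro power_strict_mono) auto
 then show ?thesis by (simp add: bump_def power2_norm_eq_inner)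
qed (simp add: bump_def)

lemma bump_nonneg: "bump b p >= 0" by (simp add: bump_def split: prod.split)

lemma bump_positive:
 assumes gb: "good_ball (c, x, r)" and p: "p \<in> patch (c, x, r)"
 shows "bump (c, x, r) p > 0"
proof -
 obtain y where y: "y \<in> ball x r" "p = chart_inv c y" using p by (auto simp: patch_def)
 then have yi: "y \<in> chart_image c" using good_ballD(4)[OF gb] by blast
 then have "chart_map c p = y" "p \<in> chart_dom c" using map_inv inv_in_dom good_ballD(1)[OF gb] y(2) by auto
 moreover have "(norm (y - x))^2 < r^2" using y(1) by (intro power_strict_mono) (auto simp: dist_norm norm_minus_commute)
 ultimately show ?thesis by (simp add: bump_def power2_norm_eq_inner)
qed

lemma bump_C1:
 assumes gb: "good_ball (c, x, r)"
 shows "C1_function (bump (c, x, r))"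
proof (rule C1I)
 fix c' assume c': "c' \<in> A"
 note gbD = good_ballD[OF gb]
 define S where "S = chart_map c' ` (chart_dom c' \<inter> chart_dom c)"
 define T where "T = {y \<in> chart_image c'. chart_inv c' y \<in> - (chart_inv c ` cball x r)}"
 have openS: "open S" unfolding S_def by (rule overlap_open[OF c' gbD(1)])
 have "compact (chart_inv c ` cball x r)"
  by (rule compact_continuous_image[OF continuous_on_subset[OF chart_inv_continuous[OF gbD(1)] gbD(3)] compact_cball])
 then have "closed (chart_inv c ` cball x r)" by (rule compact_imp_closed)
 then have openT: "open T"
  using continuous_open_preimage[OF chart_inv_continuous[OF c'] chart_image_open[OF c'], of "- (chart_inv c ` cball x r)"]
  by (simp add: T_def vimage_def Int_def open_Compl)
 have cT: "Ck_on (Suc 0) T (\<lambda>y. bump (c, x, r) (chart_inv c' y))"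
 proof (subst Ck_on_cong[OF openT])
  show "bump (c, x, r) (chart_inv c' y) = 0" if "y \<in> T" for y using that by (intro bump_outside[OF gb]) (simp add: T_def)
 qed (rule Ck_on_const[OF openT])
 have Sd: "chart_inv c' y \<in> chart_dom c \<and> chart_map c (chart_inv c' y) = transition c' c y" if "y \<in> S" for y
  using that inv_map[OF c'] by (auto simp: S_def transition_def)
 have cS: "Ck_on (Suc 0) S (\<lambda>y. bump (c, x, r) (chart_inv c' y))"
 proof (subst Ck_on_cong[OF openS])
  show "bump (c, x, r) (chart_inv c' y)
    = (\<lambda>z. (max 0 (r^2 - (z - x) \<bullet> (z - x))) ^ Suc (Suc 0)) (transition c' c y)" if "y \<in> S" for y
   using Sd[OF that] by (simp add: bump_def numeral_2_eq_2)
  show "Ck_on (Suc 0) S (\<lambda>y. (\<lambda>z. (max 0 (r^2 - (z - x) \<bullet> (z - x))) ^ Suc (Suc 0)) (transition c' c y))"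
  proof (rule Ck_on_compose_1[OF openS, where T = UNIV and \<tau> = "transition c' c"
     and B = "\<lambda>z. (max 0 (r^2 - (z - x) \<bullet> (z - x))) ^ Suc (Suc 0)"])
   have "Ck_on (Suc 0) UNIV (\<lambda>z. r^2 + (- 1) * ((z - x) \<bullet> (z - x)))"
    by (intro Ck_on_add Ck_on_mult Ck_on_const dist_square_Ck open_UNIV)
   then have "Ck_on (Suc 0) UNIV (\<lambda>z. r^2 - (z - x) \<bullet> (z - x))" by simp
   from max_0_power_compose_Ck[OF open_UNIV this, of 0]
   show "Ck_on (Suc 0) UNIV (\<lambda>z. (max 0 (r^2 - (z - x) \<bullet> (z - x))) ^ Suc (Suc 0))" .
   show "Ck_on (Suc 0) S (transition c' c)" using transition_smooth[OF c' gbD(1)] unfolding smooth_on_def S_def by blast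
  qed simp
 qed
 have "chart_image c' \<subseteq> S \<union> T"
 proof
  fix y assume y: "y \<in> chart_image c'"
  show "y \<in> S \<union> T"
  proof (cases "chart_inv c' y \<in> chart_dom c")
   case True
   then have "y \<in> S" unfolding S_def using map_inv[OF c' y] inv_in_dom[OF c' y]
    by (intro image_eqI[where x = "chart_inv c' y"]) auto
   then show ?thesis ..
  next
   case False
   moreover have "chart_inv c ` cball x r \<subseteq> chart_dom c"
   proof (rule image_subsetI)
    fix y assume "y \<in> cball x r"
    then show "chart_inv c y \<in> chart_dom c" by (intro inv_in_dom gbD(1) subsetD[OF gbD(3)])
   qed
   ultimately have "y \<in> T" using y by (auto simp: T_def)
   then show ?thesis ..
  qed
 qed
 then show "Ck_on (Suc 0) (chart_image c') (\<lambda>y. bump (c, x, r) (chart_inv c' y))"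
  by (rule Ck_on_subset[OF Ck_on_Un[OF cS cT openS openT]])
qed

text \<open>Green's formula in a chart applies to functions supported in a patch; a partition of unity of class \<open>C\<^sup>1\<close>
subordinate to the finite cover reduces the general case to it.\<close>

theorem green_eigenfunction:
 assumes F: "C1_function F" and f: "f \<in> eigenspace M A g l"
 shows "l * (LINT p|\<nu>. F p * f p) = (LINT p|\<nu>. gamma F f p)"
proof -
 define H where "H p = (\<Sum>b\<in>cover. bump b p)" for p
 have bC1: "C1_function (bump b)" if "b \<in> cover" for b using bump_C1 cover(2)[OF that] by (cases b) auto
 have HC1: "C1_function H" unfolding H_def by (rule C1_sum) (rule bC1)
 have Hpos: "H p > 0" if p: "p \<in> M" for p
 proof -
  obtain b where b: "b \<in> cover" "p \<in> patch b" using cover(3) p by blast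
  then have "bump b p > 0" using bump_positive cover(2)[OF b(1)] by (cases b) auto
  then show ?thesis unfolding H_def using b(1) cover(1) bump_nonneg by (intro sum_pos2[of _ b]) auto
 qed
 have IC1: "C1_function (\<lambda>p. inverse (H p))" by (rule C1_inverse[OF HC1]) (use Hpos in force)
 define X where "X b p = bump b p * (inverse (H p) * F p)" for b p
 have XC1: "C1_function (X b)" if "b \<in> cover" for b unfolding X_def using that by (intro C1_mult bC1 IC1 F)
 have sumX: "(\<Sum>b\<in>cover. X b p) = F p" if "p \<in> M" for p
  using Hpos[OF that] unfolding X_def by (simp add: H_def flip: sum_distrib_right)
 have loc: "l * (LINT p|\<nu>. X b p * f p) = (LINT p|\<nu>. gamma (X b) f p)" if b: "b \<in> cover" for b
 proof -
  obtain c x r where b': "b = (c, x, r)" by (cases b)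
  note gb = cover(2)[OF b, unfolded b']
  show ?thesis by (rule green_local[OF good_ballD(1)[OF gb] compact_cball good_ballD(3)[OF gb] XC1[OF b] _ f])
    (simp add: X_def b' bump_outside[OF gb])
 qed
 have fC: "continuous_on M f" by (rule C1_continuous[OF eigen_C1[OF f]])
 have "l * (LINT p|\<nu>. F p * f p) = l * (LINT p|\<nu>. (\<Sum>b\<in>cover. X b p * f p))"
  by (rule arg_cong[where f = "(*) l"], rule Bochner_Integration.integral_cong[OF refl])
   (simp add: sumX flip: sum_distrib_right)
 also have "... = (\<Sum>b\<in>cover. l * (LINT p|\<nu>. X b p * f p))"
 proof -
  have "integrable \<nu> (\<lambda>p. X b p * f p)" if "b \<in> cover" for b
   by (intro continuous_integrable continuous_on_mult fC C1_continuous XC1 that)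
  then show ?thesis by (subst Bochner_Integration.integral_sum) (simp_all add: sum_distrib_left)
 qed
 also have "... = (\<Sum>b\<in>cover. LINT p|\<nu>. gamma (X b) f p)" by (simp add: loc)
 also have "... = (LINT p|\<nu>. (\<Sum>b\<in>cover. gamma (X b) f p))"
  using XC1 eigen_C1[OF f] by (intro Bochner_Integration.integral_sum[symmetric] continuous_integrable gamma_continuous)
 also have "... = (LINT p|\<nu>. gamma F f p)"
 proof (rule Bochner_Integration.integral_cong[OF refl])
  fix p assume "p \<in> space \<nu>"
  then have p: "p \<in> M" by simp
  have "(\<Sum>b\<in>cover. gamma (X b) f p) = gamma (\<lambda>p. \<Sum>b\<in>cover. X b p) f p"
   by (rule gamma_sum[symmetric, OF p XC1 eigen_C1[OF f]])
  also have "... = gamma F f p" by (rule gamma_cong[OF p C1_sum F eigen_C1[OF f] sumX]) (rule XC1)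
  finally show "(\<Sum>b\<in>cover. gamma (X b) f p) = gamma F f p" .
 qed
 finally show ?thesis .
qed

corollary eigenspaces_orthogonal:
 assumes f: "f \<in> eigenspace M A g l" and u: "u \<in> eigenspace M A g m" and "l \<noteq> m"
 shows "(LINT p|\<nu>. f p * u p) = 0"
proof -
 have "m * (LINT p|\<nu>. f p * u p) = (LINT p|\<nu>. gamma f u p)" by (rule green_eigenfunction[OF eigen_C1[OF f] u])
 also have "... = (LINT p|\<nu>. gamma u f p)" by (intro integral_eqI gamma_sym eigen_C1[OF f] eigen_C1[OF u]) simp
 also have "... = l * (LINT p|\<nu>. f p * u p)" using green_eigenfunction[OF eigen_C1[OF u] f] by (simp add: mult.commute)
 finally show ?thesis using \<open>l \<noteq> m\<close> by simp
qed

end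

section \<open>Averages over shrunk balls\<close>

lemma nn_integral_lborel_affine:
 fixes f :: "'e::euclidean_space \<Rightarrow> ennreal"
 assumes f: "f \<in> borel_measurable borel" and c: "c > 0"
 shows "(\<integral>\<^sup>+w. f w \<partial>lborel) = ennreal (c ^ DIM('e)) * (\<integral>\<^sup>+z. f (t + c *\<^sub>R z) \<partial>lborel)"
proof -
 have m: "(\<lambda>z. t + c *\<^sub>R z) \<in> measurable borel borel" by simp
 have "(\<integral>\<^sup>+w. f w \<partial>lborel) = (\<integral>\<^sup>+w. f w \<partial>density (distr lborel borel (\<lambda>z. t + c *\<^sub>R z)) (\<lambda>_. \<bar>c\<bar> ^ DIM('e)))"
  using lborel_affine[of c t] c by (simp flip: ennreal_power)
 also have "... = (\<integral>\<^sup>+z. ennreal (c ^ DIM('e)) * f (t + c *\<^sub>R z) \<partial>lborel)"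
  using f c m by (subst nn_integral_density) (auto simp: nn_integral_distr)
 also have "... = ennreal (c ^ DIM('e)) * (\<integral>\<^sup>+z. f (t + c *\<^sub>R z) \<partial>lborel)"
  using measurable_compose[OF m f] by (intro nn_integral_cmult) simp
 finally show ?thesis .
qed

lemma path_increment_square_le:
 fixes \<phi> :: "real \<Rightarrow> real"
 assumes D: "\<And>t. 0 <= t ==> t <= 1 ==> (\<phi> has_real_derivative \<phi>' t) (at t)" and c: "continuous_on {0..1} \<phi>'"
 shows "ennreal ((\<phi> 1 - \<phi> 0)^2) <= (\<integral>\<^sup>+t\<in>{0..1}. ennreal ((\<phi>' t)^2) \<partial>lborel)"
proof -
 have m: "(\<lambda>t. \<phi>' t * indicator {0..1} t) \<in> borel_measurable lborel"
  using borel_measurable_continuous_on_indicator[OF _ c] by (simp add: mult.commute)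
 have "ennreal \<bar>\<phi> 1 - \<phi> 0\<bar> = ennreal \<bar>LINT t|lborel. \<phi>' t * indicator {0..1} t\<bar>"
 proof -
  have "(LINT t|lborel. indicator {0..1} t *\<^sub>R \<phi>' t) = \<phi> 1 - \<phi> 0" using D c by (intro integral_FTC_Icc)
    (auto simp: has_real_derivative_iff_has_vector_derivative intro: has_vector_derivative_at_within)
  then show ?thesis by (simp add: mult.commute)
 qed
 also have "... <= (\<integral>\<^sup>+t. ennreal \<bar>\<phi>' t * indicator {0..1} t\<bar> \<partial>lborel)"
  using integral_norm_bound_ennreal[of lborel "\<lambda>t. \<phi>' t * indicator {0..1} t"] borel_integrable_compact[OF compact_Icc c]
  by (simp add: mult.commute)
 also have "... = (\<integral>\<^sup>+t. ennreal \<bar>\<phi>' t * indicator {0..1} t\<bar> * indicator {0..1} t \<partial>lborel)"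
  by (intro nn_integral_cong) (auto simp: indicator_def)
 finally have "ennreal \<bar>\<phi> 1 - \<phi> 0\<bar> ^ 2 <= (\<integral>\<^sup>+t. ennreal \<bar>\<phi>' t * indicator {0..1} t\<bar> * indicator {0..1} t \<partial>lborel) ^ 2"
  by (intro power_mono) auto
 also have "... <= (\<integral>\<^sup>+t. ennreal \<bar>\<phi>' t * indicator {0..1} t\<bar> ^ 2 \<partial>lborel) * (\<integral>\<^sup>+t. indicator {0..1} t ^ 2 \<partial>(lborel :: real measure))"
  using m by (intro Cauchy_Schwarz_nn_integral) auto
 also have "(\<integral>\<^sup>+t. indicator {0..1} t ^ 2 \<partial>(lborel :: real measure)) = (\<integral>\<^sup>+t. indicator {0..1} t \<partial>(lborel :: real measure))"
  by (intro nn_integral_cong) (auto simp: indicator_def)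
 also have "... = 1" by simp
 also have "(\<integral>\<^sup>+t. ennreal \<bar>\<phi>' t * indicator {0..1} t\<bar> ^ 2 \<partial>lborel) = (\<integral>\<^sup>+t\<in>{0..1}. ennreal ((\<phi>' t)^2) \<partial>lborel)"
  by (intro nn_integral_cong) (auto simp: indicator_def ennreal_power)
 finally show ?thesis by (simp add: ennreal_power)
qed

text \<open>The kernel of the average over \<open>(1 - h) *\<^sub>R y + h *\<^sub>R cball x r\<close>, the copy of the
ball shrunk towards \<open>y\<close> by the factor \<open>h\<close>. This copy stays inside the ball by convexity, in contrast to
the ball of radius \<open>h\<close> about \<open>y\<close>; hence no boundary terms arise.\<close>

definition shrink_ker :: "(real^'n) \<Rightarrow> real \<Rightarrow> real \<Rightarrow> real^'n \<Rightarrow> real^'n \<Rightarrow> real" where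
 "shrink_ker x r h y w =
   indicator (cball x r) ((1 / h) *\<^sub>R (w - (1 - h) *\<^sub>R y)) / (h ^ CARD('n) * measure lborel (cball x r))"

definition shrink_avg :: "(real^'n) \<Rightarrow> real \<Rightarrow> real \<Rightarrow> (real^'n \<Rightarrow> real) \<Rightarrow> real^'n \<Rightarrow> real" where
 "shrink_avg x r h u y = (LINT w|lborel. shrink_ker x r h y w * u w)"

lemma measure_cball_pos: "r > 0 ==> measure lborel (cball (x::real^'n) r) > 0" by (simp add: content_cball_pos)

lemma emeasure_cball_measure: "emeasure lborel (cball (x::real^'n) r) = ennreal (measure lborel (cball x r))"
 using emeasure_lborel_cball_finite[of x r] by (intro emeasure_eq_ennreal_measure) auto

lemma shrink_ker_nonneg: "0 < h ==> shrink_ker x r h y w >= 0" by (simp add: shrink_ker_def)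

lemma shrink_ker_le: "0 < h ==> shrink_ker x r h y w <= 1 / (h ^ CARD('n) * measure lborel (cball x r))"
 for x :: "real^'n" by (auto simp: shrink_ker_def indicator_def)

lemma shrink_ker_support:
 assumes "y \<in> cball x r" "0 < h" "h <= 1" "w \<notin> cball x r"
 shows "shrink_ker x r h y w = 0"
proof -
 have "(1 / h) *\<^sub>R (w - (1 - h) *\<^sub>R y) \<notin> cball x r"
 proof
  assume z: "(1 / h) *\<^sub>R (w - (1 - h) *\<^sub>R y) \<in> cball x r"
  have "(1 - h) *\<^sub>R y + h *\<^sub>R ((1 / h) *\<^sub>R (w - (1 - h) *\<^sub>R y)) \<in> cball x r"
   by (rule convexD[OF convex_cball assms(1) z]) (use assms in auto)
  then show False using assms by simp
 qed
 then show ?thesis by (simp add: shrink_ker_def)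
qed

lemma shrink_ker_measurable [measurable]:
 "(\<lambda>(y, w). shrink_ker x r h y w) \<in> borel_measurable (borel \<Otimes>\<^sub>M borel)"
proof -
 have [measurable]: "cball x r \<in> sets borel" by simp
 have [measurable]: "(\<lambda>p::(real^'n) \<times> (real^'n). (1 / h) *\<^sub>R (snd p - (1 - h) *\<^sub>R fst p)) \<in> borel_measurable (borel \<Otimes>\<^sub>M borel)"
  by measurable
 show ?thesis unfolding shrink_ker_def case_prod_unfold by measurable
qed

lemma shrink_ker_measurable' [measurable]:
 "shrink_ker x r h y \<in> borel_measurable borel" using measurable_Pair2[OF shrink_ker_measurable, of y] by simp

lemma nn_integral_shrink_ker:
 fixes F :: "real^'n \<Rightarrow> ennreal"
 assumes [measurable]: "F \<in> borel_measurable borel" and h: "0 < h" and r: "r > 0"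
 shows "(\<integral>\<^sup>+w. ennreal (shrink_ker x r h y w) * F w \<partial>lborel)
  = ennreal (1 / measure lborel (cball x r)) * (\<integral>\<^sup>+z\<in>cball x r. F (y + h *\<^sub>R (z - y)) \<partial>lborel)"
proof -
 let ?v = "measure lborel (cball x r)"
 have [measurable]: "cball x r \<in> sets borel" by simp
 have v: "?v > 0" by (rule measure_cball_pos[OF r])
 have "(\<integral>\<^sup>+w. ennreal (shrink_ker x r h y w) * F w \<partial>lborel)
   = ennreal (h ^ CARD('n)) * (\<integral>\<^sup>+z. ennreal (shrink_ker x r h y ((1 - h) *\<^sub>R y + h *\<^sub>R z)) * F ((1 - h) *\<^sub>R y + h *\<^sub>R z) \<partial>lborel)"
  by (subst nn_integral_lborel_affine[OF _ h, where t = "(1 - h) *\<^sub>R y"]) auto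
 also have "... = ennreal (h ^ CARD('n)) * (\<integral>\<^sup>+z. ennreal (1 / (h ^ CARD('n) * ?v)) * (F (y + h *\<^sub>R (z - y)) * indicator (cball x r) z) \<partial>lborel)"
 proof (rule arg_cong[where f = "(*) _"], intro nn_integral_cong)
  fix z
  have "shrink_ker x r h y ((1 - h) *\<^sub>R y + h *\<^sub>R z) = indicator (cball x r) z / (h ^ CARD('n) * ?v)"
   using h by (simp add: shrink_ker_def)
  moreover have "(1 - h) *\<^sub>R y + h *\<^sub>R z = y + h *\<^sub>R (z - y)" by (simp add: algebra_simps)
  ultimately show "ennreal (shrink_ker x r h y ((1 - h) *\<^sub>R y + h *\<^sub>R z)) * F ((1 - h) *\<^sub>R y + h *\<^sub>R z)
    = ennreal (1 / (h ^ CARD('n) * ?v)) * (F (y + h *\<^sub>R (z - y)) * indicator (cball x r) z)" by (simp add: indicator_def)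
 qed
 also have "... = ennreal (h ^ CARD('n)) * (ennreal (1 / (h ^ CARD('n) * ?v)) * (\<integral>\<^sup>+z\<in>cball x r. F (y + h *\<^sub>R (z - y)) \<partial>lborel))"
  by (subst nn_integral_cmult) auto
 also have "... = ennreal (h ^ CARD('n) * (1 / (h ^ CARD('n) * ?v))) * (\<integral>\<^sup>+z\<in>cball x r. F (y + h *\<^sub>R (z - y)) \<partial>lborel)"
  using h v by (subst ennreal_mult) (auto simp: mult.assoc)
 also have "h ^ CARD('n) * (1 / (h ^ CARD('n) * ?v)) = 1 / ?v" using h by simp
 finally show ?thesis .
qed

lemma shrink_ker_total:
 fixes x :: "real^'n"
 assumes "0 < h" "r > 0"
 shows "(\<integral>\<^sup>+w. ennreal (shrink_ker x r h y w) \<partial>lborel) = 1"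
proof -
 have "(\<integral>\<^sup>+w. ennreal (shrink_ker x r h y w) \<partial>lborel) = (\<integral>\<^sup>+w. ennreal (shrink_ker x r h y w) * 1 \<partial>lborel)" by simp
 also have "... = ennreal (1 / measure lborel (cball x r)) * emeasure lborel (cball x r)"
  by (subst nn_integral_shrink_ker[OF _ assms]) auto
 also have "... = ennreal (1 / measure lborel (cball x r) * measure lborel (cball x r))"
  unfolding emeasure_cball_measure using measure_cball_pos[OF assms(2), of x] by (intro ennreal_mult[symmetric]) auto
 also have "1 / measure lborel (cball x r) * measure lborel (cball x r) = 1" using measure_cball_pos[OF assms(2), of x] by simp
 finally show ?thesis by simp
qed

lemma shrink_deviation_le:
 fixes u :: "real^'n \<Rightarrow> real"
 assumes h: "0 < h" and r: "r > 0" and u: "u \<in> borel_measurable borel"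
  and int: "integrable lborel (\<lambda>w. shrink_ker x r h y w * u w)"
 shows "ennreal ((u y - shrink_avg x r h u y)^2) <= (\<integral>\<^sup>+w. ennreal (shrink_ker x r h y w) * ennreal ((u y - u w)^2) \<partial>lborel)"
proof -
 let ?k = "shrink_ker x r h y"
 have k0: "?k w >= 0" for w by (rule shrink_ker_nonneg[OF h])
 have intk: "integrable lborel ?k" using shrink_ker_total[OF h r, of x y] k0 by (intro integrableI_nonneg) auto
 have one: "(LINT w|lborel. ?k w) = 1" using shrink_ker_total[OF h r, of x y] k0 nn_integral_eq_integral[OF intk] by simp
 have "u y - shrink_avg x r h u y = (LINT w|lborel. ?k w * (u y - u w))"
  using intk int one by (simp add: shrink_avg_def right_diff_distrib)
 then have "ennreal \<bar>u y - shrink_avg x r h u y\<bar> <= (\<integral>\<^sup>+w. ennreal \<bar>?k w * (u y - u w)\<bar> \<partial>lborel)"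
  using integral_norm_bound_ennreal[of lborel "\<lambda>w. ?k w * (u y - u w)"] intk int by (simp add: right_diff_distrib)
 also have "... = (\<integral>\<^sup>+w. ennreal (sqrt (?k w)) * ennreal (sqrt (?k w) * \<bar>u y - u w\<bar>) \<partial>lborel)"
  using k0 by (intro nn_integral_cong) (simp add: abs_mult flip: ennreal_mult mult.assoc)
 finally have "ennreal \<bar>u y - shrink_avg x r h u y\<bar> ^ 2
   <= (\<integral>\<^sup>+w. ennreal (sqrt (?k w)) * ennreal (sqrt (?k w) * \<bar>u y - u w\<bar>) \<partial>lborel) ^ 2"
  by (intro power_mono) auto
 also have "... <= (\<integral>\<^sup>+w. ennreal (sqrt (?k w)) ^ 2 \<partial>lborel) * (\<integral>\<^sup>+w. ennreal (sqrt (?k w) * \<bar>u y - u w\<bar>) ^ 2 \<partial>lborel)"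
  using u by (intro Cauchy_Schwarz_nn_integral) auto
 also have "(\<integral>\<^sup>+w. ennreal (sqrt (?k w)) ^ 2 \<partial>lborel) = 1"
  using k0 shrink_ker_total[OF h r, of x y] by (simp add: ennreal_power)
 also have "(\<integral>\<^sup>+w. ennreal (sqrt (?k w) * \<bar>u y - u w\<bar>) ^ 2 \<partial>lborel) = (\<integral>\<^sup>+w. ennreal (?k w) * ennreal ((u y - u w)^2) \<partial>lborel)"
  using k0 by (intro nn_integral_cong) (simp add: ennreal_power power_mult_distrib ennreal_mult)
 finally show ?thesis by (simp add: ennreal_power)
qed

lemma nn_integral_fubini_lborel:
 fixes f :: "'b::euclidean_space \<Rightarrow> 'c::euclidean_space \<Rightarrow> ennreal"
 assumes "(\<lambda>(y, z). f y z) \<in> borel_measurable (lborel \<Otimes>\<^sub>M lborel)"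
 shows "(\<integral>\<^sup>+y. (\<integral>\<^sup>+z. f y z \<partial>lborel) \<partial>lborel) = (\<integral>\<^sup>+z. (\<integral>\<^sup>+y. f y z \<partial>lborel) \<partial>lborel)"
 using lborel_pair.Fubini[OF assms] by simp

text \<open>The map \<open>y \<mapsto> (1 - a) *\<^sub>R y + a *\<^sub>R z\<close> has the Jacobian determinant
\<open>(1 - a) ^ CARD('n) \<ge> 2 powr (- CARD('n))\<close>.\<close>

lemma nn_integral_contraction_le:
 fixes G :: "real^'n \<Rightarrow> ennreal"
 assumes G: "G \<in> borel_measurable borel" and a: "0 <= a" "a <= 1 / 2"
 shows "(\<integral>\<^sup>+y. G (y + a *\<^sub>R (z - y)) \<partial>lborel) <= ennreal (2 ^ CARD('n)) * (\<integral>\<^sup>+w. G w \<partial>lborel)"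
proof -
 let ?J = "\<integral>\<^sup>+y. G (y + a *\<^sub>R (z - y)) \<partial>lborel" and ?I = "\<integral>\<^sup>+w. G w \<partial>lborel"
 have "?I = ennreal ((1 - a) ^ CARD('n)) * (\<integral>\<^sup>+y. G (a *\<^sub>R z + (1 - a) *\<^sub>R y) \<partial>lborel)"
  using nn_integral_lborel_affine[OF G, of "1 - a" "a *\<^sub>R z"] a by simp
 moreover have "a *\<^sub>R z + (1 - a) *\<^sub>R y = y + a *\<^sub>R (z - y)" for y by (simp add: algebra_simps)
 ultimately have "ennreal (2 ^ CARD('n)) * ?I
   = ennreal (2 ^ CARD('n) * (1 - a) ^ CARD('n)) * ?J" using a by (simp add: ennreal_mult mult.assoc)
 moreover have "1 <= 2 ^ CARD('n) * (1 - a) ^ CARD('n)"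
  unfolding power_mult_distrib[symmetric] using a by (intro one_le_power) simp
 then have "ennreal 1 <= ennreal (2 ^ CARD('n) * (1 - a) ^ CARD('n))" by (rule ennreal_leI)
 then have "1 * ?J
   <= ennreal (2 ^ CARD('n) * (1 - a) ^ CARD('n)) * ?J" by (intro mult_right_mono) auto
 ultimately show ?thesis by simp
qed

lemma shrink_ker_integrable:
 assumes h: "0 < h" "h <= 1" and y: "y \<in> cball x r" and K: "cball x r \<subseteq> U"
  and u: "continuous_on U u" "u \<in> borel_measurable borel"
 shows "integrable lborel (\<lambda>w. shrink_ker x r h y w * u w)"
proof -
 let ?c = "1 / (h ^ CARD('a) * measure lborel (cball x r))" and ?k = "shrink_ker x r h y"
 have "integrable lborel (\<lambda>w. indicator (cball x r) w *\<^sub>R u w)"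
  using continuous_on_subset[OF u(1) K] by (intro borel_integrable_compact compact_cball)
 then have "integrable lborel (\<lambda>w. ?c * (indicator (cball x r) w *\<^sub>R u w))" by (rule integrable_mult_right)
 then show ?thesis
 proof (rule Bochner_Integration.integrable_bound)
  show "AE w in lborel. norm (?k w * u w)
    <= norm (?c * (indicator (cball x r) w *\<^sub>R u w))"
  proof (rule AE_I2)
   fix w
   show "norm (?k w * u w)
     <= norm (?c * (indicator (cball x r) w *\<^sub>R u w))"
   proof (cases "w \<in> cball x r")
    case True
    have "\<bar>?k w\<bar> * \<bar>u w\<bar> <= \<bar>?c\<bar> * \<bar>u w\<bar>"
     using shrink_ker_le[OF h(1), of x r y w] shrink_ker_nonneg[OF h(1), of x r y w]
     by (intro mult_right_mono) (simp_all only: abs_of_nonneg order_trans[OF _ abs_ge_self] abs_ge_zero)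
    then show ?thesis using True by (simp add: abs_mult)
   next
    case False
    then show ?thesis using shrink_ker_support[OF y h] by simp
   qed
  qed
 qed (use u(2) in simp)
qed

text \<open>A local Poincare inequality. The difference \<open>u y - u (y + h *\<^sub>R (z - y))\<close> is the integral
of the gradient along a segment of length at most \<open>2 * r * h\<close>; square it, integrate over \<open>y\<close> for
fixed \<open>z\<close> and fixed position on the segment, and apply \<open>nn_integral_contraction_le\<close>.\<close>

lemma shrink_avg_error:
 fixes u :: "real^'n \<Rightarrow> real"
 assumes h: "0 < h" "h <= 1 / 2" and r: "r > 0" and U: "open U" "cball x r \<subseteq> U"
  and u: "Ck_on (Suc 0) U u" "u \<in> borel_measurable borel"
 shows "(\<integral>\<^sup>+y\<in>cball x r. ennreal ((u y - shrink_avg x r h u y)^2) \<partial>lborel)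
  <= ennreal (2 ^ CARD('n) * (2 * r)^2 * h^2) * (\<integral>\<^sup>+y\<in>cball x r. ennreal ((norm (grad u y))^2) \<partial>lborel)"
proof -
 let ?K = "cball x r" and ?v = "measure lborel (cball x r)"
 have v: "?v > 0" by (rule measure_cball_pos[OF r])
 have [measurable]: "?K \<in> sets borel" by simp
 have gc: "continuous_on U (grad u)"
 proof -
  have "continuous_on U (\<lambda>z. partial i u z)" for i using u(1) Ck_on_partial[of 0 U u i] by simp
  then show ?thesis unfolding grad_def[abs_def] by (rule continuous_on_vec_lambda)
 qed
 define G where "G w = ennreal ((norm (grad u w))^2) * indicator ?K w" for w
 have G[measurable]: "G \<in> borel_measurable borel"
 proof -
  have "(\<lambda>w. indicator ?K w *\<^sub>R (norm (grad u w))^2) \<in> borel_measurable borel"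
   by (rule borel_measurable_continuous_on_indicator)
    (auto intro!: continuous_intros continuous_on_subset[OF gc U(2)])
  then have "(\<lambda>w. ennreal (indicator ?K w *\<^sub>R (norm (grad u w))^2)) \<in> borel_measurable borel" by simp
  moreover have "(\<lambda>w. ennreal (indicator ?K w *\<^sub>R (norm (grad u w))^2)) = G" by (auto simp: G_def indicator_def)
  ultimately show ?thesis by (simp only:)
 qed
 let ?I = "\<integral>\<^sup>+w. G w \<partial>lborel"
 define C where "C = (2 * r)^2 * h^2"
 have C0: "C >= 0" by (simp add: C_def)
 have step: "ennreal ((u y - u (y + h *\<^sub>R (z - y)))^2) <= ennreal C * (\<integral>\<^sup>+t\<in>{0..1}. G (y + (t * h) *\<^sub>R (z - y)) \<partial>lborel)"
  if y: "y \<in> ?K" and z: "z \<in> ?K" for y z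
 proof -
  let ?p = "\<lambda>t. y + (t * h) *\<^sub>R (z - y)"
  define \<phi> where "\<phi> t = u (?p t)" for t
  define \<phi>' where "\<phi>' t = grad u (?p t) \<bullet> (h *\<^sub>R (z - y))" for t
  have inK: "?p t \<in> ?K" if "0 <= t" "t <= 1" for t
  proof -
   have "(1 - t * h) *\<^sub>R y + (t * h) *\<^sub>R z \<in> ?K"
    using that h mult_mono[of t 1 h 1] by (intro convexD[OF convex_cball y z]) auto
   then show ?thesis by (simp add: algebra_simps)
  qed
  have D: "(\<phi> has_real_derivative \<phi>' t) (at t)" if t: "0 <= t" "t <= 1" for t
  proof -
   have "(?p has_derivative (\<lambda>s. (s * h) *\<^sub>R (z - y))) (at t)" by (auto intro!: derivative_eq_intros)
   moreover have "(u has_derivative (\<lambda>v. grad u (?p t) \<bullet> v)) (at (?p t))"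
    using u(1) inK[OF t] U(2) by (intro has_derivative_grad) auto
   ultimately have "(\<phi> has_derivative (\<lambda>s. grad u (?p t) \<bullet> ((s * h) *\<^sub>R (z - y)))) (at t)"
    unfolding \<phi>_def by (rule has_derivative_compose)
   moreover have "(\<lambda>s. grad u (?p t) \<bullet> ((s * h) *\<^sub>R (z - y))) = (*) (\<phi>' t)"
    by (auto simp: \<phi>'_def)
   ultimately show ?thesis by (simp add: has_field_derivative_def)
  qed
  have c\<phi>: "continuous_on {0..1} \<phi>'"
   unfolding \<phi>'_def
  proof (intro continuous_on_inner continuous_on_const)
   show "continuous_on {0..1} (\<lambda>t. grad u (?p t))"
    by (rule continuous_on_compose2[OF gc]) (use inK U(2) in \<open>auto intro!: continuous_intros\<close>)
  qed
  have "ennreal ((u y - u (y + h *\<^sub>R (z - y)))^2) = ennreal ((\<phi> 1 - \<phi> 0)^2)"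
   by (simp add: \<phi>_def power2_commute)
  also have "... <= (\<integral>\<^sup>+t\<in>{0..1}. ennreal ((\<phi>' t)^2) \<partial>lborel)"
   by (rule path_increment_square_le[OF D c\<phi>])
  also have "... <= (\<integral>\<^sup>+t. ennreal C * (G (?p t) * indicator {0..1} t) \<partial>lborel)"
  proof (intro nn_integral_mono)
   fix t :: real
   show "ennreal ((\<phi>' t)^2) * indicator {0..1} t <= ennreal C * (G (?p t) * indicator {0..1} t)"
   proof (cases "t \<in> {0..1}")
    case True
    have zy: "norm (z - y) <= 2 * r"
     using y z norm_triangle_ineq4[of "z - x" "y - x"] by (simp add: dist_norm norm_minus_commute)
    have "\<bar>\<phi>' t\<bar> <= norm (grad u (?p t)) * norm (h *\<^sub>R (z - y))"
     unfolding \<phi>'_def by (rule Cauchy_Schwarz_ineq2)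
    also have "... <= norm (grad u (?p t)) * (h * (2 * r))" using h zy by (intro mult_left_mono) auto
    finally have "\<bar>\<phi>' t\<bar>^2 <= (norm (grad u (?p t)) * (h * (2 * r)))^2" by (intro power_mono) auto
    then have "(\<phi>' t)^2 <= C * (norm (grad u (?p t)))^2" by (simp add: C_def power_mult_distrib mult_ac)
    then have "ennreal ((\<phi>' t)^2) <= ennreal C * ennreal ((norm (grad u (?p t)))^2)"
     using C0 by (simp add: ennreal_leI flip: ennreal_mult)
    then show ?thesis using True inK[of t] by (simp add: G_def)
   qed simp
  qed
  also have "... = ennreal C * (\<integral>\<^sup>+t\<in>{0..1}. G (?p t) \<partial>lborel)"
   by (rule nn_integral_cmult) measurable
  finally show ?thesis .
 qed
 define H where "H y z = (\<integral>\<^sup>+t\<in>{0..1}. G (y + (t * h) *\<^sub>R (z - y)) \<partial>lborel)" for y z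
 let ?H = "\<lambda>y. \<integral>\<^sup>+z\<in>?K. H y z \<partial>lborel"
 have Hm[measurable]: "(\<lambda>(y, z). H y z) \<in> borel_measurable (lborel \<Otimes>\<^sub>M lborel)"
  unfolding H_def by measurable
 have ptw: "ennreal ((u y - shrink_avg x r h u y)^2) <= ennreal (C / ?v) * (?H y)" if y: "y \<in> ?K" for y
 proof -
  have "ennreal ((u y - shrink_avg x r h u y)^2)
    <= (\<integral>\<^sup>+w. ennreal (shrink_ker x r h y w) * ennreal ((u y - u w)^2) \<partial>lborel)"
   using h by (intro shrink_deviation_le r u(2) shrink_ker_integrable[OF _ _ y U(2) Ck_on_imp_continuous[OF u(1)] u(2)]) auto
  also have "... = ennreal (1 / ?v) * (\<integral>\<^sup>+z\<in>?K. ennreal ((u y - u (y + h *\<^sub>R (z - y)))^2) \<partial>lborel)"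
   using u(2) h r by (intro nn_integral_shrink_ker) auto
  also have "... <= ennreal (1 / ?v) * (\<integral>\<^sup>+z. ennreal C * (H y z * indicator ?K z) \<partial>lborel)"
   using step[OF y] by (intro mult_left_mono nn_integral_mono) (auto simp: H_def indicator_def)
  also have "(\<integral>\<^sup>+z. ennreal C * (H y z * indicator ?K z) \<partial>lborel) = ennreal C * (?H y)"
   by (rule nn_integral_cmult) measurable
  also have "ennreal (1 / ?v) * (ennreal C * (?H y)) = ennreal (C / ?v) * (?H y)"
   using C0 v by (simp add: ennreal_mult[symmetric] mult.assoc[symmetric])
  finally show ?thesis .
 qed
 have Hint: "(\<integral>\<^sup>+y. H y z \<partial>lborel) <= ennreal (2 ^ CARD('n)) * ?I" for z
 proof -
  have "(\<integral>\<^sup>+y. H y z \<partial>lborel) = (\<integral>\<^sup>+t. (\<integral>\<^sup>+y. G (y + (t * h) *\<^sub>R (z - y)) * indicator {0..1} t \<partial>lborel) \<partial>lborel)"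
   unfolding H_def by (rule nn_integral_fubini_lborel[of "\<lambda>y t. G (y + (t * h) *\<^sub>R (z - y)) * indicator {0..1} t"]) measurable
  also have "... <= (\<integral>\<^sup>+(t::real). ennreal (2 ^ CARD('n)) * ?I * indicator {0..1} t \<partial>lborel)"
  proof (intro nn_integral_mono)
   fix t :: real
   show "(\<integral>\<^sup>+y. G (y + (t * h) *\<^sub>R (z - y)) * indicator {0..1} t \<partial>lborel)
     <= ennreal (2 ^ CARD('n)) * ?I * indicator {0..1} t"
    using nn_integral_contraction_le[OF G, of "t * h" z] h mult_mono[of t 1 h "1/2"] by (cases "t \<in> {0..1}") auto
  qed
  also have "... = ennreal (2 ^ CARD('n)) * ?I" by (subst nn_integral_cmult) auto
  finally show ?thesis .
 qed
 have "(\<integral>\<^sup>+y\<in>?K. ennreal ((u y - shrink_avg x r h u y)^2) \<partial>lborel)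
   <= (\<integral>\<^sup>+y. ennreal (C / ?v) * (?H y) \<partial>lborel)"
  using ptw by (intro nn_integral_mono) (auto simp: indicator_def)
 also have "... = ennreal (C / ?v) * (\<integral>\<^sup>+y. (?H y) \<partial>lborel)" by (rule nn_integral_cmult) measurable
 also have "(\<integral>\<^sup>+y. (?H y) \<partial>lborel) = (\<integral>\<^sup>+z. (\<integral>\<^sup>+y. H y z * indicator ?K z \<partial>lborel) \<partial>lborel)"
  by (rule nn_integral_fubini_lborel[of "\<lambda>y z. H y z * indicator ?K z"]) measurable
 also have "... <= (\<integral>\<^sup>+z. ennreal (2 ^ CARD('n)) * ?I * indicator ?K z \<partial>lborel)"
  using Hint by (intro nn_integral_mono) (auto simp: indicator_def)
 also have "... = ennreal (2 ^ CARD('n)) * ?I * ennreal ?v" by (subst nn_integral_cmult) (auto simp: emeasure_cball_measure)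
 also have "ennreal (C / ?v) * (ennreal (2 ^ CARD('n)) * ?I * ennreal ?v)
   = (ennreal (C / ?v) * ennreal (2 ^ CARD('n)) * ennreal ?v) * ?I" by (simp add: mult_ac)
 also have "ennreal (C / ?v) * ennreal (2 ^ CARD('n)) * ennreal ?v = ennreal (C / ?v * 2 ^ CARD('n) * ?v)"
 proof -
  have "0 <= C / ?v" "0 <= C / ?v * 2 ^ CARD('n)" "(0::real) <= 2 ^ CARD('n)" "0 <= ?v" using C0 v by auto
  then show ?thesis by (simp only: ennreal_mult)
 qed
 also have "C / ?v * 2 ^ CARD('n) * ?v = 2 ^ CARD('n) * (2 * r)^2 * h^2" using v by (simp add: C_def)
 finally show ?thesis by (simp add: G_def mult_left_mono)
qed

section \<open>The Nash inequality and the count of low-energy functions\<close>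

context riemannian_probability
begin

abbreviation pull :: "('a, 'n) chart \<Rightarrow> ('a \<Rightarrow> real) \<Rightarrow> real^'n \<Rightarrow> real" where
 "pull c u \<equiv> \<lambda>y. u (chart_inv_ext c y)"

lemma pull_measurable: "c \<in> A ==> u \<in> borel_measurable \<nu> ==> pull c u \<in> borel_measurable borel"
 by (rule measurable_compose[OF chart_inv_ext_measurable_nu])

lemma pull_C1:
 assumes "C1_function u" "c \<in> A"
 shows "Ck_on (Suc 0) (chart_image c) (pull c u)"
 using C1D[OF assms] Ck_on_cong[OF chart_image_open[OF assms(2)], of "pull c u" "\<lambda>y. u (chart_inv c y)" "Suc 0"]
 by (simp add: chart_inv_ext_def del: Ck_on.simps)

lemma pull_grad:
 assumes "C1_function u" "c \<in> A" "y \<in> chart_image c"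
 shows "grad (pull c u) y = grad (u \<circ> chart_inv c) y" by (rule grad_cong[OF chart_image_open[OF assms(2)] assms(3)])
  (use C1_differentiable[OF assms] in \<open>auto simp: chart_inv_ext_def\<close>)

lemma dens_bounds:
 assumes "good_ball (c, x, r)"
 shows "\<exists>l>0. \<exists>u>0. \<forall>y\<in>cball x r. l <= dens c y \<and> dens c y <= u"
proof -
 obtain l u where "l > 0" "u > 0" "\<forall>y\<in>cball x r. l <= sqrt_det c y \<and> sqrt_det c y <= u"
  using sqrt_det_bounds[OF assms] by blast
 then show ?thesis using \<kappa>_pos by (intro exI[of _ "\<kappa> * l"] conjI exI[of _ "\<kappa> * u"]) (auto simp: dens_def)
qed

text \<open>The local Poincare inequality on the manifold: on a good ball the density and the metric are comparable to their Euclidean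
counterparts.\<close>

lemma patch_energy_estimate:
 assumes gb: "good_ball (c, x, r)"
 shows "\<exists>C>0. \<forall>u h. C1_function u --> 0 < h --> h <= 1 / 2 -->
  (\<integral>\<^sup>+p\<in>patch (c, x, r). ennreal ((u p)^2) \<partial>\<nu>)
   <= ennreal (C * h^2) * (\<integral>\<^sup>+p. ennreal (gamma u u p) \<partial>\<nu>)
    + ennreal C * (\<integral>\<^sup>+y\<in>cball x r. ennreal ((shrink_avg x r h (pull c u) y)^2) \<partial>lborel)"
proof -
 note gbD = good_ballD[OF gb]
 note c = gbD(1)
 let ?K = "cball x r"
 have [measurable]: "?K \<in> sets borel" by simp
 have Pm: "patch (c, x, r) \<in> sets \<nu>" using patch_sets[OF gb] sets_nu_vol by simp
 obtain l U where lU: "l > 0" "U > 0" "\<And>y. y \<in> ?K ==> l <= dens c y \<and> dens c y <= U"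
  using dens_bounds[OF gb] by blast
 obtain E where E: "E > 0" "\<And>y v. y \<in> ?K ==> (norm v)^2 <= E * (v \<bullet> (matrix_inv (g c y) *v v))"
  using gamma_elliptic[OF gb] by blast
 define B where "B = 2 ^ CARD('n) * (2 * r)^2"
 have B0: "B >= 0" by (simp add: B_def)
 define C where "C = 2 * U + 2 * U * B * (E / l)"
 have C0: "C > 0" using lU E B0 by (simp add: C_def add_pos_nonneg)
 have main: "(\<integral>\<^sup>+p\<in>patch (c, x, r). ennreal ((u p)^2) \<partial>\<nu>)
   <= ennreal (C * h^2) * (\<integral>\<^sup>+p. ennreal (gamma u u p) \<partial>\<nu>)
    + ennreal C * (\<integral>\<^sup>+y\<in>?K. ennreal ((shrink_avg x r h (pull c u) y)^2) \<partial>lborel)"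
  if u: "C1_function u" and h: "0 < h" "h <= 1 / 2" for u h
 proof -
  have um[measurable]: "u \<in> borel_measurable \<nu>" by (intro continuous_measurable C1_continuous u)
  have pm[measurable]: "pull c u \<in> borel_measurable borel" by (rule pull_measurable[OF c um])
  have gm[measurable]: "gamma u u \<in> borel_measurable \<nu>" by (intro continuous_measurable gamma_continuous u)
  let ?avg = "\<lambda>y. shrink_avg x r h (pull c u) y"
  let ?I1 = "\<integral>\<^sup>+y\<in>?K. ennreal ((pull c u y - ?avg y)^2) \<partial>lborel"
  let ?I2 = "\<integral>\<^sup>+y\<in>?K. ennreal ((?avg y)^2) \<partial>lborel"
  let ?G = "\<integral>\<^sup>+p. ennreal (gamma u u p) \<partial>\<nu>"
  have avgm[measurable]: "?avg \<in> borel_measurable borel"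
   unfolding shrink_avg_def using pm
   by (intro lborel.borel_measurable_lebesgue_integral) (simp add: measurable_split_conv, measurable)
  have "(\<integral>\<^sup>+p\<in>patch (c, x, r). ennreal ((u p)^2) \<partial>\<nu>)
    = (\<integral>\<^sup>+p\<in>chart_dom c. (ennreal ((u p)^2) * indicator (patch (c, x, r)) p) \<partial>\<nu>)"
   using patch_subset_dom[OF gb] by (intro nn_integral_cong) (auto simp: indicator_def)
  also have "... = (\<integral>\<^sup>+y. (ennreal ((pull c u y)^2) * indicator (patch (c, x, r)) (chart_inv_ext c y)) * ennreal (dens c y) \<partial>lborel)"
   by (intro nn_integral_chart[OF c] borel_measurable_times_ennreal borel_measurable_indicator Pm) simp
  also have "... <= (\<integral>\<^sup>+y. ennreal U * (2 * (ennreal ((pull c u y - ?avg y)^2) * indicator ?K y) + 2 * (ennreal ((?avg y)^2) * indicator ?K y)) \<partial>lborel)"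
  proof (intro nn_integral_mono)
   fix y
   show "(ennreal ((pull c u y)^2) * indicator (patch (c, x, r)) (chart_inv_ext c y)) * ennreal (dens c y)
     <= ennreal U * (2 * (ennreal ((pull c u y - ?avg y)^2) * indicator ?K y) + 2 * (ennreal ((?avg y)^2) * indicator ?K y))"
   proof (cases "y \<in> chart_image c \<and> y \<in> ball x r")
    case True
    then have K: "y \<in> ?K" and P: "chart_inv_ext c y \<in> patch (c, x, r)" using inv_ext_in_patch[OF gb] by auto
    have "(pull c u y)^2 <= 2 * (pull c u y - ?avg y)^2 + 2 * (?avg y)^2"
     using zero_le_power2[of "pull c u y - 2 * ?avg y"] by (simp add: power2_eq_square algebra_simps)
    then have "(pull c u y)^2 * dens c y <= (2 * (pull c u y - ?avg y)^2 + 2 * (?avg y)^2) * U"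
     using lU(3)[OF K] dens_nonneg[OF c] by (intro mult_mono) auto
    then have "ennreal ((pull c u y)^2 * dens c y) <= ennreal ((2 * (pull c u y - ?avg y)^2 + 2 * (?avg y)^2) * U)"
     by (rule ennreal_leI)
    also have "... = ennreal U * (2 * ennreal ((pull c u y - ?avg y)^2) + 2 * ennreal ((?avg y)^2))"
     using lU(2) by (simp add: ennreal_mult mult.commute)
    finally show ?thesis using K P dens_nonneg[OF c] by (simp add: ennreal_mult)
   next
    case False
    then have "chart_inv_ext c y \<notin> patch (c, x, r) \<or> dens c y = 0"
     using inv_ext_in_patch[OF gb, of y] by (auto simp: dens_def sqrt_det_def)
    then show ?thesis by auto
   qed
  qed
  also have "... = ennreal U * (2 * ?I1 + 2 * ?I2)" by (simp add: nn_integral_cmult nn_integral_add)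
  also have "?I1 <= ennreal (B * h^2) * (\<integral>\<^sup>+y\<in>?K. ennreal ((norm (grad (pull c u) y))^2) \<partial>lborel)"
   unfolding B_def by (rule shrink_avg_error[OF h gbD(2) chart_image_open[OF c] gbD(3) pull_C1[OF u c] pm])
  also have "(\<integral>\<^sup>+y\<in>?K. ennreal ((norm (grad (pull c u) y))^2) \<partial>lborel)
    <= (\<integral>\<^sup>+y. ennreal (E / l) * (ennreal (gamma u u (chart_inv_ext c y)) * ennreal (dens c y)) \<partial>lborel)"
  proof (intro nn_integral_mono)
   fix y
   show "ennreal ((norm (grad (pull c u) y))^2) * indicator ?K y
     <= ennreal (E / l) * (ennreal (gamma u u (chart_inv_ext c y)) * ennreal (dens c y))"
   proof (cases "y \<in> ?K")
    case True
    then have im: "y \<in> chart_image c" using gbD(3) by blast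
    then have ext: "chart_inv_ext c y = chart_inv c y" by (simp add: chart_inv_ext_def)
    have gam: "gamma u u (chart_inv_ext c y) = grad (pull c u) y \<bullet> (matrix_inv (g c y) *v grad (pull c u) y)"
     unfolding ext gamma_chart_inv[OF c im u u] chart_gamma_def pull_grad[OF u c im] ..
    have g0: "gamma u u (chart_inv_ext c y) >= 0" using gamma_nonneg[OF inv_in_M[OF c im] u] ext by simp
    have "(norm (grad (pull c u) y))^2 <= E * gamma u u (chart_inv_ext c y)" unfolding gam by (rule E(2)[OF True])
    also have "... <= E * (gamma u u (chart_inv_ext c y) * (dens c y / l))"
    proof (rule mult_left_mono)
     have "1 <= dens c y / l" using lU(1) lU(3)[OF True] by simp
     from mult_left_mono[OF this g0] show "gamma u u (chart_inv_ext c y) <= gamma u u (chart_inv_ext c y) * (dens c y / l)" by simp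
    qed (use E(1) in simp)
    finally have "ennreal ((norm (grad (pull c u) y))^2) <= ennreal (E / l * (gamma u u (chart_inv_ext c y) * dens c y))"
     by (intro ennreal_leI) (simp add: field_simps)
    also have "... = ennreal (E / l) * (ennreal (gamma u u (chart_inv_ext c y)) * ennreal (dens c y))"
    proof -
     have "0 <= E / l" "0 <= gamma u u (chart_inv_ext c y) * dens c y" using E(1) lU(1) g0 dens_nonneg[OF c] by auto
     then show ?thesis using g0 dens_nonneg[OF c] by (simp only: ennreal_mult)
    qed
    finally show ?thesis using True by simp
   qed simp
  qed
  also have "... = ennreal (E / l) * (\<integral>\<^sup>+y. ennreal (gamma u u (chart_inv_ext c y)) * ennreal (dens c y) \<partial>lborel)"
   using dens_measurable[OF c] pull_measurable[OF c gm] by (intro nn_integral_cmult borel_measurable_times_ennreal) simp_all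
  also have "(\<integral>\<^sup>+y. ennreal (gamma u u (chart_inv_ext c y)) * ennreal (dens c y) \<partial>lborel)
    = (\<integral>\<^sup>+p\<in>chart_dom c. ennreal (gamma u u p) \<partial>\<nu>)"
   by (rule nn_integral_chart[OF c, symmetric]) measurable
  also have "... <= ?G" by (intro nn_integral_mono) (auto simp: indicator_def)
  finally have "(\<integral>\<^sup>+p\<in>patch (c, x, r). ennreal ((u p)^2) \<partial>\<nu>)
    <= ennreal U * (2 * (ennreal (B * h^2) * (ennreal (E / l) * ?G)) + 2 * ?I2)" by (simp add: mult_left_mono add_mono)
  also have "... = ennreal (2 * U * B * (E / l) * h^2) * ?G + ennreal (2 * U) * ?I2"
  proof -
   have "ennreal (2 * U * B * (E / l) * h^2) = ennreal U * (2 * (ennreal (B * h^2) * ennreal (E / l)))"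
    using lU E B0 by (simp add: ennreal_mult[symmetric] ennreal_numeral[symmetric] mult_ac del: ennreal_numeral)
   moreover have "ennreal (2 * U) = ennreal U * 2" using lU by (simp add: ennreal_mult mult.commute)
   ultimately show ?thesis by (simp add: distrib_left mult_ac)
  qed
  also have "... <= ennreal (C * h^2) * ?G + ennreal C * ?I2"
   using lU E B0 by (intro add_mono mult_right_mono ennreal_leI) (auto simp: C_def)
  finally show ?thesis .
 qed
 show ?thesis using C0 main by blast
qed

lemma chart_map_measurable:
 assumes c: "c \<in> A"
 shows "(\<lambda>p. if p \<in> chart_dom c then chart_map c p else 0) \<in> measurable \<nu> borel"
proof -
 have "chart_map c \<in> measurable (restrict_space borel (chart_dom c)) borel"
  by (rule borel_measurable_continuous_on_restrict[OF chart_map_continuous[OF c]])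
 moreover have "sets (restrict_space \<nu> (chart_dom c)) = sets (restrict_space borel (chart_dom c))"
 proof -
  have "sets (restrict_space \<nu> (chart_dom c)) = sets (restrict_space (restrict_space borel M) (chart_dom c))"
   by (rule sets_restrict_space_cong[OF sets_nu])
  also have "... = sets (restrict_space borel (M \<inter> chart_dom c))" by (simp add: sets_restrict_restrict_space)
  also have "M \<inter> chart_dom c = chart_dom c" using dom_subset[OF c] by blast
  finally show ?thesis .
 qed
 ultimately have "chart_map c \<in> measurable (restrict_space \<nu> (chart_dom c)) borel" using measurable_cong_sets by blast
 then show ?thesis
  using sets.sets_into_space[OF dom_sets_nu[OF c]] dom_sets_nu[OF c]
  by (subst measurable_If_restrict_space_iff) (auto simp: Collect_conj_eq Int_absorb1)
qed

text \<open>Since the density of the volume is bounded below on the ball, averages are inner products with functions \<open>\<beta>\<close>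
whose supremum and squared norm are at most of order \<open>h powr (- CARD('n))\<close>.\<close>

lemma shrink_avg_representation:
 assumes gb: "good_ball (c, x, r)"
 shows "\<exists>C>0. \<forall>h y. 0 < h --> h <= 1 --> y \<in> cball x r -->
  (\<exists>\<beta>. L2 \<beta> \<and> (\<forall>p\<in>M. \<bar>\<beta> p\<bar> <= C / h ^ CARD('n)) \<and> (LINT p|\<nu>. (\<beta> p)^2) <= C / h ^ CARD('n) \<and>
   (\<forall>u. C1_function u --> shrink_avg x r h (pull c u) y = (LINT p|\<nu>. u p * \<beta> p)))"
proof -
 note gbD = good_ballD[OF gb]
 note c = gbD(1)
 obtain l U where lU: "l > 0" "\<And>y. y \<in> cball x r ==> l <= dens c y" using dens_bounds[OF gb] by blast
 let ?v = "measure lborel (cball x r)"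
 have v: "?v > 0" by (rule measure_cball_pos[OF gbD(2)])
 define C where "C = 1 / (?v * l)"
 have C0: "C > 0" using v lU by (simp add: C_def)
 have main: "\<exists>\<beta>. L2 \<beta> \<and> (\<forall>p\<in>M. \<bar>\<beta> p\<bar> <= C / h ^ CARD('n)) \<and> (LINT p|\<nu>. (\<beta> p)^2) <= C / h ^ CARD('n) \<and>
   (\<forall>u. C1_function u --> shrink_avg x r h (pull c u) y = (LINT p|\<nu>. u p * \<beta> p))"
  if h: "0 < h" "h <= 1" and y: "y \<in> cball x r" for h y
 proof -
  define k where "k = shrink_ker x r h y"
  define \<beta> where "\<beta> p = indicator (chart_dom c) p * (k (if p \<in> chart_dom c then chart_map c p else 0)
    / dens c (if p \<in> chart_dom c then chart_map c p else 0))" for p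
  have km: "(\<lambda>w. k w / dens c w) \<in> borel_measurable borel" unfolding k_def using dens_measurable[OF c] by measurable
  have bm: "\<beta> \<in> borel_measurable \<nu>"
   unfolding \<beta>_def by (intro borel_measurable_times measurable_compose[OF chart_map_measurable[OF c] km]
     borel_measurable_indicator dom_sets_nu[OF c])
  have k0: "k w >= 0" for w unfolding k_def by (rule shrink_ker_nonneg[OF h(1)])
  have kK: "k w = 0" if "w \<notin> cball x r" for w unfolding k_def by (rule shrink_ker_support[OF y h that])
  have kd: "k w / dens c w <= C / h ^ CARD('n)" for w
  proof (cases "w \<in> cball x r")
   case True
   have "k w / dens c w <= (1 / (h ^ CARD('n) * ?v)) / l"
    using shrink_ker_le[OF h(1), of x r y w] k0[of w] lU(1) lU(2)[OF True] v h unfolding k_def by (intro frac_le) auto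
   then show ?thesis by (simp add: C_def mult_ac)
  next
   case False
   then show ?thesis using kK C0 h by simp
  qed
  have kd0: "0 <= k w / dens c w" for w using k0 dens_nonneg[OF c] by simp
  have b0: "0 <= \<beta> p" for p using kd0 by (auto simp: \<beta>_def indicator_def)
  have bC: "\<beta> p <= C / h ^ CARD('n)" for p using kd C0 h by (auto simp: \<beta>_def indicator_def)
  have bsq: "L2 \<beta>" by (rule sq_bounded[OF nu.finite_measure_axioms bm, of "C / h ^ CARD('n)"])
    (use b0 bC in \<open>auto intro!: AE_I2\<close>)
  have ext: "dens c w * (a * \<beta> (chart_inv_ext c w)) = k w * a" for w a
  proof (cases "w \<in> chart_image c")
   case True
   have "dens c w \<noteq> 0 \<or> k w = 0" using lU(1) lU(2)[of w] kK[of w] by (cases "w \<in> cball x r") auto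
   then show ?thesis using True inv_in_dom[OF c True] map_inv[OF c True] by (auto simp: \<beta>_def chart_inv_ext_def)
  next
   case False
   then have "w \<notin> cball x r" using gbD(3) by blast
   then show ?thesis using False kK by (simp add: dens_def sqrt_det_def)
  qed
  have rep: "(LINT p|\<nu>. u p * \<beta> p) = (LINT w|lborel. k w * pull c u w)" if um: "u \<in> borel_measurable \<nu>" for u
  proof -
   have "(LINT p|\<nu>. u p * \<beta> p) = (LINT w|lborel. dens c w * (pull c u w * \<beta> (chart_inv_ext c w)))"
    using borel_measurable_times[OF um bm] by (intro integral_chart[OF c]) (simp_all add: \<beta>_def[of p for p])
   then show ?thesis by (simp add: ext)
  qed
  have "(LINT p|\<nu>. \<beta> p) = 1"
  proof -
   have "(LINT p|\<nu>. 1 * \<beta> p) = (LINT w|lborel. k w * 1)" using rep[of "\<lambda>_. 1"] by simp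
   also have "... = enn2real (\<integral>\<^sup>+w. ennreal (k w) \<partial>lborel)"
    using k0 by (subst integral_eq_nn_integral) (auto simp: k_def)
   also have "... = 1" using shrink_ker_total[OF h(1) gbD(2), of x y] by (simp add: k_def)
   finally show ?thesis by simp
  qed
  moreover have "(LINT p|\<nu>. (\<beta> p)^2) <= (LINT p|\<nu>. C / h ^ CARD('n) * \<beta> p)"
  proof (rule integral_mono)
   show "integrable \<nu> (\<lambda>p. C / h ^ CARD('n) * \<beta> p)"
    by (intro integrable_mult_right sq_integrable nu.finite_measure_axioms bsq)
   show "(\<beta> p)^2 <= C / h ^ CARD('n) * \<beta> p" for p unfolding power2_eq_square by (intro mult_right_mono b0 bC)
  qed (use bsq in \<open>simp add: square_integrable_def\<close>)
  ultimately have "(LINT p|\<nu>. (\<beta> p)^2) <= C / h ^ CARD('n)" by simp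
  moreover have "shrink_avg x r h (pull c u) y = (LINT p|\<nu>. u p * \<beta> p)" if "C1_function u" for u
   using rep[OF continuous_measurable[OF C1_continuous[OF that]]] by (simp add: shrink_avg_def k_def)
  ultimately show ?thesis using bsq b0 bC by (intro exI[of _ \<beta>]) auto
 qed
 show ?thesis using C0 main by blast
qed

definition energy :: "('a \<Rightarrow> real) \<Rightarrow> real" where
 "energy u = (LINT p|\<nu>. gamma u u p)"

lemma energy_nonneg: "C1_function u ==> energy u >= 0"
 unfolding energy_def by (intro Bochner_Integration.integral_nonneg) (simp add: gamma_nonneg)

lemma nn_energy: "C1_function u ==> (\<integral>\<^sup>+p. ennreal (gamma u u p) \<partial>\<nu>) = ennreal (energy u)"
 unfolding energy_def
 by (intro nn_integral_eq_integral continuous_integrable gamma_continuous) (auto intro!: AE_I2 gamma_nonneg)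

text \<open>An abstract bound \<open>Q\<close> for the summed squares of all averages at scale \<open>h\<close>. The two bounds on the weight
\<open>\<beta>\<close> are for two uses: the supremum gives the Nash inequality, the squared norm the eigenvalue count by Bessel's
inequality.\<close>

definition averages_le :: "real \<Rightarrow> real \<Rightarrow> 'j set \<Rightarrow> ('j \<Rightarrow> 'a \<Rightarrow> real) \<Rightarrow> real \<Rightarrow> bool" where
 "averages_le C h J w Q \<longleftrightarrow> 0 <= Q \<and> (\<forall>\<beta>. L2 \<beta> --> (\<forall>p\<in>M. \<bar>\<beta> p\<bar> <= C / h ^ CARD('n)) -->
   (LINT p|\<nu>. (\<beta> p)^2) <= C / h ^ CARD('n) --> (\<Sum>j\<in>J. (LINT p|\<nu>. w j p * \<beta> p)^2) <= Q)"

lemma averages_le_mono: "averages_le C' h J w Q ==> C <= C' ==> 0 < h ==> averages_le C h J w Q"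
 unfolding averages_le_def by (meson divide_right_mono less_imp_le order_trans zero_less_power)

lemma patch_mass:
 assumes gb: "good_ball (c, x, r)"
 shows "\<exists>C>0. \<forall>(J :: 'j set) w h Q. finite J --> (\<forall>j\<in>J. C1_function (w j)) --> 0 < h --> h <= 1 / 2 --> averages_le C h J w Q -->
  (\<Sum>j\<in>J. \<integral>\<^sup>+p\<in>patch (c, x, r). ennreal ((w j p)^2) \<partial>\<nu>) <= ennreal (C * (h^2 * (\<Sum>j\<in>J. energy (w j)) + Q))"
proof -
 let ?v = "measure lborel (cball x r)" and ?K = "cball x r"
 have v: "?v > 0" by (rule measure_cball_pos[OF good_ballD(2)[OF gb]])
 obtain C1 where C1: "C1 > 0" "\<And>u h. C1_function u ==> 0 < h ==> h <= 1 / 2 ==>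
  (\<integral>\<^sup>+p\<in>patch (c, x, r). ennreal ((u p)^2) \<partial>\<nu>)
   <= ennreal (C1 * h^2) * (\<integral>\<^sup>+p. ennreal (gamma u u p) \<partial>\<nu>)
    + ennreal C1 * (\<integral>\<^sup>+y\<in>?K. ennreal ((shrink_avg x r h (pull c u) y)^2) \<partial>lborel)"
  using patch_energy_estimate[OF gb] by blast
 obtain C2 where C2: "C2 > 0" "\<And>h y. 0 < h ==> h <= 1 ==> y \<in> ?K ==>
  (\<exists>\<beta>. L2 \<beta> \<and> (\<forall>p\<in>M. \<bar>\<beta> p\<bar> <= C2 / h ^ CARD('n)) \<and> (LINT p|\<nu>. (\<beta> p)^2) <= C2 / h ^ CARD('n) \<and>
   (\<forall>u. C1_function u --> shrink_avg x r h (pull c u) y = (LINT p|\<nu>. u p * \<beta> p)))"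
  using shrink_avg_representation[OF gb] by blast
 define C where "C = C1 + C1 * ?v + C2"
 have C: "C > 0" "C1 <= C" "C1 * ?v <= C" "C2 <= C" using C1(1) C2(1) v by (auto simp: C_def add_pos_pos)
 show ?thesis
 proof (intro exI[of _ C] conjI allI impI)
  fix J :: "'j set" and w h Q
  assume J: "finite J" and w': "\<forall>j\<in>J. C1_function (w j)" and h: "0 < h" "h <= 1 / 2" and "averages_le C h J w Q"
  then have Q: "averages_le C2 h J w Q" using averages_le_mono C(4) by blast
  then have Q0: "0 <= Q" by (simp add: averages_le_def)
  have w: "C1_function (w j)" if "j \<in> J" for j using w' that by blast
  define avg where "avg j y = shrink_avg x r h (pull c (w j)) y" for j y
  have avg: "(\<Sum>j\<in>J. (avg j y)^2) <= Q" if y: "y \<in> ?K" for y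
  proof -
   obtain \<beta> where b: "L2 \<beta>" "\<forall>p\<in>M. \<bar>\<beta> p\<bar> <= C2 / h ^ CARD('n)" "(LINT p|\<nu>. (\<beta> p)^2) <= C2 / h ^ CARD('n)"
     "\<And>u. C1_function u ==> shrink_avg x r h (pull c u) y = (LINT p|\<nu>. u p * \<beta> p)"
    using C2(2)[OF h(1) _ y] h by auto
   have "(\<Sum>j\<in>J. (avg j y)^2) = (\<Sum>j\<in>J. (LINT p|\<nu>. w j p * \<beta> p)^2)" by (simp add: avg_def b(4) w)
   then show ?thesis using Q b(1-3) unfolding averages_le_def by simp
  qed
  have avgm: "avg j \<in> borel_measurable borel" if "j \<in> J" for j
  proof -
   have [measurable]: "pull c (w j) \<in> borel_measurable borel"
    by (intro pull_measurable good_ballD(1)[OF gb] continuous_measurable C1_continuous w that)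
   show ?thesis unfolding avg_def shrink_avg_def
    by (intro lborel.borel_measurable_lebesgue_integral) (simp add: measurable_split_conv, measurable)
  qed
  have "(\<Sum>j\<in>J. \<integral>\<^sup>+y\<in>?K. ennreal ((avg j y)^2) \<partial>lborel)
    = (\<integral>\<^sup>+y. (\<Sum>j\<in>J. ennreal ((avg j y)^2) * indicator ?K y) \<partial>lborel)"
   using avgm by (intro nn_integral_sum[symmetric] borel_measurable_times_ennreal borel_measurable_indicator) auto
  also have "... <= (\<integral>\<^sup>+y. ennreal Q * indicator ?K y \<partial>lborel)"
   using avg by (intro nn_integral_mono) (auto simp: indicator_def sum_ennreal intro!: ennreal_leI)
  also have "... = ennreal (Q * ?v)" using v Q0 by (simp add: nn_integral_cmult_indicator emeasure_cball_measure ennreal_mult)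
  finally have I2: "(\<Sum>j\<in>J. \<integral>\<^sup>+y\<in>?K. ennreal ((avg j y)^2) \<partial>lborel) <= ennreal (Q * ?v)" .
  define S where "S = (\<Sum>j\<in>J. energy (w j))"
  have S0: "S >= 0" unfolding S_def by (intro sum_nonneg energy_nonneg w)
  have "(\<Sum>j\<in>J. \<integral>\<^sup>+p\<in>patch (c, x, r). ennreal ((w j p)^2) \<partial>\<nu>)
    <= (\<Sum>j\<in>J. ennreal (C1 * h^2) * ennreal (energy (w j)) + ennreal C1 * (\<integral>\<^sup>+y\<in>?K. ennreal ((avg j y)^2) \<partial>lborel))"
   using C1(2)[OF w h] by (intro sum_mono) (simp add: nn_energy[OF w] avg_def)
  also have "... = ennreal (C1 * h^2) * ennreal S + ennreal C1 * (\<Sum>j\<in>J. \<integral>\<^sup>+y\<in>?K. ennreal ((avg j y)^2) \<partial>lborel)"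
   using sum_ennreal[of J "\<lambda>j. energy (w j)"] energy_nonneg[OF w] by (simp add: S_def sum.distrib flip: sum_distrib_left)
  also have "... <= ennreal (C1 * h^2) * ennreal S + ennreal C1 * ennreal (Q * ?v)"
   by (intro add_left_mono mult_left_mono I2) simp
  also have "... = ennreal (C1 * (h^2 * S) + C1 * ?v * Q)"
   using C1(1) Q0 S0 v by (simp add: ennreal_plus[symmetric] ennreal_mult[symmetric] mult_ac del: ennreal_plus)
  also have "... <= ennreal (C * (h^2 * S) + C * Q)" using C Q0 S0 by (intro ennreal_leI add_mono mult_right_mono) auto
  finally show "(\<Sum>j\<in>J. \<integral>\<^sup>+p\<in>patch (c, x, r). ennreal ((w j p)^2) \<partial>\<nu>) <= ennreal (C * (h^2 * (\<Sum>j\<in>J. energy (w j)) + Q))"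
   by (simp add: S_def distrib_left)
 qed (rule C(1))
qed

lemma nn_integral_le_cover_sum:
 assumes f: "f \<in> borel_measurable \<nu>"
 shows "(\<integral>\<^sup>+p. f p \<partial>\<nu>) <= (\<Sum>b\<in>cover. \<integral>\<^sup>+p\<in>patch b. f p \<partial>\<nu>)"
proof -
 have Pm: "patch b \<in> sets \<nu>" if "b \<in> cover" for b using patch_sets[OF cover(2)[OF that]] sets_nu_vol by simp
 have "(\<integral>\<^sup>+p. f p \<partial>\<nu>) <= (\<integral>\<^sup>+p. (\<Sum>b\<in>cover. f p * indicator (patch b) p) \<partial>\<nu>)"
 proof (intro nn_integral_mono)
  fix p assume "p \<in> space \<nu>"
  then have "p \<in> (\<Union>b\<in>cover. patch b)" unfolding cover(3)[symmetric] by simp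
  then obtain b where b: "b \<in> cover" "p \<in> patch b" by blast
  have "f p = f p * indicator (patch b) p" using b by simp
  also have "... <= (\<Sum>b\<in>cover. f p * indicator (patch b) p)" using cover(1) b(1) by (intro member_le_sum) auto
  finally show "f p <= (\<Sum>b\<in>cover. f p * indicator (patch b) p)" .
 qed
 also have "... = (\<Sum>b\<in>cover. \<integral>\<^sup>+p\<in>patch b. f p \<partial>\<nu>)"
  using f Pm by (intro nn_integral_sum) auto
 finally show ?thesis .
qed

text \<open>On each patch of the finite cover the functions differ from their averages at scale \<open>h\<close> by at most
\<open>h\<^sup>2\<close> times the energy.\<close>

theorem mass_le_energy_plus_averages:
 "\<exists>C>0. \<forall>(J :: 'j set) w h Q. finite J --> (\<forall>j\<in>J. C1_function (w j)) --> 0 < h --> h <= 1 / 2 --> averages_le C h J w Q -->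
  (\<Sum>j\<in>J. LINT p|\<nu>. (w j p)^2) <= C * (h^2 * (\<Sum>j\<in>J. energy (w j)) + Q)"
proof -
 have "\<forall>b\<in>cover. \<exists>C>0. \<forall>(J :: 'j set) w h Q. finite J --> (\<forall>j\<in>J. C1_function (w j)) --> 0 < h --> h <= 1 / 2 --> averages_le C h J w Q -->
  (\<Sum>j\<in>J. \<integral>\<^sup>+p\<in>patch b. ennreal ((w j p)^2) \<partial>\<nu>) <= ennreal (C * (h^2 * (\<Sum>j\<in>J. energy (w j)) + Q))"
  (is "\<forall>b\<in>cover. \<exists>C>0. ?P b C")
 proof
  fix b assume "b \<in> cover"
  then have "good_ball (fst b, fst (snd b), snd (snd b))" using cover(2) by simp
  from patch_mass[where 'j = 'j, OF this] show "\<exists>C>0. ?P b C" by simp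
 qed
 from bchoice[OF this] obtain C where PC: "\<forall>b\<in>cover. C b > 0 \<and> ?P b (C b)" ..
 have C: "C b > 0" if "b \<in> cover" for b using PC that by blast
 define C' where "C' = (\<Sum>b\<in>cover. C b) + 1"
 have Cb: "C b <= C'" if "b \<in> cover" for b
  using member_le_sum[of b cover C] that C cover(1) unfolding C'_def by (simp add: less_imp_le add_increasing2)
 have C0: "(\<Sum>b\<in>cover. C b) >= 0" using C by (intro sum_nonneg) (auto intro: less_imp_le)
 show ?thesis
 proof (intro exI[of _ C'] conjI allI impI)
  show "C' > 0" using C0 by (simp add: C'_def)
  fix J :: "'j set" and w h Q
  assume J: "finite J" and w: "\<forall>j\<in>J. C1_function (w j)" and h: "0 < h" "h <= 1 / 2" and Q: "averages_le C' h J w Q"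
  have wC: "continuous_on M (w j)" if "j \<in> J" for j using w that C1_continuous by blast
  define P where "P = h^2 * (\<Sum>j\<in>J. energy (w j)) + Q"
  have P0: "P >= 0" unfolding P_def using Q w energy_nonneg by (intro add_nonneg_nonneg mult_nonneg_nonneg sum_nonneg) (auto simp: averages_le_def)
  have "ennreal (\<Sum>j\<in>J. LINT p|\<nu>. (w j p)^2) = (\<Sum>j\<in>J. ennreal (LINT p|\<nu>. (w j p)^2))" by (simp add: sum_ennreal)
  also have "... = (\<Sum>j\<in>J. \<integral>\<^sup>+p. ennreal ((w j p)^2) \<partial>\<nu>)"
   using continuous_sq[OF wC] by (intro sum.cong nn_integral_eq_integral[symmetric]) (auto simp: square_integrable_def)
  also have "... <= (\<Sum>j\<in>J. \<Sum>b\<in>cover. \<integral>\<^sup>+p\<in>patch b. ennreal ((w j p)^2) \<partial>\<nu>)"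
   using continuous_measurable[OF wC] by (intro sum_mono nn_integral_le_cover_sum) simp
  also have "... = (\<Sum>b\<in>cover. \<Sum>j\<in>J. \<integral>\<^sup>+p\<in>patch b. ennreal ((w j p)^2) \<partial>\<nu>)" by (rule sum.swap)
  also have "... <= (\<Sum>b\<in>cover. ennreal (C b * P))"
  proof (rule sum_mono)
   fix b assume b: "b \<in> cover"
   have "averages_le (C b) h J w Q" by (rule averages_le_mono[OF Q Cb[OF b] h(1)])
   then show "(\<Sum>j\<in>J. \<integral>\<^sup>+p\<in>patch b. ennreal ((w j p)^2) \<partial>\<nu>) <= ennreal (C b * P)"
    unfolding P_def by (intro bspec[OF PC b, THEN conjunct2, rule_format] J w h) (use w in blast)
  qed
  also have "... = ennreal (\<Sum>b\<in>cover. C b * P)"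
   using C P0 by (intro sum_ennreal mult_nonneg_nonneg) (auto intro: less_imp_le)
  finally have "(\<Sum>j\<in>J. LINT p|\<nu>. (w j p)^2) <= (\<Sum>b\<in>cover. C b) * P"
   using C0 P0 by (subst (asm) ennreal_le_iff) (auto simp: sum_distrib_right[symmetric])
  also have "... <= C' * P" using P0 by (intro mult_right_mono) (auto simp: C'_def)
  finally show "(\<Sum>j\<in>J. LINT p|\<nu>. (w j p)^2) <= C' * (h^2 * (\<Sum>j\<in>J. energy (w j)) + Q)" by (simp add: P_def)
 qed
qed

text \<open>Averages are bounded by the \<open>L\<^sup>1\<close> norm. Keeping \<open>h\<close> as a parameter is more convenient below than
optimizing over it.\<close>

theorem nash_inequality:
 "\<exists>C>0. \<forall>u h. C1_function u --> 0 < h --> h <= 1 / 2 -->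
  (LINT p|\<nu>. (u p)^2) <= C * (h^2 * energy u + (1 / h ^ CARD('n))^2 * (LINT p|\<nu>. \<bar>u p\<bar>)^2)"
proof -
 obtain C where C: "C > 0" and mass: "\<And>(J :: unit set) w h Q. finite J ==> (\<forall>j\<in>J. C1_function (w j)) ==> 0 < h ==> h <= 1 / 2 ==>
  averages_le C h J w Q ==> (\<Sum>j\<in>J. LINT p|\<nu>. (w j p)^2) <= C * (h^2 * (\<Sum>j\<in>J. energy (w j)) + Q)"
  using mass_le_energy_plus_averages[where 'j = unit] by blast
 show ?thesis
 proof (intro exI[of _ "C + C * C^2"] conjI allI impI)
  show "C + C * C^2 > 0" using C by (simp add: add_pos_pos)
  fix u h assume u: "C1_function u" and h: "(0::real) < h" "h <= 1 / 2"
  define q a where "q = 1 / h ^ CARD('n)" and "a = (LINT p|\<nu>. \<bar>u p\<bar>)"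
  have a: "0 <= a" by (simp add: a_def)
  have uC: "continuous_on M u" by (rule C1_continuous[OF u])
  have "averages_le C h {()} (\<lambda>_. u) ((C * q * a)^2)"
   unfolding averages_le_def
  proof (intro conjI allI impI)
   fix \<beta> assume b: "L2 \<beta>" "\<forall>p\<in>M. \<bar>\<beta> p\<bar> <= C / h ^ CARD('n)"
   have "\<bar>(LINT p|\<nu>. u p * \<beta> p)\<bar> <= (LINT p|\<nu>. \<bar>u p * \<beta> p\<bar>)" by (rule integral_abs_bound)
   also have "... <= (LINT p|\<nu>. C * q * \<bar>u p\<bar>)"
   proof (rule integral_mono)
    show "integrable \<nu> (\<lambda>p. \<bar>u p * \<beta> p\<bar>)"
     by (intro integrable_abs sq_mult_integrable b(1) continuous_sq uC)
    show "integrable \<nu> (\<lambda>p. C * q * \<bar>u p\<bar>)"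
     by (intro integrable_mult_right integrable_abs continuous_integrable uC)
    show "\<bar>u p * \<beta> p\<bar> <= C * q * \<bar>u p\<bar>" if "p \<in> space \<nu>" for p
     using b(2) that mult_right_mono[of "\<bar>\<beta> p\<bar>" "C * q" "\<bar>u p\<bar>"] by (simp add: abs_mult q_def mult.commute)
   qed
   finally have "\<bar>(LINT p|\<nu>. u p * \<beta> p)\<bar> <= \<bar>C * q * a\<bar>" by (simp add: a_def)
   then show "(\<Sum>j\<in>{()}. (LINT p|\<nu>. u p * \<beta> p)^2) <= (C * q * a)^2" by (simp add: abs_le_square_iff)
  qed simp
  from mass[OF _ _ h this] have "(LINT p|\<nu>. (u p)^2) <= C * (h^2 * energy u) + C * C^2 * (q^2 * a^2)"
   using u by (simp add: distrib_left power_mult_distrib mult_ac)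
  also have "... <= (C + C * C^2) * (h^2 * energy u) + (C + C * C^2) * (q^2 * a^2)"
   using C energy_nonneg[OF u] by (intro add_mono mult_right_mono) auto
  finally show "(LINT p|\<nu>. (u p)^2) <= (C + C * C^2) * (h^2 * energy u + (1 / h ^ CARD('n))^2 * (LINT p|\<nu>. \<bar>u p\<bar>)^2)"
   by (simp add: q_def a_def distrib_left)
 qed
qed

definition nash_constant :: real where
 "nash_constant = (SOME C. C > 0 \<and> (\<forall>u h. C1_function u --> 0 < h --> h <= 1 / 2 -->
  (LINT p|\<nu>. (u p)^2) <= C * (h^2 * energy u + (1 / h ^ CARD('n))^2 * (LINT p|\<nu>. \<bar>u p\<bar>)^2)))"

lemmas nash = someI_ex[OF nash_inequality, folded nash_constant_def, THEN conjunct2, rule_format]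
 and nash_constant_pos = someI_ex[OF nash_inequality, folded nash_constant_def, THEN conjunct1]

text \<open>At the scale \<open>h\<close> with \<open>C * h\<^sup>2 * l \<le> 1 / 2\<close> the energy term is absorbed into
\<open>card J\<close>, and by Bessel's inequality the averages contribute at most a multiple of
\<open>h powr (- CARD('n))\<close>, irrespective of \<open>card J\<close>.\<close>

theorem orthonormal_low_energy_count:
 "\<exists>C>0. \<forall>(J :: 'j set) w l. finite J --> orthonormal_on \<nu> J w --> (\<forall>j\<in>J. C1_function (w j)) -->
  (\<forall>j\<in>J. energy (w j) <= l) --> 1 <= l --> real (card J) <= C * sqrt l ^ CARD('n)"
proof -
 let ?D = "CARD('n)"
 obtain C where C0: "C > 0" and mass: "\<And>(J :: 'j set) w h Q. finite J ==> (\<forall>j\<in>J. C1_function (w j)) ==> 0 < h ==> h <= 1 / 2 ==>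
  averages_le C h J w Q ==> (\<Sum>j\<in>J. LINT p|\<nu>. (w j p)^2) <= C * (h^2 * (\<Sum>j\<in>J. energy (w j)) + Q)"
  using mass_le_energy_plus_averages[where 'j = 'j] by blast
 \<comment> \<open>\<open>2 * C \<le> K\<close> lets the energy term be absorbed, and \<open>4 \<le> K\<close> ensures \<open>h \<le> 1 / 2\<close>\<close>
 define K where "K = 2 * C + 4"
 have K: "K >= 4" "2 * C <= K" using C0 by (auto simp: K_def)
 show ?thesis
 proof (intro exI[of _ "2 * C^2 * sqrt K ^ ?D"] conjI allI impI)
  show "2 * C^2 * sqrt K ^ ?D > 0" using C0 K by simp
  fix J :: "'j set" and w l
  assume J: "finite J" "orthonormal_on \<nu> J w" and w: "\<forall>j\<in>J. C1_function (w j)" and l: "\<forall>j\<in>J. energy (w j) <= l" "1 <= l"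
  define h where "h = 1 / sqrt (K * l)"
  have Kl: "4 <= K * l" using mult_mono[of 4 K 1 l] K l(2) by simp
  then have "2 <= sqrt (K * l)" by (intro real_le_rsqrt) simp
  then have h: "0 < h" "h <= 1 / 2" using frac_le[of 1 1 2 "sqrt (K * l)"] Kl by (auto simp: h_def)
  have h2: "h^2 = 1 / (K * l)" using Kl by (simp add: h_def power_divide)
  have "averages_le C h J w (C / h ^ ?D)"
   unfolding averages_le_def mult.commute[of "w _ _"] using C0 h bessel_inequality[OF J(2,1)] by (auto intro: order_trans)
  from mass[OF J(1) w h this] have "real (card J) <= C * (h^2 * (\<Sum>j\<in>J. energy (w j)) + C / h ^ ?D)"
   using J(2) by (simp add: orthonormal_on_def power2_eq_square)
  also have "... <= C * (h^2 * (real (card J) * l) + C / h ^ ?D)"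
   using C0 sum_mono[of J "\<lambda>j. energy (w j)" "\<lambda>_. l"] l(1) by (intro mult_left_mono add_right_mono) auto
  also have "... = C / K * real (card J) + C^2 / h ^ ?D"
   using l(2) K by (simp add: h2 distrib_left) (simp add: power2_eq_square)
  also have "... <= 1 / 2 * real (card J) + C^2 / h ^ ?D"
   using K by (intro add_right_mono mult_right_mono) (auto simp: divide_le_eq)
  finally have "real (card J) <= 2 * C^2 * (1 / h ^ ?D)" by simp
  also have "1 / h ^ ?D = sqrt K ^ ?D * sqrt l ^ ?D" by (simp add: h_def power_one_over real_sqrt_mult power_mult_distrib)
  finally show "real (card J) <= 2 * C^2 * sqrt K ^ ?D * sqrt l ^ ?D" by (simp add: mult.assoc)
 qed
qed

end

section \<open>The heat flow of finite combinations of eigenfunctions\<close>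

lemma DERIV_integral:
 fixes f f' :: "real \<Rightarrow> 'a \<Rightarrow> real"
 assumes fin: "finite_measure N"
  and D: "\<And>s p. p \<in> space N ==> ((\<lambda>s. f s p) has_real_derivative f' s p) (at s)"
  and i: "\<And>s. integrable N (f s)" and m: "f' t \<in> borel_measurable N"
  and B: "\<And>s p. \<bar>s - t\<bar> < 1 ==> p \<in> space N ==> \<bar>f' s p\<bar> <= B"
 shows "((\<lambda>s. LINT p|N. f s p) has_real_derivative (LINT p|N. f' t p)) (at t)"
 unfolding DERIV_def tendsto_at_iff_sequentially comp_def
proof (intro allI impI)
 interpret finite_measure N by fact
 fix X :: "nat \<Rightarrow> real" assume X0: "\<forall>i. X i \<in> UNIV - {0}" and X: "X \<longlonglongrightarrow> 0"
 have Xne: "X n \<noteq> 0" for n using X0 by auto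
 define d where "d n p = (f (t + X n) p - f t p) / X n" for n p
 have "(\<lambda>n. LINT p|N. d n p) \<longlonglongrightarrow> (LINT p|N. f' t p)"
 proof -
  obtain n0 where n0: "\<And>n. n >= n0 ==> \<bar>X n\<bar> < 1" using LIMSEQ_D[OF X, of 1] by auto
  have "(\<lambda>n. LINT p|N. d (n + n0) p) \<longlonglongrightarrow> (LINT p|N. f' t p)"
  proof (rule integral_dominated_convergence[where w = "\<lambda>_. B"])
   show "AE p in N. (\<lambda>n. d (n + n0) p) \<longlonglongrightarrow> f' t p"
   proof (rule AE_I2)
    fix p assume p: "p \<in> space N"
    have "((\<lambda>h. (f (t + h) p - f t p) / h) \<longlongrightarrow> f' t p) (at 0)" using D[OF p, of t] by (simp add: DERIV_def)
    then have "(\<lambda>n. d n p) \<longlonglongrightarrow> f' t p"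
     unfolding d_def tendsto_at_iff_sequentially comp_def using X0 X by blast
    then show "(\<lambda>n. d (n + n0) p) \<longlonglongrightarrow> f' t p" by (rule LIMSEQ_ignore_initial_segment)
   qed
   show "AE p in N. norm (d (n + n0) p) <= B" for n
   proof (rule AE_I2)
    fix p assume p: "p \<in> space N"
    let ?h = "X (n + n0)"
    have h: "?h \<noteq> 0" "\<bar>?h\<bar> < 1" using Xne n0 by auto
    have "\<exists>s. \<bar>s - t\<bar> < 1 \<and> d (n + n0) p = f' s p"
    proof (cases "?h > 0")
     case True
     obtain z where z: "t < z" "z < t + ?h" "f (t + ?h) p - f t p = (t + ?h - t) * f' z p"
      using MVT2[of t "t + ?h" "\<lambda>s. f s p" "\<lambda>s. f' s p"] D[OF p] True by auto
     then show ?thesis using h by (intro exI[of _ z]) (auto simp: d_def)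
    next
     case False
     then have neg: "t + ?h < t" using h by simp
     obtain z where z: "t + ?h < z" "z < t" "f t p - f (t + ?h) p = (t - (t + ?h)) * f' z p"
      using MVT2[of "t + ?h" t "\<lambda>s. f s p" "\<lambda>s. f' s p"] D[OF p] neg by auto
     then have "f (t + ?h) p - f t p = ?h * f' z p" by simp
     then show ?thesis using z(1,2) h by (intro exI[of _ z]) (auto simp: d_def)
    qed
    then show "norm (d (n + n0) p) <= B" using B[OF _ p] by auto
   qed
  qed (use m i in \<open>auto simp: d_def\<close>)
  then show ?thesis by (rule LIMSEQ_offset)
 qed
 moreover have "(LINT p|N. d n p) = ((LINT p|N. f (t + X n) p) - (LINT p|N. f t p)) / X n" for n using i by (simp add: d_def)
 ultimately show "(\<lambda>n. ((LINT p|N. f (t + X n) p) - (LINT p|N. f t p)) / X n) \<longlonglongrightarrow> (LINT p|N. f' t p)" by simp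
qed

text \<open>The power \<open>y powr (- 1 / D)\<close> grows at least linearly, so the bound does not depend on the initial value.\<close>

lemma ode_decay:
 fixes y :: "real \<Rightarrow> real" and D :: nat
 assumes D: "D > 0" and T: "T > 0" and k: "k > 0"
  and der: "\<And>t. 0 <= t ==> t <= T ==> (y has_real_derivative y' t) (at t)"
  and pos: "\<And>t. 0 <= t ==> t <= T ==> y t > 0"
  and le: "\<And>t. 0 <= t ==> t <= T ==> y' t <= - (k * y t * y t powr (1 / real D))"
 shows "y T <= (real D / (k * T)) ^ D"
proof -
 define z where "z t = y t powr (- (1 / real D))" for t
 have dz: "(z has_real_derivative (- (1 / real D) * y t powr (- (1 / real D) - 1) * y' t)) (at t)" if "0 <= t" "t <= T" for t
  unfolding z_def using pos[OF that] der[OF that] by (auto intro!: derivative_eq_intros simp: powr_diff)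
 obtain s where s: "0 < s" "s < T" "z T - z 0 = (T - 0) * (- (1 / real D) * y s powr (- (1 / real D) - 1) * y' s)"
  using MVT2[OF T dz] by auto
 have ys: "y s > 0" using pos s by simp
 have "k / real D <= - (1 / real D) * y s powr (- (1 / real D) - 1) * y' s"
 proof -
  have "1 = y s powr (- (1 / real D) - 1) * (y s * y s powr (1 / real D))"
  proof -
   have "y s * y s powr (1 / real D) = y s powr (1 / real D + 1)" using ys by (simp add: powr_add mult.commute)
   then show ?thesis using ys by (simp add: powr_add[symmetric])
  qed
  then have "k / real D = (1 / real D) * y s powr (- (1 / real D) - 1) * (k * y s * y s powr (1 / real D))"
   by (simp add: mult_ac)
  also have "... <= (1 / real D) * y s powr (- (1 / real D) - 1) * (- y' s)" using le[of s] s by (intro mult_left_mono) auto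
  finally show ?thesis by simp
 qed
 from mult_left_mono[OF this, of T] have "T * (k / real D) <= z T - z 0" unfolding s(3) using T by simp
 moreover have "z 0 >= 0" by (simp add: z_def)
 ultimately have zT: "T * k / real D <= z T" by simp
 have "z T = 1 / y T powr (1 / real D)" using pos[of T] T by (simp add: z_def powr_minus divide_inverse)
 then have "y T powr (1 / real D) <= real D / (k * T)" using zT D T k pos[of T] by (simp add: field_simps)
 then have "(y T powr (1 / real D)) ^ D <= (real D / (k * T)) ^ D" by (intro power_mono) auto
 also have "(y T powr (1 / real D)) ^ D = y T" using pos[of T] T D by (simp flip: powr_realpow add: powr_powr)
 finally show ?thesis .
qed

text \<open>The initial value is the combination of the eigenfunctions \<open>w j\<close> with coefficients \<open>a j\<close>. As
\<open>J\<close> is finite, the flow is given in closed form by the exponential decay of each coefficient.\<close>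

locale heat_flow = riemannian_probability M A g \<nu>
 for M :: "'a::t2_space set" and A :: "('a, 'n::finite) chart set"
  and g :: "('a, 'n) chart \<Rightarrow> real^'n \<Rightarrow> real^'n^'n" and \<nu> :: "'a measure" +
 fixes J :: "'j set" and w :: "'j \<Rightarrow> 'a \<Rightarrow> real" and \<mu> a :: "'j \<Rightarrow> real"
 assumes finite_J: "finite J" and w: "j \<in> J ==> w j \<in> eigenspace M A g (\<mu> j)"
begin

definition heat :: "real \<Rightarrow> 'a \<Rightarrow> real" where
 "heat t p = (\<Sum>j\<in>J. exp (- (t * \<mu> j)) * a j * w j p)"

lemma heat_C1: "C1_function (heat t)" unfolding heat_def[abs_def] by (intro C1_sum C1_mult C1_const eigen_C1[OF w])

lemma heat_continuous: "continuous_on M (heat t)" by (rule C1_continuous[OF heat_C1])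

lemma w_continuous: "j \<in> J ==> continuous_on M (w j)" by (rule C1_continuous[OF eigen_C1[OF w]])

text \<open>Green's formula applied to \<open>heat t p ^ n\<close> and each of the eigenfunctions.\<close>

lemma heat_power_derivative:
 "((\<lambda>t. LINT p|\<nu>. heat t p ^ Suc n) has_real_derivative
  - (real (Suc n) * (LINT p|\<nu>. real n * heat t p ^ (n - 1) * gamma (heat t) (heat t) p))) (at t)"
proof -
 define Lv where "Lv s p = (\<Sum>j\<in>J. \<mu> j * (exp (- (s * \<mu> j)) * a j) * w j p)" for s p
 have LC: "continuous_on M (Lv s)" for s
  unfolding Lv_def[abs_def] by (intro continuous_on_sum continuous_on_mult continuous_on_const w_continuous)
 have dv: "((\<lambda>s. heat s p) has_real_derivative - Lv s p) (at s)" for s p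
  unfolding heat_def Lv_def by (auto intro!: derivative_eq_intros simp: sum_negf[symmetric] algebra_simps intro!: sum.cong)
 have "\<forall>j\<in>J. \<exists>b. \<forall>p\<in>M. \<bar>w j p\<bar> <= b"
 proof
  fix j assume j: "j \<in> J"
  show "\<exists>b. \<forall>p\<in>M. \<bar>w j p\<bar> <= b" by (rule continuous_bounded[OF w_continuous[OF j]]) (rule exI, rule ballI)
 qed
 from bchoice[OF this] obtain B where B: "\<forall>j\<in>J. \<forall>p\<in>M. \<bar>w j p\<bar> <= B j" ..
 define E where "E j = exp ((\<bar>t\<bar> + 1) * \<bar>\<mu> j\<bar>) * \<bar>a j\<bar>" for j
 have Ebound: "\<bar>exp (- (s * \<mu> j)) * a j\<bar> <= E j" if "\<bar>s - t\<bar> < 1" for s j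
 proof -
  have "- (s * \<mu> j) <= \<bar>s\<bar> * \<bar>\<mu> j\<bar>" by (simp flip: abs_mult)
  also have "... <= (\<bar>t\<bar> + 1) * \<bar>\<mu> j\<bar>" using that by (intro mult_right_mono) auto
  finally show ?thesis unfolding E_def abs_mult by (intro mult_right_mono) auto
 qed
 \<comment> \<open>uniform bounds for the flow and its time derivative at times within distance 1 of \<open>t\<close>\<close>
 define V W where "V = (\<Sum>j\<in>J. E j * B j)" and "W = (\<Sum>j\<in>J. \<bar>\<mu> j\<bar> * E j * B j)"
 have Vb: "\<bar>heat s p\<bar> <= V" and Wb: "\<bar>Lv s p\<bar> <= W" if s: "\<bar>s - t\<bar> < 1" and p: "p \<in> M" for s p
 proof -
  have e: "\<bar>exp (- (s * \<mu> j)) * a j * w j p\<bar> <= E j * B j" if "j \<in> J" for j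
   unfolding abs_mult[of _ "w j p"] using B p that Ebound[OF s] by (intro mult_mono) (auto simp: E_def)
  then show "\<bar>heat s p\<bar> <= V" unfolding heat_def V_def by (intro order_trans[OF sum_abs] sum_mono)
  have "\<bar>\<mu> j * (exp (- (s * \<mu> j)) * a j) * w j p\<bar> <= \<bar>\<mu> j\<bar> * E j * B j" if "j \<in> J" for j
   unfolding mult.assoc[of "\<mu> j"] abs_mult[of "\<mu> j"] mult.assoc[of "\<bar>\<mu> j\<bar>"] by (intro mult_left_mono e that) simp
  then show "\<bar>Lv s p\<bar> <= W" unfolding Lv_def W_def by (intro order_trans[OF sum_abs] sum_mono)
 qed
 have "((\<lambda>t. LINT p|\<nu>. heat t p ^ Suc n) has_real_derivative (LINT p|\<nu>. real (Suc n) * heat t p ^ n * (- Lv t p))) (at t)"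
 proof (rule DERIV_integral[OF nu.finite_measure_axioms])
  show "((\<lambda>s. heat s p ^ Suc n) has_real_derivative real (Suc n) * heat s p ^ n * (- Lv s p)) (at s)" for s p
   using DERIV_power[OF dv[of p s], of "Suc n"] by (simp add: mult_ac del: power_Suc)
  show "integrable \<nu> (\<lambda>p. heat s p ^ Suc n)" for s
   by (intro continuous_integrable continuous_on_power heat_continuous)
  show "(\<lambda>p. real (Suc n) * heat t p ^ n * (- Lv t p)) \<in> borel_measurable \<nu>"
   by (intro continuous_measurable continuous_on_mult continuous_on_const continuous_on_power heat_continuous continuous_on_minus LC)
  fix s p assume s: "\<bar>s - t\<bar> < 1" and "p \<in> space \<nu>"
  then have p: "p \<in> M" by simp
  have "0 <= V" using Vb[OF s p] by linarith
  then show "\<bar>real (Suc n) * heat s p ^ n * (- Lv s p)\<bar> <= real (Suc n) * V ^ n * W"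
   unfolding abs_mult power_abs abs_minus_cancel abs_of_nat using Vb[OF s p] Wb[OF s p] by (intro mult_mono power_mono) auto
 qed
 also have "(LINT p|\<nu>. real (Suc n) * heat t p ^ n * (- Lv t p)) = - (real (Suc n) * (LINT p|\<nu>. heat t p ^ n * Lv t p))"
  by (simp add: mult.assoc)
 also have "(LINT p|\<nu>. heat t p ^ n * Lv t p) = (LINT p|\<nu>. real n * heat t p ^ (n - 1) * gamma (heat t) (heat t) p)"
 proof -
  let ?c = "\<lambda>j. exp (- (t * \<mu> j)) * a j" and ?u = "\<lambda>p. heat t p ^ n"
  have un: "C1_function ?u" by (rule C1_power[OF heat_C1])
  have "(LINT p|\<nu>. ?u p * Lv t p) = (LINT p|\<nu>. (\<Sum>j\<in>J. ?c j * (\<mu> j * (?u p * w j p))))"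
   unfolding Lv_def by (intro integral_eqI) (simp add: sum_distrib_left mult_ac)
  also have "... = (\<Sum>j\<in>J. LINT p|\<nu>. ?c j * (\<mu> j * (?u p * w j p)))"
   by (intro Bochner_Integration.integral_sum integrable_mult_right continuous_integrable continuous_on_mult
     continuous_on_power heat_continuous w_continuous)
  also have "... = (\<Sum>j\<in>J. LINT p|\<nu>. ?c j * gamma ?u (w j) p)"
   using green_eigenfunction[OF un w] by (intro sum.cong refl) (simp only: integral_mult_right_zero)
  also have "... = (LINT p|\<nu>. (\<Sum>j\<in>J. ?c j * gamma ?u (w j) p))"
   by (intro Bochner_Integration.integral_sum[symmetric] integrable_mult_right continuous_integrable gamma_continuous un eigen_C1[OF w])
  also have "... = (LINT p|\<nu>. real n * heat t p ^ (n - 1) * gamma (heat t) (heat t) p)"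
  proof (intro integral_eqI)
   fix p assume "p \<in> space \<nu>"
   then have p: "p \<in> M" by simp
   have "(\<Sum>j\<in>J. ?c j * gamma ?u (w j) p) = (\<Sum>j\<in>J. gamma (\<lambda>q. ?c j * w j q) ?u p)"
    by (intro sum.cong refl) (simp add: gamma_cmult[OF p eigen_C1[OF w] un] gamma_sym[OF p un eigen_C1[OF w]])
   also have "... = gamma (\<lambda>q. \<Sum>j\<in>J. ?c j * w j q) ?u p"
    by (rule gamma_sum[OF p _ un, symmetric]) (intro C1_mult C1_const eigen_C1[OF w])
   also have "(\<lambda>q. \<Sum>j\<in>J. ?c j * w j q) = heat t" by (simp add: fun_eq_iff heat_def)
   also have "gamma (heat t) ?u p = gamma ?u (heat t) p" by (rule gamma_sym[OF p heat_C1 un])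
   also have "... = real n * heat t p ^ (n - 1) * gamma (heat t) (heat t) p" by (rule gamma_power[OF p heat_C1 heat_C1])
   finally show "(\<Sum>j\<in>J. ?c j * gamma ?u (w j) p) = real n * heat t p ^ (n - 1) * gamma (heat t) (heat t) p" .
  qed
  finally show ?thesis .
 qed
 finally show ?thesis .
qed

end

context riemannian_probability
begin

lemma energy_power:
 assumes u: "C1_function u"
 shows "energy (\<lambda>p. u p ^ e) = (LINT p|\<nu>. (real e)^2 * (u p ^ (e - 1))^2 * gamma u u p)"
 unfolding energy_def
proof (intro integral_eqI)
 fix p assume "p \<in> space \<nu>"
 then have p: "p \<in> M" by simp
 have "gamma (\<lambda>p. u p ^ e) (\<lambda>p. u p ^ e) p = real e * u p ^ (e - 1) * gamma u (\<lambda>p. u p ^ e) p"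
  by (rule gamma_power[OF p u C1_power[OF u]])
 also have "gamma u (\<lambda>p. u p ^ e) p = real e * u p ^ (e - 1) * gamma u u p"
  using gamma_sym[OF p u C1_power[OF u]] gamma_power[OF p u u] by simp
 finally show "gamma (\<lambda>p. u p ^ e) (\<lambda>p. u p ^ e) p = (real e)^2 * (u p ^ (e - 1))^2 * gamma u u p"
  by (simp add: power2_eq_square mult_ac)
qed

definition stage_constant :: real where
 "stage_constant = 2 * nash_constant * 4 ^ CARD('n) + 2 * nash_constant * (nash_constant * real CARD('n)) ^ CARD('n) + 1"

end

context heat_flow
begin

lemma heat_double_power_derivative:
 assumes e: "e > 0"
 shows "\<exists>d. d <= - (2 * energy (\<lambda>p. heat t p ^ e)) \<and> ((\<lambda>t. LINT p|\<nu>. heat t p ^ (2 * e)) has_real_derivative d) (at t)"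
proof -
 let ?v = "heat t"
 define G where "G = (LINT p|\<nu>. (?v p ^ (e - 1))^2 * gamma ?v ?v p)"
 have G0: "G >= 0" unfolding G_def by (intro Bochner_Integration.integral_nonneg mult_nonneg_nonneg gamma_nonneg heat_C1) auto
 have en: "energy (\<lambda>p. ?v p ^ e) = (real e)^2 * G"
  unfolding energy_power[OF heat_C1] G_def by (simp only: mult.assoc integral_mult_right_zero)
 obtain n where n: "2 * e = Suc n" "n - 1 = 2 * (e - 1)" "real n = 2 * real e - 1" using e by (intro that[of "2 * e - 1"]) auto
 have "(LINT p|\<nu>. real n * ?v p ^ (n - 1) * gamma ?v ?v p) = real n * G"
  unfolding G_def n(2) by (simp only: mult.assoc integral_mult_right_zero power_even_eq)
 then have "((\<lambda>t. LINT p|\<nu>. heat t p ^ (2 * e)) has_real_derivative - (real (Suc n) * (real n * G))) (at t)"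
  using heat_power_derivative[of n t] unfolding n(1) by (simp only:)
 moreover have "- (real (Suc n) * (real n * G)) <= - (2 * ((real e)^2 * G))"
 proof -
  have "real (Suc n) = 2 * real e" using n(1) by (metis of_nat_mult of_nat_numeral)
  then have "2 * (real e)^2 * G <= real (Suc n) * real n * G"
   using e G0 by (intro mult_right_mono) (auto simp: n(3) power2_eq_square)
  then show ?thesis by (simp add: mult.assoc)
 qed
 ultimately show ?thesis unfolding en by blast
qed

lemma heat_even_power_antimono:
 assumes e: "even e" "e > 0" and st: "s <= t"
 shows "(LINT p|\<nu>. heat t p ^ e) <= (LINT p|\<nu>. heat s p ^ e)"
proof (rule DERIV_nonpos_imp_nonincreasing[OF st])
 fix r
 obtain k where k: "e = 2 * k" "k > 0" using e by (auto elim: evenE)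
 obtain d where d: "d <= - (2 * energy (\<lambda>p. heat r p ^ k))"
  "((\<lambda>t. LINT p|\<nu>. heat t p ^ (2 * k)) has_real_derivative d) (at r)"
  using heat_double_power_derivative[OF k(2)] by blast
 then show "\<exists>d. ((\<lambda>t. LINT p|\<nu>. heat t p ^ e) has_real_derivative d) (at r) \<and> d <= 0"
  using energy_nonneg[OF C1_power[OF heat_C1[of r], of k]] unfolding k(1) by (intro exI[of _ d]) auto
qed

text \<open>One step of Moser's iteration. By the Nash inequality for \<open>heat t p ^ e\<close> at a suitable scale
\<open>h\<close>, the integral \<open>y\<close> of the \<open>2 * e\<close>-th power satisfies the differential inequality of
\<open>ode_decay\<close> as long as it is large; the integral of the \<open>e\<close>-th power, which enters as the
\<open>L\<^sup>1\<close> norm, does not increase.\<close>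

lemma heat_stage:
 assumes T: "0 < T" "T <= 1" and e: "even e" "e > 0"
 shows "(LINT p|\<nu>. heat (s + T) p ^ (2 * e)) <= stage_constant * (1 / T) ^ CARD('n) * (LINT p|\<nu>. heat s p ^ e)^2"
proof -
 let ?D = "CARD('n)" and ?C = nash_constant
 note C = nash_constant_pos
 define y where "y t = (LINT p|\<nu>. heat (s + t) p ^ (2 * e))" for t
 define A0 where "A0 = (LINT p|\<nu>. heat s p ^ e)^2"
 define q where "q = stage_constant * (1 / T) ^ ?D"
 have q: "q > 0" using C T by (simp add: q_def stage_constant_def add_pos_pos)
 \<comment> \<open>the strict upper bound \<open>A'\<close> avoids a division by zero when the flow vanishes\<close>
 have le: "y T <= q * A'" if A': "A' > A0" for A'
 proof -
  have Apos: "A' > 0" using A' by (simp add: A0_def order_le_less_trans[OF zero_le_power2])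
  have At: "(LINT p|\<nu>. \<bar>heat (s + t) p ^ e\<bar>)^2 <= A'" if "t >= 0" for t
  proof -
   have "(LINT p|\<nu>. \<bar>heat (s + t) p ^ e\<bar>) = (LINT p|\<nu>. heat (s + t) p ^ e)"
    using e(1) by (simp add: zero_le_even_power)
   also have "... <= (LINT p|\<nu>. heat s p ^ e)" using that by (intro heat_even_power_antimono e) auto
   finally have "(LINT p|\<nu>. \<bar>heat (s + t) p ^ e\<bar>)^2 <= A0" unfolding A0_def by (intro power_mono) auto
   then show ?thesis using A' by simp
  qed
  have yanti: "y t2 <= y t1" if "t1 <= t2" for t1 t2 unfolding y_def using that e by (intro heat_even_power_antimono) auto
  have "\<forall>t. \<exists>d. d <= - (2 * energy (\<lambda>p. heat (s + t) p ^ e)) \<and> (y has_real_derivative d) (at t)"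
  proof
   fix t
   obtain d where d: "d <= - (2 * energy (\<lambda>p. heat (s + t) p ^ e))"
     "((\<lambda>t. LINT p|\<nu>. heat t p ^ (2 * e)) has_real_derivative d) (at (s + t))"
    using heat_double_power_derivative[OF e(2)] by blast
   have "(y has_real_derivative d * 1) (at t)"
    unfolding y_def by (rule DERIV_chain2[where f = "\<lambda>t. LINT p|\<nu>. heat t p ^ (2 * e)" and g = "\<lambda>t. s + t"])
     (use d(2) in \<open>auto intro!: derivative_eq_intros\<close>)
   then show "\<exists>d. d <= - (2 * energy (\<lambda>p. heat (s + t) p ^ e)) \<and> (y has_real_derivative d) (at t)"
    using d(1) by auto
  qed
  from choice[OF this] obtain y' where y': "\<And>t. y' t <= - (2 * energy (\<lambda>p. heat (s + t) p ^ e))"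
   "\<And>t. (y has_real_derivative y' t) (at t)" by blast
  define k where "k = (1 / ?C) * (1 / (2 * ?C * A')) powr (1 / real ?D)"
  have kpos: "k > 0" using C Apos by (simp add: k_def)
  have kD: "(1 / k) ^ ?D = ?C ^ ?D * (2 * ?C * A')"
   using C Apos by (simp add: k_def power_divide power_mult_distrib powr_powr flip: powr_realpow powr_realpow[of "(1 / (2 * ?C * A')) powr (1 / real ?D)"])
  have le1: "1 <= (1 / T) ^ ?D" using T by (intro one_le_power) auto
  show ?thesis
  proof (cases "y T <= 2 * ?C * 4 ^ ?D * A'")
   case True
   have "2 * ?C * 4 ^ ?D * 1 <= q" unfolding q_def using C le1 by (intro mult_mono) (auto simp: stage_constant_def)
   then have "2 * ?C * 4 ^ ?D * A' <= q * A'" using Apos by (intro mult_right_mono) auto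
   then show ?thesis using True by linarith
  next
   case False
   have big: "y t > 2 * ?C * 4 ^ ?D * A'" if "t <= T" for t using yanti[OF that] False by linarith
   have pos: "y t > 0" if "t <= T" for t using C Apos by (intro less_trans[OF _ big[OF that]]) simp
   have "y T <= (real ?D / (k * T)) ^ ?D"
   proof (rule ode_decay[where y' = y' and y = y])
    fix t assume t: "0 <= t" "t <= T"
    define \<rho> where "\<rho> = y t / (2 * ?C * A')"
    have rho4: "\<rho> > 4 ^ ?D" using big[OF t(2)] C Apos by (simp add: \<rho>_def field_simps)
    have rho0: "\<rho> > 0" using rho4 by (rule less_trans[rotated]) simp
    \<comment> \<open>the scale at which the term with the \<open>L\<^sup>1\<close> norm is half of the left-hand side; \<open>h \<le> 1 / 2\<close> as \<open>y\<close> is large\<close>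
    define h where "h = \<rho> powr (- (1 / (2 * real ?D)))"
    have h0: "h > 0" using rho0 by (simp add: h_def)
    have h2: "h^2 = \<rho> powr (- (1 / real ?D))"
     using rho0 by (simp add: h_def powr_powr flip: powr_realpow[OF powr_gt_zero[THEN iffD2]] powr_numeral)
    have hD: "(1 / h ^ ?D)^2 = \<rho>"
    proof -
     have "(h ^ ?D)^2 = (h^2) ^ ?D" by (simp add: power_mult[symmetric] mult.commute)
     also have "... = \<rho> powr (- 1)" unfolding h2 using rho0 by (simp add: powr_powr flip: powr_realpow)
     also have "... = 1 / \<rho>" using rho0 by (simp add: powr_minus divide_inverse)
     finally show ?thesis using rho0 by (simp add: power_one_over)
    qed
    have "h <= 1 / 2"
    proof -
     have "(4::real) = (4 ^ ?D) powr (1 / real ?D)" by (simp add: powr_powr flip: powr_realpow)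
     also have "... <= \<rho> powr (1 / real ?D)" using rho4 by (intro powr_mono2) auto
     finally have "h^2 <= (1 / 2)^2" unfolding h2 using rho0 by (simp add: powr_minus field_simps)
     then show ?thesis by (rule power2_le_imp_le) simp
    qed
    define En where "En = energy (\<lambda>p. heat (s + t) p ^ e)"
    have "y t = (LINT p|\<nu>. (heat (s + t) p ^ e)^2)" unfolding y_def by (simp add: power_mult[symmetric] mult.commute)
    also have "... <= ?C * (h^2 * En + (1 / h ^ ?D)^2 * (LINT p|\<nu>. \<bar>heat (s + t) p ^ e\<bar>)^2)"
     unfolding En_def by (rule nash[OF C1_power[OF heat_C1] h0 \<open>h <= 1 / 2\<close>])
    also have "... <= ?C * (h^2 * En + \<rho> * A')"
     unfolding hD using C rho0 At[OF t(1)] by (intro mult_left_mono add_left_mono) auto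
    also have "... = ?C * h^2 * En + y t / 2" using C Apos by (simp add: \<rho>_def field_simps)
    finally have "y t <= 2 * ?C * En * h^2" by (simp add: mult_ac)
    then have "y t * \<rho> powr (1 / real ?D) <= 2 * ?C * En * h^2 * \<rho> powr (1 / real ?D)" by (intro mult_right_mono) auto
    also have "h^2 * \<rho> powr (1 / real ?D) = 1" unfolding h2 using rho0 by (simp add: powr_minus)
    then have "2 * ?C * En * h^2 * \<rho> powr (1 / real ?D) = 2 * ?C * En" by (simp add: mult.assoc)
    finally have "y t * \<rho> powr (1 / real ?D) / ?C <= 2 * En" using C by (simp add: field_simps)
    moreover have "\<rho> powr (1 / real ?D) = y t powr (1 / real ?D) * (1 / (2 * ?C * A')) powr (1 / real ?D)"
     unfolding \<rho>_def using pos[OF t(2)] C Apos by (subst powr_mult[symmetric]) auto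
    then have "y t * \<rho> powr (1 / real ?D) / ?C = k * y t * y t powr (1 / real ?D)" by (simp add: k_def)
    ultimately show "y' t <= - (k * y t * y t powr (1 / real ?D))" using y'(1)[of t] by (simp add: En_def)
   qed (use T kpos y'(2) pos in auto)
   also have "... = (1 / k) ^ ?D * real ?D ^ ?D * (1 / T) ^ ?D" by (simp add: power_divide power_mult_distrib)
   also have "... = 2 * ?C * (?C * real ?D) ^ ?D * (1 / T) ^ ?D * A'" unfolding kD by (simp add: power_mult_distrib)
   also have "... <= q * A'" unfolding q_def using C T Apos by (intro mult_right_mono) (auto simp: stage_constant_def)
   finally show ?thesis .
  qed
 qed
 have "y T <= q * A0"
 proof (rule field_le_epsilon)
  fix \<epsilon> :: real assume "\<epsilon> > 0"
  then have "y T <= q * (A0 + \<epsilon> / q)" using q by (intro le) simp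
  then show "y T <= q * A0 + \<epsilon>" using q by (simp add: distrib_left)
 qed
 then show ?thesis by (simp add: y_def A0_def q_def)
qed

end

text \<open>A power integral is at least \<open>Q' ^ (2 ^ i)\<close> times the measure of the set where \<open>f > Q'\<close>.\<close>

lemma AE_le_of_power_integrals:
 fixes f :: "'a \<Rightarrow> real"
 assumes fin: "finite_measure N" and m: "f \<in> borel_measurable N" and f0: "\<And>p. p \<in> space N ==> 0 <= f p" and Q: "0 <= Q"
  and i: "\<And>i. integrable N (\<lambda>p. f p ^ (2 ^ i))" and le: "\<And>i. (LINT p|N. f p ^ (2 ^ i)) <= Q ^ (2 ^ i)"
 shows "AE p in N. f p <= Q"
proof -
 interpret finite_measure N by fact
 have above: "AE p in N. f p <= Q'" if Q': "Q' > Q" for Q'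
 proof -
  define S where "S = {p \<in> space N. f p > Q'}"
  have S: "S \<in> sets N" unfolding S_def using m by measurable
  have "measure N S <= (Q / Q') ^ i" for i
  proof -
   have "Q' ^ (2 ^ i) * measure N S = (LINT p|N. Q' ^ (2 ^ i) * indicator S p)" using S by simp
   also have "... <= (LINT p|N. f p ^ (2 ^ i))"
   proof (rule integral_mono[OF _ assms(5)])
    show "integrable N (\<lambda>p. Q' ^ (2 ^ i) * indicator S p)" using S by (simp add: less_top[symmetric])
    show "Q' ^ (2 ^ i) * indicator S p <= f p ^ (2 ^ i)" if "p \<in> space N" for p
     using that Q Q' f0[OF that] by (auto simp: S_def indicator_def intro!: power_mono)
   qed
   also have "... <= Q ^ (2 ^ i)" by (rule le)
   finally have "measure N S <= (Q / Q') ^ (2 ^ i)" using Q Q' by (simp add: power_divide field_simps)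
   also have "... <= (Q / Q') ^ i" using Q Q' less_exp[of i] by (intro power_decreasing) auto
   finally show ?thesis .
  qed
  moreover have "(\<lambda>i. (Q / Q') ^ i) \<longlonglongrightarrow> 0" using Q Q' by (intro LIMSEQ_realpow_zero) auto
  ultimately have "measure N S <= 0" by (intro LIMSEQ_le_const[where X = "\<lambda>i. (Q / Q') ^ i"]) auto
  then have "measure N S = 0" by (simp add: measure_le_0_iff)
  then have "emeasure N S = 0" by (simp add: emeasure_eq_measure)
  then have "AE p in N. p \<notin> S" using S by (intro AE_not_in) (simp add: null_sets_def)
  then show ?thesis by (rule AE_mp) (auto simp: S_def intro!: AE_I2)
 qed
 have "AE p in N. \<forall>n. f p <= Q + 1 / real (Suc n)" unfolding AE_all_countable by (intro allI above) simp
 then show ?thesis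
 proof eventually_elim
  fix p assume p: "\<forall>n. f p <= Q + 1 / real (Suc n)"
  have "(\<lambda>n. Q + 1 / real (Suc n)) \<longlonglongrightarrow> Q + 0"
   using LIMSEQ_inverse_real_of_nat by (intro tendsto_add tendsto_const) (simp add: divide_inverse)
  then show "f p <= Q" using p by (intro LIMSEQ_le_const[where X = "\<lambda>n. Q + 1 / real (Suc n)"]) auto
 qed
qed

context riemannian_probability
begin

definition heat_constant :: real where "heat_constant = stage_constant * (2 ^ CARD('n))^2"

lemma stage_constant_ge_1: "stage_constant >= 1" using nash_constant_pos by (simp add: stage_constant_def)

lemma heat_constant_pos: "heat_constant > 0" using stage_constant_ge_1 by (simp add: heat_constant_def)

end

context heat_flow
begin

text \<open>Moser's iteration: the time is divided into steps \<open>\<tau> / 2, \<tau> / 4, \<dots>\<close>, and the exponent is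
doubled in each. The constants of the steps grow geometrically, and after the substitution
\<open>Z i = c0 * b ^ Suc i * Y i\<close> the recursion reads
\<open>Z (Suc i) \<le> (Z i)\<^sup>2\<close>.\<close>

theorem heat_sup:
 assumes \<tau>: "0 < \<tau>" "\<tau> <= 1" and e: "even e" "e > 0"
 shows "AE p in \<nu>. heat \<tau> p ^ e <= heat_constant * (1 / \<tau>) ^ CARD('n) * (LINT p|\<nu>. heat 0 p ^ e)"
proof -
 let ?D = "CARD('n)"
 define b :: real where "b = 2 ^ ?D"
 have b1: "b >= 1" by (simp add: b_def)
 define t where "t i = \<tau> * (1 - 1 / 2 ^ i)" for i :: nat
 define Y where "Y i = (LINT p|\<nu>. heat (t i) p ^ (2 ^ i * e))" for i
 define c0 where "c0 = stage_constant * (1 / \<tau>) ^ ?D * b"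
 have c01: "c0 >= 1"
 proof -
  have "1 * 1 * 1 <= c0" unfolding c0_def using stage_constant_ge_1 \<tau> b1 by (intro mult_mono one_le_power) auto
  then show ?thesis by simp
 qed
 have Y0: "Y i >= 0" for i unfolding Y_def using e by (intro Bochner_Integration.integral_nonneg zero_le_even_power) simp
 have Ystep: "Y (Suc i) <= c0 * b ^ i * (Y i)^2" for i
 proof -
  have ts: "t (Suc i) = t i + \<tau> / 2 ^ Suc i" by (simp add: t_def field_simps)
  have T: "0 < \<tau> / 2 ^ Suc i" "\<tau> / 2 ^ Suc i <= 1"
  proof -
   have "(1::real) <= 2 ^ Suc i" by (rule one_le_power) simp
   then have "\<tau> <= 1 * 2 ^ Suc i" using \<tau> by linarith
   then show "\<tau> / 2 ^ Suc i <= 1" by (subst pos_divide_le_eq) simp_all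
  qed (use \<tau> in simp)
  have "Y (Suc i) <= stage_constant * (1 / (\<tau> / 2 ^ Suc i)) ^ ?D * (Y i)^2"
   unfolding Y_def ts power_Suc mult.assoc using heat_stage[OF T, of "2 ^ i * e" "t i"] e by (simp add: mult.assoc)
  also have "(1 / (\<tau> / 2 ^ Suc i)) ^ ?D = (1 / \<tau>) ^ ?D * b * b ^ i"
   by (simp add: b_def power_divide power_mult_distrib power_mult[symmetric] mult.commute)
  finally show ?thesis by (simp add: c0_def mult_ac)
 qed
 define Z where "Z i = c0 * b ^ Suc i * Y i" for i
 have Z0: "Z i >= 0" for i unfolding Z_def using c01 b1 Y0 by (intro mult_nonneg_nonneg) auto
 have Zstep: "Z (Suc i) <= (Z i)^2" for i
 proof -
  have "Z (Suc i) <= c0 * b ^ Suc (Suc i) * (c0 * b ^ i * (Y i)^2)"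
   unfolding Z_def using Ystep c01 b1 by (intro mult_left_mono) auto
  also have "... = (Z i)^2" by (simp add: Z_def power2_eq_square mult_ac)
  finally show ?thesis .
 qed
 have ZZ: "Z i <= Z 0 ^ (2 ^ i)" for i
 proof (induction i)
  case (Suc i)
  have "Z (Suc i) <= (Z i)^2" by (rule Zstep)
  also have "... <= (Z 0 ^ (2 ^ i))^2" using Suc Z0 by (intro power_mono) auto
  finally show ?case by (simp add: power_mult[symmetric] mult.commute)
 qed simp
 have "AE p in \<nu>. heat \<tau> p ^ e <= Z 0"
 proof (rule AE_le_of_power_integrals[OF nu.finite_measure_axioms])
  show "(\<lambda>p. heat \<tau> p ^ e) \<in> borel_measurable \<nu>" by (intro continuous_measurable continuous_on_power heat_continuous)
  show "0 <= heat \<tau> p ^ e" for p using e by (intro zero_le_even_power)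
  show "integrable \<nu> (\<lambda>p. (heat \<tau> p ^ e) ^ 2 ^ i)" for i by (intro continuous_integrable continuous_on_power heat_continuous)
  fix i
  have "(LINT p|\<nu>. (heat \<tau> p ^ e) ^ 2 ^ i) = (LINT p|\<nu>. heat \<tau> p ^ (2 ^ i * e))"
   by (simp add: power_mult[symmetric] mult.commute)
  also have "... <= Y i"
  proof -
   have "t i <= \<tau>" using \<tau> by (simp add: t_def mult_left_le)
   then show ?thesis unfolding Y_def using e by (intro heat_even_power_antimono) auto
  qed
  also have "... <= Z i"
  proof -
   have "1 * 1 <= c0 * b ^ Suc i" using c01 b1 by (intro mult_mono one_le_power) auto
   then show ?thesis unfolding Z_def using mult_right_mono[OF _ Y0, of 1 "c0 * b ^ Suc i" i] by simp
  qed
  also have "... <= Z 0 ^ 2 ^ i" by (rule ZZ)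
  finally show "(LINT p|\<nu>. (heat \<tau> p ^ e) ^ 2 ^ i) <= Z 0 ^ 2 ^ i" .
 qed (rule Z0)
 moreover have "Z 0 = heat_constant * (1 / \<tau>) ^ ?D * (LINT p|\<nu>. heat 0 p ^ e)"
  by (simp add: Z_def c0_def Y_def t_def heat_constant_def b_def power2_eq_square mult_ac)
 ultimately show ?thesis by simp
qed

end

section \<open>Uniform bounds for random projections\<close>

lemma card_markov:
 fixes f :: "'i set \<Rightarrow> real"
 assumes "finite I" and f: "\<And>S. S \<in> Pow I ==> 0 <= f S" and sum: "(\<Sum>S\<in>Pow I. f S) <= 2 ^ card I * B" and B: "0 <= B"
 shows "16 * card {S \<in> Pow I. f S > 16 * B} <= 2 ^ card I"
proof -
 let ?G = "{S \<in> Pow I. f S > 16 * B}"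
 have finP: "finite (Pow I)" using assms by simp
 show ?thesis
 proof (cases "B = 0")
  case True
  then have "(\<Sum>S\<in>Pow I. f S) = 0" using sum sum_nonneg[of "Pow I" f] f by simp
  then have "\<forall>S\<in>Pow I. f S = 0" using sum_nonneg_eq_0_iff[OF finP, of f] f by blast
  then have "?G = {}" using True by auto
  then show ?thesis by (simp only: card.empty)
 next
  case False
  have "real (card ?G) * (16 * B) = (\<Sum>S\<in>?G. 16 * B)" by simp
  also have "... <= (\<Sum>S\<in>?G. f S)" by (intro sum_mono) auto
  also have "... <= (\<Sum>S\<in>Pow I. f S)" using finP f by (intro sum_mono2) auto
  also have "... <= 2 ^ card I * B" by (rule sum)
  finally have "real (16 * card ?G) <= real (2 ^ card I)" using False B by simp
  then show ?thesis by (simp only: of_nat_le_iff)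
 qed
qed

context riemannian_probability
begin

definition projection_constant :: "nat \<Rightarrow> real" where
 "projection_constant r = heat_constant * (16 * (4 * fact (2 * r) * (exp 2) ^ r))"

lemma projection_constant_pos: "projection_constant r > 0" using heat_constant_pos by (simp add: projection_constant_def)

text \<open>The projection of \<open>\<Sum>i\<in>I. \<plusminus> \<psi> i\<close> onto the span of the eigenfunctions \<open>w\<close>
is the value at time \<open>1 / L\<close> of a heat flow, whose initial coefficients are larger by at most the factor
\<open>exp 1\<close> because \<open>\<mu> j \<le> L\<close>. At each point the variance of the initial value is at most
\<open>exp 2 * K\<close> by Bessel's inequality for \<open>\<psi>\<close>; Khintchine's inequality, integration over
\<open>M\<close> and Markov's inequality bound its \<open>2 * r\<close>-th power integral for most signs, and
\<open>heat_sup\<close> gives the bound almost everywhere.\<close>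

theorem random_projection_sup:
 assumes r: "r > 0" and I: "finite I" and J: "finite J" and psi: "orthonormal_on \<nu> I \<psi>" and wo: "orthonormal_on \<nu> J w"
  and w: "\<And>j. j \<in> J ==> w j \<in> eigenspace M A g (\<mu> j)" and mu: "\<And>j. j \<in> J ==> \<mu> j <= L" and L: "1 <= L"
  and K: "\<And>p. p \<in> M ==> (\<Sum>j\<in>J. (w j p)^2) <= K" and K0: "0 <= K"
 shows "16 * card {S \<in> Pow I. \<not> (AE p in \<nu>. (\<Sum>i\<in>I. rsign S i * (\<Sum>j\<in>J. (LINT x|\<nu>. \<psi> i x * w j x) * w j p)) ^ (2 * r)
   <= projection_constant r * L ^ CARD('n) * K ^ r)} <= 2 ^ card I"
proof -
 let ?D = "CARD('n)" and ?c = "projection_constant r"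
 define ip where "ip i j = (LINT x|\<nu>. \<psi> i x * w j x)" for i j
 define v where "v S p = (\<Sum>i\<in>I. rsign S i * (\<Sum>j\<in>J. ip i j * w j p))" for S p
 define cf where "cf S j = exp (\<mu> j / L) * (\<Sum>i\<in>I. rsign S i * ip i j)" for S j
 have hf: "heat_flow M A g \<nu> J w \<mu>" by unfold_locales (use J w in auto)
 interpret heat_flow M A g \<nu> J w \<mu> "cf S" for S by (rule hf)
 let ?W = "\<lambda>S. heat S 0"
 have vheat: "heat S (1 / L) p = v S p" for S p
 proof -
  have "exp (- (1 / L * \<mu> j)) * cf S j = (\<Sum>i\<in>I. rsign S i * ip i j)" for j
   by (simp add: cf_def exp_minus mult.assoc[symmetric])
  then have "heat S (1 / L) p = (\<Sum>j\<in>J. \<Sum>i\<in>I. rsign S i * (ip i j * w j p))"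
   unfolding heat_def by (simp only: sum_distrib_right mult.assoc)
  also have "... = v S p" unfolding v_def by (subst sum.swap) (simp only: sum_distrib_left)
  finally show ?thesis .
 qed
 have Wp: "?W S p = (\<Sum>i\<in>I. rsign S i * (\<Sum>j\<in>J. exp (\<mu> j / L) * ip i j * w j p))" for S p
 proof -
  have "?W S p = (\<Sum>j\<in>J. \<Sum>i\<in>I. rsign S i * (exp (\<mu> j / L) * ip i j * w j p))"
   unfolding heat_def cf_def by (simp add: sum_distrib_left sum_distrib_right mult_ac)
  also have "... = (\<Sum>i\<in>I. rsign S i * (\<Sum>j\<in>J. exp (\<mu> j / L) * ip i j * w j p))"
   by (subst sum.swap) (simp only: sum_distrib_left)
  finally show ?thesis .
 qed
 have wsq: "L2 (w j)" if "j \<in> J" for j using wo that by (simp add: orthonormal_on_def)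
 have psq: "L2 (\<psi> i)" if "i \<in> I" for i using psi that by (simp add: orthonormal_on_def)
 have var: "(\<Sum>i\<in>I. (\<Sum>j\<in>J. exp (\<mu> j / L) * ip i j * w j p)^2) <= exp 2 * K" if p: "p \<in> M" for p
 proof -
  define b where "b j = exp (\<mu> j / L) * w j p" for j
  define k where "k x = (\<Sum>j\<in>J. b j * w j x)" for x
  have ksq: "L2 k" unfolding k_def by (intro sq_sum sq_cmult wsq)
  have "(\<Sum>j\<in>J. exp (\<mu> j / L) * ip i j * w j p) = (LINT x|\<nu>. k x * \<psi> i x)" if "i \<in> I" for i
  proof -
   have "(LINT x|\<nu>. k x * \<psi> i x) = (LINT x|\<nu>. \<psi> i x * k x)" by (simp only: mult.commute)
   also have "... = (\<Sum>j\<in>J. b j * (LINT x|\<nu>. \<psi> i x * w j x))"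
    unfolding k_def by (rule integral_mult_sum[OF psq[OF that] wsq])
   finally show ?thesis by (simp add: b_def ip_def mult_ac)
  qed
  then have "(\<Sum>i\<in>I. (\<Sum>j\<in>J. exp (\<mu> j / L) * ip i j * w j p)^2) = (\<Sum>i\<in>I. (LINT x|\<nu>. k x * \<psi> i x)^2)"
   by (intro sum.cong refl) simp
  also have "... <= (LINT x|\<nu>. (k x)^2)" by (rule bessel_inequality[OF psi I ksq])
  also have "... = (\<Sum>j\<in>J. (b j)^2)" unfolding k_def by (rule orthonormal_sum_square[OF wo J])
  also have "... <= (\<Sum>j\<in>J. exp 2 * (w j p)^2)"
  proof (rule sum_mono)
   fix j assume "j \<in> J"
   then have "exp (\<mu> j / L) <= exp 1" using mu L by simp
   then have "(exp (\<mu> j / L))^2 <= (exp 1)^2" by (intro power_mono) auto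
   also have "... = exp (2::real)" by (simp flip: exp_double)
   finally show "(b j)^2 <= exp 2 * (w j p)^2" unfolding b_def power_mult_distrib by (intro mult_right_mono) auto
  qed
  also have "... <= exp 2 * K" unfolding sum_distrib_left[symmetric] using K[OF p] by (intro mult_left_mono) auto
  finally show ?thesis .
 qed
 define B where "B = 4 * fact (2 * r) * (exp 2 * K) ^ r"
 have B0: "B >= 0" using K0 by (simp add: B_def)
 define f where "f S = (LINT p|\<nu>. ?W S p ^ (2 * r))" for S
 have f0: "0 <= f S" for S unfolding f_def by (intro Bochner_Integration.integral_nonneg zero_le_even_power) simp
 have fi: "integrable \<nu> (\<lambda>p. ?W S p ^ (2 * r))" for S by (intro continuous_integrable continuous_on_power heat_continuous)
 have "(\<Sum>S\<in>Pow I. f S) = (LINT p|\<nu>. (\<Sum>S\<in>Pow I. ?W S p ^ (2 * r)))"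
  unfolding f_def by (rule Bochner_Integration.integral_sum[symmetric]) (rule fi)
 also have "... <= (LINT p|\<nu>. 2 ^ card I * B)"
 proof (rule integral_mono)
  show "integrable \<nu> (\<lambda>p. \<Sum>S\<in>Pow I. ?W S p ^ (2 * r))" by (rule Bochner_Integration.integrable_sum) (rule fi)
  fix p assume "p \<in> space \<nu>"
  then have p: "p \<in> M" by simp
  show "(\<Sum>S\<in>Pow I. ?W S p ^ (2 * r)) <= 2 ^ card I * B"
   unfolding Wp B_def mult.assoc[symmetric] using rsign_even_moment_le[OF I var[OF p], of r] by (simp only: mult.assoc)
 qed simp
 also have "... = 2 ^ card I * B" using nu.prob_space by simp
 finally have few: "16 * card {S \<in> Pow I. f S > 16 * B} <= 2 ^ card I" by (intro card_markov I f0 B0)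
 have good: "AE p in \<nu>. v S p ^ (2 * r) <= ?c * L ^ ?D * K ^ r" if "f S <= 16 * B" for S
 proof -
  have "AE p in \<nu>. heat S (1 / L) p ^ (2 * r) <= heat_constant * (1 / (1 / L)) ^ ?D * f S"
   unfolding f_def using L r by (intro heat_sup) auto
  then show ?thesis
  proof eventually_elim
   fix p assume "heat S (1 / L) p ^ (2 * r) <= heat_constant * (1 / (1 / L)) ^ ?D * f S"
   then have "v S p ^ (2 * r) <= heat_constant * L ^ ?D * f S" unfolding vheat by simp
   also have "... <= heat_constant * L ^ ?D * (16 * B)" using that heat_constant_pos L by (intro mult_left_mono) auto
   also have "... = ?c * L ^ ?D * K ^ r" by (simp add: B_def projection_constant_def power_mult_distrib mult_ac)
   finally show "v S p ^ (2 * r) <= ?c * L ^ ?D * K ^ r" .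
  qed
 qed
 have "card {S \<in> Pow I. \<not> (AE p in \<nu>. v S p ^ (2 * r) <= ?c * L ^ ?D * K ^ r)} <= card {S \<in> Pow I. f S > 16 * B}"
 proof (rule card_mono)
  show "{S \<in> Pow I. \<not> (AE p in \<nu>. v S p ^ (2 * r) <= ?c * L ^ ?D * K ^ r)} \<subseteq> {S \<in> Pow I. f S > 16 * B}"
   using good not_le by blast
 qed (use I in simp)
 then show ?thesis using few unfolding v_def ip_def by linarith
qed

end

section \<open>The spectral description of the density class\<close>

lemma span_image_lessThan:
 assumes "h \<in> real_fun.span (e ` {..<d::nat})"
 shows "\<exists>c. h = (\<lambda>x. \<Sum>l<d. c l * e l x)"
 using assms
proof (induction rule: real_fun.span_induct_alt)
 case base
 show ?case by (intro exI[of _ "\<lambda>_. 0"]) (auto simp: fun_eq_iff)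
next
 case (step a x y)
 then obtain c l where c: "y = (\<lambda>x. \<Sum>l<d. c l * e l x)" and l: "l < d" "x = e l" by auto
 have "(\<Sum>k<d. (if k = l then a else 0) * e k z) = a * e l z" for z
  using l(1) by (simp add: if_distrib[of "\<lambda>t. t * _"] cong: if_cong)
 then have "(\<lambda>z. a * x z) + y = (\<lambda>z. \<Sum>k<d. ((if k = l then a else 0) + c k) * e k z)"
  unfolding l(2) c by (simp add: fun_eq_iff distrib_right sum.distrib)
 then show ?case unfolding l(2) by (intro exI[of _ "\<lambda>k. (if k = l then a else 0) + c k"]) (simp only: l(2))
qed

context riemannian_probability
begin

lemma lap_linear:
 assumes c: "c \<in> A" and y: "y \<in> chart_image c"
  and F: "Ck_on (Suc (Suc 0)) (chart_image c) F" and G: "Ck_on (Suc (Suc 0)) (chart_image c) G"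
 shows "lap c (\<lambda>z. a * F z + b * G z) y = a * lap c F y + b * lap c G y"
proof -
 have lin: "grad (\<lambda>z. a * P z + b * Q z) z = a *\<^sub>R grad P z + b *\<^sub>R grad Q z"
  if "P differentiable (at z)" "Q differentiable (at z)" for P Q z using that by (simp add: grad_add grad_mult)
 have pl: "partial i (\<lambda>z. a * P z + b * Q z) z = a * partial i P z + b * partial i Q z"
  if "P differentiable (at z)" "Q differentiable (at z)" for P Q z i
  using arg_cong[OF lin[OF that], of "\<lambda>v. v $ i"] by (simp add: grad_def)
 have dF: "F differentiable (at z)" "G differentiable (at z)" if "z \<in> chart_image c" for z using F G that by auto
 have fl: "flux c (\<lambda>z. a * F z + b * G z) i z = a * flux c F i z + b * flux c G i z" if "z \<in> chart_image c" for i z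
  unfolding flux_def pl[OF dF[OF that]] by (simp add: distrib_left sum.distrib sum_distrib_left mult_ac)
 have dfl: "flux c F i differentiable (at y)" "flux c G i differentiable (at y)" for i
  using flux_Ck[OF c F, of i] flux_Ck[OF c G, of i] y by auto
 have "partial i (flux c (\<lambda>z. a * F z + b * G z) i) y = a * partial i (flux c F i) y + b * partial i (flux c G i) y" for i
 proof -
  have "grad (flux c (\<lambda>z. a * F z + b * G z) i) y = grad (\<lambda>z. a * flux c F i z + b * flux c G i z) y"
   by (rule grad_cong[OF chart_image_open[OF c] y]) (use fl dfl in auto)
  then have "partial i (flux c (\<lambda>z. a * F z + b * G z) i) y = partial i (\<lambda>z. a * flux c F i z + b * flux c G i z) y"
   by (simp add: grad_def vec_eq_iff)
  then show ?thesis by (simp only: pl[OF dfl])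
 qed
 then show ?thesis by (simp add: lap_def sum.distrib sum_distrib_left add_divide_distrib)
qed

lemma eigenspace_linear:
 assumes f: "f \<in> eigenspace M A g l" and u: "u \<in> eigenspace M A g l"
 shows "(\<lambda>p. a * f p + b * u p) \<in> eigenspace M A g l"
 unfolding eigenspace_def mem_Collect_eq
proof (intro conjI)
 show "smooth_function A (\<lambda>p. a * f p + b * u p)"
  unfolding smooth_function_def smooth_on_def o_def
  by (intro ballI allI Ck_on_add Ck_on_mult Ck_on_const chart_image_open eigen_Ck[OF f] eigen_Ck[OF u])
 show "has_laplacian A g (\<lambda>p. a * f p + b * u p) (\<lambda>p. - (l * (a * f p + b * u p)))"
  unfolding has_laplacian_def
 proof (intro ballI)
  fix c p assume c: "c \<in> A" and p: "p \<in> chart_dom c"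
  then have y: "chart_map c p \<in> chart_image c" by simp
  show "- (l * (a * f p + b * u p)) = chart_laplacian g c (\<lambda>p. a * f p + b * u p) (chart_map c p)"
   unfolding chart_laplacian_eq_lap lap_linear[OF c y eigen_Ck[OF f c] eigen_Ck[OF u c]]
    eigen_lap[OF f c y] eigen_lap[OF u c y] inv_map[OF c p] by (simp add: algebra_simps)
 qed
 show "\<forall>p. p \<notin> M --> a * f p + b * u p = 0" using f u by (simp add: eigenspace_def)
qed

lemma indicator_eigenspace: "(indicator M :: 'a \<Rightarrow> real) \<in> eigenspace M A g 0"
 unfolding eigenspace_def mem_Collect_eq
proof (intro conjI)
 have one: "Ck_on k (chart_image c) (\<lambda>y. indicator M (chart_inv c y) :: real)" if c: "c \<in> A" for c k
  by (subst Ck_on_cong[OF chart_image_open[OF c], of _ "\<lambda>_. 1"])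
   (auto simp: inv_in_M[OF c] Ck_on_const[OF chart_image_open[OF c]])
 show "smooth_function A (indicator M :: 'a \<Rightarrow> real)"
  unfolding smooth_function_def smooth_on_def o_def using one by blast
 show "has_laplacian A g (indicator M) (\<lambda>p. - (0 * indicator M p))"
  unfolding has_laplacian_def
 proof (intro ballI)
  fix c p assume c: "c \<in> A" and p: "p \<in> chart_dom c"
  then have y: "chart_map c p \<in> chart_image c" by simp
  have "partial i (\<lambda>y. indicator M (chart_inv c y) :: real) z = 0" if "z \<in> chart_image c" for z i
  proof -
   have "grad (\<lambda>y. indicator M (chart_inv c y) :: real) z = grad (\<lambda>_. 1) z"
    by (rule grad_cong[OF chart_image_open[OF c] that]) (auto simp: inv_in_M[OF c])
   then show ?thesis by (simp add: grad_def vec_eq_iff)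
  qed
  then have fz: "flux c (\<lambda>y. indicator M (chart_inv c y)) i z = 0" if "z \<in> chart_image c" for z i
   using that by (simp add: flux_def)
  have "partial i (flux c (\<lambda>y. indicator M (chart_inv c y)) i) (chart_map c p) = 0" for i
  proof -
   have "grad (flux c (\<lambda>y. indicator M (chart_inv c y)) i) (chart_map c p) = grad (\<lambda>_. 0) (chart_map c p)"
    by (rule grad_cong[OF chart_image_open[OF c] y]) (auto simp: fz)
   then show ?thesis by (simp add: grad_def vec_eq_iff)
  qed
  then show "- (0 * indicator M p) = chart_laplacian g c (indicator M) (chart_map c p)"
   by (simp add: chart_laplacian_eq_lap lap_def)
 qed
qed simp

end

locale riemannian_spectrum = riemannian_probability M A g \<nu>
 for M :: "'a::t2_space set" and A :: "('a, 'n::finite) chart set"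
  and g :: "('a, 'n) chart \<Rightarrow> real^'n \<Rightarrow> real^'n^'n" and \<nu> :: "'a measure" +
 fixes \<mu> :: "nat \<Rightarrow> real" and \<phi> :: "nat \<Rightarrow> nat \<Rightarrow> 'a \<Rightarrow> real"
 assumes enumeration: "eigenvalue_enumeration M A g \<mu>"
  and basis: "orthonormal_basis \<nu> (eigenspace M A g (\<mu> j)) (\<phi> j)"
begin

definition d :: "nat \<Rightarrow> nat" where "d j = fun_dim (eigenspace M A g (\<mu> j))"

abbreviation E :: "nat \<Rightarrow> ('a \<Rightarrow> real) set" where "E j \<equiv> eigenspace M A g (\<mu> j)"

lemma mu_0: "\<mu> 0 = 0" and mu_strict: "strict_mono \<mu>" using enumeration by (auto simp: eigenvalue_enumeration_def)

lemma mu_nonneg: "\<mu> j >= 0" using strict_mono_less_eq[OF mu_strict, of 0 j] mu_0 by simp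

lemma mu_pos: "j > 0 ==> \<mu> j > 0" using strict_mono_less[OF mu_strict, of 0 j] mu_0 by simp

lemma mu_eq_iff: "\<mu> j = \<mu> k \<longleftrightarrow> j = k"
 using strict_mono_eq[OF mu_strict] .

lemma phi_in: "l < d j ==> \<phi> j l \<in> E j" using basis[of j] by (simp add: orthonormal_basis_def d_def)

lemma phi_C1: "l < d j ==> C1_function (\<phi> j l)" by (rule eigen_C1[OF phi_in])

lemma phi_continuous: "l < d j ==> continuous_on M (\<phi> j l)" by (rule C1_continuous[OF phi_C1])

lemma phi_sq: "l < d j ==> L2 (\<phi> j l)" by (rule continuous_sq[OF phi_continuous])

lemma phi_inner: "l < d j ==> m < d j ==> (LINT x|\<nu>. \<phi> j l x * \<phi> j m x) = (if l = m then 1 else 0)"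
 using basis[of j] by (simp add: orthonormal_basis_def d_def)

lemma phi_expansion: "h \<in> E j ==> \<exists>c. h = (\<lambda>x. \<Sum>l<d j. c l * \<phi> j l x)"
 using basis[of j] by (intro span_image_lessThan) (auto simp: orthonormal_basis_def d_def)

definition modes :: "(nat \<times> nat) set" where "modes = {(j, l). l < d j}"

definition mode :: "nat \<times> nat \<Rightarrow> 'a \<Rightarrow> real" where "mode i = \<phi> (fst i) (snd i)"

lemma mode_in: "i \<in> modes ==> mode i \<in> E (fst i)" by (auto simp: modes_def mode_def phi_in)

lemma modes_orthonormal: "orthonormal_on \<nu> modes mode"
 unfolding orthonormal_on_def
proof (intro conjI ballI)
 fix i assume "i \<in> modes"
 then show "L2 (mode i)" by (auto simp: modes_def mode_def phi_sq)
next
 fix i k assume i: "i \<in> modes" and k: "k \<in> modes"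
 show "(LINT x|\<nu>. mode i x * mode k x) = (if i = k then 1 else 0)"
 proof (cases "fst i = fst k")
  case True
  then show ?thesis using i k by (cases i, cases k) (auto simp: modes_def mode_def phi_inner)
 next
  case False
  then show ?thesis using eigenspaces_orthogonal[OF mode_in[OF i] mode_in[OF k]] mu_eq_iff by auto
 qed
qed

lemma mode_energy:
 assumes i: "i \<in> modes" shows "energy (mode i) = \<mu> (fst i)"
proof -
 have "energy (mode i) = \<mu> (fst i) * (LINT p|\<nu>. mode i p * mode i p)"
  unfolding energy_def using green_eigenfunction[OF eigen_C1[OF mode_in[OF i]] mode_in[OF i]] by simp
 then show ?thesis using modes_orthonormal i by (simp add: orthonormal_on_def)
qed

definition low :: "real \<Rightarrow> (nat \<times> nat) set" where "low l = {i \<in> modes. \<mu> (fst i) <= l}"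

lemma low_count:
 "\<exists>C>0. \<forall>l\<ge>1. finite (low l) \<and> real (card (low l)) <= C * sqrt l ^ CARD('n)"
proof -
 obtain C where C: "C > 0" "\<And>(J :: (nat \<times> nat) set) w l. finite J ==> orthonormal_on \<nu> J w ==> (\<forall>j\<in>J. C1_function (w j)) ==>
  (\<forall>j\<in>J. energy (w j) <= l) ==> 1 <= l ==> real (card J) <= C * sqrt l ^ CARD('n)"
  using orthonormal_low_energy_count[where 'j = "nat \<times> nat"] by blast
 have sub: "real (card J) <= C * sqrt l ^ CARD('n)" if "finite J" "J \<subseteq> low l" "1 <= l" for J l
 proof (rule C(2)[OF that(1) _ _ _ that(3)])
  have m: "J \<subseteq> modes" using that(2) by (auto simp: low_def)
  then show "orthonormal_on \<nu> J mode" by (rule orthonormal_on_subset[OF modes_orthonormal])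
  show "\<forall>j\<in>J. C1_function (mode j)" using m mode_in eigen_C1 by blast
  show "\<forall>j\<in>J. energy (mode j) <= l" using that(2) mode_energy by (auto simp: low_def)
 qed
 have "finite (low l) \<and> real (card (low l)) <= C * sqrt l ^ CARD('n)" if l: "1 <= l" for l
 proof -
  have "finite (low l)"
  proof (rule ccontr)
   assume "infinite (low l)"
   then obtain J where J: "finite J" "card J = nat \<lceil>C * sqrt l ^ CARD('n)\<rceil> + 1" "J \<subseteq> low l"
    using infinite_arbitrarily_large by blast
   have "real (card J) <= C * sqrt l ^ CARD('n)" by (rule sub[OF J(1,3) l])
   then show False unfolding J(2) by linarith
  qed
  then show ?thesis using sub l by blast
 qed
 then show ?thesis using C(1) by blast
qed

lemma d_pos: "d j > 0"
proof (rule ccontr)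
 assume "\<not> d j > 0"
 then have d0: "d j = 0" by simp
 have "is_eigenvalue M A g (\<mu> j)" using enumeration by (auto simp: eigenvalue_enumeration_def)
 then obtain f p where f: "f \<in> E j" "p \<in> M" "f p \<noteq> 0" by (auto simp: is_eigenvalue_def)
 obtain c where "f = (\<lambda>x. \<Sum>l<d j. c l * \<phi> j l x)" using phi_expansion[OF f(1)] by blast
 then show False using f(3) d0 by simp
qed

lemma finite_low: "finite (low l)"
proof -
 obtain C where "\<forall>l\<ge>1. finite (low l) \<and> real (card (low l)) <= C * sqrt l ^ CARD('n)" using low_count by blast
 then have "finite (low (max l 1))" by simp
 then show ?thesis by (rule rev_finite_subset) (auto simp: low_def)
qed

lemma blocks_finite: "finite {j. \<mu> j <= l}" "card {j. \<mu> j <= l} <= card (low l)"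
proof -
 have "(\<lambda>j. (j, 0)) ` {j. \<mu> j <= l} \<subseteq> low l" using d_pos by (auto simp: low_def modes_def)
 moreover have inj: "inj_on (\<lambda>j. (j, 0::nat)) {j. \<mu> j <= l}" by (auto simp: inj_on_def)
 ultimately show "finite {j. \<mu> j <= l}" "card {j. \<mu> j <= l} <= card (low l)"
  using finite_imageD[OF finite_subset[OF _ finite_low] inj] card_inj_on_le[OF inj _ finite_low] by simp_all
qed

definition block :: "nat \<Rightarrow> ('a \<Rightarrow> real) \<Rightarrow> real" where
 "block j f = sqrt (\<Sum>l<d j. (LINT x|\<nu>. f x * \<phi> j l x)^2)"

lemma phi_orthonormal: "orthonormal_on \<nu> {..<d j} (\<phi> j)" using phi_sq phi_inner by (auto simp: orthonormal_on_def)

lemma E_sum: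
 "(\<lambda>x. \<Sum>l<m. c l * \<phi> j l x) \<in> E j" if "m <= d j"
 using that
proof (induction m)
 case 0
 have "(\<lambda>p. 0 * \<phi> j 0 p + 0 * \<phi> j 0 p) \<in> E j" by (rule eigenspace_linear[OF phi_in phi_in]) (rule d_pos)+
 then show ?case by simp
next
 case (Suc m)
 then have "(\<lambda>x. 1 * (\<Sum>l<m. c l * \<phi> j l x) + c m * \<phi> j m x) \<in> E j"
  by (intro eigenspace_linear phi_in) auto
 then show ?case by simp
qed

lemma orth_proj_formula:
 assumes f: "L2 f"
 shows "orth_proj \<nu> (E j) f = (\<lambda>x. \<Sum>l<d j. (LINT y|\<nu>. f y * \<phi> j l y) * \<phi> j l x)"
proof -
 define h where "h x = (\<Sum>l<d j. (LINT y|\<nu>. f y * \<phi> j l y) * \<phi> j l x)" for x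
 have inner: "(LINT x|\<nu>. (f x - (\<Sum>l<d j. b l * \<phi> j l x)) * \<phi> j k x) = (LINT x|\<nu>. f x * \<phi> j k x) - b k" if k: "k < d j" for b k
 proof -
  have hs: "L2 (\<lambda>x. \<Sum>l<d j. b l * \<phi> j l x)" by (intro sq_sum sq_cmult phi_sq) simp
  have "(LINT x|\<nu>. (f x - (\<Sum>l<d j. b l * \<phi> j l x)) * \<phi> j k x)
    = (LINT x|\<nu>. f x * \<phi> j k x - (\<Sum>l<d j. b l * \<phi> j l x) * \<phi> j k x)" by (simp only: left_diff_distrib)
  also have "... = (LINT x|\<nu>. f x * \<phi> j k x) - (LINT x|\<nu>. (\<Sum>l<d j. b l * \<phi> j l x) * \<phi> j k x)"
   by (intro Bochner_Integration.integral_diff sq_mult_integrable f hs phi_sq[OF k])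
  also have "(LINT x|\<nu>. (\<Sum>l<d j. b l * \<phi> j l x) * \<phi> j k x) = b k"
   by (rule orthonormal_coefficient[OF phi_orthonormal]) (use k in auto)
  finally show ?thesis .
 qed
 have "(THE h. h \<in> E j \<and> (\<forall>e\<in>E j. (LINT x|\<nu>. (f x - h x) * e x) = 0)) = h"
 proof (rule the_equality)
  have hE: "h \<in> E j" unfolding h_def by (rule E_sum) simp
  have hs: "L2 h" by (rule continuous_sq[OF C1_continuous[OF eigen_C1[OF hE]]])
  have "(LINT x|\<nu>. (f x - h x) * e x) = 0" if eE: "e \<in> E j" for e
  proof -
   obtain b where b: "e = (\<lambda>x. \<Sum>l<d j. b l * \<phi> j l x)" using phi_expansion[OF eE] by blast
   have "(LINT x|\<nu>. (f x - h x) * e x) = (\<Sum>l<d j. b l * (LINT x|\<nu>. (f x - h x) * \<phi> j l x))"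
    unfolding b by (rule integral_mult_sum) (auto intro: sq_diff f hs phi_sq)
   also have "... = 0" unfolding h_def by (intro sum.neutral ballI) (simp add: inner)
   finally show ?thesis .
  qed
  then show "h \<in> E j \<and> (\<forall>e\<in>E j. (LINT x|\<nu>. (f x - h x) * e x) = 0)" using hE by blast
 next
  fix h' assume h': "h' \<in> E j \<and> (\<forall>e\<in>E j. (LINT x|\<nu>. (f x - h' x) * e x) = 0)"
  obtain b where b: "h' = (\<lambda>x. \<Sum>l<d j. b l * \<phi> j l x)" using phi_expansion h' by blast
  have "b k = (LINT x|\<nu>. f x * \<phi> j k x)" if k: "k < d j" for k
  proof -
   have "(LINT x|\<nu>. (f x - h' x) * \<phi> j k x) = 0" using h' phi_in[OF k] by blast
   then show ?thesis unfolding b inner[OF k] by simp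
  qed
  then show "h' = h" unfolding b by (simp add: h_def fun_eq_iff)
 qed
 then show ?thesis unfolding orth_proj_def h_def[abs_def] .
qed

lemma variation_norm_blocks:
 assumes f: "L2 f"
 shows "variation_norm M A g \<nu> \<mu> s f = (\<Sum>j. ennreal ((1 + \<mu> j) powr (s / 2) * block j f))"
proof -
 have "L2_norm \<nu> (orth_proj \<nu> (E j) f) = block j f" for j
  unfolding orth_proj_formula[OF f] L2_norm_def block_def by (subst orthonormal_sum_square[OF phi_orthonormal]) auto
 then show ?thesis by (simp add: variation_norm_def)
qed

lemma integral_indicator_M: "(LINT x|\<nu>. indicator M x * f x) = (LINT x|\<nu>. (f x :: real))"
 by (intro integral_eqI) (simp add: space_nu)

lemma phi_mean_zero:
 assumes "j > 0" "l < d j" shows "(LINT x|\<nu>. \<phi> j l x) = 0"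
proof -
 have "(LINT x|\<nu>. indicator M x * \<phi> j l x) = 0"
  using mu_pos[OF assms(1)] by (intro eigenspaces_orthogonal[OF indicator_eigenspace phi_in[OF assms(2)]]) simp
 then show ?thesis unfolding integral_indicator_M .
qed

lemma block_one: "block 0 (\<lambda>_. 1) = 1"
proof -
 obtain b where b: "(indicator M :: 'a \<Rightarrow> real) = (\<lambda>x. \<Sum>l<d 0. b l * \<phi> 0 l x)"
  using phi_expansion[of "indicator M" 0] indicator_eigenspace mu_0 by auto
 have "(LINT x|\<nu>. 1 * \<phi> 0 l x) = b l" if "l < d 0" for l
 proof -
  have "(LINT x|\<nu>. 1 * \<phi> 0 l x) = (LINT x|\<nu>. indicator M x * \<phi> 0 l x)" unfolding integral_indicator_M by simp
  also have "... = b l" unfolding b by (rule orthonormal_coefficient[OF phi_orthonormal]) (use that in auto)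
  finally show ?thesis .
 qed
 then have "(\<Sum>l<d 0. (LINT x|\<nu>. 1 * \<phi> 0 l x)^2) = (\<Sum>l<d 0. (b l)^2)" by (intro sum.cong) auto
 also have "... = (LINT x|\<nu>. (\<Sum>l<d 0. b l * \<phi> 0 l x)^2)"
  by (rule orthonormal_sum_square[OF phi_orthonormal, symmetric]) simp
 also have "... = (LINT x|\<nu>. indicator M x * indicator M x)" by (simp only: b power2_eq_square)
 also have "... = (LINT x|\<nu>. 1)" by (intro integral_eqI) (simp add: space_nu)
 also have "... = 1" using nu.prob_space by simp
 finally show ?thesis by (simp add: block_def)
qed

lemma mean_zero_if_orthogonal_E0:
 assumes f: "L2 f" and 0: "\<And>l. l < d 0 ==> (LINT x|\<nu>. f x * \<phi> 0 l x) = 0"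
 shows "(LINT x|\<nu>. f x) = 0"
proof -
 obtain b where b: "(indicator M :: 'a \<Rightarrow> real) = (\<lambda>x. \<Sum>l<d 0. b l * \<phi> 0 l x)"
  using phi_expansion[of "indicator M" 0] indicator_eigenspace mu_0 by auto
 have "(LINT x|\<nu>. f x) = (LINT x|\<nu>. f x * indicator M x)" using integral_indicator_M[of f] by (simp only: mult.commute)
 also have "... = (\<Sum>l<d 0. b l * (LINT x|\<nu>. f x * \<phi> 0 l x))"
  unfolding b by (rule integral_mult_sum[OF f]) (simp add: phi_sq)
 also have "... = 0" using 0 by simp
 finally show ?thesis .
qed

lemma one_sq: "L2 (\<lambda>_. c)" by (intro sq_bounded[OF nu.finite_measure_axioms, where B = "\<bar>c\<bar>"]) auto

text \<open>The constant 1 lies in the first block and has norm 1 there, and \<open>f\<close> has no component in this block; so the variation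
norms add up to at most \<open>R\<close>. Since \<open>f\<close> is bounded almost everywhere only, the density is clipped on a
null set.\<close>

lemma clipped_perturbation_in_class:
 assumes f: "L2 f" and 0: "\<And>l. l < d 0 ==> (LINT x|\<nu>. f x * \<phi> 0 l x) = 0"
  and sup: "AE x in \<nu>. \<bar>f x\<bar> <= 1 / 2"
  and var: "(\<Sum>j. ennreal ((1 + \<mu> j) powr (s / 2) * block j f)) <= ennreal (R - 1)" and R: "R > 1"
 defines "p \<equiv> \<lambda>x. max (1 / 2) (min (3 / 2) (1 + f x))"
 shows "p \<in> density_class M A g \<nu> \<mu> s R (1 / 2) (3 / 2)" and "AE x in \<nu>. p x = 1 + f x"
  and "(LINT x|\<nu>. p x) = 1" and "p \<in> borel_measurable \<nu>"
proof -
 show ae: "AE x in \<nu>. p x = 1 + f x" using sup by eventually_elim (auto simp: p_def min_def max_def)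
 have fm: "f \<in> borel_measurable \<nu>" using f by (simp add: square_integrable_def)
 show pm: "p \<in> borel_measurable \<nu>" unfolding p_def using fm by measurable
 have psq: "L2 p"
  by (rule sq_bounded[OF nu.finite_measure_axioms pm, where B = "3 / 2"], intro AE_I2) (simp add: p_def min_def max_def)
 have qsq: "L2 (\<lambda>x. 1 + f x)" by (rule sq_add[OF one_sq f])
 have "(LINT x|\<nu>. p x) = (LINT x|\<nu>. 1 + f x)"
  using ae pm qsq by (intro integral_cong_AE) (auto simp: square_integrable_def)
 also have "... = (LINT x|\<nu>. 1) + (LINT x|\<nu>. f x)"
  by (intro Bochner_Integration.integral_add sq_integrable[OF nu.finite_measure_axioms] one_sq f)
 also have "... = 1" using mean_zero_if_orthogonal_E0[OF f 0] nu.prob_space by simp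
 finally show p1: "(LINT x|\<nu>. p x) = 1" .
 have coef: "(LINT x|\<nu>. p x * \<phi> j l x) = (LINT x|\<nu>. 1 * \<phi> j l x) + (LINT x|\<nu>. f x * \<phi> j l x)" if l: "l < d j" for j l
 proof -
  have lm: "\<phi> j l \<in> borel_measurable \<nu>" using phi_sq[OF l] by (simp add: square_integrable_def)
  have "(LINT x|\<nu>. p x * \<phi> j l x) = (LINT x|\<nu>. (1 + f x) * \<phi> j l x)"
  proof (rule integral_cong_AE)
   show "(\<lambda>x. p x * \<phi> j l x) \<in> borel_measurable \<nu>" by (rule borel_measurable_times[OF pm lm])
   show "(\<lambda>x. (1 + f x) * \<phi> j l x) \<in> borel_measurable \<nu>" using fm lm by measurable
   show "AE x in \<nu>. p x * \<phi> j l x = (1 + f x) * \<phi> j l x" using ae by eventually_elim simp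
  qed
  also have "... = (LINT x|\<nu>. 1 * \<phi> j l x + f x * \<phi> j l x)" by (simp only: distrib_right)
  also have "... = (LINT x|\<nu>. 1 * \<phi> j l x) + (LINT x|\<nu>. f x * \<phi> j l x)"
   by (intro Bochner_Integration.integral_add sq_mult_integrable one_sq f phi_sq l)
  finally show ?thesis .
 qed
 have b0: "block 0 p = 1"
 proof -
  have "block 0 p = block 0 (\<lambda>_. 1)" unfolding block_def by (simp add: coef 0)
  then show ?thesis by (simp add: block_one)
 qed
 have bj: "block (Suc j) p = block (Suc j) f" for j unfolding block_def by (simp add: coef phi_mean_zero)
 have bnn: "0 <= block j h" for j h by (simp add: block_def sum_nonneg)
 have "variation_norm M A g \<nu> \<mu> s p = (\<Sum>j. ennreal ((1 + \<mu> j) powr (s / 2) * block j p))"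
  by (rule variation_norm_blocks[OF psq])
 also have "... = (\<Sum>j. ennreal ((1 + \<mu> (Suc j)) powr (s / 2) * block (Suc j) p)) + ennreal ((1 + \<mu> 0) powr (s / 2) * block 0 p)"
  using suminf_offset[of "\<lambda>j. ennreal ((1 + \<mu> j) powr (s / 2) * block j p)" 1] by (simp add: add.commute)
 also have "... = (\<Sum>j. ennreal ((1 + \<mu> (Suc j)) powr (s / 2) * block (Suc j) f)) + 1" by (simp add: bj b0 mu_0)
 also have "(\<Sum>j. ennreal ((1 + \<mu> (Suc j)) powr (s / 2) * block (Suc j) f)) <= (\<Sum>j. ennreal ((1 + \<mu> j) powr (s / 2) * block j f))"
  using suminf_offset[of "\<lambda>j. ennreal ((1 + \<mu> j) powr (s / 2) * block j f)" 1] by simp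
 also have "... <= ennreal (R - 1)" by (rule var)
 finally have "variation_norm M A g \<nu> \<mu> s p <= ennreal (R - 1) + 1" by (simp add: add_right_mono)
 also have "... = ennreal R" using R by (simp flip: ennreal_1 ennreal_plus)
 finally have vn: "variation_norm M A g \<nu> \<mu> s p <= ennreal R" .
 show "p \<in> density_class M A g \<nu> \<mu> s R (1 / 2) (3 / 2)"
  unfolding density_class_def using psq p1 vn by (auto intro!: AE_I2 simp: p_def min_def max_def)
qed

text \<open>The \<open>\<rho> i\<close> perturb the density, while the \<open>\<psi> i\<close> detect the signs; for most signs the two
sums are close in \<open>L\<^sup>2\<close>.\<close>

lemma minimax_risk_ge_hypercube:
 fixes I :: "'i set" and \<psi> \<rho> :: "'i \<Rightarrow> 'a \<Rightarrow> real"
 defines "F \<equiv> \<lambda>S x. \<Sum>i\<in>I. rsign S i * \<rho> i x"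
 assumes I: "finite I" and ons: "orthonormal_on \<nu> I \<psi>"
  and G: "G \<subseteq> Pow I" "4 * card G >= 3 * 2 ^ card I"
  and \<rho>: "\<And>i. i \<in> I ==> L2 (\<rho> i)" "\<And>i. i \<in> I ==> (LINT x|\<nu>. (\<rho> i x)^2) <= 1"
  and F0: "\<And>S l. S \<in> G ==> l < d 0 ==> (LINT x|\<nu>. F S x * \<phi> 0 l x) = 0"
  and sup: "\<And>S. S \<in> G ==> AE x in \<nu>. \<bar>\<delta> * F S x\<bar> <= 1 / 2"
  and var: "\<And>S. S \<in> G ==> (\<Sum>j. ennreal ((1 + \<mu> j) powr (s / 2) * block j (\<lambda>x. \<delta> * F S x))) <= ennreal (R - 1)"
  and err: "\<And>S. S \<in> G ==> (LINT x|\<nu>. (F S x - (\<Sum>i\<in>I. rsign S i * \<psi> i x))^2) <= real (card I) / 64"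
  and \<delta>: "\<delta> > 0" "real n * \<delta>^2 <= 1 / 2" and n: "n > 0" and R: "R > 1"
 shows "minimax_risk \<nu> n (density_class M A g \<nu> \<mu> s R (1 / 2) (3 / 2)) >= ennreal (\<delta>^2 * real (card I) / 64)"
 unfolding minimax_risk_def
proof (rule INF_greatest)
 let ?g = "\<lambda>S x. \<Sum>i\<in>I. rsign S i * \<psi> i x" and ?C = "density_class M A g \<nu> \<mu> s R (1 / 2) (3 / 2)" and ?e = "ennreal (\<delta>^2 * real (card I) / 64)"
 fix T assume T: "T \<in> estimators \<nu> n"
 define p where "p S = (\<lambda>x. max (1 / 2) (min (3 / 2) (1 + \<delta> * F S x)))" for S
 have F: "L2 (F S)" for S unfolding F_def by (intro sq_sum sq_cmult \<rho>(1))
 have sq: "L2 (\<lambda>x. \<delta> * F S x)" if S: "S \<in> G" for S by (rule sq_cmult[OF F])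
 have orth: "(LINT x|\<nu>. \<delta> * F S x * \<phi> 0 l x) = 0" if S: "S \<in> G" and l: "l < d 0" for S l
  using F0[OF S l] by (simp add: mult.assoc)
 have clip: "p S \<in> ?C" "AE x in \<nu>. p S x = 1 + \<delta> * F S x"
  "(LINT x|\<nu>. p S x) = 1" "p S \<in> borel_measurable \<nu>" if S: "S \<in> G" for S
  using clipped_perturbation_in_class[OF sq[OF S] orth[OF S] sup[OF S] var[OF S] R] by (simp_all only: p_def)
 have fm: "F S \<in> borel_measurable \<nu>" if S: "S \<in> G" for S using F by (simp add: square_integrable_def)
 have psim: "\<psi> i \<in> borel_measurable \<nu>" if "i \<in> I" for i
  using ons that by (simp add: orthonormal_on_def square_integrable_def)
 have "\<exists>S\<in>G. risk \<nu> n T (p S) >= ?e"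
 proof (rule assouad_risk[OF nu.prob_space_axioms I ons G _ _ _ _ _ \<delta> n T])
  fix S assume S: "S \<in> G"
  show pm: "p S \<in> borel_measurable \<nu>" by (rule clip(4)[OF S])
  show "(LINT x|\<nu>. p S x) = 1" by (rule clip(3)[OF S])
  show "p S x \<in> {1 / 2..3 / 2}" for x by (simp add: p_def min_def max_def)
  have ae: "AE x in \<nu>. p S x = 1 + \<delta> * F S x" by (rule clip(2)[OF S])
  have sm: "?g S \<in> borel_measurable \<nu>"
   using psim by (intro borel_measurable_sum borel_measurable_times borel_measurable_const)
  have "(LINT x|\<nu>. (p S x - (1 + \<delta> * ?g S x))^2)
    = (LINT x|\<nu>. \<delta>^2 * (F S x - ?g S x)^2)"
  proof (rule integral_cong_AE)
   show "(\<lambda>x. (p S x - (1 + \<delta> * ?g S x))^2) \<in> borel_measurable \<nu>" using pm sm by measurable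
   show "(\<lambda>x. \<delta>^2 * (F S x - ?g S x)^2) \<in> borel_measurable \<nu>" using fm[OF S] sm by measurable
   show "AE x in \<nu>. (p S x - (1 + \<delta> * ?g S x))^2 = \<delta>^2 * (F S x - ?g S x)^2"
    using ae by eventually_elim (simp add: algebra_simps flip: power_mult_distrib)
  qed
  also have "... = \<delta>^2 * (LINT x|\<nu>. (F S x - ?g S x)^2)" by simp
  also have "... <= \<delta>^2 * (real (card I) / 64)" by (intro mult_left_mono err[OF S]) simp
  finally show "(LINT x|\<nu>. (p S x - (1 + \<delta> * ?g S x))^2) <= \<delta>^2 * real (card I) / 64" by simp
  fix i assume i: "i \<in> I" "i \<notin> S" and S': "insert i S \<in> G"
  have ae': "AE x in \<nu>. p (insert i S) x = 1 + \<delta> * F (insert i S) x" by (rule clip(2)[OF S'])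
  have pm': "p (insert i S) \<in> borel_measurable \<nu>" by (rule clip(4)[OF S'])
  have "(LINT x|\<nu>. (p S x - p (insert i S) x)^2) = (LINT x|\<nu>. \<delta>^2 * (F S x - F (insert i S) x)^2)"
  proof (rule integral_cong_AE)
   show "(\<lambda>x. (p S x - p (insert i S) x)^2) \<in> borel_measurable \<nu>" using pm pm' by measurable
   show "(\<lambda>x. \<delta>^2 * (F S x - F (insert i S) x)^2) \<in> borel_measurable \<nu>" using fm[OF S] fm[OF S'] by measurable
   show "AE x in \<nu>. (p S x - p (insert i S) x)^2 = \<delta>^2 * (F S x - F (insert i S) x)^2"
    using ae ae' by eventually_elim (simp add: algebra_simps flip: power_mult_distrib)
  qed
  also have "... = \<delta>^2 * (LINT x|\<nu>. (F S x - F (insert i S) x)^2)" by simp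
  also have "F S x - F (insert i S) x = - 2 * \<rho> i x" for x
  proof -
   have "F S x - F (insert i S) x = (\<Sum>k\<in>I. if k = i then - 2 * \<rho> i x else 0)"
    unfolding F_def sum_subtractf[symmetric] by (intro sum.cong refl) (use i in \<open>auto simp: rsign_def\<close>)
   then show ?thesis using i I by simp
  qed
  then have "\<delta>^2 * (LINT x|\<nu>. (F S x - F (insert i S) x)^2) <= \<delta>^2 * 4"
   using \<rho>(2)[OF i(1)] by (intro mult_left_mono) (simp_all add: power_mult_distrib)
  finally show "(LINT x|\<nu>. (p S x - p (insert i S) x)^2) <= 4 * \<delta>^2" by simp
 qed
 then obtain S where S: "S \<in> G" "?e <= risk \<nu> n T (p S)" by blast
 have "p S \<in> ?C" by (rule clip(1)[OF S(1)])
 then have "risk \<nu> n T (p S) <= (SUP p\<in>?C. risk \<nu> n T p)" by (rule SUP_upper)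
 with S(2) show "?e <= (SUP p\<in>?C. risk \<nu> n T p)" by (rule order_trans)
qed

lemma block_cmult: "block j (\<lambda>x. a * f x) = \<bar>a\<bar> * block j f"
 by (simp add: block_def mult.assoc power_mult_distrib real_sqrt_mult flip: sum_distrib_left)

end

section \<open>The lower bound from one eigenspace\<close>

lemma card_good_signs:
 assumes I: "finite I" and b: "16 * card {S \<in> Pow I. \<not> P S} <= 2 ^ card I"
  and c: "16 * card {S \<in> Pow I. \<not> Q S} <= 2 ^ card I"
 shows "4 * card {S \<in> Pow I. P S \<and> Q S} >= 3 * 2 ^ card I"
proof -
 have fin: "finite (Pow I)" using I by simp
 let ?A = "{S \<in> Pow I. P S \<and> Q S}" and ?B = "{S \<in> Pow I. \<not> P S}" and ?C = "{S \<in> Pow I. \<not> Q S}"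
 have "card (Pow I) <= card (?A \<union> (?B \<union> ?C))" using fin by (intro card_mono) auto
 also have "... <= card ?A + card (?B \<union> ?C)" by (rule card_Un_le)
 also have "card (?B \<union> ?C) <= card ?B + card ?C" by (rule card_Un_le)
 finally have "2 ^ card I <= card {S \<in> Pow I. P S \<and> Q S} + (card {S \<in> Pow I. \<not> P S} + card {S \<in> Pow I. \<not> Q S})"
  using I by (simp add: card_Pow)
 then show ?thesis using b c by linarith
qed

lemma rsign_sq: "(rsign S i)^2 = 1" by (simp add: rsign_def)

locale spectral_growth = riemannian_spectrum M A g \<nu> \<mu> \<phi>
 for M :: "'a::t2_space set" and A :: "('a, 'n::finite) chart set"
  and g :: "('a, 'n) chart \<Rightarrow> real^'n \<Rightarrow> real^'n^'n" and \<nu> :: "'a measure"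
  and \<mu> :: "nat \<Rightarrow> real" and \<phi> :: "nat \<Rightarrow> nat \<Rightarrow> 'a \<Rightarrow> real" +
 fixes s \<gamma> cd CK L0 :: real
 assumes s: "0 < s" "s < \<gamma>" and cd: "cd > 0" and CK: "CK > 0" and L0: "L0 >= 1"
  and growth: "\<mu> j >= L0 ==> real (d j) >= cd * (1 + \<mu> j) powr \<gamma>"
  and kernel: "\<mu> j >= L0 ==> p \<in> M ==> (\<Sum>l<d j. (\<phi> j l p)^2) <= CK * real (d j)"
begin

abbreviation minimax :: "nat \<Rightarrow> real \<Rightarrow> ennreal" where
 "minimax n R \<equiv> minimax_risk \<nu> n (density_class M A g \<nu> \<mu> s R (1 / 2) (3 / 2))"

text \<open>With \<open>d = d j\<close> signs on a basis of \<open>E j\<close> and \<open>l = 1 + \<mu> j\<close>, the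
variation norm of the perturbation is \<open>l powr (s / 2) * \<delta> * sqrt d\<close>; this gives the second
term in the minimum that defines \<open>\<delta>\<^sup>2\<close> below. Then
\<open>\<delta>\<^sup>2 * d \<le> (R - 1)\<^sup>2 * l powr (- s)\<close>, so that the
\<open>2 * r\<close>-th power of the perturbation is of order \<open>l powr (D - s * r)\<close> and tends to 0 as
soon as \<open>s * r > D\<close>.\<close>

lemma minimax_eigenspace:
 assumes B: "B >= 1"
 shows "\<exists>c>0. \<forall>R>1. \<exists>T0\<ge>1. \<forall>n>0. \<forall>T\<ge>T0. \<forall>j. real n * (R - 1)^2 = T powr (s + \<gamma>) --> T <= 1 + \<mu> j --> 1 + \<mu> j <= B * T -->
  ennreal (c * ((R - 1)^2 * T powr (- s))) <= minimax n R"
proof -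
 let ?D = "CARD('n)"
 \<comment> \<open>the spare exponent 1 yields the decay \<open>T powr (- 1)\<close>, which absorbs all constants\<close>
 define r where "r = nat \<lceil>(real ?D + 1) / s\<rceil>"
 have "(real ?D + 1) / s <= real r" unfolding r_def by linarith
 then have rs: "real ?D + 1 <= s * real r" using s(1) by (simp add: field_simps)
 have r: "r > 0" using rs by (cases r) auto
 define C where "C = projection_constant r"
 have C: "C > 0" by (simp add: C_def projection_constant_pos)
 define c where "c = min (cd / 2) (B powr (- s)) / 64"
 have c0: "c > 0" using cd B by (simp add: c_def)
 have main: "ennreal (c * ((R - 1)^2 * T powr (- s))) <= minimax n R"
  if R: "R > 1" and T0: "1 + L0 <= T" "C * (4 * (CK * (R - 1)^2)) ^ r <= T" and n: "n > 0"
   and nT: "real n * (R - 1)^2 = T powr (s + \<gamma>)" and j: "T <= 1 + \<mu> j" "1 + \<mu> j <= B * T" for R n T j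
 proof -
  define a where "a = R - 1"
  have a: "a > 0" using R by (simp add: a_def)
  define l where "l = 1 + \<mu> j"
  have Tpos: "T >= 1" using T0(1) L0 by simp
  have l1: "l >= 1" "l > 0" using mu_nonneg[of j] by (auto simp: l_def)
  have mj: "\<mu> j >= L0" using j(1) T0(1) by simp
  have j0: "j \<noteq> 0"
  proof
   assume "j = 0"
   then show False using mj L0 mu_0 by simp
  qed
  have dj: "real (d j) > 0" using d_pos by simp
  define D2 where "D2 = min (1 / (2 * real n)) (a^2 / (real (d j) * l powr s))"
  have D2: "D2 > 0" using n a dj l1 by (simp add: D2_def)
  define \<delta> where "\<delta> = sqrt D2"
  have \<delta>: "\<delta> > 0" "\<delta>^2 = D2" using D2 by (auto simp: \<delta>_def)
  have nd: "real n * \<delta>^2 <= 1 / 2"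
  proof -
   have "real n * \<delta>^2 <= real n * (1 / (2 * real n))" unfolding \<delta>(2) D2_def by (intro mult_left_mono) auto
   then show ?thesis using n by simp
  qed
  have dd: "\<delta>^2 * real (d j) * l powr s <= a^2"
  proof -
   have "\<delta>^2 <= a^2 / (real (d j) * l powr s)" by (simp add: \<delta>(2) D2_def)
   then show ?thesis using dj l1 by (simp add: field_simps)
  qed
  define F where "F S x = (\<Sum>i<d j. rsign S i * \<phi> j i x)" for S x
  have coef: "(LINT x|\<nu>. F S x * \<phi> k m x) = (if k = j then rsign S m else 0)" if m: "m < d k" for S k m
  proof (cases "k = j")
   case True
   then show ?thesis unfolding F_def using orthonormal_coefficient[OF phi_orthonormal[of j], where a = "rsign S"] m by simp
  next
   case False
   have "F S \<in> E j" unfolding F_def by (rule E_sum) simp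
   then show ?thesis using eigenspaces_orthogonal[of "F S" "\<mu> j" "\<phi> k m" "\<mu> k"] phi_in[OF m] False mu_eq_iff by auto
  qed
  have self: "(\<Sum>k<d j. (LINT x|\<nu>. \<phi> j i x * \<phi> j k x) * \<phi> j k p) = \<phi> j i p" if "i < d j" for i p
  proof -
   have "(\<Sum>k<d j. (LINT x|\<nu>. \<phi> j i x * \<phi> j k x) * \<phi> j k p) = (\<Sum>k<d j. if i = k then \<phi> j k p else 0)"
    by (intro sum.cong refl) (simp add: phi_inner that)
   then show ?thesis using that by simp
  qed
  let ?ok = "\<lambda>S. AE p in \<nu>. F S p ^ (2 * r) <= C * (\<mu> j) ^ ?D * (CK * real (d j)) ^ r"
  have bad: "16 * card {S \<in> Pow {..<d j}. \<not> ?ok S} <= 2 ^ card {..<d j}"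
  proof -
   have "16 * card {S \<in> Pow {..<d j}. \<not> (AE p in \<nu>. (\<Sum>i<d j. rsign S i * (\<Sum>k<d j. (LINT x|\<nu>. \<phi> j i x * \<phi> j k x) * \<phi> j k p)) ^ (2 * r)
    <= C * (\<mu> j) ^ ?D * (CK * real (d j)) ^ r)} <= 2 ^ card {..<d j}"
    unfolding C_def
    by (rule random_projection_sup[OF r finite_lessThan finite_lessThan phi_orthonormal phi_orthonormal, where \<mu> = "\<lambda>_. \<mu> j"])
     (use phi_in mj L0 kernel[OF mj] CK in auto)
   moreover have "(\<Sum>i<d j. rsign S i * (\<Sum>k<d j. (LINT x|\<nu>. \<phi> j i x * \<phi> j k x) * \<phi> j k p)) = F S p" for S p
    unfolding F_def by (intro sum.cong refl) (simp add: self)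
   ultimately show ?thesis by simp
  qed
  define G where "G = {S \<in> Pow {..<d j}. ?ok S}"
  have G: "G \<subseteq> Pow {..<d j}" "4 * card G >= 3 * 2 ^ card {..<d j}"
   using card_good_signs[of "{..<d j}" ?ok "\<lambda>_. True"] bad by (auto simp: G_def)
  have key: "(\<delta>^2) ^ r * (C * (\<mu> j) ^ ?D * (CK * real (d j)) ^ r) <= (1 / 4) ^ r"
  proof -
   have "(\<delta>^2 * real (d j)) * l powr s * CK <= a^2 * CK" using dd CK by (intro mult_right_mono) auto
   then have e1: "\<delta>^2 * real (d j) * CK <= CK * a^2 * l powr (- s)" using l1 by (simp add: powr_minus field_simps)
   have "(\<delta>^2) ^ r * (C * (\<mu> j) ^ ?D * (CK * real (d j)) ^ r) = C * (\<mu> j) ^ ?D * (\<delta>^2 * real (d j) * CK) ^ r"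
    by (simp add: power_mult_distrib mult_ac)
   also have "... <= C * l ^ ?D * (CK * a^2 * l powr (- s)) ^ r"
   proof (rule mult_mono)
    show "C * (\<mu> j) ^ ?D <= C * l ^ ?D" using C mu_nonneg[of j] by (intro mult_left_mono power_mono) (auto simp: l_def)
    show "(\<delta>^2 * real (d j) * CK) ^ r <= (CK * a^2 * l powr (- s)) ^ r" using CK by (intro power_mono e1) auto
   qed (use C CK l1 in auto)
   also have "... = C * (CK * a^2) ^ r * (l ^ ?D * (l powr (- s)) ^ r)" by (simp add: power_mult_distrib mult_ac)
   also have "l ^ ?D * (l powr (- s)) ^ r = l powr (real ?D - s * real r)"
    using l1 by (simp add: powr_realpow[symmetric] powr_powr powr_add[symmetric])
   also have "... <= l powr (- 1)" using rs l1 by (intro powr_mono) auto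
   also have "... <= T powr (- 1)" using j(1) Tpos l1 by (simp add: powr_minus l_def field_simps)
   finally have "(\<delta>^2) ^ r * (C * (\<mu> j) ^ ?D * (CK * real (d j)) ^ r) <= C * (CK * a^2) ^ r * T powr (- 1)"
    using C CK by (simp add: mult_left_mono)
   also have "... <= (1 / 4) ^ r" using T0(2) Tpos by (simp add: powr_minus a_def power_mult_distrib power_divide field_simps)
   finally show ?thesis .
  qed
  have bl: "block k (F S) = (if k = j then sqrt (real (d j)) else 0)" for k S unfolding block_def by (simp add: coef rsign_sq)
  have "ennreal (\<delta>^2 * real (card {..<d j}) / 64) <= minimax n R"
  proof (rule minimax_risk_ge_hypercube[OF finite_lessThan phi_orthonormal G, where \<rho> = "\<phi> j" and \<delta> = \<delta>, folded F_def])
   show "L2 (\<phi> j i)" "(LINT x|\<nu>. (\<phi> j i x)^2) <= 1" if "i \<in> {..<d j}" for i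
    using that phi_sq phi_inner[of i j i] by (simp_all add: power2_eq_square)
   show "(LINT x|\<nu>. F S x * \<phi> 0 m x) = 0" if "m < d 0" for S m using coef[OF that] j0 by simp
   show "AE x in \<nu>. \<bar>\<delta> * F S x\<bar> <= 1 / 2" if S: "S \<in> G" for S
   proof -
    have "?ok S" using S by (simp add: G_def)
    then show ?thesis
    proof eventually_elim
     case (elim x)
     have "\<bar>\<delta> * F S x\<bar> ^ (2 * r) = (\<delta>^2) ^ r * F S x ^ (2 * r)"
      by (simp add: power_mult power_mult_distrib)
     also have "... <= (\<delta>^2) ^ r * (C * (\<mu> j) ^ ?D * (CK * real (d j)) ^ r)"
      using elim by (intro mult_left_mono) auto
     also have "... <= (1 / 4) ^ r" by (rule key)
     also have "... = (1 / 2 :: real) ^ (2 * r)" by (simp add: power_mult power_divide)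
     finally show ?case by (subst (asm) power_mono_iff) (use r in auto)
    qed
   qed
   show "(\<Sum>k. ennreal ((1 + \<mu> k) powr (s / 2) * block k (\<lambda>x. \<delta> * F S x))) <= ennreal (R - 1)" for S
   proof -
    have "(\<Sum>k. ennreal ((1 + \<mu> k) powr (s / 2) * block k (\<lambda>x. \<delta> * F S x)))
      = (\<Sum>k\<in>{j}. ennreal ((1 + \<mu> k) powr (s / 2) * block k (\<lambda>x. \<delta> * F S x)))"
     by (rule suminf_finite) (auto simp: block_cmult bl)
    also have "... = ennreal (l powr (s / 2) * (\<delta> * sqrt (real (d j))))"
     using \<delta>(1) by (simp add: block_cmult bl l_def)
    also have "... <= ennreal a"
    proof (rule ennreal_leI, rule power2_le_imp_le)
     have "(l powr (s / 2))^2 = l powr s" using l1 by (simp add: powr_power)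
     then show "(l powr (s / 2) * (\<delta> * sqrt (real (d j))))^2 <= a^2" using dd by (simp add: power_mult_distrib mult_ac)
    qed (use a in simp)
    finally show ?thesis by (simp add: a_def)
   qed
   show "(LINT x|\<nu>. (F S x - F S x)^2) <= real (card {..<d j}) / 64" for S by simp
  qed (use \<delta> nd n R in auto)
  moreover have "c * ((R - 1)^2 * T powr (- s)) <= \<delta>^2 * real (card {..<d j}) / 64"
  proof -
   have "min (cd / 2) (B powr (- s)) * (a^2 * T powr (- s)) <= D2 * real (d j)"
   proof -
    have e: "T powr \<gamma> = real n * (a^2 * T powr (- s))"
    proof -
     have "T powr \<gamma> = T powr (s + \<gamma>) * T powr (- s)" by (simp flip: powr_add)
     then show ?thesis using nT by (simp add: a_def)
    qed
    have "min (cd / 2) (B powr (- s)) * (a^2 * T powr (- s)) <= cd / 2 * (a^2 * T powr (- s))" by (intro mult_right_mono) auto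
    also have "... = cd * T powr \<gamma> / (2 * real n)" unfolding e using n by simp
    also have "... <= real (d j) / (2 * real n)"
    proof (rule divide_right_mono)
     have "cd * T powr \<gamma> <= cd * l powr \<gamma>" using cd j(1) Tpos s by (intro mult_left_mono powr_mono2) (auto simp: l_def)
     then show "cd * T powr \<gamma> <= real (d j)" using growth[OF mj] by (simp add: l_def)
    qed simp
    finally have 1: "min (cd / 2) (B powr (- s)) * (a^2 * T powr (- s)) <= 1 / (2 * real n) * real (d j)" by simp
    have "min (cd / 2) (B powr (- s)) * (a^2 * T powr (- s)) <= B powr (- s) * (a^2 * T powr (- s))"
     by (intro mult_right_mono) auto
    also have "... = a^2 * (B * T) powr (- s)" using B Tpos by (simp add: powr_mult)
    also have "... <= a^2 * l powr (- s)" using j(2) l1 s(1) by (intro mult_left_mono powr_mono2') (auto simp: l_def)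
    also have "... = a^2 / (real (d j) * l powr s) * real (d j)" using dj by (simp add: powr_minus field_simps)
    finally have 2: "min (cd / 2) (B powr (- s)) * (a^2 * T powr (- s)) <= a^2 / (real (d j) * l powr s) * real (d j)" .
    show ?thesis using 1 2 by (simp add: D2_def min_def)
   qed
   then show ?thesis by (simp add: c_def \<delta>(2) a_def)
  qed
  ultimately show ?thesis using ennreal_leI order_trans by blast
 qed
 have "\<exists>T0\<ge>1. \<forall>n>0. \<forall>T\<ge>T0. \<forall>j. real n * (R - 1)^2 = T powr (s + \<gamma>) --> T <= 1 + \<mu> j --> 1 + \<mu> j <= B * T -->
  ennreal (c * ((R - 1)^2 * T powr (- s))) <= minimax n R" if R: "R > 1" for R
  by (rule exI[of _ "max (1 + L0) (C * (4 * (CK * (R - 1)^2)) ^ r)"]) (use main[OF R] L0 in auto)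
 then show ?thesis using c0 by blast
qed

end

section \<open>Bumps and iterated Laplacians\<close>

definition tent :: "real^'n \<Rightarrow> real \<Rightarrow> real^'n \<Rightarrow> real" where
 "tent a h x = max 0 (1 - (x - a) \<bullet> (x - a) / h^2)"

text \<open>Families of functions that vanish to order \<open>N\<close> at the boundary of the ball of radius \<open>h\<close> about
\<open>a\<close> and, for \<open>N \<ge> 1\<close>, also outside. They are built from powers of \<open>tent\<close> with
smooth coefficients; \<open>lin\<close> and \<open>scale\<close> make the class closed under \<open>h\<close> times a derivative,
which lowers \<open>N\<close> by one.\<close>

inductive oscillating :: "(real^'n::finite) set \<Rightarrow> nat \<Rightarrow> (real^'n \<Rightarrow> real \<Rightarrow> real^'n \<Rightarrow> real) \<Rightarrow> bool" for U where
 base: "smooth_on U b ==> N <= j ==> oscillating U N (\<lambda>a h x. b x * tent a h x ^ j)"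
| add: "oscillating U N f ==> oscillating U N f' ==> oscillating U N (\<lambda>a h x. f a h x + f' a h x)"
| lin: "oscillating U N f ==> oscillating U N (\<lambda>a h x. (x - a) $ i / h * f a h x)"
| scale: "oscillating U N f ==> oscillating U N (\<lambda>a h x. h * f a h x)"

lemma tent_bounds: "0 <= tent a h x" "tent a h x <= 1" by (auto simp: tent_def)

lemma tent_outside:
 assumes "0 < h" "h <= norm (x - a)" shows "tent a h x = 0"
proof -
 have "h^2 <= (x - a) \<bullet> (x - a)" using assms by (simp add: power_mono flip: power2_norm_eq_inner)
 then have "1 <= (x - a) \<bullet> (x - a) / h^2" using assms(1) by simp
 then show ?thesis by (simp add: tent_def)
qed

lemma tent_inside:
 assumes "0 < h" "norm (x - a) <= h / 2" shows "1 / 2 <= tent a h x"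
proof -
 have "(x - a) \<bullet> (x - a) <= (h / 2)^2" using assms by (simp add: power_mono flip: power2_norm_eq_inner)
 then have "(x - a) \<bullet> (x - a) / h^2 <= 1 / 4" using assms(1) by (simp add: field_simps)
 then have "1 / 2 <= 1 - (x - a) \<bullet> (x - a) / h^2" by linarith
 then show ?thesis unfolding tent_def by (rule order_trans) (rule max.cobounded2)
qed

lemma oscillating_mono: "oscillating U N f ==> N' <= N ==> oscillating U N' f"
proof (induction rule: oscillating.induct)
 case (lin N f i)
 then show ?case by (intro oscillating.lin)
qed (auto intro: oscillating.intros)

lemma oscillating_zero: "open U ==> oscillating U N (\<lambda>a h x. 0)"
 using oscillating.base[of U "\<lambda>_. 0" N N] by (simp add: smooth_on_def)

lemma oscillating_sum:
 assumes "open U" "finite I" "\<And>i. i \<in> I ==> oscillating U N (f i)"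
 shows "oscillating U N (\<lambda>a h x. \<Sum>i\<in>I. f i a h x)"
 using assms(2,3) by (induction rule: finite_induct) (auto intro: oscillating.add oscillating_zero[OF assms(1)])

lemma oscillating_mult_smooth:
 assumes U: "open U" and b: "smooth_on U b" and f: "oscillating U N f"
 shows "oscillating U N (\<lambda>a h x. b x * f a h x)"
 using f
proof (induction rule: oscillating.induct)
 case (base b' N j)
 have "smooth_on U (\<lambda>x. b x * b' x)" using b base(1) Ck_on_mult[OF U] by (auto simp: smooth_on_def)
 from oscillating.base[OF this base(2)] show ?case by (simp add: mult.assoc)
next
 case (add N f f')
 from oscillating.add[OF add.IH] show ?case by (simp add: distrib_left)
next
 case (lin N f i)
 from oscillating.lin[OF lin.IH, of i] show ?case by (simp add: mult.left_commute)
next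
 case (scale N f)
 from oscillating.scale[OF scale.IH] show ?case by (simp add: mult.left_commute)
qed

lemma oscillating_bounded:
 assumes f: "oscillating U N f" and N: "N >= 1" and K: "compact K" "K \<subseteq> U"
 shows "(\<exists>C\<ge>0. \<forall>a h x. 0 < h --> h <= 1 --> x \<in> K --> \<bar>f a h x\<bar> <= C) \<and>
  (\<forall>a h x. 0 < h --> h <= norm (x - a) --> f a h x = 0)"
 using f N
proof (induction rule: oscillating.induct)
 case (base b N j)
 have "Ck_on 0 U b" using base(1) unfolding smooth_on_def by blast
 then have "continuous_on K b" using continuous_on_subset K(2) by auto
 then have "bounded (b ` K)" using compact_continuous_image[OF _ K(1)] compact_imp_bounded by blast
 then obtain C where C: "\<And>x. x \<in> K ==> \<bar>b x\<bar> <= C" by (auto simp: bounded_iff)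
 have "\<bar>b x * tent a h x ^ j\<bar> <= max 0 C" if "x \<in> K" for a h x
 proof -
  have "\<bar>b x\<bar> * tent a h x ^ j <= max 0 C * 1"
   using C[OF that] tent_bounds[of a h x] by (intro mult_mono power_le_one) auto
  then show ?thesis using tent_bounds[of a h x] by (simp add: abs_mult)
 qed
 moreover have "b x * tent a h x ^ j = 0" if "0 < h" "h <= norm (x - a)" for a h x using tent_outside[OF that] base(2,3) by simp
 ultimately show ?case by (intro conjI exI[of _ "max 0 C"]) auto
next
 case (add N f f')
 obtain C where C: "C >= 0" "\<And>a h x. 0 < h ==> h <= 1 ==> x \<in> K ==> \<bar>f a h x\<bar> <= C" using add by blast
 obtain C' where C': "C' >= 0" "\<And>a h x. 0 < h ==> h <= 1 ==> x \<in> K ==> \<bar>f' a h x\<bar> <= C'" using add by blast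
 have "\<bar>f a h x + f' a h x\<bar> <= C + C'" if "0 < h" "h <= 1" "x \<in> K" for a h x
  using C(2)[OF that, of a] C'(2)[OF that, of a] by linarith
 then show ?case using add C(1) C'(1) by (intro conjI exI[of _ "C + C'"]) auto
next
 case (lin N f i)
 obtain C where C: "C >= 0" "\<And>a h x. 0 < h ==> h <= 1 ==> x \<in> K ==> \<bar>f a h x\<bar> <= C" using lin by blast
 have "\<bar>(x - a) $ i / h * f a h x\<bar> <= C" if "0 < h" "h <= 1" "x \<in> K" for a h x
 proof (cases "h <= norm (x - a)")
  case True
  then have "f a h x = 0" using lin that by blast
  then show ?thesis using C(1) by simp
 next
  case False
  have "\<bar>(x - a) $ i\<bar> <= h" using component_le_norm_cart[of "x - a" i] False by linarith
  then have "\<bar>(x - a) $ i / h\<bar> <= 1" using that by simp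
  then have "\<bar>(x - a) $ i / h\<bar> * \<bar>f a h x\<bar> <= 1 * C" using C(2)[OF that, of a] by (intro mult_mono) auto
  then show ?thesis by (simp only: abs_mult mult_1)
 qed
 moreover have "(x - a) $ i / h * f a h x = 0" if "0 < h" "h <= norm (x - a)" for a h x using lin that by simp
 ultimately show ?case using C(1) by blast
next
 case (scale N f)
 obtain C where C: "C >= 0" "\<And>a h x. 0 < h ==> h <= 1 ==> x \<in> K ==> \<bar>f a h x\<bar> <= C" using scale by blast
 have "\<bar>h * f a h x\<bar> <= C" if "0 < h" "h <= 1" "x \<in> K" for a h x
 proof -
  have "h * \<bar>f a h x\<bar> <= 1 * C" using C(2)[OF that, of a] that by (intro mult_mono) auto
  then show ?thesis using that by (simp add: abs_mult)
 qed
 moreover have "h * f a h x = 0" if "0 < h" "h <= norm (x - a)" for a h x using scale that by simp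
 ultimately show ?case using C(1) by blast
qed

lemma tent_power_derivative:
 assumes h: "0 < h"
 shows "((\<lambda>x. tent a h x ^ Suc (Suc n)) has_derivative
  (\<lambda>v. real (Suc (Suc n)) * tent a h x ^ Suc n * (- 2 * ((x - a) \<bullet> v) / h^2))) (at x)"
proof -
 have q: "((\<lambda>x. 1 - (x - a) \<bullet> (x - a) / h^2) has_derivative (\<lambda>v. - 2 * ((x - a) \<bullet> v) / h^2)) (at x)"
 proof -
  have "((\<lambda>x. 1 - ((x - a) \<bullet> (x - a)) * c) has_derivative (\<lambda>v. - 2 * ((x - a) \<bullet> v) * c)) (at x)" for c
   by (auto intro!: derivative_eq_intros simp: inner_commute)
  from this[of "1 / h^2"] show ?thesis by simp
 qed
 from has_derivative_compose[OF q max_0_power_has_derivative[of n "1 - (x - a) \<bullet> (x - a) / h^2", unfolded has_field_derivative_def]]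
 show ?thesis by (simp only: tent_def)
qed

text \<open>A derivative produces the factor \<open>1 / h\<close>. It hits either a power of \<open>tent\<close>, or the factor
\<open>(x - a) $ i / h\<close>, or the smooth coefficient; in the last case the constructor \<open>scale\<close>
supplies a factor \<open>h\<close> to keep the form.\<close>

lemma oscillating_derivative:
 assumes U: "open U" and f: "oscillating U M f" and M: "M = Suc N" "N >= 1"
 shows "\<exists>G. (\<forall>i. oscillating U N (G i)) \<and>
  (\<forall>a h x. 0 < h --> x \<in> U --> (f a h has_derivative (\<lambda>v. (\<chi> i. G i a h x / h) \<bullet> v)) (at x))"
 using f M
proof (induction rule: oscillating.induct)
 case (base b M j)
 then obtain n where n: "j = Suc (Suc n)" by (metis Suc_le_D Suc_le_mono One_nat_def)
 have b: "Ck_on k U b" for k using base(1) by (simp add: smooth_on_def)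
 have db: "smooth_on U (partial i b)" for i unfolding smooth_on_def by (intro allI Ck_on_partial b)
 have sb: "smooth_on U (\<lambda>x. - 2 * real j * b x)" unfolding smooth_on_def by (intro allI Ck_on_mult Ck_on_const U b)
 define G where "G i = (\<lambda>a h x. (x - a) $ i / h * ((- 2 * real j * b x) * tent a h x ^ Suc n) + h * (partial i b x * tent a h x ^ j))" for i
 have "oscillating U N (G i)" for i
  unfolding G_def using base(2,3) n
  by (intro oscillating.add oscillating.lin oscillating.scale oscillating.base[OF sb] oscillating.base[OF db]) auto
 moreover have "((\<lambda>x. b x * tent a h x ^ j) has_derivative (\<lambda>v. (\<chi> i. G i a h x / h) \<bullet> v)) (at x)" if h: "0 < h" and x: "x \<in> U" for a h x
 proof -
  have "b differentiable (at x)" using b[of "Suc 0"] x by simp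
  from has_derivative_mult[OF has_derivative_grad[OF this] tent_power_derivative[OF h, of a n x]]
  have D: "((\<lambda>x. b x * tent a h x ^ j) has_derivative
   (\<lambda>v. b x * (real j * tent a h x ^ Suc n * (- 2 * ((x - a) \<bullet> v) / h^2)) + grad b x \<bullet> v * tent a h x ^ j)) (at x)"
   unfolding n .
  have G: "(\<chi> i. G i a h x / h) = (b x * real j * tent a h x ^ Suc n * (- 2) / h^2) *\<^sub>R (x - a) + tent a h x ^ j *\<^sub>R grad b x"
   using h by (simp add: vec_eq_iff G_def grad_def field_simps power2_eq_square)
  show ?thesis by (rule has_derivative_eq_rhs[OF D]) (simp add: G inner_add_left inner_diff_left fun_eq_iff algebra_simps diff_divide_distrib)
 qed
 ultimately show ?case by blast
next
 case (add M f f')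
 obtain G where G: "\<And>i. oscillating U N (G i)"
  "\<And>a h x. 0 < h ==> x \<in> U ==> (f a h has_derivative (\<lambda>v. (\<chi> i. G i a h x / h) \<bullet> v)) (at x)"
  using add.IH(1)[OF add.prems] by blast
 obtain G' where G': "\<And>i. oscillating U N (G' i)"
  "\<And>a h x. 0 < h ==> x \<in> U ==> (f' a h has_derivative (\<lambda>v. (\<chi> i. G' i a h x / h) \<bullet> v)) (at x)"
  using add.IH(2)[OF add.prems] by blast
 show ?case
 proof (intro exI[of _ "\<lambda>i a h x. G i a h x + G' i a h x"] conjI allI impI)
  show "oscillating U N (\<lambda>a h x. G i a h x + G' i a h x)" for i by (rule oscillating.add[OF G(1) G'(1)])
  fix a h x assume h: "(0::real) < h" and x: "x \<in> U"
  have e: "(\<chi> i. (G i a h x + G' i a h x) / h) = (\<chi> i. G i a h x / h) + (\<chi> i. G' i a h x / h)"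
   by (simp add: vec_eq_iff add_divide_distrib)
  show "((\<lambda>x. f a h x + f' a h x) has_derivative (\<lambda>v. (\<chi> i. (G i a h x + G' i a h x) / h) \<bullet> v)) (at x)"
   using has_derivative_add[OF G(2)[OF h x] G'(2)[OF h x]] unfolding e inner_add_left .
 qed
next
 case (lin M f k)
 obtain G where G: "\<And>i. oscillating U N (G i)"
  "\<And>a h x. 0 < h ==> x \<in> U ==> (f a h has_derivative (\<lambda>v. (\<chi> i. G i a h x / h) \<bullet> v)) (at x)"
  using lin.IH[OF lin.prems] by blast
 have fN: "oscillating U N f" using lin.hyps lin.prems by (auto intro: oscillating_mono)
 define H where "H i = (\<lambda>a h x. (if i = k then f a h x else 0) + (x - a) $ k / h * G i a h x)" for i
 show ?case
 proof (intro exI[of _ H] conjI allI impI)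
  have "oscillating U N (\<lambda>a h x. if i = k then f a h x else 0)" for i
   using fN oscillating_zero[OF U] by (cases "i = k") simp_all
  then show "oscillating U N (H i)" for i unfolding H_def by (intro oscillating.add oscillating.lin G(1))
  fix a h x assume h: "(0::real) < h" and x: "x \<in> U"
  have c: "((\<lambda>x. (x - a) $ k / h) has_derivative (\<lambda>v. v $ k / h)) (at x)"
   using h by (auto intro!: derivative_eq_intros bounded_linear_imp_has_derivative bounded_linear_vec_nth simp: vector_minus_component)
  have e: "(\<chi> i. H i a h x / h) = ((x - a) $ k / h) *\<^sub>R (\<chi> i. G i a h x / h) + (f a h x / h) *\<^sub>R axis k 1"
   by (simp add: vec_eq_iff H_def add_divide_distrib axis_def)
  show "((\<lambda>x. (x - a) $ k / h * f a h x) has_derivative (\<lambda>v. (\<chi> i. H i a h x / h) \<bullet> v)) (at x)"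
   by (rule has_derivative_eq_rhs[OF has_derivative_mult[OF c G(2)[OF h x]]])
    (simp add: e inner_add_left fun_eq_iff inner_axis')
 qed
next
 case (scale M f)
 obtain G where G: "\<And>i. oscillating U N (G i)"
  "\<And>a h x. 0 < h ==> x \<in> U ==> (f a h has_derivative (\<lambda>v. (\<chi> i. G i a h x / h) \<bullet> v)) (at x)"
  using scale.IH[OF scale.prems] by blast
 show ?case
 proof (intro exI[of _ "\<lambda>i a h x. h * G i a h x"] conjI allI impI)
  show "oscillating U N (\<lambda>a h x. h * G i a h x)" for i by (rule oscillating.scale[OF G(1)])
  fix a h x assume h: "(0::real) < h" and x: "x \<in> U"
  have e: "(\<chi> i. h * G i a h x / h) = h *\<^sub>R (\<chi> i. G i a h x / h)" by (simp add: vec_eq_iff)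
  show "((\<lambda>x. h * f a h x) has_derivative (\<lambda>v. (\<chi> i. h * G i a h x / h) \<bullet> v)) (at x)"
   using has_derivative_mult_right[OF G(2)[OF h x], of h] unfolding e inner_scaleR_left by simp
 qed
qed

lemma oscillating_partial:
 assumes U: "open U" and f: "oscillating U (Suc N) f" and N: "N >= 1"
 shows "\<exists>G. (\<forall>i. oscillating U N (G i)) \<and>
  (\<forall>a h x i. 0 < h --> x \<in> U --> f a h differentiable (at x) \<and> partial i (f a h) x = G i a h x / h)"
proof -
 obtain G where G: "\<And>i. oscillating U N (G i)"
  "\<And>a h x. 0 < h ==> x \<in> U ==> (f a h has_derivative (\<lambda>v. (\<chi> i. G i a h x / h) \<bullet> v)) (at x)"
  using oscillating_derivative[OF U f refl N] by blast
 have "f a h differentiable (at x) \<and> partial i (f a h) x = G i a h x / h" if h: "0 < h" and x: "x \<in> U" for a h x i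
 proof
  show "f a h differentiable (at x)" using G(2)[OF h x] by (rule differentiableI)
  show "partial i (f a h) x = G i a h x / h"
   using arg_cong[OF grad_unique[OF G(2)[OF h x]], of "\<lambda>v. v $ i"] by (simp add: grad_def)
 qed
 then show ?thesis using G(1) by blast
qed

lemma Ck_on_if_partial:
 assumes "open U" "\<And>x. x \<in> U ==> f differentiable (at x)" "\<And>i. Ck_on k U (partial i f)"
 shows "Ck_on (Suc k) U f"
proof -
 have "Ck_on k U (\<lambda>x. frechet_derivative f (at x) b)" if b: "b \<in> Basis" for b
 proof -
  obtain i where "b = axis i 1" using b by (auto simp: Basis_vec_def)
  then show ?thesis using assms(3)[of i] by (simp add: partial_def[abs_def])
 qed
 then show ?thesis using assms(2) by simp
qed

lemma oscillating_Ck: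
 assumes U: "open U" and f: "oscillating U (Suc (Suc k)) f" and h: "0 < h"
 shows "Ck_on k U (f a h)"
 using f
proof (induction k arbitrary: f)
 case 0
 then obtain G where "\<And>a h x i. 0 < h ==> x \<in> U ==> f a h differentiable (at x) \<and> partial i (f a h) x = G i a h x / h"
  using oscillating_partial[OF U 0] by auto
 then have "\<forall>x\<in>U. f a h differentiable (at x)" using h by blast
 then show ?case by (auto intro!: continuous_at_imp_continuous_on differentiable_imp_continuous_within)
next
 case (Suc k)
 have k: "Suc (Suc k) >= 1" by simp
 obtain G where G: "\<And>i. oscillating U (Suc (Suc k)) (G i)"
  "\<And>a h x i. 0 < h ==> x \<in> U ==> f a h differentiable (at x) \<and> partial i (f a h) x = G i a h x / h"
  using oscillating_partial[OF U Suc.prems k] by blast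
 have "Ck_on k U (\<lambda>x. (1 / h) * G i a h x)" for i by (intro Ck_on_mult Ck_on_const U Suc.IH G(1))
 then have "Ck_on k U (partial i (f a h))" for i
  using Ck_on_cong[OF U, of "partial i (f a h)" "\<lambda>x. (1 / h) * G i a h x" k] G(2)[OF h] by simp
 then show ?case using Ck_on_if_partial[OF U, of "f a h" k] G(2)[OF h] by blast
qed

lemma grad_cmult: "F differentiable (at y) ==> grad (\<lambda>z. a * F z) y = a *\<^sub>R grad F y"
 using grad_mult[of "\<lambda>_. a" y F] by simp

context riemannian_probability
begin

text \<open>Two derivatives with smooth coefficients give the factor \<open>1 / h\<^sup>2\<close> and lower the order by two.\<close>

lemma oscillating_lap:
 assumes c: "c \<in> A" and f: "oscillating (chart_image c) (Suc (Suc N)) f" and N: "N >= 1"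
 shows "\<exists>q. oscillating (chart_image c) N q \<and>
  (\<forall>a h x. 0 < h --> x \<in> chart_image c --> lap c (f a h) x = - (q a h x / h^2))"
proof -
 let ?U = "chart_image c"
 note U = chart_image_open[OF c]
 have N1: "Suc N >= 1" by simp
 obtain G where G: "\<And>i. oscillating ?U (Suc N) (G i)"
  "\<And>a h x i. 0 < h ==> x \<in> ?U ==> f a h differentiable (at x) \<and> partial i (f a h) x = G i a h x / h"
  using oscillating_partial[OF U f N1] by blast
 define Q where "Q i = (\<lambda>a h x. \<Sum>j\<in>UNIV. sqrt (det (g c x)) * matrix_inv (g c x) $ i $ j * G j a h x)" for i
 have Q: "oscillating ?U (Suc N) (Q i)" for i
 proof -
  have "smooth_on ?U (\<lambda>x. sqrt (det (g c x)) * matrix_inv (g c x) $ i $ j)" for j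
   unfolding smooth_on_def by (intro allI Ck_on_mult[OF U sqrt_det_Ck[OF c] inverse_metric_Ck[OF c]])
  then show ?thesis unfolding Q_def by (intro oscillating_sum[OF U finite] oscillating_mult_smooth[OF U] G(1))
 qed
 have flux: "flux c (f a h) i x = (1 / h) * Q i a h x" if "0 < h" "x \<in> ?U" for a h x i
  using G(2)[OF that] by (simp add: flux_def Q_def sum_divide_distrib)
 have "\<forall>i. \<exists>P. (\<forall>k. oscillating ?U N (P k)) \<and>
  (\<forall>a h x k. 0 < h --> x \<in> ?U --> Q i a h differentiable (at x) \<and> partial k (Q i a h) x = P k a h x / h)"
  using oscillating_partial[OF U Q N] by blast
 then obtain P where "\<forall>i. (\<forall>k. oscillating ?U N (P i k)) \<and>
  (\<forall>a h x k. 0 < h --> x \<in> ?U --> Q i a h differentiable (at x) \<and> partial k (Q i a h) x = P i k a h x / h)"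
  by (rule exE[OF choice])
 then have P: "\<And>i k. oscillating ?U N (P i k)"
  "\<And>i a h x k. 0 < h ==> x \<in> ?U ==> Q i a h differentiable (at x) \<and> partial k (Q i a h) x = P i k a h x / h"
  by blast+
 have pf: "partial i (flux c (f a h) i) x = P i i a h x / h^2" if h: "0 < h" and x: "x \<in> ?U" for a h x i
 proof -
  have dQ: "Q i a h differentiable (at x)" using P(2)[OF h x] by blast
  have "grad (flux c (f a h) i) x = grad (\<lambda>x. (1 / h) * Q i a h x) x"
   by (rule grad_cong[OF U x flux[OF h, symmetric] differentiable_mult[OF differentiable_const dQ]])
  also have "... = (1 / h) *\<^sub>R grad (Q i a h) x" by (rule grad_cmult[OF dQ])
  finally have "grad (flux c (f a h) i) x $ i = ((1 / h) *\<^sub>R grad (Q i a h) x) $ i" by (rule arg_cong)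
  then have "partial i (flux c (f a h) i) x = (1 / h) * partial i (Q i a h) x" by (simp add: grad_def)
  then show ?thesis using P(2)[OF h x, of i a i] by (simp add: power2_eq_square)
 qed
 define q where "q = (\<lambda>a h x. \<Sum>i\<in>UNIV. - 1 * inverse (sqrt (det (g c x))) * P i i a h x)"
 have nz: "sqrt (det (g c x)) \<noteq> 0" if "x \<in> ?U" for x using det_pos[OF c that] by simp
 have sm: "smooth_on ?U (\<lambda>x. - 1 * inverse (sqrt (det (g c x))))"
  unfolding smooth_on_def by (intro allI Ck_on_mult[OF U Ck_on_const[OF U] Ck_on_inverse[OF U sqrt_det_Ck[OF c] nz]])
 have "oscillating ?U N q" unfolding q_def by (intro oscillating_sum[OF U finite] oscillating_mult_smooth[OF U sm] P(1))
 moreover have "lap c (f a h) x = - (q a h x / h^2)" if "0 < h" "x \<in> ?U" for a h x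
 proof -
  have "q a h x = - (\<Sum>i\<in>UNIV. P i i a h x) / sqrt (det (g c x))"
   by (simp add: q_def sum_negf divide_inverse mult.commute flip: sum_distrib_left)
  moreover have "(\<Sum>i\<in>UNIV. partial i (flux c (f a h) i) x) = (\<Sum>i\<in>UNIV. P i i a h x) / h^2"
   by (simp add: pf[OF that] sum_divide_distrib)
  ultimately show ?thesis by (simp add: lap_def)
 qed
 ultimately show ?thesis by blast
qed

text \<open>The family \<open>q\<close> is \<open>h ^ (2 * k)\<close> times the \<open>k\<close>-th power of minus the Laplacian of
\<open>f\<close>, and moving this operator onto the eigenfunction \<open>u\<close> produces the factor \<open>l ^ k\<close>.
Order 4 at the end leaves enough derivatives for the integrations by parts.\<close>

lemma oscillating_iterated_lap:
 assumes c: "c \<in> A" and f: "oscillating (chart_image c) (4 + 2 * k) f"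
 shows "\<exists>q. oscillating (chart_image c) 4 q \<and>
  (\<forall>a h l u. 0 < h --> cball a h \<subseteq> chart_image c --> u \<in> eigenspace M A g l -->
   (LINT y|lborel. sqrt_det c y * (q a h y * u (chart_inv c y)))
    = (l * h^2) ^ k * (LINT y|lborel. sqrt_det c y * (f a h y * u (chart_inv c y))))"
 using f
proof (induction k arbitrary: f)
 case 0
 then show ?case by (intro exI[of _ f]) simp
next
 case (Suc k)
 let ?U = "chart_image c"
 note U = chart_image_open[OF c]
 have f: "oscillating ?U (Suc (Suc (4 + 2 * k))) f" using Suc.prems by simp
 obtain f1 where f1: "oscillating ?U (4 + 2 * k) f1"
  "\<And>a h x. 0 < h ==> x \<in> ?U ==> lap c (f a h) x = - (f1 a h x / h^2)" using oscillating_lap[OF c f] by auto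
 obtain q where q: "oscillating ?U 4 q"
  "\<And>a h l u. 0 < h ==> cball a h \<subseteq> ?U ==> u \<in> eigenspace M A g l ==>
   (LINT y|lborel. sqrt_det c y * (q a h y * u (chart_inv c y)))
    = (l * h^2) ^ k * (LINT y|lborel. sqrt_det c y * (f1 a h y * u (chart_inv c y)))" using Suc.IH[OF f1(1)] by blast
 have "(LINT y|lborel. sqrt_det c y * (f1 a h y * u (chart_inv c y)))
   = l * h^2 * (LINT y|lborel. sqrt_det c y * (f a h y * u (chart_inv c y)))"
  if h: "0 < h" and b: "cball a h \<subseteq> ?U" and u: "u \<in> eigenspace M A g l" for a h l u
 proof -
  let ?u = "\<lambda>y. u (chart_inv c y)"
  have vanish: "f a h y = 0" if "y \<notin> cball a h" for y
   using oscillating_bounded[OF f, of "{}"] h that by (auto simp: dist_norm norm_minus_commute)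
  have fC: "Ck_on (Suc (Suc 0)) ?U (f a h)" by (rule oscillating_Ck[OF U oscillating_mono[OF f] h]) simp
  have "(LINT y|lborel. sqrt_det c y * (f1 a h y * ?u y)) = (LINT y|lborel. - (h^2) * (sqrt_det c y * (?u y * lap c (f a h) y)))"
   by (intro integral_eqI) (use h in \<open>auto simp: sqrt_det_def f1(2)\<close>)
  also have "... = - (h^2) * (LINT y|lborel. sqrt_det c y * (f a h y * lap c ?u y))"
   using chart_lap_symmetric[OF c compact_cball b eigen_Ck[OF u c] fC] vanish by simp
  also have "(LINT y|lborel. sqrt_det c y * (f a h y * lap c ?u y)) = (LINT y|lborel. - l * (sqrt_det c y * (f a h y * ?u y)))"
   by (intro integral_eqI) (auto simp: sqrt_det_def eigen_lap[OF u c])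
  finally show ?thesis by simp
 qed
 then show ?case using q by (intro exI[of _ q]) (auto simp: power_Suc2 mult_ac)
qed

definition extend :: "('a, 'n) chart \<Rightarrow> (real^'n \<Rightarrow> real) \<Rightarrow> 'a \<Rightarrow> real" where
 "extend c F p = (if p \<in> chart_dom c then F (chart_map c p) else 0)"

lemma extend_sq:
 assumes c: "c \<in> A" and F: "continuous_on (chart_image c) F" and B: "\<And>y. y \<in> chart_image c ==> \<bar>F y\<bar> <= B"
 shows "L2 (extend c F)"
proof (rule sq_bounded[OF nu.finite_measure_axioms, where B = "\<bar>B\<bar>"])
 have "continuous_on (chart_dom c) (\<lambda>p. F (chart_map c p))"
  by (rule continuous_on_compose2[OF F chart_map_continuous[OF c]]) auto
 then have "(\<lambda>p. F (chart_map c p)) \<in> borel_measurable (restrict_space borel (chart_dom c))"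
  by (rule borel_measurable_continuous_on_restrict)
 moreover have "sets (restrict_space \<nu> (chart_dom c)) = sets (restrict_space borel (chart_dom c))"
  using dom_subset[OF c] by (subst sets_restrict_space_cong[OF sets_nu]) (simp add: sets_restrict_restrict_space Int_absorb1)
 ultimately have m: "(\<lambda>p. F (chart_map c p)) \<in> borel_measurable (restrict_space \<nu> (chart_dom c))"
  using measurable_cong_sets by blast
 show "extend c F \<in> borel_measurable \<nu>"
  unfolding extend_def[abs_def]
 proof (subst measurable_If_restrict_space_iff)
  have "{x \<in> M. x \<in> chart_dom c} = chart_dom c" using dom_subset[OF c] by blast
  then show "{x \<in> space \<nu>. x \<in> chart_dom c} \<in> sets \<nu>" using dom_sets_nu[OF c] by simp
 qed (use m in simp)
 show "AE x in \<nu>. \<bar>extend c F x\<bar> <= \<bar>B\<bar>"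
  by (intro AE_I2) (use B in \<open>force simp: extend_def\<close>)
qed

lemma extend_integral:
 assumes c: "c \<in> A" and F: "extend c F \<in> borel_measurable \<nu>" and u: "u \<in> borel_measurable \<nu>"
 shows "(LINT p|\<nu>. extend c F p * u p) = \<kappa> * (LINT y|lborel. sqrt_det c y * (F y * u (chart_inv c y)))"
  and "integrable \<nu> (\<lambda>p. extend c F p * u p) ==> integrable lborel (\<lambda>y. sqrt_det c y * (F y * u (chart_inv c y)))"
proof -
 have m: "(\<lambda>p. extend c F p * u p) \<in> borel_measurable \<nu>" using F u by measurable
 have e: "dens c y * (extend c F (chart_inv_ext c y) * u (chart_inv_ext c y)) = \<kappa> * (sqrt_det c y * (F y * u (chart_inv c y)))" for y
  using inv_in_dom[OF c] map_inv[OF c] by (auto simp: dens_def sqrt_det_def extend_def chart_inv_ext_def)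
 have o: "extend c F p * u p = 0" if "p \<notin> chart_dom c" for p using that by (simp add: extend_def)
 show "(LINT p|\<nu>. extend c F p * u p) = \<kappa> * (LINT y|lborel. sqrt_det c y * (F y * u (chart_inv c y)))"
  using integral_chart[OF c m] o by (simp add: e)
 assume "integrable \<nu> (\<lambda>p. extend c F p * u p)"
 then show "integrable lborel (\<lambda>y. sqrt_det c y * (F y * u (chart_inv c y)))"
  using integrable_chart_iff[OF c m] o \<kappa>_pos by (simp add: e)
qed

lemma extend_square_bounds:
 assumes gb: "good_ball (c, x, r)"
 shows "\<exists>l>0. \<exists>L>0. \<forall>F a h b B. L2 (extend c F) --> 0 < h --> cball a h \<subseteq> cball x r -->
  (\<forall>y. h <= norm (y - a) --> F y = 0) --> (\<forall>y\<in>cball x r. \<bar>F y\<bar> <= B) -->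
  (0 <= b --> (\<forall>y. norm (y - a) <= h / 2 --> b <= F y) --> l * b^2 * h ^ CARD('n) <= (LINT p|\<nu>. (extend c F p)^2)) \<and> (LINT p|\<nu>. (extend c F p)^2) <= L * B^2 * h ^ CARD('n)"
proof -
 let ?D = "CARD('n)"
 note gbD = good_ballD[OF gb]
 note c = gbD(1)
 obtain l L where lL: "l > 0" "L > 0" "\<And>y. y \<in> cball x r ==> l <= dens c y \<and> dens c y <= L"
  using dens_bounds[OF gb] by blast
 define V where "V = unit_ball_vol (real ?D)"
 have V: "V > 0" by (simp add: V_def unit_ball_vol_pos)
 have vol: "measure lborel (ball a h) = V * h ^ ?D" if "h >= 0" for a :: "real^'n" and h
  using content_ball[OF that, of a] by (simp add: V_def)
 have "(0 <= b --> (\<forall>y. norm (y - a) <= h / 2 --> b <= F y) --> l * V / 2 ^ ?D * b^2 * h ^ ?D <= (LINT p|\<nu>. (extend c F p)^2)) \<and> (LINT p|\<nu>. (extend c F p)^2) <= L * V * B^2 * h ^ ?D"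
  if sq: "L2 (extend c F)" and h: "0 < h" and sub: "cball a h \<subseteq> cball x r"
   and out: "\<forall>y. h <= norm (y - a) --> F y = 0" and B: "\<forall>y\<in>cball x r. \<bar>F y\<bar> <= B"
  for F a h b B
 proof -
  have m: "extend c F \<in> borel_measurable \<nu>" using sq by (simp add: square_integrable_def)
  have e: "sqrt_det c y * (F y * extend c F (chart_inv c y)) = sqrt_det c y * (F y)^2" for y
   using inv_in_dom[OF c] map_inv[OF c] by (auto simp: sqrt_det_def extend_def power2_eq_square)
  have eq: "(LINT p|\<nu>. (extend c F p)^2) = (LINT y|lborel. dens c y * (F y)^2)"
   using extend_integral(1)[OF c m m] unfolding e by (simp add: power2_eq_square dens_def mult.assoc)
  have int: "integrable lborel (\<lambda>y. dens c y * (F y)^2)"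
  proof -
   have "integrable \<nu> (\<lambda>p. extend c F p * extend c F p)" using sq by (simp add: square_integrable_def power2_eq_square)
   from extend_integral(2)[OF c m m this] have "integrable lborel (\<lambda>y. \<kappa> * (sqrt_det c y * (F y)^2))" unfolding e by simp
   then show ?thesis by (simp only: dens_def mult.assoc)
  qed
  have ib: "integrable lborel (indicator (ball a t) :: real^'n \<Rightarrow> real)" for t
   using emeasure_bounded_finite[OF bounded_ball, of a t] by (intro integrable_real_indicator) (simp_all add: less_top infinity_ennreal_def)
  have up: "dens c y * (F y)^2 <= L * B^2 * indicator (ball a h) y" for y
  proof (cases "y \<in> ball a h")
   case True
   then have y: "y \<in> cball x r" using sub ball_subset_cball by blast
   have "\<bar>F y\<bar>^2 <= B^2" using B y by (intro power_mono) auto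
   then have "dens c y * (F y)^2 <= L * B^2" using lL(3)[OF y] dens_nonneg[OF c] lL by (intro mult_mono) auto
   then show ?thesis using True by simp
  next
   case False
   then have "F y = 0" using out by (auto simp: dist_norm norm_minus_commute)
   then show ?thesis using False by simp
  qed
  have low: "l * b^2 * indicator (ball a (h / 2)) y <= dens c y * (F y)^2"
   if b: "0 <= b" "\<forall>y. norm (y - a) <= h / 2 --> b <= F y" for y
  proof (cases "y \<in> ball a (h / 2)")
   case True
   then have "y \<in> cball a h" using h by simp
   then have y: "y \<in> cball x r" using sub by blast
   have "b <= F y" using b(2) True by (simp add: dist_norm norm_minus_commute)
   then have "b^2 <= (F y)^2" using b(1) by (intro power_mono) auto
   then have "l * b^2 <= dens c y * (F y)^2" using lL(3)[OF y] dens_nonneg[OF c] lL by (intro mult_mono) auto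
   then show ?thesis using True by simp
  next
   case False
   then show ?thesis using dens_nonneg[OF c] by simp
  qed
  have 1: "l * b^2 * (V * (h / 2) ^ ?D) <= (LINT y|lborel. dens c y * (F y)^2)"
   if b: "0 <= b" "\<forall>y. norm (y - a) <= h / 2 --> b <= F y"
  proof -
  have "l * b^2 * (V * (h / 2) ^ ?D) = (LINT y|lborel. l * b^2 * indicator (ball a (h / 2)) y)"
   using vol[of "h / 2" a] h by simp
  also have "... <= (LINT y|lborel. dens c y * (F y)^2)" using ib int low[OF b] by (intro integral_mono) auto
  finally show ?thesis .
  qed
  have "(LINT y|lborel. dens c y * (F y)^2) <= (LINT y|lborel. L * B^2 * indicator (ball a h) y)"
   using ib int up by (intro integral_mono) auto
  also have "... = L * B^2 * (V * h ^ ?D)" using vol[of h a] h by simp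
  finally show ?thesis using 1 unfolding eq by (simp add: power_divide mult_ac)
 qed
 then show ?thesis using lL V by (intro exI[of _ "l * V / 2 ^ ?D"] conjI exI[of _ "L * V"]) auto
qed

end

text \<open>A cubic lattice with spacing \<open>2 * h\<close>.\<close>

lemma separated_centres:
 fixes x0 :: "real^'n"
 assumes \<rho>: "\<rho> > 0" and h: "0 < h" "h <= \<rho> / (4 * real CARD('n))"
 shows "\<exists>(I :: ('n \<Rightarrow> nat) set) a. finite I \<and> (\<forall>i\<in>I. cball (a i) h \<subseteq> cball x0 \<rho>) \<and>
  (\<forall>i\<in>I. \<forall>j\<in>I. i \<noteq> j --> ball (a i) h \<inter> ball (a j) h = {}) \<and>
  (\<rho> / (8 * real CARD('n))) ^ CARD('n) <= h ^ CARD('n) * real (card I) \<and> h ^ CARD('n) * real (card I) <= \<rho> ^ CARD('n)"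
proof -
 let ?D = "CARD('n)"
 have D1: "real ?D >= 1" using zero_less_card_finite[where 'a = 'n] by linarith
 define t where "t = \<rho> / (4 * h * real ?D)"
 have t: "t >= 1" using h D1 by (simp add: t_def field_simps)
 define K where "K = nat \<lfloor>t\<rfloor>"
 have "1 <= \<lfloor>t\<rfloor>" using t by simp
 then have K: "real K <= t" "t / 2 <= real K" unfolding K_def by linarith+
 have ht: "h * t = \<rho> / (4 * real ?D)" using h by (simp add: t_def)
 define I :: "('n \<Rightarrow> nat) set" where "I = PiE UNIV (\<lambda>_. {..<K})"
 define a where "a i = x0 + (\<chi> k. 2 * h * real (i k))" for i :: "'n \<Rightarrow> nat"
 have cI: "card I = K ^ ?D" unfolding I_def by (simp add: card_PiE)
 have fin: "finite I" unfolding I_def by (intro finite_PiE) auto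
 have "cball (a i) h \<subseteq> cball x0 \<rho>" if i: "i \<in> I" for i
 proof -
  have "dist (a i) x0 <= (\<Sum>k\<in>UNIV. \<bar>(\<chi> k. 2 * h * real (i k)) $ k\<bar>)"
   unfolding dist_norm using norm_le_l1_cart[of "\<chi> k. 2 * h * real (i k)"] by (simp add: a_def)
  also have "... <= (\<Sum>k\<in>(UNIV :: 'n set). 2 * h * t)"
  proof (rule sum_mono)
   fix k :: 'n
   have "i k < K" using i by (auto simp: I_def PiE_def Pi_def)
   then have "real (i k) <= t" using K(1) by linarith
   then show "\<bar>(\<chi> k. 2 * h * real (i k)) $ k\<bar> <= 2 * h * t" using h by (simp add: mult_left_mono)
  qed
  also have "... = \<rho> / 2" using ht D1 by (simp add: mult.assoc field_simps)
  finally have d: "dist (a i) x0 <= \<rho> / 2" .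
  have D4: "2 <= 4 * real ?D" using D1 by linarith
  have "h <= \<rho> / (4 * real ?D)" by (rule h(2))
  also have "... <= \<rho> / 2" using \<rho> D4 by (intro divide_left_mono) auto
  finally have "h <= \<rho> / 2" .
  then have "dist (a i) x0 + h <= \<rho>" using d by linarith
  then show ?thesis by (simp add: cball_subset_cball_iff)
 qed
 moreover have "ball (a i) h \<inter> ball (a j) h = {}" if ij: "i \<noteq> j" for i j
 proof (rule ccontr)
  assume "ball (a i) h \<inter> ball (a j) h \<noteq> {}"
  then obtain y where y: "dist (a i) y < h" "dist (a j) y < h" by auto
  obtain k where k: "i k \<noteq> j k" using ij by auto
  have "dist (a i) (a j) < 2 * h" using dist_triangle3[of "a i" "a j" y] y by (simp add: dist_commute)
  then have "\<bar>(a i - a j) $ k\<bar> < 2 * h" using component_le_norm_cart[of "a i - a j" k] unfolding dist_norm by linarith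
  then have "2 * h * \<bar>real (i k) - real (j k)\<bar> < 2 * h * 1"
   using h by (simp add: a_def abs_mult flip: right_diff_distrib)
  then have "\<bar>real (i k) - real (j k)\<bar> < 1" using h(1) by (simp only: mult_less_cancel_left_pos)
  then show False using k by linarith
 qed
 moreover have "(\<rho> / (8 * real ?D)) ^ ?D <= h ^ ?D * real (card I)"
 proof -
  have "\<rho> / (8 * real ?D) = h * (t / 2)" using ht by simp
  also have "... <= h * real K" using K h by (intro mult_left_mono) auto
  finally have "(\<rho> / (8 * real ?D)) ^ ?D <= (h * real K) ^ ?D" using \<rho> by (intro power_mono) auto
  then show ?thesis by (simp add: cI power_mult_distrib)
 qed
 moreover have "h ^ ?D * real (card I) <= \<rho> ^ ?D"
 proof -
  have D4: "1 <= 4 * real ?D" using D1 by linarith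
  have "h * real K <= h * t" using K h by (intro mult_left_mono) auto
  also have "... <= \<rho> / 1" unfolding ht using \<rho> D4 by (intro divide_left_mono) auto
  also have "... = \<rho>" by simp
  finally have "(h * real K) ^ ?D <= \<rho> ^ ?D" using h by (intro power_mono) auto
  then show ?thesis by (simp add: cI power_mult_distrib)
 qed
 ultimately show ?thesis using fin by (intro exI[of _ I] exI[of _ a]) auto
qed

context riemannian_probability
begin

lemma extend_cmult: "(LINT p|\<nu>. (a * extend c F p) * u p) = a * (LINT p|\<nu>. extend c F p * u p)"
 by (simp add: mult.assoc)

text \<open>\<open>\<psi>\<close> are normalized disjoint bumps of radius \<open>h\<close> and \<open>G i\<close> is the \<open>k\<close>-th
power of minus the Laplacian applied to \<open>\<psi> i\<close>, in the weak sense of its inner products with eigenfunctions.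
The factor \<open>h ^ CARD('n)\<close> is the order of the volume of a bump, and \<open>h ^ (4 * k)\<close> expresses
that each application costs \<open>1 / h\<^sup>2\<close>.\<close>

definition bump_system ::
 "real \<Rightarrow> real \<Rightarrow> nat \<Rightarrow> ('n \<Rightarrow> nat) set \<Rightarrow> (('n \<Rightarrow> nat) \<Rightarrow> 'a \<Rightarrow> real) \<Rightarrow> (('n \<Rightarrow> nat) \<Rightarrow> 'a \<Rightarrow> real) \<Rightarrow> bool" where
 "bump_system C h k I \<psi> G \<longleftrightarrow> finite I \<and> orthonormal_on \<nu> I \<psi> \<and>
  1 <= C * (h ^ CARD('n) * real (card I)) \<and> h ^ CARD('n) * real (card I) <= C \<and>
  (\<forall>S p. (\<Sum>i\<in>I. rsign S i * \<psi> i p)^2 * h ^ CARD('n) <= C) \<and>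
  (\<forall>i\<in>I. L2 (G i) \<and> (LINT p|\<nu>. (G i p)^2) * h ^ (4 * k) <= C \<and>
   (\<forall>l u. u \<in> eigenspace M A g l --> (LINT p|\<nu>. G i p * u p) = l ^ k * (LINT p|\<nu>. \<psi> i p * u p)))"

lemma bump_family:
 "\<exists>C>0. \<exists>h0>0. \<forall>h. 0 < h --> h <= h0 --> (\<exists>(I :: ('n \<Rightarrow> nat) set) \<psi> G. bump_system C h k I \<psi> G)"
proof -
 let ?D = "CARD('n)"
 have D1: "real ?D >= 1" using zero_less_card_finite[where 'a = 'n] by linarith
 obtain b where "good_ball b" using good_ball_exists[OF some_point] by blast
 then obtain c x0 \<rho> where gb: "good_ball (c, x0, \<rho>)" by (cases b) auto
 note gbD = good_ballD[OF gb]
 note c = gbD(1) and \<rho> = gbD(2)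
 let ?U = "chart_image c" and ?K = "cball x0 \<rho>"
 note U = chart_image_open[OF c]
 define w :: "real^'n \<Rightarrow> real \<Rightarrow> real^'n \<Rightarrow> real" where "w = (\<lambda>a h y. 1 * tent a h y ^ (4 + 2 * k))"
 have w: "oscillating ?U (4 + 2 * k) w" unfolding w_def by (rule oscillating.base) (auto simp: smooth_on_def U)
 obtain q where q: "oscillating ?U 4 q"
  "\<And>a h l u. 0 < h ==> cball a h \<subseteq> ?U ==> u \<in> eigenspace M A g l ==>
   (LINT y|lborel. sqrt_det c y * (q a h y * u (chart_inv c y)))
    = (l * h^2) ^ k * (LINT y|lborel. sqrt_det c y * (w a h y * u (chart_inv c y)))"
  using oscillating_iterated_lap[OF c w] by blast
 obtain B where B: "B >= 0" "\<And>a h y. 0 < h ==> h <= 1 ==> y \<in> ?K ==> \<bar>q a h y\<bar> <= B"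
  and qout: "\<And>a h y. 0 < h ==> h <= norm (y - a) ==> q a h y = 0"
  using oscillating_bounded[OF q(1) _ compact_cball gbD(3)] by auto
 have wout: "w a h y = 0" if "0 < h" "h <= norm (y - a)" for a h y using tent_outside[OF that] by (simp add: w_def)
 have w1: "0 <= w a h y" "w a h y <= 1" for a h y using tent_bounds[of a h y] by (auto simp: w_def power_le_one)
 have w1': "\<forall>y\<in>?K. \<bar>w a h y\<bar> <= 1" for a h using w1 by (intro ballI) (simp only: abs_of_nonneg)
 obtain l L where lL: "l > 0" "L > 0" and sqb: "\<And>F a h b B. L2 (extend c F) ==> 0 < h ==> cball a h \<subseteq> ?K ==>
  (\<forall>y. h <= norm (y - a) --> F y = 0) ==> (\<forall>y\<in>?K. \<bar>F y\<bar> <= B) ==>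
  (0 <= b --> (\<forall>y. norm (y - a) <= h / 2 --> b <= F y) --> l * b^2 * h ^ ?D <= (LINT p|\<nu>. (extend c F p)^2)) \<and> (LINT p|\<nu>. (extend c F p)^2) <= L * B^2 * h ^ ?D"
  using extend_square_bounds[OF gb] by (elim exE conjE) blast
 define l' where "l' = l * ((1 / 2) ^ (4 + 2 * k))^2"
 have l': "l' > 0" using lL by (simp add: l'_def)
 define v where "v = (\<rho> / (8 * real ?D)) ^ ?D"
 have v: "v > 0" using \<rho> D1 by (simp add: v_def)
 define C where "C = 1 / v + \<rho> ^ ?D + 1 / l' + L * B^2 / l'"
 have C: "C > 0" "1 / v <= C" "\<rho> ^ ?D <= C" "1 / l' <= C" "L * B^2 / l' <= C"
  using v \<rho> l' lL B by (auto simp: C_def intro!: add_pos_nonneg add_nonneg_nonneg add_increasing add_increasing2)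
 have main: "\<exists>(I :: ('n \<Rightarrow> nat) set) \<psi> G. bump_system C h k I \<psi> G"
  if h: "0 < h" "h <= \<rho> / (4 * real ?D)" "h <= 1" for h
 proof -
  from separated_centres[OF \<rho> h(1,2), of x0, folded v_def]
  obtain I :: "('n \<Rightarrow> nat) set" and a where Ia: "finite I \<and> (\<forall>i\<in>I. cball (a i) h \<subseteq> ?K) \<and>
   (\<forall>i\<in>I. \<forall>j\<in>I. i \<noteq> j --> ball (a i) h \<inter> ball (a j) h = {}) \<and>
   v <= h ^ ?D * real (card I) \<and> h ^ ?D * real (card I) <= \<rho> ^ ?D" by (elim exE)
  have I: "finite I" "\<And>i. i \<in> I ==> cball (a i) h \<subseteq> ?K"
   "\<And>i j. i \<in> I ==> j \<in> I ==> i \<noteq> j ==> ball (a i) h \<inter> ball (a j) h = {}"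
   "v <= h ^ ?D * real (card I)" "h ^ ?D * real (card I) <= \<rho> ^ ?D" using Ia by blast+
  have hD: "h ^ ?D > 0" using h by simp
  have bounded_outside: "\<exists>C. \<forall>y\<in>?U. \<bar>f y\<bar> <= C" if "i \<in> I" "\<And>y. h <= norm (y - a i) ==> f y = 0" "\<forall>y\<in>?K. \<bar>f y\<bar> <= C"
   for i and f :: "real^'n \<Rightarrow> real" and C :: real
  proof (intro exI ballI)
   fix y
   show "\<bar>f y\<bar> <= max C 0"
   proof (cases "y \<in> ?K")
    case False
    then have "y \<notin> cball (a i) h" using I(2)[OF that(1)] by blast
    then have "f y = 0" by (intro that(2)) (simp add: dist_norm norm_minus_commute)
    then show ?thesis by simp
   qed (use that(3) in force)
  qed
  have wsq: "L2 (extend c (w (a i) h))" for i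
  proof (rule extend_sq[OF c, where B = 1])
   show "continuous_on ?U (w (a i) h)"
    using Ck_on_imp_continuous[OF oscillating_Ck[OF U oscillating_mono[OF w] h(1), of 0]] by simp
   show "\<bar>w (a i) h y\<bar> <= 1" for y using w1[of "a i" h y] by (simp only: abs_of_nonneg)
  qed
  have qsq: "L2 (extend c (q (a i) h))" if i: "i \<in> I" for i
  proof -
   have "continuous_on ?U (q (a i) h)"
    using Ck_on_imp_continuous[OF oscillating_Ck[OF U oscillating_mono[OF q(1)] h(1), of 0]] by simp
   moreover obtain C where "\<forall>y\<in>?U. \<bar>q (a i) h y\<bar> <= C"
    using bounded_outside[OF i, of "q (a i) h" B] qout[OF h(1)] B(2)[OF h(1,3)] by blast
   ultimately show ?thesis using extend_sq[OF c] by blast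
  qed
  define n where "n i = sqrt (LINT p|\<nu>. (extend c (w (a i) h) p)^2)" for i
  have n2: "l' * h ^ ?D <= (n i)^2" "n i > 0" "(n i)^2 = (LINT p|\<nu>. (extend c (w (a i) h) p)^2)" if i: "i \<in> I" for i
  proof -
   have "(1 / 2) ^ (4 + 2 * k) <= w (a i) h y" if "norm (y - a i) <= h / 2" for y
    using tent_inside[OF h(1) that] unfolding w_def by (simp only: mult_1, intro power_mono) auto
   then have "l' * h ^ ?D <= (LINT p|\<nu>. (extend c (w (a i) h) p)^2)"
    unfolding l'_def using sqb[OF wsq[of i] h(1) I(2)[OF i] _ w1', of "(1 / 2) ^ (4 + 2 * k)"] wout[OF h(1)] by simp
   moreover have "0 < l' * h ^ ?D" using l' hD by simp
   ultimately show "l' * h ^ ?D <= (n i)^2" "n i > 0" "(n i)^2 = (LINT p|\<nu>. (extend c (w (a i) h) p)^2)"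
    by (auto simp: n_def)
  qed
  define \<psi> where "\<psi> i = (\<lambda>p. 1 / n i * extend c (w (a i) h) p)" for i
  define G where "G i = (\<lambda>p. 1 / (n i * h ^ (2 * k)) * extend c (q (a i) h) p)" for i
  have disj: "\<psi> i p * \<psi> j p = 0" if ij: "i \<in> I" "j \<in> I" "i \<noteq> j" for i j p
  proof (rule ccontr)
   assume "\<psi> i p * \<psi> j p \<noteq> 0"
   then have "w (a i) h (chart_map c p) \<noteq> 0" "w (a j) h (chart_map c p) \<noteq> 0" by (auto simp: \<psi>_def extend_def split: if_splits)
   then have "chart_map c p \<in> ball (a i) h" "chart_map c p \<in> ball (a j) h"
    using wout[OF h(1)] by (auto simp: dist_norm norm_minus_commute not_le[symmetric])
   then show False using I(3)[OF ij] by blast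
  qed
  have ons: "orthonormal_on \<nu> I \<psi>"
   unfolding orthonormal_on_def
  proof (intro conjI ballI)
   show "L2 (\<psi> i)" for i unfolding \<psi>_def by (rule sq_cmult[OF wsq])
   fix i j assume i: "i \<in> I" and j: "j \<in> I"
   show "(LINT p|\<nu>. \<psi> i p * \<psi> j p) = (if i = j then 1 else 0)"
   proof (cases "i = j")
    case True
    have "(LINT p|\<nu>. \<psi> i p * \<psi> i p) = (LINT p|\<nu>. 1 / (n i)^2 * (extend c (w (a i) h) p)^2)"
     by (simp add: \<psi>_def power2_eq_square)
    also have "... = 1 / (n i)^2 * (n i)^2" using n2(3)[OF i] by simp
    finally show ?thesis using True n2(2)[OF i] by simp
   next
    case False
    then show ?thesis unfolding disj[OF i j False] by simp
   qed
  qed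
  have sup: "(\<Sum>i\<in>I. rsign S i * \<psi> i p)^2 * h ^ ?D <= C" for S p
  proof (cases "\<exists>j\<in>I. \<psi> j p \<noteq> 0")
   case True
   then obtain j where j: "j \<in> I" "\<psi> j p \<noteq> 0" by blast
   have "(\<Sum>i\<in>I. rsign S i * \<psi> i p) = (\<Sum>i\<in>I. if i = j then rsign S j * \<psi> j p else 0)"
    using disj[OF _ j(1), of _ p] j(2) by (intro sum.cong) auto
   then have "(\<Sum>i\<in>I. rsign S i * \<psi> i p)^2 = (\<psi> j p)^2" using j(1) I(1) by (simp add: power_mult_distrib rsign_sq)
   also have "... <= 1 / (n j)^2"
    using w1[of "a j" h "chart_map c p"] n2(2)[OF j(1)]
    by (auto simp: \<psi>_def extend_def power_divide power_le_one intro!: divide_right_mono)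
   finally have "(\<Sum>i\<in>I. rsign S i * \<psi> i p)^2 * h ^ ?D <= 1 / (n j)^2 * h ^ ?D" using hD by (intro mult_right_mono) auto
   also have "... <= 1 / l'" using n2(1,2)[OF j(1)] l' by (simp add: field_simps)
   finally show ?thesis using C(4) by linarith
  next
   case False
   then show ?thesis using C(1) by simp
  qed
  have Gs: "L2 (G i)" if "i \<in> I" for i unfolding G_def by (rule sq_cmult[OF qsq[OF that]])
  have Gn: "(LINT p|\<nu>. (G i p)^2) * h ^ (4 * k) <= C" if i: "i \<in> I" for i
  proof -
   have up: "(LINT p|\<nu>. (extend c (q (a i) h) p)^2) <= L * B^2 * h ^ ?D"
    using sqb[OF qsq[OF i] h(1) I(2)[OF i] _ _, of B] qout[OF h(1)] B(2)[OF h(1,3)] by blast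
   have "(LINT p|\<nu>. (G i p)^2) = 1 / ((n i)^2 * h ^ (4 * k)) * (LINT p|\<nu>. (extend c (q (a i) h) p)^2)"
    by (simp add: G_def power_mult_distrib power_divide flip: power_mult)
   then have "(LINT p|\<nu>. (G i p)^2) * h ^ (4 * k) = (LINT p|\<nu>. (extend c (q (a i) h) p)^2) / (n i)^2" using h by simp
   also have "... <= (L * B^2 * h ^ ?D) / (l' * h ^ ?D)" using up n2[OF i] l' hD lL by (intro frac_le) auto
   also have "... = L * B^2 / l'" using h by simp
   finally show ?thesis using C(5) by linarith
  qed
  have Ge: "(LINT p|\<nu>. G i p * u p) = l ^ k * (LINT p|\<nu>. \<psi> i p * u p)" if i: "i \<in> I" and u: "u \<in> eigenspace M A g l" for i l u
  proof -
   have um: "u \<in> borel_measurable \<nu>" by (rule continuous_measurable[OF C1_continuous[OF eigen_C1[OF u]]])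
   have m: "extend c (q (a i) h) \<in> borel_measurable \<nu>" "extend c (w (a i) h) \<in> borel_measurable \<nu>"
    using qsq[OF i] wsq by (simp_all add: square_integrable_def)
   have b: "cball (a i) h \<subseteq> ?U" using I(2)[OF i] gbD(3) by blast
   have "(LINT p|\<nu>. G i p * u p) = 1 / (n i * h ^ (2 * k)) * (\<kappa> * (LINT y|lborel. sqrt_det c y * (q (a i) h y * u (chart_inv c y))))"
    unfolding G_def extend_cmult extend_integral(1)[OF c m(1) um] ..
   also have "... = 1 / (n i * h ^ (2 * k)) * (\<kappa> * ((l * h^2) ^ k * (LINT y|lborel. sqrt_det c y * (w (a i) h y * u (chart_inv c y)))))"
    unfolding q(2)[OF h(1) b u] ..
   also have "... = l ^ k * (1 / n i * (\<kappa> * (LINT y|lborel. sqrt_det c y * (w (a i) h y * u (chart_inv c y)))))"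
    using h by (simp add: power_mult_distrib power_mult)
   also have "... = l ^ k * (LINT p|\<nu>. \<psi> i p * u p)"
    unfolding \<psi>_def extend_cmult extend_integral(1)[OF c m(2) um] ..
   finally show ?thesis .
  qed
  have "1 <= C * (h ^ ?D * real (card I))"
  proof -
   have "1 = 1 / v * v" using v by simp
   also have "... <= C * (h ^ ?D * real (card I))" by (rule mult_mono[OF C(2) I(4)]) (use C(1) v in simp_all)
   finally show ?thesis .
  qed
  moreover have "h ^ ?D * real (card I) <= C" using I(5) C(3) by linarith
  ultimately show ?thesis
   unfolding bump_system_def by (intro exI[of _ I] exI[of _ \<psi>] exI[of _ G] conjI ballI allI impI I(1) ons sup Gs Gn Ge)
 qed
 show ?thesis
  by (rule exI[of _ C], rule conjI[OF C(1)], rule exI[of _ "min 1 (\<rho> / (4 * real ?D))"]) (use main \<rho> D1 in auto)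
qed

end

section \<open>Spectral estimates from the eigenvalue count\<close>

context riemannian_spectrum
begin

lemma mu_unbounded: "\<exists>j. \<mu> j > l"
proof (rule ccontr)
 assume "\<not> (\<exists>j. \<mu> j > l)"
 then have "{j. \<mu> j <= l} = UNIV" by (auto simp: not_less)
 then show False using blocks_finite(1)[of l] by simp
qed

lemma sqrt_power_powr: "l > 0 ==> sqrt l ^ CARD('n) = l powr (real CARD('n) / 2)"
 by (simp add: powr_half_sqrt[symmetric] powr_powr flip: powr_realpow)

text \<open>As each eigenvalue contributes at least one mode, the count gives
\<open>j + 1 \<le> C * \<mu> j powr (CARD('n) / 2)\<close>, and the series is dominated by that of
\<open>1 / (j + 1)\<^sup>2\<close>.\<close>

lemma summable_eigenvalues: "\<exists>Z>0. \<forall>L\<ge>1. summable (\<lambda>j. if \<mu> j > L then \<mu> j powr (- real CARD('n)) else 0) \<and>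
  (\<Sum>j. if \<mu> j > L then \<mu> j powr (- real CARD('n)) else 0) <= Z"
proof -
 let ?D = "CARD('n)"
 obtain C where C: "C > 0" "\<And>l. l >= 1 ==> real (card (low l)) <= C * sqrt l ^ ?D" using low_count by blast
 define b where "b j = C^2 * inverse ((real (Suc j))^2)" for j
 have "summable (\<lambda>j. inverse ((real j)^2))" by (rule inverse_power_summable) simp
 then have "summable (\<lambda>j. inverse ((real (Suc j))^2))" by (rule iffD2[OF summable_Suc_iff])
 then have sb: "summable b" unfolding b_def by (rule summable_mult)
 have le: "(if \<mu> j > L then \<mu> j powr (- real ?D) else 0) <= b j" if "L >= 1" for j L
 proof (cases "\<mu> j > L")
  case True
  then have m: "\<mu> j >= 1" using that by simp
  have "{..j} \<subseteq> {i. \<mu> i <= \<mu> j}" using strict_mono_less_eq[OF mu_strict] by auto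
  then have "card {..j} <= card {i. \<mu> i <= \<mu> j}" by (rule card_mono[OF blocks_finite(1)])
  then have "Suc j <= card {i. \<mu> i <= \<mu> j}" by simp
  also have "... <= card (low (\<mu> j))" by (rule blocks_finite(2))
  finally have "real (Suc j) <= real (card (low (\<mu> j)))" by (simp only: of_nat_le_iff)
  also have "... <= C * \<mu> j powr (real ?D / 2)" using C(2)[OF m] m by (simp add: sqrt_power_powr)
  finally have "(real (Suc j))^2 <= (C * \<mu> j powr (real ?D / 2))^2" by (intro power_mono) auto
  also have "... = C^2 * \<mu> j powr real ?D" using m by (simp add: power_mult_distrib powr_power)
  finally have "\<mu> j powr (- real ?D) <= b j" using m unfolding b_def by (simp add: powr_minus field_simps)
  then show ?thesis using True by simp
 qed (simp add: b_def)
 have nn: "0 <= (if \<mu> j > L then \<mu> j powr (- real ?D) else 0)" for j L by simp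
 have s: "summable (\<lambda>j. if \<mu> j > L then \<mu> j powr (- real ?D) else 0)" if "L >= 1" for L
  by (rule summable_comparison_test'[OF sb, of 0]) (use le[OF that] nn in auto)
 have "(\<Sum>j. if \<mu> j > L then \<mu> j powr (- real ?D) else 0) <= suminf b" if "L >= 1" for L
  by (rule suminf_le[OF le[OF that] s[OF that] sb])
 moreover have "suminf b > 0" using C(1) by (intro suminf_pos sb) (simp add: b_def)
 ultimately show ?thesis using s by blast
qed

text \<open>Here \<open>g\<close> is the \<open>k\<close>-th power of minus the Laplacian of a function and \<open>f\<close> is this function
without its modes up to \<open>L\<close>. Each block of \<open>g\<close> is at most its norm, so the claim reduces to the series
of \<open>\<mu> j powr (s / 2 - k)\<close> over \<open>\<mu> j > L\<close>.\<close>

lemma tail_variation: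
 assumes s: "s > 0"
 shows "\<exists>Z>0. \<forall>k L f g. s / 2 + real CARD('n) <= real k --> 1 <= L --> L2 g -->
  (\<forall>j l. l < d j --> (LINT x|\<nu>. f x * \<phi> j l x) = (if \<mu> j <= L then 0 else (1 / \<mu> j ^ k) * (LINT x|\<nu>. g x * \<phi> j l x))) -->
  (\<Sum>j. ennreal ((1 + \<mu> j) powr (s / 2) * block j f)) <= ennreal (Z * L powr (s / 2 + real CARD('n) - real k) * sqrt (LINT x|\<nu>. (g x)^2))"
proof -
 let ?D = "real CARD('n)"
 obtain Z where Z: "Z > 0" "\<And>L. L >= 1 ==> summable (\<lambda>j. if \<mu> j > L then \<mu> j powr (- ?D) else 0)"
  "\<And>L. L >= 1 ==> (\<Sum>j. if \<mu> j > L then \<mu> j powr (- ?D) else 0) <= Z" using summable_eigenvalues by blast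
 have "(\<Sum>j. ennreal ((1 + \<mu> j) powr (s / 2) * block j f)) <= ennreal (2 powr (s / 2) * Z * L powr (s / 2 + ?D - real k) * sqrt (LINT x|\<nu>. (g x)^2))"
  if k: "s / 2 + ?D <= real k" and L: "1 <= L" and g: "L2 g"
   and co: "\<forall>j l. l < d j --> (LINT x|\<nu>. f x * \<phi> j l x) = (if \<mu> j <= L then 0 else (1 / \<mu> j ^ k) * (LINT x|\<nu>. g x * \<phi> j l x))"
  for k L f g
 proof -
  define ng where "ng = sqrt (LINT x|\<nu>. (g x)^2)"
  define cc where "cc = 2 powr (s / 2) * L powr (s / 2 + ?D - real k) * ng"
  have ng: "ng >= 0" by (simp add: ng_def)
  have cc: "cc >= 0" using ng by (simp add: cc_def)
  have le: "(1 + \<mu> j) powr (s / 2) * block j f <= cc * (if \<mu> j > L then \<mu> j powr (- ?D) else 0)" for j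
  proof (cases "\<mu> j <= L")
   case True
   then have "block j f = 0" using co by (simp add: block_def)
   then show ?thesis using True by simp
  next
   case False
   then have m: "\<mu> j > L" "\<mu> j >= 1" "\<mu> j > 0" using L by auto
   have "block j f = sqrt ((1 / \<mu> j ^ k)^2 * (\<Sum>l<d j. (LINT x|\<nu>. g x * \<phi> j l x)^2))"
    using co False by (simp add: block_def power_mult_distrib power_divide sum_divide_distrib)
   also have "... = (1 / \<mu> j ^ k) * sqrt (\<Sum>l<d j. (LINT x|\<nu>. g x * \<phi> j l x)^2)"
    using m by (simp add: real_sqrt_mult)
   also have "... <= (1 / \<mu> j ^ k) * ng"
    unfolding ng_def using m bessel_inequality[OF phi_orthonormal finite_lessThan g] by (intro mult_left_mono) auto
   finally have b: "block j f <= \<mu> j powr (- real k) * ng" using m by (simp add: powr_minus powr_realpow divide_inverse)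
   have "(1 + \<mu> j) powr (s / 2) * block j f <= (2 * \<mu> j) powr (s / 2) * (\<mu> j powr (- real k) * ng)"
    using m s b by (intro mult_mono powr_mono2) (auto simp: block_def sum_nonneg)
   also have "... = 2 powr (s / 2) * ng * (\<mu> j powr (s / 2 + ?D - real k) * \<mu> j powr (- ?D))"
    using m by (simp add: powr_mult flip: powr_add)
   also have "... <= 2 powr (s / 2) * ng * (L powr (s / 2 + ?D - real k) * \<mu> j powr (- ?D))"
    using m L k ng by (intro mult_left_mono mult_right_mono powr_mono2') auto
   finally show ?thesis using m(1) by (simp add: cc_def mult_ac)
  qed
  have "(\<Sum>j. ennreal ((1 + \<mu> j) powr (s / 2) * block j f)) <= (\<Sum>j. ennreal (cc * (if \<mu> j > L then \<mu> j powr (- ?D) else 0)))"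
   by (intro suminf_le ennreal_leI le summableI)
  also have "... = ennreal (\<Sum>j. cc * (if \<mu> j > L then \<mu> j powr (- ?D) else 0))"
   using cc Z(2)[OF L] by (intro suminf_ennreal2 summable_mult) auto
  also have "(\<Sum>j. cc * (if \<mu> j > L then \<mu> j powr (- ?D) else 0)) = cc * (\<Sum>j. if \<mu> j > L then \<mu> j powr (- ?D) else 0)"
   by (rule suminf_mult[OF Z(2)[OF L]])
  also have "ennreal ... <= ennreal (cc * Z)" using cc Z(3)[OF L] by (intro ennreal_leI mult_left_mono)
  finally show ?thesis by (simp add: cc_def ng_def mult_ac)
 qed
 then show ?thesis using Z(1) by (intro exI[of _ "2 powr (s / 2) * Z"]) auto
qed

definition rest :: "real \<Rightarrow> ('a \<Rightarrow> real) \<Rightarrow> 'a \<Rightarrow> real" where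
 "rest L u x = u x - (\<Sum>e\<in>low L. (LINT y|\<nu>. u y * mode e y) * mode e x)"

lemma low_orthonormal: "orthonormal_on \<nu> (low L) mode"
 by (rule orthonormal_on_subset[OF modes_orthonormal]) (auto simp: low_def)

lemma low_sq: "e \<in> low L ==> L2 (mode e)" using low_orthonormal by (auto simp: orthonormal_on_def)

lemma rest_sq: "L2 u ==> L2 (rest L u)" unfolding rest_def[abs_def] by (intro sq_diff sq_sum sq_cmult low_sq)

lemma rest_norm: "L2 u ==> (LINT x|\<nu>. (rest L u x)^2) <= (LINT x|\<nu>. (u x)^2)"
 unfolding rest_def by (subst projection_residual[OF low_orthonormal finite_low]) (simp_all add: sum_nonneg)

lemma rest_coefficient:
 assumes u: "L2 u" and l: "l < d j"
 shows "(LINT x|\<nu>. rest L u x * \<phi> j l x) = (if \<mu> j <= L then 0 else (LINT x|\<nu>. u x * \<phi> j l x))"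
proof -
 let ?a = "\<lambda>e. (LINT y|\<nu>. u y * mode e y)"
 have m: "(j, l) \<in> modes" using l by (simp add: modes_def)
 have ms: "mode (j, l) = \<phi> j l" by (simp add: mode_def)
 have ps: "L2 (\<lambda>x. \<Sum>e\<in>low L. ?a e * mode e x)" by (intro sq_sum sq_cmult low_sq)
 have "(LINT x|\<nu>. rest L u x * \<phi> j l x) = (LINT x|\<nu>. u x * \<phi> j l x - (\<Sum>e\<in>low L. ?a e * mode e x) * \<phi> j l x)"
  by (simp only: rest_def left_diff_distrib)
 also have "... = (LINT x|\<nu>. u x * \<phi> j l x) - (LINT x|\<nu>. (\<Sum>e\<in>low L. ?a e * mode e x) * \<phi> j l x)"
  by (intro Bochner_Integration.integral_diff sq_mult_integrable u ps phi_sq[OF l])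
 also have "(LINT x|\<nu>. (\<Sum>e\<in>low L. ?a e * mode e x) * \<phi> j l x) = (\<Sum>e\<in>low L. ?a e * (LINT x|\<nu>. \<phi> j l x * mode e x))"
  unfolding mult.commute[of _ "\<phi> j l _"] by (rule integral_mult_sum[OF phi_sq[OF l] low_sq])
 also have "... = (\<Sum>e\<in>low L. if e = (j, l) then ?a e else 0)"
 proof (intro sum.cong refl)
  fix e assume "e \<in> low L"
  then have "e \<in> modes" by (simp add: low_def)
  then have "(LINT x|\<nu>. mode (j, l) x * mode e x) = (if (j, l) = e then 1 else 0)"
   using modes_orthonormal m unfolding orthonormal_on_def by blast
  then show "?a e * (LINT x|\<nu>. \<phi> j l x * mode e x) = (if e = (j, l) then ?a e else 0)" unfolding ms by auto
 qed
 also have "... = (if \<mu> j <= L then (LINT x|\<nu>. u x * \<phi> j l x) else 0)" using m finite_low by (simp add: low_def ms)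
 finally show ?thesis by simp
qed

end

context spectral_growth
begin

text \<open>A single eigenspace cannot be larger than the count of all modes up to its eigenvalue allows.\<close>

lemma growth_exponent_le: "\<gamma> <= real CARD('n) / 2"
proof (rule ccontr)
 let ?D = "real CARD('n)"
 assume "\<not> \<gamma> <= ?D / 2"
 then have e: "\<gamma> - ?D / 2 > 0" by simp
 obtain C where C: "C > 0" "\<And>l. l >= 1 ==> real (card (low l)) <= C * sqrt l ^ CARD('n)" using low_count by blast
 obtain j where j: "\<mu> j > max L0 ((C / cd) powr (1 / (\<gamma> - ?D / 2)))" using mu_unbounded by blast
 then have m: "\<mu> j >= L0" "\<mu> j >= 1" "\<mu> j > 0" using L0 by auto
 have "(\<lambda>l. (j, l)) ` {..<d j} \<subseteq> low (\<mu> j)" by (auto simp: low_def modes_def)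
 then have "card ((\<lambda>l. (j, l)) ` {..<d j}) <= card (low (\<mu> j))" by (rule card_mono[OF finite_low])
 then have "d j <= card (low (\<mu> j))" by (simp add: card_image inj_on_def)
 then have "real (d j) <= C * sqrt (\<mu> j) ^ CARD('n)" using C(2)[OF m(2)] by linarith
 also have "... = C * \<mu> j powr (?D / 2)" using m by (simp add: sqrt_power_powr)
 finally have "cd * (1 + \<mu> j) powr \<gamma> <= C * \<mu> j powr (?D / 2)" using growth[OF m(1)] by linarith
 moreover have "cd * \<mu> j powr \<gamma> <= cd * (1 + \<mu> j) powr \<gamma>" using cd m s by (intro mult_left_mono powr_mono2) auto
 ultimately have "cd * \<mu> j powr \<gamma> <= C * \<mu> j powr (?D / 2)" by linarith
 moreover have "\<mu> j powr \<gamma> = \<mu> j powr (\<gamma> - ?D / 2) * \<mu> j powr (?D / 2)" by (simp flip: powr_add)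
 ultimately have "\<mu> j powr (\<gamma> - ?D / 2) <= C / cd" using m cd by (simp add: field_simps)
 moreover have "C / cd = ((C / cd) powr (1 / (\<gamma> - ?D / 2))) powr (\<gamma> - ?D / 2)" using C cd e by (simp add: powr_powr)
 moreover have "... < \<mu> j powr (\<gamma> - ?D / 2)" using j e by (intro powr_less_mono2) auto
 ultimately show False by linarith
qed

text \<open>Above \<open>L0\<close> the assumption on the kernels reduces this to the count of modes; the finitely many modes below are
bounded.\<close>

lemma low_kernel: "\<exists>C>0. \<forall>L\<ge>1. \<forall>p\<in>M. (\<Sum>e\<in>low L. (mode e p)^2) <= C * sqrt L ^ CARD('n)"
proof -
 let ?D = "CARD('n)"
 obtain C where C: "C > 0" "\<And>l. l >= 1 ==> real (card (low l)) <= C * sqrt l ^ ?D" using low_count by blast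
 have "\<exists>b. \<forall>p\<in>M. (\<Sum>e\<in>low L0. (mode e p)^2) <= b"
 proof -
  have "continuous_on M (\<lambda>p. \<Sum>e\<in>low L0. (mode e p)^2)"
   by (intro continuous_on_sum continuous_on_power C1_continuous eigen_C1[OF mode_in]) (simp add: low_def)
  then have "bounded ((\<lambda>p. \<Sum>e\<in>low L0. (mode e p)^2) ` M)"
   using compact_continuous_image[OF _ compact] compact_imp_bounded by blast
  then obtain b where "\<forall>p\<in>M. \<bar>\<Sum>e\<in>low L0. (mode e p)^2\<bar> <= b" by (auto simp: bounded_iff)
  then have "\<forall>p\<in>M. (\<Sum>e\<in>low L0. (mode e p)^2) <= b" by (auto intro: order_trans[OF abs_ge_self])
  then show ?thesis ..
 qed
 then obtain b where b: "\<And>p. p \<in> M ==> (\<Sum>e\<in>low L0. (mode e p)^2) <= b" by blast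
 have main: "(\<Sum>e\<in>low L. (mode e p)^2) <= (\<bar>b\<bar> + CK * C) * sqrt L ^ ?D" if L: "L >= 1" and p: "p \<in> M" for L p
 proof -
  define J where "J = {j. L0 <= \<mu> j \<and> \<mu> j <= L}"
  define H where "H = Sigma J (\<lambda>j. {..<d j})"
  have J: "finite J" unfolding J_def by (rule finite_subset[OF _ blocks_finite(1)[of L]]) auto
  have H: "finite H" using J by (auto simp: H_def)
  have Hl: "H \<subseteq> low L" by (auto simp: H_def J_def low_def modes_def)
  have "(\<Sum>e\<in>low L. (mode e p)^2) <= (\<Sum>e\<in>low L0 \<union> H. (mode e p)^2)"
   by (intro sum_mono2) (auto simp: finite_low H, auto simp: low_def modes_def H_def J_def)
  also have "... <= (\<Sum>e\<in>low L0. (mode e p)^2) + (\<Sum>e\<in>H. (mode e p)^2)"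
   using finite_low H by (simp add: sum_Un sum_nonneg)
  also have "(\<Sum>e\<in>H. (mode e p)^2) = (\<Sum>j\<in>J. \<Sum>l<d j. (\<phi> j l p)^2)"
   unfolding H_def using J by (subst sum.Sigma) (auto simp: mode_def split_def)
  also have "... <= (\<Sum>j\<in>J. CK * real (d j))" by (intro sum_mono kernel p) (simp add: J_def)
  also have "... = CK * real (card H)" using J by (simp add: H_def sum_distrib_left)
  also have "... <= CK * (C * sqrt L ^ ?D)" using C(2)[OF L] card_mono[OF finite_low Hl] CK by (intro mult_left_mono) auto
  finally have "(\<Sum>e\<in>low L. (mode e p)^2) <= b + CK * (C * sqrt L ^ ?D)" using b[OF p] by linarith
  moreover have "b <= \<bar>b\<bar> * sqrt L ^ ?D"
   using L mult_left_mono[of 1 "sqrt L ^ ?D" "\<bar>b\<bar>"] one_le_power[of "sqrt L" ?D] by simp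
  ultimately show ?thesis by (simp add: algebra_simps)
 qed
 moreover have "\<bar>b\<bar> + CK * C > 0" using CK C by (intro add_nonneg_pos) auto
 ultimately show ?thesis by blast
qed

end

section \<open>The lower bound in a spectral gap\<close>

lemma eventually_small_powr:
 assumes "e > 0" "b > 0"
 shows "\<forall>\<^sub>F T in at_top. K * T powr (- e) <= (b :: real)"
proof -
 have "((\<lambda>T. T powr (- e)) \<longlongrightarrow> 0) at_top"
  by (rule tendsto_neg_powr[OF _ filterlim_ident]) (use assms in simp)
 from tendsto_mult_right_zero[OF this] have "((\<lambda>T. K * T powr (- e)) \<longlongrightarrow> 0) at_top" .
 then have "\<forall>\<^sub>F T in at_top. K * T powr (- e) < b" using assms by (intro order_tendstoD(2)[where y = 0])
 then show ?thesis by eventually_elim simp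
qed

lemma integral_signed_sum:
 assumes "\<And>i. i \<in> I ==> square_integrable \<nu> (u i)" "square_integrable \<nu> v"
 shows "(LINT x|\<nu>. (\<Sum>i\<in>I. a i * u i x) * v x) = (\<Sum>i\<in>I. a i * (LINT x|\<nu>. u i x * v x))"
 unfolding mult.commute[of _ "v _"] by (rule integral_mult_sum[OF assms(2,1)])

lemma signed_sum_norm:
 assumes "finite I" "\<And>i. i \<in> I ==> square_integrable \<nu> (u i)" "\<And>i. i \<in> I ==> (LINT x|\<nu>. (u i x)^2) <= b"
 shows "(LINT x|\<nu>. (\<Sum>i\<in>I. rsign S i * u i x)^2) <= (real (card I))^2 * b"
proof -
 let ?m = "real (card I)"
 have sq: "square_integrable \<nu> (\<lambda>x. \<Sum>i\<in>I. rsign S i * u i x)" using assms(2) by (intro sq_sum sq_cmult)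
 have "(LINT x|\<nu>. (\<Sum>i\<in>I. rsign S i * u i x)^2) <= (LINT x|\<nu>. ?m * (\<Sum>i\<in>I. (u i x)^2))"
 proof (rule integral_mono)
  show "integrable \<nu> (\<lambda>x. (\<Sum>i\<in>I. rsign S i * u i x)^2)" using sq by (simp add: square_integrable_def)
  show "integrable \<nu> (\<lambda>x. ?m * (\<Sum>i\<in>I. (u i x)^2))" using assms(2) by (simp add: square_integrable_def)
  show "(\<Sum>i\<in>I. rsign S i * u i x)^2 <= ?m * (\<Sum>i\<in>I. (u i x)^2)" for x
   using Cauchy_Schwarz_ineq_sum[of "\<lambda>_. 1" "\<lambda>i. rsign S i * u i x" I] by (simp add: power_mult_distrib rsign_sq)
 qed
 also have "... = ?m * (\<Sum>i\<in>I. LINT x|\<nu>. (u i x)^2)" using assms(2) by (simp add: square_integrable_def)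
 also have "... <= ?m * (\<Sum>i\<in>I. b)" by (intro mult_left_mono sum_mono assms(3)) auto
 finally show ?thesis by (simp add: power2_eq_square)
qed

context spectral_growth
begin

text \<open>The modes below \<open>T\<close> contribute at most 1 each, by Bessel's inequality for \<open>\<psi>\<close>. For a mode in
\<open>[T', L]\<close> the inner product with \<open>\<psi> i\<close> is that with \<open>G i\<close> divided by the
\<open>k\<close>-th power of the eigenvalue, and Bessel's inequality is applied to \<open>G i\<close>.\<close>

lemma projection_onto_low_modes_small:
 fixes I :: "'i set"
 assumes I: "finite I" "orthonormal_on \<nu> I \<psi>" and G: "\<And>i. i \<in> I ==> L2 (G i)" "\<And>i. i \<in> I ==> (LINT x|\<nu>. (G i x)^2) <= b"
  and e: "\<And>i l u. i \<in> I ==> u \<in> eigenspace M A g l ==> (LINT p|\<nu>. G i p * u p) = l ^ k * (LINT p|\<nu>. \<psi> i p * u p)"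
  and gap: "\<And>j. 1 + \<mu> j < T \<or> \<mu> j >= T'" and T': "T' > 0"
 shows "(\<Sum>e\<in>low L. \<Sum>i\<in>I. (LINT x|\<nu>. \<psi> i x * mode e x)^2) <= real (card (low T)) + real (card I) * (b / T' ^ (2 * k))"
proof -
 let ?a = "\<lambda>i e. (LINT x|\<nu>. \<psi> i x * mode e x)"
 define H where "H = {e \<in> low L. \<mu> (fst e) >= T'}"
 have H: "finite H" "H \<subseteq> low L" using finite_low[of L] by (auto simp: H_def)
 have psi: "L2 (\<psi> i)" if "i \<in> I" for i using I(2) that by (simp add: orthonormal_on_def)
 have "low L \<subseteq> low T \<union> H" using gap by (force simp: low_def H_def)
 then have "(\<Sum>e\<in>low L. \<Sum>i\<in>I. (?a i e)^2) <= (\<Sum>e\<in>low T \<union> H. \<Sum>i\<in>I. (?a i e)^2)"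
  using finite_low H(1) by (intro sum_mono2) (auto intro!: sum_nonneg)
 also have "... <= (\<Sum>e\<in>low T. \<Sum>i\<in>I. (?a i e)^2) + (\<Sum>e\<in>H. \<Sum>i\<in>I. (?a i e)^2)"
  using finite_low H(1) by (simp add: sum_Un sum_nonneg)
 also have "(\<Sum>e\<in>low T. \<Sum>i\<in>I. (?a i e)^2) <= (\<Sum>e\<in>low T. 1)"
 proof (rule sum_mono)
  fix e assume el: "e \<in> low T"
  have "(\<Sum>i\<in>I. (LINT x|\<nu>. mode e x * \<psi> i x)^2) <= (LINT x|\<nu>. (mode e x)^2)"
   by (rule bessel_inequality[OF I(2,1) low_sq[OF el]])
  also have "... = 1" using low_orthonormal[of T] el by (simp add: orthonormal_on_def power2_eq_square)
  finally show "(\<Sum>i\<in>I. (?a i e)^2) <= 1" by (simp only: mult.commute)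
 qed
 also have "(\<Sum>e\<in>H. \<Sum>i\<in>I. (?a i e)^2) = (\<Sum>i\<in>I. \<Sum>e\<in>H. (?a i e)^2)" by (rule sum.swap)
 also have "... <= (\<Sum>i\<in>I. b / T' ^ (2 * k))"
 proof (rule sum_mono)
  fix i assume i: "i \<in> I"
  have "(\<Sum>e\<in>H. (?a i e)^2) <= (\<Sum>e\<in>H. (LINT x|\<nu>. G i x * mode e x)^2 / T' ^ (2 * k))"
  proof (rule sum_mono)
   fix e' assume e': "e' \<in> H"
   then have m: "e' \<in> modes" "T' <= \<mu> (fst e')" by (auto simp: H_def low_def)
   have "T' ^ (2 * k) <= \<mu> (fst e') ^ (2 * k)" using T' m(2) by (intro power_mono) auto
   then have "(?a i e')^2 * T' ^ (2 * k) <= (?a i e')^2 * \<mu> (fst e') ^ (2 * k)" by (rule mult_left_mono) simp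
   also have "... = (LINT x|\<nu>. G i x * mode e' x)^2"
    unfolding e[OF i mode_in[OF m(1)]] by (simp add: power_mult_distrib mult.commute flip: power_mult)
   finally show "(?a i e')^2 <= (LINT x|\<nu>. G i x * mode e' x)^2 / T' ^ (2 * k)" using T' by (simp add: field_simps)
  qed
  also have "... = (\<Sum>e\<in>H. (LINT x|\<nu>. G i x * mode e x)^2) / T' ^ (2 * k)" by (simp add: sum_divide_distrib)
  also have "... <= b / T' ^ (2 * k)"
   using bessel_inequality[OF orthonormal_on_subset[OF low_orthonormal H(2)] H(1) G(1)[OF i]] G(2)[OF i] T'
   by (intro divide_right_mono) auto
  finally show "(\<Sum>e\<in>H. (?a i e)^2) <= b / T' ^ (2 * k)" .
 qed
 finally show ?thesis by simp
qed

text \<open>The bumps have radius \<open>h = (q * T) powr (- 1 / 2)\<close> and \<open>B = q\<^sup>2\<close>. For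
\<open>q\<close> large, independently of \<open>R\<close> and \<open>n\<close>, the modes up to
\<open>L = T powr (1 + \<kappa>')\<close> carry a small fraction of the squared norm of the sum of the bumps, on
average over the signs. The exponents \<open>r\<close> and \<open>k\<close> are so large that the uniform norm of the removed part
and the variation norm of the rest, which is bounded with the help of \<open>\<delta> \<le> 1\<close>, are negative powers of
\<open>T\<close>. The choice of \<open>\<delta>\<^sup>2\<close> balances \<open>1 / n\<close> against the uniform bound on the
bumps, whose sum is of order \<open>T powr (D / 4)\<close>.\<close>

lemma minimax_spectral_gap:
 "\<exists>B\<ge>1. \<exists>c>0. \<forall>R>1. \<exists>T0\<ge>1. \<forall>n>0. \<forall>T\<ge>T0. real n * (R - 1)^2 = T powr (s + \<gamma>) -->
  (\<forall>j. \<not> (T <= 1 + \<mu> j \<and> 1 + \<mu> j <= B * T)) --> ennreal (c * ((R - 1)^2 * T powr (- s))) <= minimax n R"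
proof -
 let ?N = "CARD('n)"
 define D where "D = real ?N"
 have D: "D >= 1" using zero_less_card_finite[where 'a = 'n] unfolding D_def by linarith
 \<comment> \<open>small enough that \<open>D / 2 * (1 + \<kappa>')\<close>, the growth of the kernel of the low modes, stays below \<open>D / 2 + s / 2\<close>, the decay of \<open>\<delta>\<^sup>2\<close>\<close>
 define \<kappa>' where "\<kappa>' = s / (2 * D)"
 have \<kappa>': "\<kappa>' > 0" using s D by (simp add: \<kappa>'_def)
 define r where "r = nat \<lceil>(1 + D * (1 + \<kappa>')) * (4 / s)\<rceil>"
 have "(1 + D * (1 + \<kappa>')) * (4 / s) <= real r" unfolding r_def by linarith
 then have r: "1 + D * (1 + \<kappa>') <= s / 4 * real r" using s by (simp add: field_simps)
 have "0 <= D * (1 + \<kappa>')" using D \<kappa>' by simp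
 then have r0: "r > 0" using r by (cases r) auto
 define k where "k = Suc (nat \<lceil>((1 + \<kappa>') * (s / 2 + D) + D / 2 + 1) / \<kappa>' + s / 2 + D\<rceil>)"
 have k0: "((1 + \<kappa>') * (s / 2 + D) + D / 2 + 1) / \<kappa>' + s / 2 + D <= real k" unfolding k_def by linarith
 have kpos: "0 <= ((1 + \<kappa>') * (s / 2 + D) + D / 2 + 1) / \<kappa>'" using \<kappa>' s D by simp
 have k1: "s / 2 + D <= real k" using k0 kpos by linarith
 have "((1 + \<kappa>') * (s / 2 + D) + D / 2 + 1) / \<kappa>' <= real k" using k0 s D by linarith
 then have k2: "(1 + \<kappa>') * (s / 2 + D - real k) + D / 2 + real k <= - 1" using \<kappa>' by (simp add: field_simps)
 obtain C h0 where C: "C > 0" and h0: "h0 > 0" and bumps: "\<forall>h. 0 < h --> h <= h0 --> (\<exists>(I :: ('n \<Rightarrow> nat) set) \<psi> G. bump_system C h k I \<psi> G)"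
  using bump_family[of k] by (elim exE conjE)
 define Cs where "Cs = projection_constant r"
 have Cs: "Cs > 0" by (simp add: Cs_def projection_constant_pos)
 obtain C1 where C1: "C1 > 0" "\<And>l. l >= 1 ==> real (card (low l)) <= C1 * sqrt l ^ ?N" using low_count by blast
 obtain K where K: "K > 0" "\<And>L p. L >= 1 ==> p \<in> M ==> (\<Sum>e\<in>low L. (mode e p)^2) <= K * sqrt L ^ ?N" using low_kernel by blast
 obtain Z where Z: "Z > 0" and tail: "\<forall>k L f g. s / 2 + real ?N <= real k --> 1 <= L --> L2 g -->
  (\<forall>j l. l < d j --> (LINT x|\<nu>. f x * \<phi> j l x) = (if \<mu> j <= L then 0 else (1 / \<mu> j ^ k) * (LINT x|\<nu>. g x * \<phi> j l x))) -->
  (\<Sum>j. ennreal ((1 + \<mu> j) powr (s / 2) * block j f)) <= ennreal (Z * L powr (s / 2 + real ?N - real k) * sqrt (LINT x|\<nu>. (g x)^2))"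
  using tail_variation[OF s(1)] by (elim exE conjE)
 \<comment> \<open>the two conditions make the contributions of the modes below \<open>T\<close> and above \<open>B * T\<close> at most \<open>m / 2048\<close> each\<close>
 define q where "q = max 2 (max (4096 * C) ((2048 * C * C1)^2))"
 have q: "q >= 2" "q >= 4096 * C" "q >= (2048 * C * C1)^2" by (auto simp: q_def)
 define B where "B = q^2"
 have B1: "B >= 1" unfolding B_def using q(1) by (intro one_le_power) simp
 define c where "c = 1 / (128 * C)"
 have c0: "c > 0" using C by (simp add: c_def)
 have main: "ennreal (c * ((R - 1)^2 * T powr (- s))) <= minimax n R"
  if R: "R > 1" and n: "n > 0" and T2: "T >= 2" and nT: "real n * (R - 1)^2 = T powr (s + \<gamma>)"
   and gap: "\<forall>j. \<not> (T <= 1 + \<mu> j \<and> 1 + \<mu> j <= B * T)"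
   and E1: "q powr (- 1 / 2) * T powr (- (1 / 2)) <= h0"
   and E2: "C * q powr (D / 2) * T powr (- (s / 2)) <= 1 / 16"
   and E3: "Cs * K ^ r * T powr (- 1) <= (1 / 16) ^ r"
   and E4: "Z * C * sqrt C * q powr (D / 2 + real k) * T powr (- 1) <= R - 1"
   and E5: "(R - 1)^2 * T powr (- (s / 2)) <= 1" for R n T
 proof -
  have T: "T > 0" "T >= 1" using T2 by auto
  define y where "y = (q * T) powr (D / 2)"
  have yT: "y = q powr (D / 2) * T powr (D / 2)" using q T by (simp add: y_def powr_mult)
  have y0: "y > 0" using q T by (simp add: y_def)
  define h where "h = (q * T) powr (- 1 / 2)"
  have h: "0 < h" using q T by (simp add: h_def)
  have "h = q powr (- 1 / 2) * T powr (- (1 / 2))" using q T by (simp add: h_def powr_mult)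
  then have hh: "h <= h0" using E1 by simp
  have hN: "h ^ ?N = 1 / y"
  proof -
   have "h ^ ?N = ((q * T) powr (- 1 / 2)) powr D" using powr_realpow[OF h, of ?N] by (simp add: h_def D_def)
   also have "... = (q * T) powr (- (D / 2))" by (simp add: powr_powr)
   finally show ?thesis by (simp add: y_def powr_minus_divide)
  qed
  have hk: "h ^ (4 * k) = 1 / (q * T) ^ (2 * k)"
  proof -
   have "h ^ (4 * k) = ((q * T) powr (- 1 / 2)) powr real (4 * k)" using powr_realpow[OF h, of "4 * k"] by (simp add: h_def)
   also have "... = (q * T) powr (- real (2 * k))" by (simp add: powr_powr)
   also have "... = 1 / (q * T) ^ (2 * k)" using q T powr_realpow[of "q * T" "2 * k"] by (simp add: powr_minus_divide)
   finally show ?thesis .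
  qed
  obtain I :: "('n \<Rightarrow> nat) set" and \<psi> G where bI: "bump_system C h k I \<psi> G"
   using bumps[rule_format, OF h hh] by (elim exE)
  note bI = bI[unfolded bump_system_def]
  define m where "m = real (card I)"
  have I: "finite I" "orthonormal_on \<nu> I \<psi>" using bI by blast+
  have m: "y <= C * m" "m <= C * y" using bI y0 C unfolding hN m_def by (auto simp: field_simps)
  have psup: "(\<Sum>i\<in>I. rsign S i * \<psi> i p)^2 <= C * y" for S p
  proof -
   have "(\<Sum>i\<in>I. rsign S i * \<psi> i p)^2 * h ^ ?N <= C" using bI by blast
   then show ?thesis using y0 unfolding hN by (simp add: field_simps)
  qed
  have Gsq: "L2 (G i)" if "i \<in> I" for i using bI that by blast
  have GL: "(LINT p|\<nu>. G i p * u p) = l ^ k * (LINT p|\<nu>. \<psi> i p * u p)" if "i \<in> I" "u \<in> eigenspace M A g l" for i l u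
   using bI that by blast
  have Gb: "(LINT p|\<nu>. (G i p)^2) <= C * (q * T) ^ (2 * k)" if "i \<in> I" for i
  proof -
   have "(LINT p|\<nu>. (G i p)^2) * h ^ (4 * k) <= C" using bI that by blast
   then show ?thesis using q T unfolding hk by (simp add: field_simps)
  qed
  have psi: "L2 (\<psi> i)" if "i \<in> I" for i using I(2) that by (simp add: orthonormal_on_def)
  define L where "L = T powr (1 + \<kappa>')"
  have L: "L >= 1" "L > 0" using T \<kappa>' unfolding L_def by (auto intro!: ge_one_powr_ge_zero)
  let ?a = "\<lambda>i e. (LINT x|\<nu>. \<psi> i x * mode e x)"
  let ?b = "\<lambda>S x. \<Sum>i\<in>I. rsign S i * \<psi> i x"
  define F where "F S x = (\<Sum>i\<in>I. rsign S i * rest L (\<psi> i) x)" for S x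
  define proj where "proj S x = (\<Sum>i\<in>I. rsign S i * (\<Sum>e\<in>low L. ?a i e * mode e x))" for S x
  have Fp: "F S x = ?b S x - proj S x" for S x by (simp add: F_def proj_def rest_def right_diff_distrib sum_subtractf)
  \<comment> \<open>the second term keeps the bumps, whose squares are of order \<open>T powr (D / 2)\<close>, below \<open>1 / 4\<close>\<close>
  define D2 where "D2 = min (1 / (2 * real n)) (T powr (- (D / 2 + s / 2)))"
  have D2: "D2 > 0" using n T by (simp add: D2_def)
  define \<delta> where "\<delta> = sqrt D2"
  have \<delta>: "\<delta> > 0" "\<delta>^2 = D2" using D2 by (auto simp: \<delta>_def)
  have nd: "real n * \<delta>^2 <= 1 / 2"
  proof -
   have "real n * \<delta>^2 <= real n * (1 / (2 * real n))" unfolding \<delta>(2) D2_def by (intro mult_left_mono) auto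
   then show ?thesis using n by simp
  qed
  have dT: "\<delta>^2 <= T powr (- (D / 2 + s / 2))" by (simp add: \<delta>(2) D2_def)
  have d1: "\<delta> <= 1"
  proof -
   have "D2 <= T powr 0" unfolding D2_def using T s D by (intro min.coboundedI2 powr_mono) auto
   then show ?thesis using T by (simp add: \<delta>_def)
  qed
  let ?ok1 = "\<lambda>S. AE p in \<nu>. proj S p ^ (2 * r) <= Cs * L ^ ?N * (K * sqrt L ^ ?N) ^ r"
  let ?err = "\<lambda>S. (LINT x|\<nu>. (F S x - ?b S x)^2)"
  let ?ok2 = "\<lambda>S. ?err S <= m / 64"
  have bad1: "16 * card {S \<in> Pow I. \<not> ?ok1 S} <= 2 ^ card I"
   unfolding proj_def Cs_def
   by (rule random_projection_sup[OF r0 I(1) finite_low I(2) low_orthonormal, where \<mu> = "\<lambda>e. \<mu> (fst e)"])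
    (use mode_in L K in \<open>auto simp: low_def\<close>)
  have bad2: "16 * card {S \<in> Pow I. \<not> ?ok2 S} <= 2 ^ card I"
  proof -
   have es: "?err S = (\<Sum>e\<in>low L. (\<Sum>i\<in>I. rsign S i * ?a i e)^2)" for S
   proof -
    have "proj S x = (\<Sum>e\<in>low L. (\<Sum>i\<in>I. rsign S i * ?a i e) * mode e x)" for x
     unfolding proj_def sum_distrib_left sum_distrib_right by (subst sum.swap) (simp add: mult_ac)
    then have "?err S = (LINT x|\<nu>. (\<Sum>e\<in>low L. (\<Sum>i\<in>I. rsign S i * ?a i e) * mode e x)^2)" by (simp add: Fp)
    then show ?thesis using orthonormal_sum_square[OF low_orthonormal finite_low] by simp
   qed
   have "(\<Sum>S\<in>Pow I. ?err S) = (\<Sum>e\<in>low L. \<Sum>S\<in>Pow I. (\<Sum>i\<in>I. rsign S i * ?a i e)^2)"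
    unfolding es by (rule sum.swap)
   also have "... = 2 ^ card I * (\<Sum>e\<in>low L. \<Sum>i\<in>I. (?a i e)^2)"
    by (simp add: sum_rsign_square[OF I(1)] sum_distrib_left)
   also have "(\<Sum>e\<in>low L. \<Sum>i\<in>I. (?a i e)^2) <= real (card (low T)) + real (card I) * (C * (q * T) ^ (2 * k) / (B * T / 2) ^ (2 * k))"
   proof (rule projection_onto_low_modes_small[OF I Gsq Gb GL])
    have "1 <= B * T / 2" using mult_mono[of 1 B 2 T] B1 T2 by simp
    then show "1 + \<mu> j < T \<or> B * T / 2 <= \<mu> j" for j using gap[rule_format, of j] by auto
    show "B * T / 2 > 0" using B1 T by simp
   qed
   also have "... <= m / 2048 + m / 2048"
   proof (rule add_mono)
    have "2048 * (C * C1) <= q powr (1 / 2)"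
    proof -
     have "sqrt ((2048 * C * C1)^2) <= sqrt q" using q(3) by (rule real_sqrt_le_mono)
     then show ?thesis using C C1 q(1) by (simp add: powr_half_sqrt)
    qed
    also have "... <= q powr (D / 2)" using q(1) D by (intro powr_mono) auto
    finally have "2048 * (C * C1) * T powr (D / 2) <= y" unfolding yT by (intro mult_right_mono) auto
    then have "C * (2048 * (C1 * T powr (D / 2))) <= C * m" using m(1) by (simp add: mult_ac)
    then have "2048 * (C1 * T powr (D / 2)) <= m" using C by (simp only: mult_le_cancel_left_pos)
    moreover have "real (card (low T)) <= C1 * T powr (D / 2)" using C1(2)[OF T(2)] T(1) by (simp add: sqrt_power_powr D_def)
    ultimately show "real (card (low T)) <= m / 2048" by simp
    have "q * T / (B * T / 2) = 2 / q" using q(1) T by (simp add: B_def power2_eq_square)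
    then have "(q * T) ^ (2 * k) / (B * T / 2) ^ (2 * k) = (2 / q) ^ (2 * k)"
     unfolding power_divide[symmetric, of "q * T"] by (simp only:)
    also have "... <= (2 / q) ^ 1" using q(1) by (intro power_decreasing) (auto simp: k_def)
    finally have "C * ((q * T) ^ (2 * k) / (B * T / 2) ^ (2 * k)) <= C * (2 / q)" using C by (intro mult_left_mono) auto
    also have "... <= 1 / 2048" using q(1,2) by (simp add: field_simps)
    finally have "m * (C * ((q * T) ^ (2 * k) / (B * T / 2) ^ (2 * k))) <= m * (1 / 2048)"
     by (intro mult_left_mono) (auto simp: m_def)
    then show "real (card I) * (C * (q * T) ^ (2 * k) / (B * T / 2) ^ (2 * k)) <= m / 2048" by (simp add: m_def)
   qed
   finally have "(\<Sum>S\<in>Pow I. ?err S) <= 2 ^ card I * (m / 1024)" by simp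
   from card_markov[OF I(1) _ this] have "16 * card {S \<in> Pow I. ?err S > 16 * (m / 1024)} <= 2 ^ card I"
    by (simp add: m_def)
   then show ?thesis by (simp add: not_le)
  qed
  define GS where "GS = {S \<in> Pow I. ?ok1 S \<and> ?ok2 S}"
  have GS: "GS \<subseteq> Pow I" "4 * card GS >= 3 * 2 ^ card I"
   using card_good_signs[OF I(1) bad1 bad2] by (auto simp: GS_def)
  have f_small: "\<delta>^2 * (C * y) <= 1 / 16"
  proof -
   have "\<delta>^2 * (C * y) <= T powr (- (D / 2 + s / 2)) * (C * y)" using dT C y0 by (intro mult_right_mono) auto
   also have "... = C * q powr (D / 2) * T powr (- (s / 2))" unfolding yT using T by (simp add: mult_ac flip: powr_add)
   finally show ?thesis using E2 by simp
  qed
  have p_small: "(\<delta>^2) ^ r * (Cs * L ^ ?N * (K * sqrt L ^ ?N) ^ r) <= (1 / 16) ^ r"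
  proof -
   have ex: "- (D / 2 + s / 2) * real r + (1 + \<kappa>') * D + (1 + \<kappa>') * (D / 2) * real r <= - 1"
   proof -
    have "\<kappa>' * (D / 2) = s / 4" using D by (simp add: \<kappa>'_def)
    then have e: "(1 + \<kappa>') * (D / 2) = D / 2 + s / 4" by (simp add: algebra_simps)
    have "- (D / 2 + s / 2) * real r + x + (D / 2 + s / 4) * real r = x - s / 4 * real r" for x :: real
     by (simp add: algebra_simps)
    from this[of "(1 + \<kappa>') * D"] show ?thesis using r unfolding e mult.commute[of D] by linarith
   qed
   have "(\<delta>^2) ^ r * (Cs * L ^ ?N * (K * sqrt L ^ ?N) ^ r) <= (T powr (- (D / 2 + s / 2))) ^ r * (Cs * L ^ ?N * (K * sqrt L ^ ?N) ^ r)"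
    using dT Cs K L by (intro mult_right_mono power_mono) auto
   also have "... = Cs * K ^ r * (T powr (- (D / 2 + s / 2) * real r) * L powr D * L powr (D / 2 * real r))"
    using T L by (simp add: sqrt_power_powr power_mult_distrib powr_power D_def powr_realpow mult_ac)
   also have "... = Cs * K ^ r * T powr (- (D / 2 + s / 2) * real r + (1 + \<kappa>') * D + (1 + \<kappa>') * (D / 2) * real r)"
    unfolding L_def powr_powr by (simp add: powr_add mult_ac)
   also have "... <= Cs * K ^ r * T powr (- 1)" using Cs K T ex by (intro mult_left_mono powr_mono) auto
   finally show ?thesis using E3 by simp
  qed
  have "ennreal (\<delta>^2 * real (card I) / 64) <= minimax n R"
  proof (rule minimax_risk_ge_hypercube[OF I GS, where \<rho> = "\<lambda>i. rest L (\<psi> i)" and \<delta> = \<delta>, folded F_def])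
   show "L2 (rest L (\<psi> i))" if "i \<in> I" for i by (rule rest_sq[OF psi[OF that]])
   show "(LINT x|\<nu>. (rest L (\<psi> i) x)^2) <= 1" if i: "i \<in> I" for i
    using rest_norm[OF psi[OF i], of L] I(2) i by (simp add: orthonormal_on_def power2_eq_square)
   have Fco: "(LINT x|\<nu>. F S x * \<phi> j l x) = (\<Sum>i\<in>I. rsign S i * (LINT x|\<nu>. rest L (\<psi> i) x * \<phi> j l x))" if "l < d j" for S j l
    unfolding F_def using psi phi_sq[OF that] by (intro integral_signed_sum rest_sq)
   show "(LINT x|\<nu>. F S x * \<phi> 0 l x) = 0" if l: "l < d 0" for S l
    unfolding Fco[OF l] using L by (intro sum.neutral ballI) (simp add: rest_coefficient[OF psi l] mu_0)
   show "AE x in \<nu>. \<bar>\<delta> * F S x\<bar> <= 1 / 2" if S: "S \<in> GS" for S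
   proof -
    have "?ok1 S" using S by (simp add: GS_def)
    then show ?thesis
    proof eventually_elim
     case (elim x)
     have "(\<delta> * ?b S x)^2 <= \<delta>^2 * (C * y)" unfolding power_mult_distrib by (intro mult_left_mono psup) simp
     also have "... <= (1 / 4)^2" using f_small by (simp add: power_divide)
     finally have 1: "\<bar>\<delta> * ?b S x\<bar> <= 1 / 4" by (simp add: abs_le_square_iff[symmetric])
     have "\<bar>\<delta> * proj S x\<bar> ^ (2 * r) = (\<delta>^2) ^ r * proj S x ^ (2 * r)" by (simp add: power_mult power_mult_distrib)
     also have "... <= (\<delta>^2) ^ r * (Cs * L ^ ?N * (K * sqrt L ^ ?N) ^ r)" using elim by (intro mult_left_mono) auto
     also have "... <= (1 / 16) ^ r" by (rule p_small)
     also have "... = (1 / 4 :: real) ^ (2 * r)" by (simp add: power_mult power_divide)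
     finally have 2: "\<bar>\<delta> * proj S x\<bar> <= 1 / 4" by (subst (asm) power_mono_iff) (use r0 in auto)
     show ?case using 1 2 unfolding Fp right_diff_distrib by linarith
    qed
   qed
   show "(\<Sum>j. ennreal ((1 + \<mu> j) powr (s / 2) * block j (\<lambda>x. \<delta> * F S x))) <= ennreal (R - 1)" for S
   proof -
    define gS where "gS x = (\<Sum>i\<in>I. rsign S i * G i x)" for x
    have gsq: "L2 gS" unfolding gS_def by (intro sq_sum sq_cmult Gsq)
    have "(LINT x|\<nu>. (gS x)^2) <= m^2 * (C * (q * T) ^ (2 * k))"
     unfolding gS_def m_def by (rule signed_sum_norm[OF I(1) Gsq Gb])
    then have "sqrt (LINT x|\<nu>. (gS x)^2) <= sqrt (m^2 * (C * (q * T) ^ (2 * k)))" by (rule real_sqrt_le_mono)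
    also have "... = m * (sqrt C * (q * T) ^ k)" using q T by (simp add: real_sqrt_mult m_def power_even_eq)
    also have "... <= C * y * (sqrt C * (q * T) ^ k)" using m(2) C q T by (intro mult_right_mono) auto
    finally have gn: "sqrt (LINT x|\<nu>. (gS x)^2) <= C * y * (sqrt C * (q * T) ^ k)" .
    have co: "(LINT x|\<nu>. F S x * \<phi> j l x) = (if \<mu> j <= L then 0 else (1 / \<mu> j ^ k) * (LINT x|\<nu>. gS x * \<phi> j l x))" if l: "l < d j" for j l
    proof (cases "\<mu> j <= L")
     case True
     then show ?thesis unfolding Fco[OF l] by (simp add: rest_coefficient[OF psi l])
    next
     case False
     have "(LINT x|\<nu>. gS x * \<phi> j l x) = (\<Sum>i\<in>I. rsign S i * (LINT x|\<nu>. G i x * \<phi> j l x))"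
      unfolding gS_def using phi_sq[OF l] by (intro integral_signed_sum Gsq)
     also have "... = \<mu> j ^ k * (\<Sum>i\<in>I. rsign S i * (LINT x|\<nu>. \<psi> i x * \<phi> j l x))"
      by (simp add: GL[OF _ phi_in[OF l]] sum_distrib_left mult_ac)
     also have "(\<Sum>i\<in>I. rsign S i * (LINT x|\<nu>. \<psi> i x * \<phi> j l x)) = (LINT x|\<nu>. F S x * \<phi> j l x)"
      unfolding Fco[OF l] using False by (intro sum.cong refl) (simp add: rest_coefficient[OF psi l])
     finally show ?thesis using False L by simp
    qed
    have "(1 + \<mu> j) powr (s / 2) * block j (\<lambda>x. \<delta> * F S x) <= (1 + \<mu> j) powr (s / 2) * block j (F S)" for j
     unfolding block_cmult using \<delta>(1) d1 by (intro mult_left_mono mult_left_le_one_le) (auto simp: block_def sum_nonneg)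
    then have "(\<Sum>j. ennreal ((1 + \<mu> j) powr (s / 2) * block j (\<lambda>x. \<delta> * F S x))) <= (\<Sum>j. ennreal ((1 + \<mu> j) powr (s / 2) * block j (F S)))"
     by (intro suminf_le ennreal_leI summableI)
    also have "... <= ennreal (Z * L powr (s / 2 + real ?N - real k) * sqrt (LINT x|\<nu>. (gS x)^2))"
     using tail k1 L(1) gsq co unfolding D_def by blast
    also have "... <= ennreal (R - 1)"
    proof (rule ennreal_leI)
     have "Z * L powr (s / 2 + D - real k) * sqrt (LINT x|\<nu>. (gS x)^2) <= Z * L powr (s / 2 + D - real k) * (C * y * (sqrt C * (q * T) ^ k))"
      using Z gn by (intro mult_left_mono) auto
     also have "... = Z * C * sqrt C * q powr (D / 2 + real k) * T powr ((1 + \<kappa>') * (s / 2 + D - real k) + D / 2 + real k)"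
      unfolding yT L_def powr_powr using q T by (simp add: powr_add powr_realpow power_mult_distrib mult_ac)
     also have "... <= Z * C * sqrt C * q powr (D / 2 + real k) * T powr (- 1)"
      using Z C T k2 by (intro mult_left_mono powr_mono) auto
     also have "... <= R - 1" by (rule E4)
     finally show "Z * L powr (s / 2 + real ?N - real k) * sqrt (LINT x|\<nu>. (gS x)^2) <= R - 1" by (simp add: D_def)
    qed
    finally show ?thesis .
   qed
   show "?err S <= real (card I) / 64" if "S \<in> GS" for S using that by (simp add: GS_def m_def)
  qed (use \<delta> nd n R in auto)
  moreover have "c * ((R - 1)^2 * T powr (- s)) <= \<delta>^2 * real (card I) / 64"
  proof -
   have my: "T powr (D / 2) <= C * m"
   proof -
    have "1 <= q powr (D / 2)" using q(1) D by (intro ge_one_powr_ge_zero) auto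
    then have "1 * T powr (D / 2) <= y" unfolding yT by (intro mult_right_mono) auto
    then show ?thesis using m(1) by simp
   qed
   have "(R - 1)^2 * T powr (- s) = T powr \<gamma> / real n"
   proof -
    have "T powr \<gamma> = T powr (s + \<gamma>) * T powr (- s)" by (simp flip: powr_add)
    then show ?thesis using nT n by (simp add: field_simps)
   qed
   also have "T powr \<gamma> <= T powr (D / 2)" using growth_exponent_le T by (intro powr_mono) (auto simp: D_def)
   also have "... <= C * m" by (rule my)
   finally have 1: "(R - 1)^2 * T powr (- s) <= C * m / real n" using n by (simp add: divide_right_mono)
   have "(R - 1)^2 * T powr (- s) = (R - 1)^2 * T powr (- (s / 2)) * T powr (- (s / 2))" by (simp flip: powr_add)
   also have "... <= 1 * T powr (- (s / 2))" by (intro mult_right_mono E5) simp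
   also have "... = T powr (- (D / 2 + s / 2)) * T powr (D / 2)" by (simp flip: powr_add)
   also have "... <= T powr (- (D / 2 + s / 2)) * (C * m)" by (intro mult_left_mono my) simp
   finally have 2: "(R - 1)^2 * T powr (- s) <= T powr (- (D / 2 + s / 2)) * (C * m)" .
   have m0: "m >= 0" by (simp add: m_def)
   have "(R - 1)^2 * T powr (- s) <= 2 * (D2 * (C * m))"
   proof (cases "1 / (2 * real n) <= T powr (- (D / 2 + s / 2))")
    case True
    then show ?thesis using 1 n by (simp add: D2_def min_def)
   next
    case False
    have "0 <= T powr (- (D / 2 + s / 2)) * (C * m)" using C m0 by simp
    then show ?thesis using 2 False by (simp add: D2_def min_def)
   qed
   then show ?thesis using C by (simp add: c_def \<delta>(2) m_def field_simps)
  qed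
  ultimately show ?thesis using ennreal_leI order_trans by blast
 qed
 have "\<exists>T0\<ge>1. \<forall>n>0. \<forall>T\<ge>T0. real n * (R - 1)^2 = T powr (s + \<gamma>) -->
  (\<forall>j. \<not> (T <= 1 + \<mu> j \<and> 1 + \<mu> j <= B * T)) --> ennreal (c * ((R - 1)^2 * T powr (- s))) <= minimax n R" if R: "R > 1" for R
 proof -
  have "\<forall>\<^sub>F T in at_top. q powr (- 1 / 2) * T powr (- (1 / 2)) <= h0 \<and> C * q powr (D / 2) * T powr (- (s / 2)) <= 1 / 16 \<and>
   Cs * K ^ r * T powr (- 1) <= (1 / 16) ^ r \<and> Z * C * sqrt C * q powr (D / 2 + real k) * T powr (- 1) <= R - 1 \<and>
   (R - 1)^2 * T powr (- (s / 2)) <= 1 \<and> T >= 2" (is "\<forall>\<^sub>F T in at_top. ?P T")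
   using h0 s R by (intro eventually_conj eventually_small_powr eventually_ge_at_top) auto
  then obtain T0 where T0: "\<And>T. T >= T0 ==> ?P T" unfolding eventually_at_top_linorder by blast
  show ?thesis
  proof (intro exI[of _ "max 1 T0"] conjI allI impI)
   fix n :: nat and T assume "0 < n" "max 1 T0 <= T" "real n * (R - 1)^2 = T powr (s + \<gamma>)"
    "\<forall>j. \<not> (T <= 1 + \<mu> j \<and> 1 + \<mu> j <= B * T)"
   then show "ennreal (c * ((R - 1)^2 * T powr (- s))) <= minimax n R" using T0[of T] by (intro main[OF R]) auto
  qed simp
 qed
 then show ?thesis using B1 c0 by blast
qed

end

section \<open>The minimax rate\<close>

theorem theorem4p4:
  fixes M :: "'a::t2_space set"
    and A :: "('a, 'n::finite) chart set"
    and g :: "('a, 'n) chart \<Rightarrow> real^'n \<Rightarrow> real^'n^'n"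
    and \<nu> :: "'a measure"
    and \<mu> :: "nat \<Rightarrow> real"
    and \<phi> :: "nat \<Rightarrow> nat \<Rightarrow> 'a \<Rightarrow> real"
    and s \<gamma> c\<^sub>d C\<^sub>K \<Lambda>\<^sub>0 :: real
  assumes "compact_riemannian_manifold M A g"
    and "is_normalized_volume M A g \<nu>"
    and "eigenvalue_enumeration M A g \<mu>"
    and "\<And>j. orthonormal_basis \<nu> (eigenspace M A g (\<mu> j)) (\<phi> j)"
    and "0 < s" and "s < \<gamma>"
    and "c\<^sub>d > 0" and "C\<^sub>K > 0" and "\<Lambda>\<^sub>0 \<ge> 1"
    and "\<And>j. \<mu> j \<ge> \<Lambda>\<^sub>0 \<Longrightarrow>
           real (fun_dim (eigenspace M A g (\<mu> j))) \<ge> c\<^sub>d * (1 + \<mu> j) powr \<gamma>"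
    and "\<And>j x. \<mu> j \<ge> \<Lambda>\<^sub>0 \<Longrightarrow> x \<in> M \<Longrightarrow>
           proj_kernel (eigenspace M A g (\<mu> j)) (\<phi> j) x x
             \<le> C\<^sub>K * real (fun_dim (eigenspace M A g (\<mu> j)))"
  shows "\<exists>c>0. \<forall>R>1. \<exists>n\<^sub>0\<ge>1. \<forall>n\<ge>n\<^sub>0.
           minimax_risk \<nu> n (density_class M A g \<nu> \<mu> s R (1/2) (3/2))
             \<ge> ennreal (c * (R - 1) powr (2 * \<gamma> / (s + \<gamma>)) * real n powr (- (s / (s + \<gamma>))))"
proof -
 interpret riemannian_spectrum M A g \<nu> \<mu> \<phi>
  by (intro riemannian_spectrum.intro riemannian_spectrum_axioms.intro riemannian_probability.intro
    riemannian_probability_axioms.intro assms(1-4))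
 interpret spectral_growth M A g \<nu> \<mu> \<phi> s \<gamma> c\<^sub>d C\<^sub>K \<Lambda>\<^sub>0
  by unfold_locales (use assms in \<open>auto simp: d_def proj_kernel_def power2_eq_square\<close>)
 define a where "a = s + \<gamma>"
 have a: "a > 0" using assms(5,6) by (simp add: a_def)
 obtain B c1 where B: "B >= 1" and c1: "c1 > 0" and gap: "\<forall>R>1. \<exists>T0\<ge>1. \<forall>n>0. \<forall>T\<ge>T0. real n * (R - 1)^2 = T powr (s + \<gamma>) -->
  (\<forall>j. \<not> (T <= 1 + \<mu> j \<and> 1 + \<mu> j <= B * T)) --> ennreal (c1 * ((R - 1)^2 * T powr (- s))) <= minimax n R"
  using minimax_spectral_gap by (elim exE conjE)
 obtain c2 where c2: "c2 > 0" and eig: "\<forall>R>1. \<exists>T0\<ge>1. \<forall>n>0. \<forall>T\<ge>T0. \<forall>j. real n * (R - 1)^2 = T powr (s + \<gamma>) --> T <= 1 + \<mu> j --> 1 + \<mu> j <= B * T -->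
  ennreal (c2 * ((R - 1)^2 * T powr (- s))) <= minimax n R" using minimax_eigenspace[OF B] by (elim exE conjE)
 define c where "c = min c1 c2"
 have main: "\<exists>n\<^sub>0\<ge>1. \<forall>n\<ge>n\<^sub>0. minimax n R >= ennreal (c * (R - 1) powr (2 * \<gamma> / (s + \<gamma>)) * real n powr (- (s / (s + \<gamma>))))"
  if R: "R > 1" for R
 proof -
  obtain T1 where T1: "T1 >= 1" and gapR: "\<forall>n>0. \<forall>T\<ge>T1. real n * (R - 1)^2 = T powr (s + \<gamma>) -->
   (\<forall>j. \<not> (T <= 1 + \<mu> j \<and> 1 + \<mu> j <= B * T)) --> ennreal (c1 * ((R - 1)^2 * T powr (- s))) <= minimax n R"
   using gap[THEN spec, THEN mp, OF R] by (elim exE conjE)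
  obtain T2 where T2: "T2 >= 1" and eigR: "\<forall>n>0. \<forall>T\<ge>T2. \<forall>j. real n * (R - 1)^2 = T powr (s + \<gamma>) --> T <= 1 + \<mu> j --> 1 + \<mu> j <= B * T -->
   ennreal (c2 * ((R - 1)^2 * T powr (- s))) <= minimax n R" using eig[THEN spec, THEN mp, OF R] by (elim exE conjE)
  define b where "b = R - 1"
  have b: "b > 0" using R by (simp add: b_def)
  \<comment> \<open>from here on \<open>T\<close> exceeds both thresholds, as \<open>T\<close> increases with \<open>n\<close>\<close>
  define n0 where "n0 = nat \<lceil>(max T1 T2) powr a / b^2\<rceil> + 1"
  show ?thesis
  proof (intro exI[of _ n0] conjI allI impI)
   show "1 <= n0" by (simp add: n0_def)
   fix n assume n: "n0 <= n"
   then have n1: "n > 0" by (simp add: n0_def)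
   define T where "T = (real n * b^2) powr (1 / a)"
   have nb: "real n * b^2 > 0" using n1 b by simp
   have Ta: "T powr a = real n * b^2" using a nb by (simp add: T_def powr_powr)
   have "(max T1 T2) powr a / b^2 <= real n" using n unfolding n0_def by linarith
   then have "(max T1 T2) powr a <= T powr a" using b by (simp add: Ta field_simps)
   then have "max T1 T2 <= T" using a T1 powr_less_mono2[of a T "max T1 T2"] by (auto simp: not_le[symmetric] T_def)
   then have T: "T1 <= T" "T2 <= T" by auto
   have rate: "b^2 * T powr (- s) = b powr (2 * \<gamma> / a) * real n powr (- (s / a))"
   proof -
    have "b^2 * T powr (- s) = b powr 2 * (real n powr (- (s / a)) * (b powr 2) powr (- (s / a)))"
     using b n1 by (simp add: T_def powr_powr powr_mult)
    also have "... = b powr (2 - 2 * (s / a)) * real n powr (- (s / a))"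
     by (simp add: powr_powr powr_diff powr_minus divide_inverse)
    also have "2 - 2 * (s / a) = 2 * \<gamma> / a" using a by (simp add: a_def field_simps)
    finally show ?thesis .
   qed
   have "ennreal (c * (b^2 * T powr (- s))) <= minimax n R"
   proof (cases "\<exists>j. T <= 1 + \<mu> j \<and> 1 + \<mu> j <= B * T")
    case True
    then obtain j where j: "T <= 1 + \<mu> j" "1 + \<mu> j <= B * T" by blast
    have "ennreal (c2 * (b^2 * T powr (- s))) <= minimax n R"
     using eigR[rule_format, OF n1 T(2) _ j] Ta unfolding a_def b_def by simp
    moreover have "c * (b^2 * T powr (- s)) <= c2 * (b^2 * T powr (- s))" by (intro mult_right_mono) (auto simp: c_def)
    ultimately show ?thesis using ennreal_leI order_trans by blast
   next
    case False
    then have "ennreal (c1 * (b^2 * T powr (- s))) <= minimax n R"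
     using gapR[rule_format, OF n1 T(1)] Ta unfolding a_def b_def by simp
    moreover have "c * (b^2 * T powr (- s)) <= c1 * (b^2 * T powr (- s))" by (intro mult_right_mono) (auto simp: c_def)
    ultimately show ?thesis using ennreal_leI order_trans by blast
   qed
   then show "minimax n R >= ennreal (c * (R - 1) powr (2 * \<gamma> / (s + \<gamma>)) * real n powr (- (s / (s + \<gamma>))))"
    unfolding rate by (simp add: b_def a_def mult.assoc)
  qed
 qed
 show ?thesis using main c1 c2 by (intro exI[of _ c]) (simp add: c_def)
qed

end
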